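(* Let $S$ be a codimension-two spacelike submanifold embedded in a spacetime $(M,g)$ of dimension $n+2\ge4$, let $\xi$ be a lightlike normal vector field on $S$, and let $\Sigma=\Phi(\mathscr O)$ be the lightlike hypersurface generated from $S$ by the normal exponential map along $\xi$ (see context). Assume $\Sigma$ is totally umbilical. Then every Jacobi field $J$ along a lightlike geodesic generator $\gamma$ of $\Sigma$ with $g(J,\gamma')=0$ satisfies $$J''+\frac{\widetilde{\mathrm{Ric}}(\gamma',\gamma')}{n}J=f\,\gamma'$$ for some smooth function $f$ along $\gamma$, where $n=\dim S$ and $\widetilde{\mathrm{Ric}}$ is the Ricci tensor of $M$. In this setting, $J$ does not need to be tangent to the screen distribution $\mathcal S$ (see context), and therefore $f$ is not, in general, related to the associated rotation one-form $\tau$, nor can it necessarily be written in the explicit form $$f=\gamma'(\tau(J))-\mu\,\tau(J),$$ where $\mu$ is the umbilicity function of $\Sigma$ with respect to $U$ and $\tau$ is the rotation one-form associated with $U$ and $\mathcal S$ (all defined in the context).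
   Context: A spacetime is a connected time-oriented Lorentzian manifold of signature $(-,+,\dots,+)$, with Levi-Civita connection $\widetilde\nabla$; lightlike vectors are nonzero null vectors; $S$ is connected of dimension $n$ with induced Riemannian metric. Curvature convention: $\widetilde R(X,Y)Z=\widetilde\nabla_X\widetilde\nabla_YZ-\widetilde\nabla_Y\widetilde\nabla_XZ-\widetilde\nabla_{[X,Y]}Z$, $\widetilde{\mathrm{Ric}}(Y,Z)=\operatorname{trace}(X\mapsto\widetilde R(X,Y)Z)$; Jacobi fields satisfy $J''+\widetilde R(J,\gamma')\gamma'=0$, primes on $J$ denoting covariant derivatives along $\gamma$, and $\gamma'(h)$ denoting the derivative of a function $h$ along $\gamma$. Normal exponential construction: choose an open neighborhood $\mathscr V$ of the zero section of the normal bundle $T^\perp S$, fiberwise star-shaped about $0$, such that the normal exponential map $\exp^\perp$ restricts to a diffeomorphism from $\mathscr V$ onto an open neighborhood of $S$ in $M$. Put $\mathscr O=\{(p,t)\in S\times\mathbb R: t\xi_p\in\mathscr V\}$, $\Phi\colon\mathscr O\to M$, $\Phi(p,t)=\exp^\perp_p(t\xi_p)$, and $\Sigma=\Phi(\mathscr O)$. Then $\Phi$ is an embedding, $\Sigma$ is a lightlike hypersurface (the induced metric is everywhere degenerate) containing $S$, and $U=\Phi_*(\partial_t)$ is a lightlike vector field on $\Sigma$ with $\widetilde\nabla_UU=0$ and $U|_S=\xi$; $U$ spans the radical of the induced metric. The lightlike geodesic generators are the integral curves $\gamma(t)=\Phi(p,t)$ of $U$, $p\in S$. Screen distribution: $\mathcal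 S$ is the distribution on $\Sigma$ obtained by pushing forward by $\Phi$ the distribution on $\mathscr O$ tangent to the slices $S\times\{t\}$. It is integrable, spacelike, complementary to $\operatorname{span}\{U\}$ in $T\Sigma$, and has $S$ as a leaf. Let $V$ be the unique lightlike vector field along $\Sigma$ orthogonal to $\mathcal S$ with $g(U,V)=-1$. The rotation one-form associated with $U$ and $\mathcal S$ is $\tau(X)=-g(\widetilde\nabla_XU,V)$ for $X\in\mathfrak X(\Sigma)$. $B_U(X,Y)=-g(\widetilde\nabla_XU,Y)$ for $X,Y\in\mathfrak X(\Sigma)$; $\Sigma$ is totally umbilical if $B_U=\mu g$ for a smooth function $\mu$ on $\Sigma$, called the umbilicity function. Background for the displayed formula for $f$: let $X$ be a vector field on $\Sigma$ that is the push-forward by $\Phi$ of the horizontal lift (tangent to the slices $S\times\{t\}$) of a vector field on $S$. Then, in the totally umbilical case, $J=X\circ\gamma$ is a Jacobi field along $\gamma$ tangent to $\mathcal S$ that satisfies the equation with $f=\gamma'(\tau(J))-\mu\,\tau(J)$. *)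

theory Defs
  imports "HOL-Analysis.Analysis"
begin

section \<open>Smooth functions between Euclidean spaces\<close>

text \<open>The functions of class C^k on an open subset of a Euclidean space, through iterated
  directional derivatives.\<close>

primrec Ck_on :: "nat \<Rightarrow> 'a::euclidean_space set \<Rightarrow> ('a \<Rightarrow> 'b::real_normed_vector) \<Rightarrow> bool" where
  "Ck_on 0 X f \<longleftrightarrow> continuous_on X f"
| "Ck_on (Suc k) X f \<longleftrightarrow>
     (\<forall>x\<in>X. f differentiable (at x)) \<and> (\<forall>v. Ck_on k X (\<lambda>x. frechet_derivative f (at x) v))"

definition smooth_on :: "'a::euclidean_space set \<Rightarrow> ('a \<Rightarrow> 'b::real_normed_vector) \<Rightarrow> bool" where
  "smooth_on X f \<longleftrightarrow> (\<forall>k. Ck_on k X f)"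


section \<open>Manifolds\<close>

text \<open>A chart is a pair of a domain and a coordinate map; values of the map outside the domain are
  irrelevant. The underlying set of a manifold is the union of the chart domains, and its topology
  is the one induced by the charts.\<close>

type_synonym ('m, 'e) chart = "'m set \<times> ('m \<Rightarrow> 'e)"

definition points :: "('m, 'e) chart set \<Rightarrow> 'm set" where
  "points A = (\<Union>c\<in>A. fst c)"

definition charts_at :: "('m, 'e) chart set \<Rightarrow> 'm \<Rightarrow> ('m, 'e) chart set" where
  "charts_at A p = {c \<in> A. p \<in> fst c}"

definition transition :: "('m, 'e) chart \<Rightarrow> ('m, 'e) chart \<Rightarrow> 'e \<Rightarrow> 'e" where
  "transition c d = snd d \<circ> inv_into (fst c) (snd c)"

definition smooth_atlas :: "('m, 'e::euclidean_space) chart set \<Rightarrow> bool" where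
  "smooth_atlas A \<longleftrightarrow>
     (\<forall>c\<in>A. inj_on (snd c) (fst c) \<and> open (snd c ` fst c)) \<and>
     (\<forall>c\<in>A. \<forall>d\<in>A. open (snd c ` (fst c \<inter> fst d)) \<and>
        smooth_on (snd c ` (fst c \<inter> fst d)) (transition c d))"

definition manifold_topology :: "('m, 'e::euclidean_space) chart set \<Rightarrow> 'm topology" where
  "manifold_topology A =
     topology (\<lambda>W. W \<subseteq> points A \<and> (\<forall>c\<in>A. open (snd c ` (W \<inter> fst c))))"

definition smooth_manifold :: "('m, 'e::euclidean_space) chart set \<Rightarrow> bool" where
  "smooth_manifold A \<longleftrightarrow> smooth_atlas A \<and>
     Hausdorff_space (manifold_topology A) \<and> second_countable (manifold_topology A)"

definition std_atlas :: "('e, 'e) chart set" where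
  "std_atlas = {(UNIV, id)}"

text \<open>Smoothness of a map defined on an arbitrary subset of a manifold: in charts, it locally
  extends to a smooth map on an open set. For open subsets and for embedded submanifolds this is the
  intrinsic notion.\<close>

definition smooth_map ::
  "('m, 'e::euclidean_space) chart set \<Rightarrow> ('k, 'f::euclidean_space) chart set \<Rightarrow>
     'm set \<Rightarrow> ('m \<Rightarrow> 'k) \<Rightarrow> bool" where
  "smooth_map A B X f \<longleftrightarrow> X \<subseteq> points A \<and> f ` X \<subseteq> points B \<and>
     (\<forall>x\<in>X. \<forall>c\<in>charts_at A x. \<forall>d\<in>charts_at B (f x).
        \<exists>N F. open N \<and> snd c x \<in> N \<and> smooth_on N F \<and>
          (\<forall>y\<in>X \<inter> fst c. snd c y \<in> N \<longrightarrow> f y \<in> fst d \<and> snd d (f y) = F (snd c y)))"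

definition diffeo ::
  "('m, 'e::euclidean_space) chart set \<Rightarrow> ('k, 'f::euclidean_space) chart set \<Rightarrow>
     'm set \<Rightarrow> 'k set \<Rightarrow> ('m \<Rightarrow> 'k) \<Rightarrow> bool" where
  "diffeo A B X Y f \<longleftrightarrow>
     bij_betw f X Y \<and> smooth_map A B X f \<and> smooth_map B A Y (inv_into X f)"

text \<open>Slice charts are taken from the maximal atlas containing the given one.\<close>

definition embedded_submanifold ::
  "('m, 'e::euclidean_space) chart set \<Rightarrow> nat \<Rightarrow> 'm set \<Rightarrow> bool" where
  "embedded_submanifold A k S \<longleftrightarrow> S \<subseteq> points A \<and>
     (\<forall>p\<in>S. \<exists>d L. p \<in> fst d \<and> fst d \<subseteq> points A \<and> smooth_atlas (insert d A) \<and>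
        subspace L \<and> dim L = k \<and> snd d ` (S \<inter> fst d) = L \<inter> snd d ` fst d)"


section \<open>Tangent vectors\<close>

text \<open>A tangent vector at a point is the family of its components in all charts around the point,
  subject to the contravariant transformation law. It is set to zero on all other charts, so that
  equality of tangent vectors is equality of functions.\<close>

type_synonym ('m, 'e) tvec = "('m, 'e) chart \<Rightarrow> 'e"

definition tangent_space ::
  "('m, 'e::euclidean_space) chart set \<Rightarrow> 'm \<Rightarrow> ('m, 'e) tvec set" where
  "tangent_space A p = {v. (\<forall>c. c \<notin> charts_at A p \<longrightarrow> v c = 0) \<and>
     (\<forall>c\<in>charts_at A p. \<forall>d\<in>charts_at A p.
        v d = frechet_derivative (transition c d) (at (snd c p)) (v c))}"

text \<open>The tangent vector with components \<open>a\<close> in the chart \<open>c\<close>.\<close>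

definition coord_vec ::
  "('m, 'e::euclidean_space) chart set \<Rightarrow> 'm \<Rightarrow> ('m, 'e) chart \<Rightarrow> 'e \<Rightarrow> ('m, 'e) tvec" where
  "coord_vec A p c a = (\<lambda>d. if d \<in> charts_at A p
     then frechet_derivative (transition c d) (at (snd c p)) a else 0)"

definition tangent_atlas ::
  "('m, 'e::euclidean_space) chart set \<Rightarrow> ('m \<times> ('m, 'e) tvec, 'e \<times> 'e) chart set" where
  "tangent_atlas A =
     (\<lambda>c. ({(p, v). p \<in> fst c \<and> v \<in> tangent_space A p}, \<lambda>(p, v). (snd c p, v c))) ` A"

definition velocity ::
  "('m, 'e::euclidean_space) chart set \<Rightarrow> (real \<Rightarrow> 'm) \<Rightarrow> real \<Rightarrow> ('m, 'e) tvec" where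
  "velocity A \<gamma> t = (\<lambda>c. if c \<in> charts_at A (\<gamma> t)
     then vector_derivative (\<lambda>s. snd c (\<gamma> s)) (at t) else 0)"

definition curves_through ::
  "('m, 'e::euclidean_space) chart set \<Rightarrow> 'm set \<Rightarrow> 'm \<Rightarrow> (real \<Rightarrow> 'm) set" where
  "curves_through A X p = {\<sigma>. \<sigma> 0 = p \<and>
     (\<exists>\<epsilon>>0. \<sigma> ` {-\<epsilon><..<\<epsilon>} \<subseteq> X \<and> smooth_map std_atlas A {-\<epsilon><..<\<epsilon>} \<sigma>)}"

definition sub_tangent ::
  "('m, 'e::euclidean_space) chart set \<Rightarrow> 'm set \<Rightarrow> 'm \<Rightarrow> ('m, 'e) tvec set" where
  "sub_tangent A X p = {velocity A \<sigma> 0 | \<sigma>. \<sigma> \<in> curves_through A X p}"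

definition smooth_field ::
  "('m, 'e::euclidean_space) chart set \<Rightarrow> 'm set \<Rightarrow> ('m \<Rightarrow> ('m, 'e) tvec) \<Rightarrow> bool" where
  "smooth_field A X W \<longleftrightarrow> (\<forall>p\<in>X. W p \<in> tangent_space A p) \<and>
     smooth_map A (tangent_atlas A) X (\<lambda>p. (p, W p))"

definition smooth_field_along ::
  "('m, 'e::euclidean_space) chart set \<Rightarrow> real set \<Rightarrow> (real \<Rightarrow> 'm) \<Rightarrow>
     (real \<Rightarrow> ('m, 'e) tvec) \<Rightarrow> bool" where
  "smooth_field_along A I \<gamma> Y \<longleftrightarrow> (\<forall>t\<in>I. Y t \<in> tangent_space A (\<gamma> t)) \<and>
     smooth_map std_atlas (tangent_atlas A) I (\<lambda>t. (\<gamma> t, Y t))"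


section \<open>Lorentzian geometry\<close>

type_synonym ('m, 'e) metric = "'m \<Rightarrow> ('m, 'e) tvec \<Rightarrow> ('m, 'e) tvec \<Rightarrow> real"

definition metric_coeff ::
  "('m, 'e::euclidean_space) chart set \<Rightarrow> ('m, 'e) metric \<Rightarrow> ('m, 'e) chart \<Rightarrow>
     'e \<Rightarrow> 'e \<Rightarrow> 'e \<Rightarrow> real" where
  "metric_coeff A g c x a b = (let p = inv_into (fst c) (snd c) x
     in g p (coord_vec A p c a) (coord_vec A p c b))"

text \<open>The signature is expressed by an orthonormal family with exactly one timelike member; it is
  indexed by the basis of the model space, hence is a basis of the tangent space.\<close>

definition lorentzian_metric ::
  "('m, 'e::euclidean_space) chart set \<Rightarrow> ('m, 'e) metric \<Rightarrow> bool" where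
  "lorentzian_metric A g \<longleftrightarrow>
     (\<forall>p\<in>points A. \<forall>u\<in>tangent_space A p. \<forall>v\<in>tangent_space A p. g p u v = g p v u) \<and>
     (\<forall>p\<in>points A. \<forall>u\<in>tangent_space A p. \<forall>v\<in>tangent_space A p. \<forall>w\<in>tangent_space A p. \<forall>r s.
        g p (\<lambda>c. r *\<^sub>R u c + s *\<^sub>R v c) w = r * g p u w + s * g p v w) \<and>
     (\<forall>c\<in>A. \<forall>a b. smooth_on (snd c ` fst c) (\<lambda>x. metric_coeff A g c x a b)) \<and>
     (\<forall>p\<in>points A. \<exists>b0\<in>(Basis :: 'e set). \<exists>E. \<forall>b\<in>Basis. E b \<in> tangent_space A p \<and>
        (\<forall>b'\<in>Basis. g p (E b) (E b') = (if b \<noteq> b' then 0 else if b = b0 then -1 else 1)))"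

text \<open>The time orientation is represented by a smooth timelike vector field \<open>T\<close>.\<close>

definition spacetime ::
  "('m, 'e::euclidean_space) chart set \<Rightarrow> ('m, 'e) metric \<Rightarrow> ('m \<Rightarrow> ('m, 'e) tvec) \<Rightarrow> bool" where
  "spacetime A g T \<longleftrightarrow> smooth_manifold A \<and> connected_space (manifold_topology A) \<and>
     lorentzian_metric A g \<and>
     smooth_field A (points A) T \<and> (\<forall>p\<in>points A. g p (T p) (T p) < 0)"

text \<open>The Levi-Civita connection in a chart: the unique torsion-free metric connection, whose
  torsion-freeness is symmetry of the Christoffel symbol.\<close>

definition christoffel ::
  "('m, 'e::euclidean_space) chart set \<Rightarrow> ('m, 'e) metric \<Rightarrow> ('m, 'e) chart \<Rightarrow>
     'e \<Rightarrow> 'e \<Rightarrow> 'e \<Rightarrow> 'e" where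
  "christoffel A g c x = (THE \<Gamma>. bilinear \<Gamma> \<and> (\<forall>a b. \<Gamma> a b = \<Gamma> b a) \<and>
     (\<forall>v a b. frechet_derivative (\<lambda>y. metric_coeff A g c y a b) (at x) v =
        metric_coeff A g c x (\<Gamma> v a) b + metric_coeff A g c x a (\<Gamma> v b)))"

definition nabla_chart ::
  "('m, 'e::euclidean_space) chart set \<Rightarrow> ('m, 'e) metric \<Rightarrow> ('m, 'e) chart \<Rightarrow>
     ('e \<Rightarrow> 'e) \<Rightarrow> ('e \<Rightarrow> 'e) \<Rightarrow> 'e \<Rightarrow> 'e" where
  "nabla_chart A g c X Y x =
     frechet_derivative Y (at x) (X x) + christoffel A g c x (X x) (Y x)"

definition lie_bracket :: "('e::euclidean_space \<Rightarrow> 'e) \<Rightarrow> ('e \<Rightarrow> 'e) \<Rightarrow> 'e \<Rightarrow> 'e" where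
  "lie_bracket X Y x = frechet_derivative Y (at x) (X x) - frechet_derivative X (at x) (Y x)"

definition curvature_chart ::
  "('m, 'e::euclidean_space) chart set \<Rightarrow> ('m, 'e) metric \<Rightarrow> ('m, 'e) chart \<Rightarrow>
     ('e \<Rightarrow> 'e) \<Rightarrow> ('e \<Rightarrow> 'e) \<Rightarrow> ('e \<Rightarrow> 'e) \<Rightarrow> 'e \<Rightarrow> 'e" where
  "curvature_chart A g c X Y Z x =
     nabla_chart A g c X (nabla_chart A g c Y Z) x
     - nabla_chart A g c Y (nabla_chart A g c X Z) x
     - nabla_chart A g c (lie_bracket X Y) Z x"

text \<open>The curvature is tensorial, so the three vectors may be extended to any vector fields near the
  point, here to those with constant components.\<close>

definition riemann ::
  "('m, 'e::euclidean_space) chart set \<Rightarrow> ('m, 'e) metric \<Rightarrow> 'm \<Rightarrow>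
     ('m, 'e) tvec \<Rightarrow> ('m, 'e) tvec \<Rightarrow> ('m, 'e) tvec \<Rightarrow> ('m, 'e) tvec" where
  "riemann A g p u v w = (\<lambda>c. if c \<in> charts_at A p
     then curvature_chart A g c (\<lambda>_. u c) (\<lambda>_. v c) (\<lambda>_. w c) (snd c p) else 0)"

text \<open>The trace of an endomorphism of a tangent space, computed in the coordinate basis of some
  chart; it does not depend on the chart.\<close>

definition trace_at ::
  "('m, 'e::euclidean_space) chart set \<Rightarrow> 'm \<Rightarrow> (('m, 'e) tvec \<Rightarrow> ('m, 'e) tvec) \<Rightarrow> real" where
  "trace_at A p L = (let c = SOME c. c \<in> charts_at A p
     in \<Sum>b\<in>Basis. L (coord_vec A p c b) c \<bullet> b)"

definition ricci ::
  "('m, 'e::euclidean_space) chart set \<Rightarrow> ('m, 'e) metric \<Rightarrow> 'm \<Rightarrow>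
     ('m, 'e) tvec \<Rightarrow> ('m, 'e) tvec \<Rightarrow> real" where
  "ricci A g p y z = trace_at A p (\<lambda>x. riemann A g p x y z)"

definition cov_along ::
  "('m, 'e::euclidean_space) chart set \<Rightarrow> ('m, 'e) metric \<Rightarrow> (real \<Rightarrow> 'm) \<Rightarrow>
     (real \<Rightarrow> ('m, 'e) tvec) \<Rightarrow> real \<Rightarrow> ('m, 'e) tvec" where
  "cov_along A g \<gamma> Y t = (\<lambda>c. if c \<in> charts_at A (\<gamma> t)
     then vector_derivative (\<lambda>s. Y s c) (at t)
       + christoffel A g c (snd c (\<gamma> t)) (velocity A \<gamma> t c) (Y t c)
     else 0)"

definition geodesic ::
  "('m, 'e::euclidean_space) chart set \<Rightarrow> ('m, 'e) metric \<Rightarrow> real set \<Rightarrow> (real \<Rightarrow> 'm) \<Rightarrow> bool" where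
  "geodesic A g I \<gamma> \<longleftrightarrow> smooth_map std_atlas A I \<gamma> \<and>
     (\<forall>t\<in>I. cov_along A g \<gamma> (velocity A \<gamma>) t = (\<lambda>_. 0))"

definition jacobi_field ::
  "('m, 'e::euclidean_space) chart set \<Rightarrow> ('m, 'e) metric \<Rightarrow> real set \<Rightarrow> (real \<Rightarrow> 'm) \<Rightarrow>
     (real \<Rightarrow> ('m, 'e) tvec) \<Rightarrow> bool" where
  "jacobi_field A g I \<gamma> J \<longleftrightarrow> smooth_field_along A I \<gamma> J \<and>
     (\<forall>t\<in>I. (\<lambda>c. cov_along A g \<gamma> (cov_along A g \<gamma> J) t c
        + riemann A g (\<gamma> t) (J t) (velocity A \<gamma> t) (velocity A \<gamma> t) c) = (\<lambda>_. 0))"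

definition exp_rel ::
  "('m, 'e::euclidean_space) chart set \<Rightarrow> ('m, 'e) metric \<Rightarrow> 'm \<Rightarrow> ('m, 'e) tvec \<Rightarrow> 'm \<Rightarrow> bool" where
  "exp_rel A g p v q \<longleftrightarrow> (\<exists>\<gamma> a b. a < 0 \<and> 1 < b \<and> geodesic A g {a<..<b} \<gamma> \<and>
     \<gamma> 0 = p \<and> velocity A \<gamma> 0 = v \<and> \<gamma> 1 = q)"

definition exp_map ::
  "('m, 'e::euclidean_space) chart set \<Rightarrow> ('m, 'e) metric \<Rightarrow> 'm \<Rightarrow> ('m, 'e) tvec \<Rightarrow> 'm" where
  "exp_map A g p v = (THE q. exp_rel A g p v q)"


section \<open>The null hypersurface generated by a spacelike submanifold\<close>

definition spacelike_submanifold ::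
  "('m, 'e::euclidean_space) chart set \<Rightarrow> ('m, 'e) metric \<Rightarrow> nat \<Rightarrow> 'm set \<Rightarrow> bool" where
  "spacelike_submanifold A g k S \<longleftrightarrow> embedded_submanifold A k S \<and>
     connectedin (manifold_topology A) S \<and>
     (\<forall>p\<in>S. \<forall>x\<in>sub_tangent A S p. x \<noteq> (\<lambda>_. 0) \<longrightarrow> g p x x > 0)"

definition normal_bundle ::
  "('m, 'e::euclidean_space) chart set \<Rightarrow> ('m, 'e) metric \<Rightarrow> 'm set \<Rightarrow>
     ('m \<times> ('m, 'e) tvec) set" where
  "normal_bundle A g S = {(p, v). p \<in> S \<and> v \<in> tangent_space A p \<and>
     (\<forall>x\<in>sub_tangent A S p. g p v x = 0)}"

definition lightlike_normal_field ::
  "('m, 'e::euclidean_space) chart set \<Rightarrow> ('m, 'e) metric \<Rightarrow> 'm set \<Rightarrow>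
     ('m \<Rightarrow> ('m, 'e) tvec) \<Rightarrow> bool" where
  "lightlike_normal_field A g S \<xi> \<longleftrightarrow> smooth_field A S \<xi> \<and>
     (\<forall>p\<in>S. (p, \<xi> p) \<in> normal_bundle A g S \<and> \<xi> p \<noteq> (\<lambda>_. 0) \<and> g p (\<xi> p) (\<xi> p) = 0)"

text \<open>The admissible domains of the normal exponential map. The image is an open set containing the
  submanifold, because the zero section is mapped identically onto the latter.\<close>

definition normal_exp_domain ::
  "('m, 'e::euclidean_space) chart set \<Rightarrow> ('m, 'e) metric \<Rightarrow> 'm set \<Rightarrow>
     ('m \<times> ('m, 'e) tvec) set \<Rightarrow> bool" where
  "normal_exp_domain A g S \<V> \<longleftrightarrow>
     openin (subtopology (manifold_topology (tangent_atlas A)) (normal_bundle A g S)) \<V> \<and>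
     (\<forall>p\<in>S. (p, \<lambda>_. 0) \<in> \<V>) \<and>
     (\<forall>(p, v)\<in>\<V>. \<forall>s\<in>{0..1}. (p, \<lambda>c. s *\<^sub>R v c) \<in> \<V>) \<and>
     (\<forall>(p, v)\<in>\<V>. \<exists>q. exp_rel A g p v q) \<and>
     (\<exists>W. openin (manifold_topology A) W \<and>
        diffeo (tangent_atlas A) A \<V> W (\<lambda>(p, v). exp_map A g p v))"

text \<open>The data of the construction: an ambient spacetime of dimension \<open>n + 2\<close>, a codimension two
  spacelike submanifold \<open>S\<close>, a lightlike normal field \<open>\<xi>\<close> on it and a domain \<open>\<V>\<close> of the normal
  exponential map.\<close>

definition null_generation ::
  "nat \<Rightarrow> ('m, 'e::euclidean_space) chart set \<Rightarrow> ('m, 'e) metric \<Rightarrow> ('m \<Rightarrow> ('m, 'e) tvec) \<Rightarrow>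
     'm set \<Rightarrow> ('m \<Rightarrow> ('m, 'e) tvec) \<Rightarrow> ('m \<times> ('m, 'e) tvec) set \<Rightarrow> bool" where
  "null_generation n A g T S \<xi> \<V> \<longleftrightarrow> DIM('e) = n + 2 \<and> spacetime A g T \<and>
     spacelike_submanifold A g n S \<and> lightlike_normal_field A g S \<xi> \<and>
     normal_exp_domain A g S \<V>"

definition flow_domain ::
  "'m set \<Rightarrow> ('m \<Rightarrow> ('m, 'e::real_vector) tvec) \<Rightarrow> ('m \<times> ('m, 'e) tvec) set \<Rightarrow>
     ('m \<times> real) set" where
  "flow_domain S \<xi> \<V> = {(p, t). p \<in> S \<and> (p, \<lambda>c. t *\<^sub>R \<xi> p c) \<in> \<V>}"

definition generator_interval ::
  "'m set \<Rightarrow> ('m \<Rightarrow> ('m, 'e::real_vector) tvec) \<Rightarrow> ('m \<times> ('m, 'e) tvec) set \<Rightarrow>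
     'm \<Rightarrow> real set" where
  "generator_interval S \<xi> \<V> p = {t. (p, t) \<in> flow_domain S \<xi> \<V>}"

definition generator ::
  "('m, 'e::euclidean_space) chart set \<Rightarrow> ('m, 'e) metric \<Rightarrow> ('m \<Rightarrow> ('m, 'e) tvec) \<Rightarrow>
     'm \<Rightarrow> real \<Rightarrow> 'm" where
  "generator A g \<xi> p t = exp_map A g p (\<lambda>c. t *\<^sub>R \<xi> p c)"

definition null_hypersurface ::
  "('m, 'e::euclidean_space) chart set \<Rightarrow> ('m, 'e) metric \<Rightarrow> 'm set \<Rightarrow>
     ('m \<Rightarrow> ('m, 'e) tvec) \<Rightarrow> ('m \<times> ('m, 'e) tvec) set \<Rightarrow> 'm set" where
  "null_hypersurface A g S \<xi> \<V> = (\<lambda>(p, t). generator A g \<xi> p t) ` flow_domain S \<xi> \<V>"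

definition flow_coords ::
  "('m, 'e::euclidean_space) chart set \<Rightarrow> ('m, 'e) metric \<Rightarrow> 'm set \<Rightarrow>
     ('m \<Rightarrow> ('m, 'e) tvec) \<Rightarrow> ('m \<times> ('m, 'e) tvec) set \<Rightarrow> 'm \<Rightarrow> 'm \<times> real" where
  "flow_coords A g S \<xi> \<V> =
     inv_into (flow_domain S \<xi> \<V>) (\<lambda>(p, t). generator A g \<xi> p t)"

text \<open>The vector field \<open>U\<close>, push-forward of the coordinate field of the flow parameter.\<close>

definition null_field ::
  "('m, 'e::euclidean_space) chart set \<Rightarrow> ('m, 'e) metric \<Rightarrow> 'm set \<Rightarrow>
     ('m \<Rightarrow> ('m, 'e) tvec) \<Rightarrow> ('m \<times> ('m, 'e) tvec) set \<Rightarrow> 'm \<Rightarrow> ('m, 'e) tvec" where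
  "null_field A g S \<xi> \<V> q =
     (case flow_coords A g S \<xi> \<V> q of (p, t) \<Rightarrow> velocity A (generator A g \<xi> p) t)"

definition screen ::
  "('m, 'e::euclidean_space) chart set \<Rightarrow> ('m, 'e) metric \<Rightarrow> 'm set \<Rightarrow>
     ('m \<Rightarrow> ('m, 'e) tvec) \<Rightarrow> ('m \<times> ('m, 'e) tvec) set \<Rightarrow> 'm \<Rightarrow> ('m, 'e) tvec set" where
  "screen A g S \<xi> \<V> q = (case flow_coords A g S \<xi> \<V> q of (p, t) \<Rightarrow>
     {velocity A (\<lambda>s. generator A g \<xi> (\<sigma> s) t) 0 | \<sigma>. \<sigma> \<in> curves_through A S p})"

text \<open>The vector field \<open>V\<close>; it is nonzero by the normalization, hence lightlike.\<close>

definition transversal_field ::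
  "('m, 'e::euclidean_space) chart set \<Rightarrow> ('m, 'e) metric \<Rightarrow> 'm set \<Rightarrow>
     ('m \<Rightarrow> ('m, 'e) tvec) \<Rightarrow> ('m \<times> ('m, 'e) tvec) set \<Rightarrow> 'm \<Rightarrow> ('m, 'e) tvec" where
  "transversal_field A g S \<xi> \<V> q = (THE v. v \<in> tangent_space A q \<and> g q v v = 0 \<and>
     (\<forall>x\<in>screen A g S \<xi> \<V> q. g q v x = 0) \<and> g q (null_field A g S \<xi> \<V> q) v = -1)"

text \<open>The ambient covariant derivative, in a direction \<open>x\<close> tangent to \<open>X\<close>, of a vector field \<open>W\<close> that
  is defined on \<open>X\<close> only: the common value of the covariant derivatives of \<open>W\<close> along the curves in
  \<open>X\<close> with initial velocity \<open>x\<close>.\<close>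

definition nabla_sub ::
  "('m, 'e::euclidean_space) chart set \<Rightarrow> ('m, 'e) metric \<Rightarrow> 'm set \<Rightarrow>
     ('m \<Rightarrow> ('m, 'e) tvec) \<Rightarrow> 'm \<Rightarrow> ('m, 'e) tvec \<Rightarrow> ('m, 'e) tvec" where
  "nabla_sub A g X W q x = (THE w. \<forall>\<sigma>\<in>curves_through A X q. velocity A \<sigma> 0 = x \<longrightarrow>
     cov_along A g \<sigma> (\<lambda>s. W (\<sigma> s)) 0 = w)"

definition null_second_form ::
  "('m, 'e::euclidean_space) chart set \<Rightarrow> ('m, 'e) metric \<Rightarrow> 'm set \<Rightarrow>
     ('m \<Rightarrow> ('m, 'e) tvec) \<Rightarrow> ('m \<times> ('m, 'e) tvec) set \<Rightarrow> 'm \<Rightarrow>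
     ('m, 'e) tvec \<Rightarrow> ('m, 'e) tvec \<Rightarrow> real" where
  "null_second_form A g S \<xi> \<V> q x y =
     - g q (nabla_sub A g (null_hypersurface A g S \<xi> \<V>) (null_field A g S \<xi> \<V>) q x) y"

text \<open>Total umbilicity of the hypersurface, with umbilicity function \<open>\<mu>\<close>.\<close>

definition umbilical_with ::
  "('m, 'e::euclidean_space) chart set \<Rightarrow> ('m, 'e) metric \<Rightarrow> 'm set \<Rightarrow>
     ('m \<Rightarrow> ('m, 'e) tvec) \<Rightarrow> ('m \<times> ('m, 'e) tvec) set \<Rightarrow> ('m \<Rightarrow> real) \<Rightarrow> bool" where
  "umbilical_with A g S \<xi> \<V> \<mu> \<longleftrightarrow>
     smooth_map A std_atlas (null_hypersurface A g S \<xi> \<V>) \<mu> \<and>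
     (\<forall>q\<in>null_hypersurface A g S \<xi> \<V>.
        \<forall>x\<in>sub_tangent A (null_hypersurface A g S \<xi> \<V>) q.
        \<forall>y\<in>sub_tangent A (null_hypersurface A g S \<xi> \<V>) q.
          null_second_form A g S \<xi> \<V> q x y = \<mu> q * g q x y)"

definition rotation_form ::
  "('m, 'e::euclidean_space) chart set \<Rightarrow> ('m, 'e) metric \<Rightarrow> 'm set \<Rightarrow>
     ('m \<Rightarrow> ('m, 'e) tvec) \<Rightarrow> ('m \<times> ('m, 'e) tvec) set \<Rightarrow> 'm \<Rightarrow> ('m, 'e) tvec \<Rightarrow> real" where
  "rotation_form A g S \<xi> \<V> q x =
     - g q (nabla_sub A g (null_hypersurface A g S \<xi> \<V>) (null_field A g S \<xi> \<V>) q x)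
         (transversal_field A g S \<xi> \<V> q)"

definition orthogonal_jacobi_field ::
  "('m, 'e::euclidean_space) chart set \<Rightarrow> ('m, 'e) metric \<Rightarrow> real set \<Rightarrow> (real \<Rightarrow> 'm) \<Rightarrow>
     (real \<Rightarrow> ('m, 'e) tvec) \<Rightarrow> bool" where
  "orthogonal_jacobi_field A g I \<gamma> J \<longleftrightarrow> jacobi_field A g I \<gamma> J \<and>
     (\<forall>t\<in>I. g (\<gamma> t) (J t) (velocity A \<gamma> t) = 0)"

text \<open>The equation \<open>J'' + (Ric(\<gamma>', \<gamma>') / n) J = f \<gamma>'\<close> on the interval \<open>I\<close>, with smooth \<open>f\<close>.\<close>

definition ricci_jacobi_equation ::
  "nat \<Rightarrow> ('m, 'e::euclidean_space) chart set \<Rightarrow> ('m, 'e) metric \<Rightarrow> real set \<Rightarrow> (real \<Rightarrow> 'm) \<Rightarrow>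
     (real \<Rightarrow> ('m, 'e) tvec) \<Rightarrow> (real \<Rightarrow> real) \<Rightarrow> bool" where
  "ricci_jacobi_equation n A g I \<gamma> J f \<longleftrightarrow> smooth_on I f \<and>
     (\<forall>t\<in>I. (\<lambda>c. cov_along A g \<gamma> (cov_along A g \<gamma> J) t c
         + (ricci A g (\<gamma> t) (velocity A \<gamma> t) (velocity A \<gamma> t) / real n) *\<^sub>R J t c)
       = (\<lambda>c. f t *\<^sub>R velocity A \<gamma> t c))"

end

theory Submission
  imports Defs
begin

text \<open>Let \<open>X\<close> be the push-forward of a tangent vector of \<open>S\<close> along a generator. Total umbilicity gives
  \<open>\<nabla>\<^sub>X U = - \<mu> X + \<alpha> U\<close>. Since \<open>X\<close> and \<open>U\<close> commute and \<open>\<nabla>\<^sub>U U = 0\<close>, differentiating along \<open>U\<close> yields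
  \<open>R(X, U) U = \<kappa> X\<close> modulo \<open>U\<close>, with \<open>\<kappa> = U \<mu> - \<mu>\<^sup>2\<close>. The vectors \<open>X\<close> and \<open>U\<close> span the
  null hyperplane \<open>U\<^sup>\<bottom>\<close> by a dimension count, and \<open>R(V, U) U\<close> is orthogonal to \<open>U\<close> for every \<open>V\<close>, so the trace
  is \<open>Ric(U, U) = n \<kappa>\<close>. Inserting this into the Jacobi equation gives the claim for every \<open>J\<close> orthogonal to \<open>U\<close>.

  For the second part, \<open>\<gamma>'\<close> itself is an orthogonal Jacobi field with \<open>\<tau>(\<gamma>') = 0\<close>, not tangent to the
  screen, and with \<open>f = Ric(\<gamma>', \<gamma>') / n\<close>, whereas the zero field has \<open>f = 0\<close>. Hence any umbilical example
  with \<open>Ric(\<gamma>', \<gamma>') \<noteq> 0\<close> suffices, and a plane wave provides one.\<close>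

section \<open>Calculus of smooth functions\<close>

text \<open>The curvature argument is pointwise linear algebra; the obstacle is that every object is
  known only on a thin set or through a description. The normal field lives on \<open>S\<close>,
  \<open>U\<close> on the hypersurface, and the Christoffel symbol, \<open>nabla_sub\<close> and the
  trace are defined by definite or indefinite choice. Smoothness is therefore rarely read off a
  formula: in charts, the fields are replaced by smooth functions on open sets of the model space
  that agree with them at the relevant points, the Christoffel symbol is treated as the solution of
  a smooth linear system, and coefficients of \<open>U\<close> are recovered as Euclidean quotients.
  Tangent vectors enter as velocities of curves, so that the commutation of \<open>X\<close> and
  \<open>U\<close> becomes the symmetry of second derivatives of a map of two real variables.

  The Ricci factor is n although the ambient dimension is n + 2, because R(., U) U - \<kappa> id has
  trace -2 \<kappa>. In the plane wave the factor e^(2u) makes the umbilicity function the constant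
  -1; then \<kappa> = 0 - 1 = -1, and the field \<gamma>' has f = -1.\<close>

abbreviation Dat :: "('a::real_normed_vector \<Rightarrow> 'b::real_normed_vector) \<Rightarrow> 'a \<Rightarrow> 'a \<Rightarrow> 'b" where
  "Dat f x \<equiv> frechet_derivative f (at x)"

lemma Dat_eq: "(f has_derivative f') (at x) \<Longrightarrow> Dat f x = f'"
  using frechet_derivative_at by metis

lemma Dat_works: "f differentiable (at x) \<Longrightarrow> (f has_derivative Dat f x) (at x)"
  by (simp add: frechet_derivative_works)

text \<open>\<open>Dat\<close> is a choice among all derivatives at \<open>x\<close>. Two functions
  that agree near \<open>x\<close> have the same derivatives there, so the choices coincide even
  where nothing is differentiable.\<close>

lemma Dat_cong:
  assumes "open X" "x \<in> X" "\<And>y. y \<in> X \<Longrightarrow> f y = g y"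
  shows "Dat f x = Dat g x"
proof -
  have "(f has_derivative L) (at x) \<longleftrightarrow> (g has_derivative L) (at x)" for L
    using assms has_derivative_transform_within_open[of f L x UNIV X g]
      has_derivative_transform_within_open[of g L x UNIV X f] by auto
  then show ?thesis by (simp add: frechet_derivative_def)
qed

section \<open>Closure properties of the classes C^k\<close>

lemma Ck_on_continuous: "Ck_on k X f \<Longrightarrow> continuous_on X f"
  by (cases k) (auto simp: continuous_on_eq_continuous_within differentiable_imp_continuous_within
      intro: continuous_at_imp_continuous_at_within)

lemma Ck_on_SucD: "Ck_on (Suc k) X f \<Longrightarrow> Ck_on k X f"
proof (induction k arbitrary: f)
  case 0
  then show ?case using Ck_on_continuous Ck_on.simps(1) by blast
next
  case (Suc k)
  then show ?case by (metis Ck_on.simps(2))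
qed

lemma Ck_on_subset: "Ck_on k X f \<Longrightarrow> Y \<subseteq> X \<Longrightarrow> Ck_on k Y f"
  by (induction k arbitrary: f) (auto intro: continuous_on_subset)

lemma Ck_on_local:
  assumes "\<And>x. x \<in> X \<Longrightarrow> \<exists>N. open N \<and> x \<in> N \<and> Ck_on k N f"
  shows "Ck_on k X f"
  using assms
proof (induction k arbitrary: f)
  case 0
  have "isCont f x" if "x \<in> X" for x
    using 0[OF that] by (auto simp: continuous_on_eq_continuous_at)
  then show ?case by (simp add: continuous_at_imp_continuous_on)
next
  case (Suc k)
  have "f differentiable (at x)" if "x \<in> X" for x
    using Suc.prems[OF that] by auto
  moreover have "Ck_on k X (\<lambda>x. Dat f x v)" for v
    by (rule Suc.IH) (use Suc.prems in fastforce)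
  ultimately show ?case by simp
qed

text \<open>Derivatives are taken in the full space at points of \<open>X\<close>; openness turns
  agreement on \<open>X\<close> into agreement near each of its points.\<close>

lemma Ck_on_cong:
  assumes "open X" "Ck_on k X f" "\<And>x. x \<in> X \<Longrightarrow> f x = g x"
  shows "Ck_on k X g"
  using assms(2,3)
proof (induction k arbitrary: f g)
  case 0
  then show ?case by (metis Ck_on.simps(1) continuous_on_cong)
next
  case (Suc k)
  have "g differentiable (at x)" if "x \<in> X" for x
  proof -
    have "f differentiable (at x)" using Suc.prems that by simp
    then obtain L where "(f has_derivative L) (at x)" by (auto simp: differentiable_def)
    then have "(g has_derivative L) (at x)"
      using has_derivative_transform_within_open[of f L x UNIV X g] that Suc.prems assms(1) by auto
    then show ?thesis by (auto simp: differentiable_def)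
  qed
  moreover have "Ck_on k X (\<lambda>x. Dat g x v)" for v
  proof (rule Suc.IH)
    show "Ck_on k X (\<lambda>x. Dat f x v)" using Suc.prems by simp
    show "Dat f x v = Dat g x v" if "x \<in> X" for x
      using Dat_cong[OF assms(1) that, of f g] Suc.prems by simp
  qed
  ultimately show ?case by simp
qed

text \<open>The rule behind the closure properties below: it suffices to exhibit some derivative
  whose value in each fixed direction is of class C^k.\<close>

lemma Ck_on_SucI:
  assumes "open X" "\<And>x. x \<in> X \<Longrightarrow> (f has_derivative f' x) (at x)"
    "\<And>v. Ck_on k X (\<lambda>x. f' x v)"
  shows "Ck_on (Suc k) X f"
proof -
  have "f differentiable (at x)" if "x \<in> X" for x
    using assms(2)[OF that] by (auto simp: differentiable_def)
  moreover have "Ck_on k X (\<lambda>x. Dat f x v)" for v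
    by (rule Ck_on_cong[OF assms(1) assms(3)]) (simp add: Dat_eq[OF assms(2)])
  ultimately show ?thesis by simp
qed

lemma Ck_on_SucE:
  assumes "Ck_on (Suc k) X f"
  shows "x \<in> X \<Longrightarrow> (f has_derivative Dat f x) (at x)" "Ck_on k X (\<lambda>x. Dat f x v)"
  using assms Dat_works by auto

lemma Ck_on_const: "Ck_on k X (\<lambda>x. c)"
  by (induction k arbitrary: c) auto

lemma Ck_on_bounded_linear:
  assumes "bounded_linear f" "open X" shows "Ck_on k X f"
proof (cases k)
  case 0 then show ?thesis by (simp add: assms linear_continuous_on)
next
  case (Suc j)
  show ?thesis unfolding Suc
    by (rule Ck_on_SucI[OF assms(2) bounded_linear_imp_has_derivative[OF assms(1)] Ck_on_const])
qed

lemma Ck_on_linear_comp: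
  assumes "bounded_linear h" "open X"
  shows "Ck_on k X f \<Longrightarrow> Ck_on k X (\<lambda>x. h (f x))"
proof (induction k arbitrary: f)
  case 0
  then show ?case by (simp add: assms bounded_linear.continuous_on)
next
  case (Suc k)
  show ?case
    by (rule Ck_on_SucI[OF assms(2) bounded_linear.has_derivative[OF assms(1) Ck_on_SucE(1)]])
      (use Suc in auto)
qed

lemma Ck_on_add:
  assumes "open X"
  shows "Ck_on k X f \<Longrightarrow> Ck_on k X g \<Longrightarrow> Ck_on k X (\<lambda>x. f x + g x)"
proof (induction k arbitrary: f g)
  case 0
  then show ?case by (simp add: continuous_on_add)
next
  case (Suc k)
  show ?case
    by (rule Ck_on_SucI[OF assms has_derivative_add[OF Ck_on_SucE(1)[OF Suc.prems(1)] Ck_on_SucE(1)[OF Suc.prems(2)]]])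
      (use Suc in auto)
qed

lemma Ck_on_sum:
  assumes "open X" "\<And>i. i \<in> I \<Longrightarrow> Ck_on k X (f i)"
  shows "Ck_on k X (\<lambda>x. \<Sum>i\<in>I. f i x)"
  using assms(2)
  by (induction I rule: infinite_finite_induct) (auto simp: Ck_on_const Ck_on_add[OF assms(1)])

lemma Ck_on_bilinear:
  assumes "open X" "bounded_bilinear pr"
  shows "Ck_on k X f \<Longrightarrow> Ck_on k X g \<Longrightarrow> Ck_on k X (\<lambda>x. pr (f x) (g x))"
proof (induction k arbitrary: f g)
  case 0
  then show ?case by (simp add: bounded_bilinear.continuous_on[OF assms(2)])
next
  case (Suc k)
  show ?case
  proof (rule Ck_on_SucI[OF assms(1) bounded_bilinear.FDERIV[OF assms(2) Ck_on_SucE(1)[OF Suc.prems(1)] Ck_on_SucE(1)[OF Suc.prems(2)]]])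
    show "Ck_on k X (\<lambda>x. pr (f x) (Dat g x v) + pr (Dat f x v) (g x))" for v
      by (intro Ck_on_add[OF assms(1)] Suc.IH Ck_on_SucE(2)[OF Suc.prems(1)]
          Ck_on_SucE(2)[OF Suc.prems(2)] Ck_on_SucD[OF Suc.prems(1)] Ck_on_SucD[OF Suc.prems(2)])
  qed auto
qed

lemma Ck_on_Pair:
  assumes "open X"
  shows "Ck_on k X f \<Longrightarrow> Ck_on k X g \<Longrightarrow> Ck_on k X (\<lambda>x. (f x, g x))"
proof (induction k arbitrary: f g)
  case 0
  then show ?case by (simp add: continuous_on_Pair)
next
  case (Suc k)
  show ?case
    by (rule Ck_on_SucI[OF assms has_derivative_Pair[OF Ck_on_SucE(1)[OF Suc.prems(1)] Ck_on_SucE(1)[OF Suc.prems(2)]]])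
      (use Suc in auto)
qed

text \<open>Replaces statements about operator-valued maps by statements about their finitely many
  values on basis vectors, the only ones that \<open>Ck_on\<close> speaks about.\<close>

lemma linear_Basis_expand:
  fixes h :: "'a::euclidean_space \<Rightarrow> 'b::real_vector"
  assumes "linear h"
  shows "h v = (\<Sum>b\<in>Basis. (v \<bullet> b) *\<^sub>R h b)"
  by (metis (no_types, lifting) assms euclidean_representation linear_scale linear_sum sum.cong)

text \<open>The chain rule yields \<open>Dat f (g x) (Dat g x v)\<close>, whose direction moves with
  \<open>x\<close>, while \<open>Ck_on\<close> controls fixed directions only. Expanding the
  direction in the basis leaves products with \<open>Dat f (g x) b\<close>, to which the induction
  hypothesis applies.\<close>

lemma Ck_on_compose:
  fixes f :: "'b::euclidean_space \<Rightarrow> 'c::real_normed_vector" and g :: "'a::euclidean_space \<Rightarrow> 'b"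
  assumes X: "open X" and Y: "open Y" and gX: "g ` X \<subseteq> Y"
  shows "Ck_on k Y f \<Longrightarrow> Ck_on k X g \<Longrightarrow> Ck_on k X (\<lambda>x. f (g x))"
proof (induction k arbitrary: f)
  case 0
  then show ?case using gX by (auto intro: continuous_on_compose2)
next
  case (Suc k)
  show ?case
  proof (rule Ck_on_SucI[OF X])
    fix x assume x: "x \<in> X"
    show "((\<lambda>x. f (g x)) has_derivative
        (\<lambda>v. \<Sum>b\<in>Basis. (Dat g x v \<bullet> b) *\<^sub>R Dat f (g x) b)) (at x)"
    proof -
      have f: "(f has_derivative Dat f (g x)) (at (g x))" 
        using Ck_on_SucE(1)[OF Suc.prems(1)] x gX by auto
      have "((\<lambda>x. f (g x)) has_derivative (\<lambda>v. Dat f (g x) (Dat g x v))) (at x)"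
        using has_derivative_compose[OF Ck_on_SucE(1)[OF Suc.prems(2) x] f] .
      then show ?thesis
        by (rule has_derivative_eq_rhs)
          (rule ext, rule linear_Basis_expand, rule has_derivative_linear[OF f])
    qed
  next
    fix v
    have "Ck_on k X (\<lambda>x. (Dat g x v \<bullet> b) *\<^sub>R Dat f (g x) b)" for b
    proof (intro Ck_on_bilinear[OF X bounded_bilinear_scaleR])
      show "Ck_on k X (\<lambda>x. Dat g x v \<bullet> b)"
        by (intro Ck_on_linear_comp[OF bounded_linear_inner_left X] Ck_on_SucE(2)[OF Suc.prems(2)])
      show "Ck_on k X (\<lambda>x. Dat f (g x) b)"
        by (intro Suc.IH Ck_on_SucE(2)[OF Suc.prems(1)] Ck_on_SucD[OF Suc.prems(2)])
    qed
    then show "Ck_on k X (\<lambda>x. \<Sum>b\<in>Basis. (Dat g x v \<bullet> b) *\<^sub>R Dat f (g x) b)"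
      by (intro Ck_on_sum[OF X])
  qed
qed

text \<open>The derivative - (1/f) Df (1/f) involves only Df and the inverse itself, which is of
  class C^k by induction.\<close>

lemma Ck_on_inverse:
  fixes f :: "'a::euclidean_space \<Rightarrow> real"
  assumes X: "open X" and nz: "\<And>x. x \<in> X \<Longrightarrow> f x \<noteq> 0"
  shows "Ck_on k X f \<Longrightarrow> Ck_on k X (\<lambda>x. inverse (f x))"
proof (induction k)
  case 0
  then show ?case using nz by (auto intro: continuous_on_inverse)
next
  case (Suc k)
  note mult = Ck_on_bilinear[OF X bounded_bilinear_mult]
  show ?case
  proof (rule Ck_on_SucI[OF X Deriv.has_derivative_inverse[OF nz Ck_on_SucE(1)[OF Suc.prems]]])
    fix v
    have "Ck_on k X (\<lambda>x. (-1) * (inverse (f x) * Dat f x v * inverse (f x)))"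
      by (intro mult Ck_on_const Suc.IH Ck_on_SucD[OF Suc.prems] Ck_on_SucE(2)[OF Suc.prems])
    then show "Ck_on k X (\<lambda>x. - (inverse (f x) * Dat f x v * inverse (f x)))" by simp
  qed
qed

lemma Ck_on_exp:
  fixes f :: "'a::euclidean_space \<Rightarrow> real"
  assumes X: "open X"
  shows "Ck_on k X f \<Longrightarrow> Ck_on k X (\<lambda>x. exp (f x))"
proof (induction k)
  case 0
  then show ?case by (auto intro: continuous_on_exp)
next
  case (Suc k)
  have d: "((\<lambda>x. exp (f x)) has_derivative (\<lambda>v. exp (f x) * Dat f x v)) (at x)" if "x \<in> X" for x
    using has_derivative_exp[OF Ck_on_SucE(1)[OF Suc.prems that]] by (simp add: mult.commute)
  show ?case
    by (rule Ck_on_SucI[OF X d])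
      (auto intro!: Ck_on_bilinear[OF X bounded_bilinear_mult] Suc.IH Ck_on_SucD[OF Suc.prems] Ck_on_SucE(2)[OF Suc.prems])
qed

section \<open>Smooth functions: derivatives and closure properties\<close>

lemma smooth_on_Ck: "smooth_on X f \<Longrightarrow> Ck_on k X f"
  by (simp add: smooth_on_def)

lemma smooth_on_has_derivative:
  "smooth_on X f \<Longrightarrow> x \<in> X \<Longrightarrow> (f has_derivative Dat f x) (at x)"
  using Ck_on_SucE(1) smooth_on_Ck by blast

lemma smooth_on_differentiable: "smooth_on X f \<Longrightarrow> x \<in> X \<Longrightarrow> f differentiable (at x)"
  using smooth_on_has_derivative differentiable_def by blast

lemma smooth_on_linear_Dat: "smooth_on X f \<Longrightarrow> x \<in> X \<Longrightarrow> linear (Dat f x)"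
  using smooth_on_has_derivative has_derivative_linear by blast

lemma smooth_on_Dat: "smooth_on X f \<Longrightarrow> smooth_on X (\<lambda>x. Dat f x v)"
  unfolding smooth_on_def using Ck_on_SucE(2) by blast

lemma smooth_on_continuous: "smooth_on X f \<Longrightarrow> continuous_on X f"
  using Ck_on_continuous smooth_on_Ck by blast

lemma smooth_on_subset: "smooth_on X f \<Longrightarrow> Y \<subseteq> X \<Longrightarrow> smooth_on Y f"
  unfolding smooth_on_def using Ck_on_subset by blast

lemma smooth_on_cong:
  assumes "open X" "smooth_on X f" "\<And>x. x \<in> X \<Longrightarrow> f x = g x"
  shows "smooth_on X g"
  using assms Ck_on_cong unfolding smooth_on_def by metis

lemma smooth_on_local:
  assumes "\<And>x. x \<in> X \<Longrightarrow> \<exists>N. open N \<and> x \<in> N \<and> smooth_on N f"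
  shows "smooth_on X f"
  unfolding smooth_on_def using assms Ck_on_local smooth_on_Ck by metis

lemma smooth_on_const: "smooth_on X (\<lambda>x. c)"
  by (simp add: smooth_on_def Ck_on_const)

lemma smooth_on_bounded_linear: "bounded_linear f \<Longrightarrow> open X \<Longrightarrow> smooth_on X f"
  by (simp add: smooth_on_def Ck_on_bounded_linear)

lemma smooth_on_ident: "open X \<Longrightarrow> smooth_on X (\<lambda>x. x)"
  by (simp add: smooth_on_bounded_linear)

lemma smooth_on_linear_comp:
  "bounded_linear h \<Longrightarrow> open X \<Longrightarrow> smooth_on X f \<Longrightarrow> smooth_on X (\<lambda>x. h (f x))"
  by (simp add: smooth_on_def Ck_on_linear_comp)

lemma smooth_on_add:
  "open X \<Longrightarrow> smooth_on X f \<Longrightarrow> smooth_on X g \<Longrightarrow> smooth_on X (\<lambda>x. f x + g x)"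
  by (simp add: smooth_on_def Ck_on_add)

lemma smooth_on_sum:
  "open X \<Longrightarrow> (\<And>i. i \<in> I \<Longrightarrow> smooth_on X (f i)) \<Longrightarrow> smooth_on X (\<lambda>x. \<Sum>i\<in>I. f i x)"
  by (simp add: smooth_on_def Ck_on_sum)

lemma smooth_on_bilinear:
  "open X \<Longrightarrow> bounded_bilinear pr \<Longrightarrow> smooth_on X f \<Longrightarrow> smooth_on X g \<Longrightarrow>
    smooth_on X (\<lambda>x. pr (f x) (g x))"
  by (simp add: smooth_on_def Ck_on_bilinear)

lemmas smooth_on_scaleR = smooth_on_bilinear[OF _ bounded_bilinear_scaleR]
lemmas smooth_on_mult = smooth_on_bilinear[OF _ bounded_bilinear_mult]
lemmas smooth_on_inner = smooth_on_bilinear[OF _ bounded_bilinear_inner]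

lemma smooth_on_minus: "open X \<Longrightarrow> smooth_on X f \<Longrightarrow> smooth_on X (\<lambda>x. - f x)"
  using smooth_on_linear_comp[OF bounded_linear_minus[OF bounded_linear_ident]] by blast

lemma smooth_on_diff:
  assumes "open X" "smooth_on X f" "smooth_on X g" shows "smooth_on X (\<lambda>x. f x - g x)"
  using smooth_on_add[OF assms(1,2) smooth_on_minus[OF assms(1,3)]] by simp

lemma smooth_on_Pair:
  "open X \<Longrightarrow> smooth_on X f \<Longrightarrow> smooth_on X g \<Longrightarrow> smooth_on X (\<lambda>x. (f x, g x))"
  by (simp add: smooth_on_def Ck_on_Pair)

lemma smooth_on_fst: "open X \<Longrightarrow> smooth_on X f \<Longrightarrow> smooth_on X (\<lambda>x. fst (f x))"
  using smooth_on_linear_comp[OF bounded_linear_fst] by blast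

lemma smooth_on_snd: "open X \<Longrightarrow> smooth_on X f \<Longrightarrow> smooth_on X (\<lambda>x. snd (f x))"
  using smooth_on_linear_comp[OF bounded_linear_snd] by blast

lemma smooth_on_compose:
  fixes f :: "'b::euclidean_space \<Rightarrow> 'c::real_normed_vector" and g :: "'a::euclidean_space \<Rightarrow> 'b"
  shows "open X \<Longrightarrow> open Y \<Longrightarrow> smooth_on Y f \<Longrightarrow> smooth_on X g \<Longrightarrow> g ` X \<subseteq> Y \<Longrightarrow>
    smooth_on X (\<lambda>x. f (g x))"
  by (simp add: smooth_on_def Ck_on_compose)

lemma smooth_on_inverse:
  fixes f :: "'a::euclidean_space \<Rightarrow> real"
  shows "open X \<Longrightarrow> smooth_on X f \<Longrightarrow> (\<And>x. x \<in> X \<Longrightarrow> f x \<noteq> 0) \<Longrightarrow>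
    smooth_on X (\<lambda>x. inverse (f x))"
  by (simp add: smooth_on_def Ck_on_inverse)

lemma smooth_on_divide:
  fixes f g :: "'a::euclidean_space \<Rightarrow> real"
  assumes "open X" "smooth_on X f" "smooth_on X g" "\<And>x. x \<in> X \<Longrightarrow> g x \<noteq> 0"
  shows "smooth_on X (\<lambda>x. f x / g x)"
  using smooth_on_mult[OF assms(1,2) smooth_on_inverse[OF assms(1,3,4)]] by (simp add: divide_inverse)

lemma smooth_on_exp:
  fixes f :: "'a::euclidean_space \<Rightarrow> real"
  shows "open X \<Longrightarrow> smooth_on X f \<Longrightarrow> smooth_on X (\<lambda>x. exp (f x))"
  by (simp add: smooth_on_def Ck_on_exp)

text \<open>Families of linear maps are known to be smooth only at fixed arguments. A basis
  expansion of \<open>h x\<close> separates the moving argument from the moving map.\<close>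

lemma smooth_on_family_apply:
  fixes L :: "'a::euclidean_space \<Rightarrow> 'b::euclidean_space \<Rightarrow> 'c::real_normed_vector"
  assumes X: "open X" and lin: "\<And>x. x \<in> X \<Longrightarrow> linear (L x)"
    and L: "\<And>b. smooth_on X (\<lambda>x. L x b)" and h: "smooth_on X h"
  shows "smooth_on X (\<lambda>x. L x (h x))"
proof (rule smooth_on_cong[OF X])
  show "smooth_on X (\<lambda>x. \<Sum>b\<in>Basis. (h x \<bullet> b) *\<^sub>R L x b)"
    by (intro smooth_on_sum smooth_on_scaleR smooth_on_inner X L h smooth_on_const)
  show "(\<Sum>b\<in>Basis. (h x \<bullet> b) *\<^sub>R L x b) = L x (h x)" if "x \<in> X" for x
    using linear_Basis_expand[OF lin[OF that], of "h x"] by (rule sym)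
qed

lemma smooth_on_Dat_apply:
  fixes f :: "'b::euclidean_space \<Rightarrow> 'c::real_normed_vector" and g h :: "'a::euclidean_space \<Rightarrow> 'b"
  assumes X: "open X" and Y: "open Y" and f: "smooth_on Y f" and g: "smooth_on X g"
    and "g ` X \<subseteq> Y" and h: "smooth_on X h"
  shows "smooth_on X (\<lambda>x. Dat f (g x) (h x))"
proof (rule smooth_on_family_apply[OF X _ _ h])
  show "linear (Dat f (g x))" if "x \<in> X" for x
    using smooth_on_linear_Dat[OF f] that assms(5) by blast
  show "smooth_on X (\<lambda>x. Dat f (g x) b)" for b
    by (rule smooth_on_compose[OF X Y smooth_on_Dat[OF f] g assms(5)])
qed

text \<open>First half of the proof of Schwarz's theorem: the mean value theorem along
  \<open>v\<close> for the increment of \<open>f\<close> in direction \<open>h *\<^sub>R w\<close>,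
  then along \<open>w\<close> for the derivative just obtained. The second difference on the left is
  symmetric in \<open>v\<close> and \<open>w\<close>, the right side is not.\<close>

lemma double_mean_value:
  fixes f :: "'a::euclidean_space \<Rightarrow> real"
  assumes f: "smooth_on X f" and h: "h > 0"
    and X: "\<And>s t. s \<in> {0..h} \<Longrightarrow> t \<in> {0..h} \<Longrightarrow> x + s *\<^sub>R v + t *\<^sub>R w \<in> X"
  shows "\<exists>s\<in>{0..h}. \<exists>t\<in>{0..h}. f (x + h *\<^sub>R v + h *\<^sub>R w) - f (x + h *\<^sub>R v)
    - f (x + h *\<^sub>R w) + f x = h * h * Dat (\<lambda>y. Dat f y v) (x + s *\<^sub>R v + t *\<^sub>R w) w"
proof -
  have dv: "((\<lambda>s. k (x + s *\<^sub>R v + t *\<^sub>R w)) has_real_derivative Dat k (x + s *\<^sub>R v + t *\<^sub>R w) v) (at s)"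
    if "smooth_on X k" "s \<in> {0..h}" "t \<in> {0..h}" for k s t
  proof -
    have "((\<lambda>s. k (x + s *\<^sub>R v + t *\<^sub>R w)) has_derivative
        (\<lambda>r. Dat k (x + s *\<^sub>R v + t *\<^sub>R w) (r *\<^sub>R v))) (at s)"
      by (rule has_derivative_compose[where f = "\<lambda>s. x + s *\<^sub>R v + t *\<^sub>R w" and g = k, OF _ smooth_on_has_derivative[OF that(1) X[OF that(2,3)]]])
        (auto intro!: derivative_eq_intros)
    then show ?thesis
      using linear_scale[OF smooth_on_linear_Dat[OF that(1) X[OF that(2,3)]]]
      by (simp add: has_field_derivative_def mult_commute_abs)
  qed
  have dw: "((\<lambda>t. k (x + s *\<^sub>R v + t *\<^sub>R w)) has_real_derivative Dat k (x + s *\<^sub>R v + t *\<^sub>R w) w) (at t)"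
    if "smooth_on X k" "s \<in> {0..h}" "t \<in> {0..h}" for k s t
  proof -
    have "((\<lambda>t. k (x + s *\<^sub>R v + t *\<^sub>R w)) has_derivative
        (\<lambda>r. Dat k (x + s *\<^sub>R v + t *\<^sub>R w) (r *\<^sub>R w))) (at t)"
      by (rule has_derivative_compose[where f = "\<lambda>t. x + s *\<^sub>R v + t *\<^sub>R w" and g = k, OF _ smooth_on_has_derivative[OF that(1) X[OF that(2,3)]]])
        (auto intro!: derivative_eq_intros)
    then show ?thesis
      using linear_scale[OF smooth_on_linear_Dat[OF that(1) X[OF that(2,3)]]]
      by (simp add: has_field_derivative_def mult_commute_abs)
  qed
  let ?\<phi> = "\<lambda>s. f (x + s *\<^sub>R v + h *\<^sub>R w) - f (x + s *\<^sub>R v + 0 *\<^sub>R w)"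
  have "\<exists>s>0. s < h \<and> ?\<phi> h - ?\<phi> 0 =
      (h - 0) * (Dat f (x + s *\<^sub>R v + h *\<^sub>R w) v - Dat f (x + s *\<^sub>R v + 0 *\<^sub>R w) v)"
    by (rule MVT2[OF h], intro DERIV_diff dv[OF f]) (use h in auto)
  then obtain s where s: "0 < s" "s < h" "?\<phi> h - ?\<phi> 0 =
      h * (Dat f (x + s *\<^sub>R v + h *\<^sub>R w) v - Dat f (x + s *\<^sub>R v + 0 *\<^sub>R w) v)" by auto
  let ?\<psi> = "\<lambda>t. Dat f (x + s *\<^sub>R v + t *\<^sub>R w) v"
  have "\<exists>t>0. t < h \<and> ?\<psi> h - ?\<psi> 0 = (h - 0) * Dat (\<lambda>y. Dat f y v) (x + s *\<^sub>R v + t *\<^sub>R w) w"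
    by (rule MVT2[OF h], intro dw[OF smooth_on_Dat[OF f]]) (use h s in auto)
  then obtain t where t: "0 < t" "t < h"
    "?\<psi> h - ?\<psi> 0 = h * Dat (\<lambda>y. Dat f y v) (x + s *\<^sub>R v + t *\<^sub>R w) w" by auto
  have "?\<phi> h - ?\<phi> 0 = h * (h * Dat (\<lambda>y. Dat f y v) (x + s *\<^sub>R v + t *\<^sub>R w) w)"
    unfolding s(3) t(3)[symmetric] by simp
  then show ?thesis
    using s(1,2) t(1,2) by (intro bexI[of _ s] bexI[of _ t]) (auto simp: algebra_simps)
qed

text \<open>The second difference divided by h^2 is a value of either mixed derivative at some point
  near \<open>x\<close>. By continuity the two derivatives at \<open>x\<close> then differ by less
  than \<open>2 * e\<close>, which was chosen to be their distance.\<close>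

lemma Dat_commute_real:
  fixes f :: "'a::euclidean_space \<Rightarrow> real"
  assumes f: "smooth_on X f" and X: "open X" "x \<in> X"
  shows "Dat (\<lambda>y. Dat f y v) x w = Dat (\<lambda>y. Dat f y w) x v"
proof (rule ccontr)
  let ?A = "\<lambda>y. Dat (\<lambda>y. Dat f y v) y w" and ?B = "\<lambda>y. Dat (\<lambda>y. Dat f y w) y v"
  assume ne: "?A x \<noteq> ?B x"
  define e where "e = \<bar>?A x - ?B x\<bar> / 2"
  have e: "e > 0" using ne by (simp add: e_def)
  have cont: "isCont ?A x" "isCont ?B x"
    using smooth_on_continuous[OF smooth_on_Dat[OF smooth_on_Dat[OF f]]] X
    by (auto simp: continuous_on_eq_continuous_at)
  obtain d1 where d1: "d1 > 0" "\<And>y. dist y x < d1 \<Longrightarrow> dist (?A y) (?A x) < e"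
    using cont(1) e unfolding continuous_at_eps_delta by blast
  obtain d2 where d2: "d2 > 0" "\<And>y. dist y x < d2 \<Longrightarrow> dist (?B y) (?B x) < e"
    using cont(2) e unfolding continuous_at_eps_delta by blast
  obtain d3 where d3: "d3 > 0" "ball x d3 \<subseteq> X" using X open_contains_ball by metis
  define d where "d = min d1 (min d2 d3)"
  have d: "d > 0" using d1 d2 d3 by (simp add: d_def)
  define P where "P = norm v + norm w + 1"
  \<comment> \<open>With this \<open>h\<close> the whole parallelogram spanned by
    \<open>h *\<^sub>R v\<close> and \<open>h *\<^sub>R w\<close> at \<open>x\<close> stays within
    distance d / 2; the summand 1 in \<open>P\<close> avoids a division by zero.\<close>
  define h where "h = d / (2 * P)"
  have pos: "P > 0" using norm_ge_zero[of v] norm_ge_zero[of w] unfolding P_def by linarith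
  have h: "h > 0" using d pos by (simp add: h_def)
  have near: "dist (x + s *\<^sub>R v + t *\<^sub>R w) x < d" if "s \<in> {0..h}" "t \<in> {0..h}" for s t
  proof -
    have "dist (x + s *\<^sub>R v + t *\<^sub>R w) x = norm (s *\<^sub>R v + t *\<^sub>R w)" by (simp add: dist_norm)
    also have "\<dots> \<le> s * norm v + t * norm w"
      using norm_triangle_ineq[of "s *\<^sub>R v" "t *\<^sub>R w"] that by simp
    also have "\<dots> \<le> h * norm v + h * norm w"
      using that by (intro add_mono mult_right_mono) auto
    also have "\<dots> \<le> h * P" using h by (simp add: P_def algebra_simps)
    also have "\<dots> = d / 2" using pos by (simp add: h_def)
    also have "\<dots> < d" using d by simp
    finally show ?thesis .
  qed
  have inX: "x + s *\<^sub>R v + t *\<^sub>R w \<in> X" if "s \<in> {0..h}" "t \<in> {0..h}" for s t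
    using near[OF that] d3(2) by (auto simp: d_def dist_commute)
  obtain s t where st: "s \<in> {0..h}" "t \<in> {0..h}" "f (x + h *\<^sub>R v + h *\<^sub>R w) - f (x + h *\<^sub>R v)
    - f (x + h *\<^sub>R w) + f x = h * h * ?A (x + s *\<^sub>R v + t *\<^sub>R w)"
    using double_mean_value[OF f h inX] by blast
  have inX': "x + s *\<^sub>R w + t *\<^sub>R v \<in> X" if "s \<in> {0..h}" "t \<in> {0..h}" for s t
    using inX[OF that(2,1)] by (simp add: algebra_simps)
  obtain s' t' where st': "s' \<in> {0..h}" "t' \<in> {0..h}" "f (x + h *\<^sub>R w + h *\<^sub>R v) - f (x + h *\<^sub>R w)
    - f (x + h *\<^sub>R v) + f x = h * h * ?B (x + s' *\<^sub>R w + t' *\<^sub>R v)"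
    using double_mean_value[OF f h inX'] by blast
  have "h * h * ?A (x + s *\<^sub>R v + t *\<^sub>R w) = h * h * ?B (x + t' *\<^sub>R v + s' *\<^sub>R w)"
  proof -
    have "x + h *\<^sub>R w + h *\<^sub>R v = x + h *\<^sub>R v + h *\<^sub>R w"
      "x + s' *\<^sub>R w + t' *\<^sub>R v = x + t' *\<^sub>R v + s' *\<^sub>R w" by simp_all
    then show ?thesis using st(3) st'(3) by (simp only:)
  qed
  then have "?A (x + s *\<^sub>R v + t *\<^sub>R w) = ?B (x + t' *\<^sub>R v + s' *\<^sub>R w)" using h by simp
  moreover have "dist (?A (x + s *\<^sub>R v + t *\<^sub>R w)) (?A x) < e"
    using near[OF st(1,2)] by (intro d1(2)) (simp add: d_def)
  moreover have "dist (?B (x + t' *\<^sub>R v + s' *\<^sub>R w)) (?B x) < e"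
    using near[OF st'(2,1)] by (intro d2(2)) (simp add: d_def)
  ultimately have "\<bar>?A x - ?B x\<bar> < 2 * e" by (simp add: dist_real_def)
  then show False by (simp add: e_def)
qed

text \<open>Componentwise reduction to the real case; differentiation commutes with the inner
  product against a fixed vector.\<close>

lemma Dat_commute:
  fixes f :: "'a::euclidean_space \<Rightarrow> 'b::euclidean_space"
  assumes f: "smooth_on X f" and X: "open X" "x \<in> X"
  shows "Dat (\<lambda>y. Dat f y v) x w = Dat (\<lambda>y. Dat f y w) x v"
proof (rule euclidean_eqI)
  fix b :: 'b
  have D1: "Dat (\<lambda>y. g y \<bullet> b) y u = Dat g y u \<bullet> b" if "smooth_on X g" "y \<in> X" for g :: "'a \<Rightarrow> 'b" and y u
    using Dat_eq[OF bounded_linear.has_derivative[OF bounded_linear_inner_left smooth_on_has_derivative[OF that]]]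
    by metis
  have D2: "Dat (\<lambda>y. Dat f y u) x u' \<bullet> b = Dat (\<lambda>y. Dat (\<lambda>z. f z \<bullet> b) y u) x u'" for u u'
  proof -
    have "Dat (\<lambda>y. Dat f y u) x u' \<bullet> b = Dat (\<lambda>y. Dat f y u \<bullet> b) x u'"
      by (rule D1[OF smooth_on_Dat[OF f] X(2), symmetric])
    also have "\<dots> = Dat (\<lambda>y. Dat (\<lambda>z. f z \<bullet> b) y u) x u'"
      by (subst Dat_cong[OF X, of "\<lambda>y. Dat f y u \<bullet> b" "\<lambda>y. Dat (\<lambda>z. f z \<bullet> b) y u"]) (simp_all add: D1[OF f])
    finally show ?thesis .
  qed
  have "smooth_on X (\<lambda>z. f z \<bullet> b)"
    by (rule smooth_on_linear_comp[OF bounded_linear_inner_left X(1) f])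
  then show "Dat (\<lambda>y. Dat f y v) x w \<bullet> b = Dat (\<lambda>y. Dat f y w) x v \<bullet> b"
    unfolding D2 by (rule Dat_commute_real[OF _ X])
qed

text \<open>On a compact ball the basis derivatives are bounded, which bounds the operator norm of
  the derivative; convexity of the ball then allows the mean value inequality.\<close>

lemma smooth_on_locally_Lipschitz:
  fixes G :: "'a::euclidean_space \<Rightarrow> 'b::real_normed_vector"
  assumes G: "smooth_on W G" and W: "open W" "z \<in> W"
  obtains r C where "r > 0" "C \<ge> 0" "cball z r \<subseteq> W"
    "\<And>a b. a \<in> cball z r \<Longrightarrow> b \<in> cball z r \<Longrightarrow> norm (G a - G b) \<le> C * norm (a - b)"
proof -
  obtain r where r: "r > 0" "cball z r \<subseteq> W" using W open_contains_cball by metis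
  have "continuous_on (cball z r) (\<lambda>x. \<Sum>b\<in>Basis. norm (Dat G x b))"
    using continuous_on_subset[OF smooth_on_continuous[OF smooth_on_Dat[OF G]] r(2)]
    by (intro continuous_on_sum continuous_on_norm)
  then have "bounded ((\<lambda>x. \<Sum>b\<in>Basis. norm (Dat G x b)) ` cball z r)"
    by (intro compact_imp_bounded compact_continuous_image) auto
  then obtain C where C: "\<And>x. x \<in> cball z r \<Longrightarrow> \<bar>\<Sum>b\<in>Basis. norm (Dat G x b)\<bar> \<le> C"
    unfolding bounded_iff by fastforce
  have C0: "C \<ge> 0" using C[of z] r(1) by (meson abs_ge_zero centre_in_cball less_imp_le order_trans)
  have on: "onorm (Dat G x) \<le> C" if "x \<in> cball z r" for x
  proof (rule onorm_bound[OF C0])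
    fix v
    have "norm (Dat G x v) = norm (\<Sum>b\<in>Basis. (v \<bullet> b) *\<^sub>R Dat G x b)"
      using linear_Basis_expand[OF smooth_on_linear_Dat[OF G, of x], of v] that r(2) by auto
    also have "\<dots> \<le> (\<Sum>b\<in>Basis. \<bar>v \<bullet> b\<bar> * norm (Dat G x b))"
      by (rule order_trans[OF norm_sum]) simp
    also have "\<dots> \<le> (\<Sum>b\<in>Basis. norm v * norm (Dat G x b))"
      by (intro sum_mono mult_right_mono Basis_le_norm) auto
    also have "\<dots> = norm v * (\<Sum>b\<in>Basis. norm (Dat G x b))" by (simp add: sum_distrib_left)
    also have "\<dots> \<le> norm v * C" using C[OF that] by (intro mult_left_mono) auto
    finally show "norm (Dat G x v) \<le> C * norm v" by (simp add: mult.commute)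
  qed
  have "norm (G a - G b) \<le> C * norm (a - b)" if "a \<in> cball z r" "b \<in> cball z r" for a b
    by (rule differentiable_bound[OF convex_cball _ on that(1,2)])
      (use r(2) smooth_on_has_derivative[OF G] in \<open>blast intro: has_derivative_at_withinI\<close>)
  then show ?thesis using that r C0 by blast
qed

text \<open>A Gronwall argument for the squared distance \<phi> of the solutions: |\<phi>'| \<le> 2
  C \<phi>. Hence exp(-2 C (t - t0)) \<phi> does not increase to the right of \<open>t0\<close>, and
  exp(2 C (t - t0)) \<phi> does not decrease to the left. Both vanish at \<open>t0\<close>, so
  \<phi> \<le> 0 on both sides.\<close>

lemma ode_locally_unique:
  fixes G :: "'a::euclidean_space \<Rightarrow> 'a" and z1 z2 :: "real \<Rightarrow> 'a"
  assumes G: "smooth_on W G" "open W" and I: "open I" "t0 \<in> I"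
    and z1: "\<And>t. t \<in> I \<Longrightarrow> (z1 has_vector_derivative G (z1 t)) (at t)"
    and z2: "\<And>t. t \<in> I \<Longrightarrow> (z2 has_vector_derivative G (z2 t)) (at t)"
    and eq: "z1 t0 = z2 t0" and W: "z1 t0 \<in> W"
  shows "\<exists>\<delta>>0. \<forall>t. \<bar>t - t0\<bar> < \<delta> \<longrightarrow> z1 t = z2 t"
proof -
  obtain r C where r: "r > 0" "C \<ge> 0" "cball (z1 t0) r \<subseteq> W" and
    L: "\<And>a b. a \<in> cball (z1 t0) r \<Longrightarrow> b \<in> cball (z1 t0) r \<Longrightarrow> norm (G a - G b) \<le> C * norm (a - b)"
    using smooth_on_locally_Lipschitz[OF G W] by metis
  have "isCont z1 t0" "isCont z2 t0"
    using z1[OF I(2)] z2[OF I(2)] by (auto intro: has_vector_derivative_continuous)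
  then obtain d1 d2 where d1: "d1 > 0" "\<And>t. dist t t0 < d1 \<Longrightarrow> dist (z1 t) (z1 t0) < r"
    and d2: "d2 > 0" "\<And>t. dist t t0 < d2 \<Longrightarrow> dist (z2 t) (z2 t0) < r"
    using r(1) unfolding continuous_at_eps_delta by metis
  obtain d3 where d3: "d3 > 0" "ball t0 d3 \<subseteq> I" using I open_contains_ball by metis
  define d where "d = min d1 (min d2 d3)"
  have d: "d > 0" using d1 d2 d3 by (simp add: d_def)
  define \<phi> where "\<phi> t = (z1 t - z2 t) \<bullet> (z1 t - z2 t)" for t
  define \<phi>' where "\<phi>' t = 2 * ((z1 t - z2 t) \<bullet> (G (z1 t) - G (z2 t)))" for t
  have inI: "t \<in> I" if "\<bar>t - t0\<bar> < d" for t
    using that d3(2) by (auto simp: d_def dist_real_def)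
  have D: "(\<phi> has_real_derivative \<phi>' t) (at t)" if "\<bar>t - t0\<bar> < d" for t
  proof -
    have z: "((\<lambda>t. z1 t - z2 t) has_derivative (\<lambda>r. r *\<^sub>R (G (z1 t) - G (z2 t)))) (at t)"
      using has_vector_derivative_diff[OF z1 z2, OF inI inI, OF that that]
      by (simp add: has_vector_derivative_def)
    show ?thesis
      unfolding \<phi>_def \<phi>'_def has_field_derivative_def
      by (rule has_derivative_eq_rhs[OF has_derivative_inner[OF z z]])
        (auto simp: inner_commute fun_eq_iff)
  qed
  have bound: "\<bar>\<phi>' t\<bar> \<le> 2 * C * \<phi> t" if "\<bar>t - t0\<bar> < d" for t
  proof -
    have "z1 t \<in> cball (z1 t0) r" "z2 t \<in> cball (z1 t0) r"
      using d1(2)[of t] d2(2)[of t] that eq by (auto simp: d_def dist_real_def dist_commute)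
    then have "norm (G (z1 t) - G (z2 t)) \<le> C * norm (z1 t - z2 t)" by (rule L)
    then have "norm (z1 t - z2 t) * norm (G (z1 t) - G (z2 t)) \<le> norm (z1 t - z2 t) * (C * norm (z1 t - z2 t))"
      by (intro mult_left_mono) auto
    then have "\<bar>(z1 t - z2 t) \<bullet> (G (z1 t) - G (z2 t))\<bar> \<le> norm (z1 t - z2 t) * (C * norm (z1 t - z2 t))"
      using Cauchy_Schwarz_ineq2 order_trans by blast
    then show ?thesis
      by (simp add: \<phi>'_def \<phi>_def abs_mult dot_square_norm power2_eq_square algebra_simps)
  qed
  have "z1 t = z2 t" if t: "\<bar>t - t0\<bar> < d" for t
  proof -
    have DE: "((\<lambda>s. exp (k * (s - t0)) * \<phi> s) has_real_derivative
        exp (k * (s - t0)) * (\<phi>' s + k * \<phi> s)) (at s)" if "\<bar>s - t0\<bar> < d" for k s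
      by (rule derivative_eq_intros D[OF that] refl | simp add: algebra_simps)+
    have "\<phi> t0 = 0" by (simp add: \<phi>_def eq)
    have "\<phi> t \<le> 0"
    proof (cases "t \<ge> t0")
      case True
      have "exp (- (2 * C) * (t - t0)) * \<phi> t \<le> exp (- (2 * C) * (t0 - t0)) * \<phi> t0"
      proof (rule DERIV_nonpos_imp_nonincreasing[OF True])
        fix s assume s: "t0 \<le> s" "s \<le> t"
        then have s': "\<bar>s - t0\<bar> < d" using t by auto
        have "\<phi>' s + - (2 * C) * \<phi> s \<le> 0" using bound[OF s'] by linarith
        then show "\<exists>y. ((\<lambda>s. exp (- (2 * C) * (s - t0)) * \<phi> s) has_real_derivative y) (at s) \<and> y \<le> 0"
          by (intro exI conjI) (rule DE[OF s'], simp add: mult_nonneg_nonpos)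
      qed
      then show ?thesis using \<open>\<phi> t0 = 0\<close> by (simp add: mult_le_0_iff)
    next
      case False
      have "exp (2 * C * (t - t0)) * \<phi> t \<le> exp (2 * C * (t0 - t0)) * \<phi> t0"
      proof (rule DERIV_nonneg_imp_nondecreasing[where a = t and b = t0])
        show "t \<le> t0" using False by simp
      next
        fix s assume s: "t \<le> s" "s \<le> t0"
        then have s': "\<bar>s - t0\<bar> < d" using t by auto
        have "\<phi>' s + (2 * C) * \<phi> s \<ge> 0" using bound[OF s'] by linarith
        then show "\<exists>y. ((\<lambda>s. exp (2 * C * (s - t0)) * \<phi> s) has_real_derivative y) (at s) \<and> 0 \<le> y"
          by (intro exI conjI) (rule DE[OF s'], simp)
      qed
      then show ?thesis using \<open>\<phi> t0 = 0\<close> by (simp add: mult_le_0_iff)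
    qed
    then have "z1 t - z2 t = 0"
      unfolding \<phi>_def by (metis inner_eq_zero_iff inner_ge_zero order_antisym)
    then show ?thesis by simp
  qed
  then show ?thesis using d by blast
qed

text \<open>A product rule in which \<open>p\<close> is merely continuous: \<open>q\<close> vanishes
  at \<open>x\<close> and is therefore of order |y - x|, so the error (p y - p x) q y is of smaller
  order.\<close>

lemma has_derivative_scaleR_vanishing:
  fixes p :: "'a::real_normed_vector \<Rightarrow> real" and q :: "'a \<Rightarrow> 'b::real_normed_vector"
  assumes p: "isCont p x" and q: "(q has_derivative q') (at x)" and 0: "q x = 0"
  shows "((\<lambda>y. p y *\<^sub>R q y) has_derivative (\<lambda>v. p x *\<^sub>R q' v)) (at x)"
proof -
  have bl: "bounded_linear q'" using q has_derivative_bounded_linear by blast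
  obtain K where K: "K > 0" "\<And>v. norm (q' v) \<le> norm v * K"
    using bounded_linear.pos_bounded[OF bl] by blast
  obtain d where d: "d > 0" "\<And>y. norm (y - x) < d \<Longrightarrow> norm (q y - q x - q' (y - x)) \<le> 1 * norm (y - x)"
    using q unfolding has_derivative_at_alt by (meson zero_less_one)
  have qb: "norm (q y) \<le> (1 + K) * norm (y - x)" if "norm (y - x) < d" for y
    using d(2)[OF that] K(2)[of "y - x"] norm_triangle_sub[of "q y" "q' (y - x)"] 0
    by (simp add: algebra_simps)
  have "((\<lambda>y. (p y - p x) *\<^sub>R q y) has_derivative (\<lambda>v. 0)) (at x)"
    unfolding has_derivative_at_alt
  proof (intro conjI allI impI)
    fix e :: real assume e: "e > 0"
    then have "e / (1 + K) > 0" using K(1) by simp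
    then obtain d' where d': "d' > 0" "\<And>y. dist y x < d' \<Longrightarrow> dist (p y) (p x) < e / (1 + K)"
      using p unfolding continuous_at_eps_delta by blast
    have "norm ((p y - p x) *\<^sub>R q y - (p x - p x) *\<^sub>R q x - 0) \<le> e * norm (y - x)"
      if y: "norm (y - x) < min d d'" for y
    proof -
      have "\<bar>p y - p x\<bar> \<le> e / (1 + K)" using d'(2)[of y] y by (simp add: dist_norm)
      then have "\<bar>p y - p x\<bar> * norm (q y) \<le> e / (1 + K) * ((1 + K) * norm (y - x))"
        using qb[of y] y by (intro mult_mono) auto
      also have "e / (1 + K) * ((1 + K) * norm (y - x)) = e * norm (y - x)" using K(1) by simp
      finally show ?thesis by simp
    qed
    then show "\<exists>d>0. \<forall>y. norm (y - x) < d \<longrightarrow>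
        norm ((p y - p x) *\<^sub>R q y - (p x - p x) *\<^sub>R q x - 0) \<le> e * norm (y - x)"
      using d(1) d'(1) by (intro exI[of _ "min d d'"]) auto
  qed simp
  from has_derivative_add[OF this bounded_linear.has_derivative[OF bounded_linear_scaleR_right q, of "p x"]]
  show ?thesis by (simp add: algebra_simps)
qed

text \<open>Injectivity bounds \<open>G x0\<close> from below by some c > 0, and the bound c / 2
  persists for \<open>G x\<close> with \<open>x\<close> near \<open>x0\<close>. Applied to a = h x -
  h x0, for which G x a = k x - G x (h x0) tends to 0, it forces a to tend to 0.\<close>

lemma linear_solution_continuous:
  fixes G :: "'a::euclidean_space \<Rightarrow> 'e::euclidean_space \<Rightarrow> 'e"
  assumes X: "open X" and lin: "\<And>x. x \<in> X \<Longrightarrow> linear (G x)" and inj: "\<And>x. x \<in> X \<Longrightarrow> inj (G x)"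
    and G: "\<And>a. continuous_on X (\<lambda>x. G x a)" and k: "continuous_on X k"
    and eq: "\<And>x. x \<in> X \<Longrightarrow> G x (h x) = k x"
  shows "continuous_on X h"
proof (rule continuous_at_imp_continuous_on, rule ballI)
  fix x0 assume x0: "x0 \<in> X"
  obtain c where c: "c > 0" "\<And>a. c * norm a \<le> norm (G x0 a)"
    using linear_inj_bounded_below_pos[OF lin[OF x0] inj[OF x0]] by blast
  have cG: "isCont (\<lambda>x. G x a) x0" for a using G X x0 by (simp add: continuous_on_eq_continuous_at)
  have ck: "isCont k x0" using k X x0 by (simp add: continuous_on_eq_continuous_at)
  have "isCont (\<lambda>x. \<Sum>b\<in>Basis. norm (G x b - G x0 b)) x0"
    by (intro continuous_intros cG)
  then have "\<forall>\<^sub>F x in at x0. (\<Sum>b\<in>Basis. norm (G x b - G x0 b)) < c / 2"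
    using c(1) by (auto simp: isCont_def dest!: order_tendstoD(2)[of _ _ _ "c/2"])
  moreover have "\<forall>\<^sub>F x in at x0. x \<in> X" using X x0 by (rule eventually_at_in_open')
  ultimately have ev: "\<forall>\<^sub>F x in at x0. norm (h x - h x0) \<le> (2 / c) * norm (k x - G x (h x0))"
  proof eventually_elim
    case (elim x)
    define a where "a = h x - h x0"
    have l: "linear (\<lambda>v. G x v - G x0 v)"
      using lin[OF elim(2)] lin[OF x0] by (simp add: linear_compose_sub)
    have "norm (G x a - G x0 a) = norm (\<Sum>b\<in>Basis. (a \<bullet> b) *\<^sub>R (G x b - G x0 b))"
      by (subst linear_Basis_expand[OF l, of a]) simp
    also have "\<dots> \<le> (\<Sum>b\<in>Basis. norm a * norm (G x b - G x0 b))"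
      by (rule order_trans[OF norm_sum]) (auto intro!: sum_mono mult_right_mono Basis_le_norm)
    also have "\<dots> = norm a * (\<Sum>b\<in>Basis. norm (G x b - G x0 b))" by (simp add: sum_distrib_left)
    also have "\<dots> \<le> norm a * (c / 2)" using elim(1) by (intro mult_left_mono) auto
    finally have "c * norm a \<le> norm (G x a) + norm a * (c / 2)"
      using c(2)[of a] norm_triangle_ineq4[of "G x a" "G x a - G x0 a"] by simp
    then have "c / 2 * norm a \<le> norm (G x a)" by (simp add: field_simps)
    moreover have "G x a = k x - G x (h x0)"
      unfolding a_def using eq[OF elim(2)] by (simp add: linear_diff[OF lin[OF elim(2)]])
    ultimately show ?case using c(1) unfolding a_def by (simp add: field_simps)
  qed
  have "((\<lambda>x. (2 / c) * norm (k x - G x (h x0))) \<longlongrightarrow> (2 / c) * norm (k x0 - G x0 (h x0))) (at x0)"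
    by (intro tendsto_intros ck[unfolded isCont_def] cG[unfolded isCont_def])
  then have "((\<lambda>x. (2 / c) * norm (k x - G x (h x0))) \<longlongrightarrow> 0) (at x0)" using eq[OF x0] by simp
  then have "((\<lambda>x. h x - h x0) \<longlongrightarrow> 0) (at x0)" using ev by (rule Lim_null_comparison[rotated])
  then show "isCont h x0" unfolding isCont_def by (simp add: Lim_null[symmetric])
qed

text \<open>Differentiability of the solution comes from
  \<open>G x\<^sub>0 (h x) = k x - (G x - G x\<^sub>0) (h x)\<close>, where the factor \<open>G x - G x\<^sub>0\<close>
  vanishes at \<open>x\<^sub>0\<close>, so that only continuity of \<open>h\<close> is needed on the right.\<close>

lemma Ck_on_linear_solution:
  fixes G :: "'a::euclidean_space \<Rightarrow> 'e::euclidean_space \<Rightarrow> 'e"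
  assumes X: "open X" and lin: "\<And>x. x \<in> X \<Longrightarrow> linear (G x)" and inj: "\<And>x. x \<in> X \<Longrightarrow> inj (G x)"
    and G: "\<And>a. smooth_on X (\<lambda>x. G x a)"
  shows "Ck_on j X k \<Longrightarrow> (\<And>x. x \<in> X \<Longrightarrow> G x (h x) = k x) \<Longrightarrow> Ck_on j X h"
proof (induction j arbitrary: k h)
  case 0
  have "continuous_on X h"
    by (rule linear_solution_continuous[OF X lin inj smooth_on_continuous[OF G] _ 0(2)])
      (use 0(1) in auto)
  then show ?case by simp
next
  case (Suc j)
  have hj: "Ck_on j X h" by (rule Suc.IH[OF Ck_on_SucD[OF Suc.prems(1)] Suc.prems(2)])
  define k' where "k' v x = Dat k x v - (\<Sum>b\<in>Basis. (h x \<bullet> b) *\<^sub>R Dat (\<lambda>y. G y b) x v)" for v x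
  define Gi where "Gi x = inv (G x)" for x
  have surj: "surj (G x)" if "x \<in> X" for x
    using linear_injective_imp_surjective[OF lin[OF that] inj[OF that]] by simp
  have Gi: "linear (Gi x)" "\<And>a. Gi x (G x a) = a" "\<And>a. G x (Gi x a) = a" if "x \<in> X" for x
  proof -
    show "Gi x (G x a) = a" for a using inj[OF that] by (simp add: Gi_def)
    show G1: "G x (Gi x a) = a" for a using surj[OF that] by (simp add: Gi_def surj_f_inv_f)
    show "linear (Gi x)" unfolding Gi_def
      using linear_inj_on_left_inverse inj_linear_imp_inv_linear[OF lin[OF that] inj[OF that]] by blast
  qed
  have D: "(h has_derivative (\<lambda>v. Gi x (k' v x))) (at x)" if x: "x \<in> X" for x
  proof -
    have bl: "bounded_linear (Gi x)" using Gi(1)[OF x] linear_conv_bounded_linear by blast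
    have ch: "isCont (\<lambda>y. h y \<bullet> b) x" for b
      using Ck_on_continuous[OF hj] X x by (auto simp: continuous_on_eq_continuous_at intro!: continuous_intros)
    have dG: "((\<lambda>y. G y b - G x b) has_derivative Dat (\<lambda>y. G y b) x) (at x)" for b
      using has_derivative_diff[OF smooth_on_has_derivative[OF G x] has_derivative_const] by simp
    have "((\<lambda>y. \<Sum>b\<in>Basis. (h y \<bullet> b) *\<^sub>R (G y b - G x b)) has_derivative
        (\<lambda>v. \<Sum>b\<in>Basis. (h x \<bullet> b) *\<^sub>R Dat (\<lambda>y. G y b) x v)) (at x)"
      by (intro has_derivative_sum has_derivative_scaleR_vanishing ch dG) simp
    from has_derivative_diff[OF Ck_on_SucE(1)[OF Suc.prems(1) x] this]
    have "((\<lambda>y. Gi x (k y - (\<Sum>b\<in>Basis. (h y \<bullet> b) *\<^sub>R (G y b - G x b)))) has_derivative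
        (\<lambda>v. Gi x (k' v x))) (at x)"
      unfolding k'_def by (rule bounded_linear.has_derivative[OF bl])
    then show ?thesis
    proof (rule has_derivative_transform_within_open[OF _ X x])
      fix y assume y: "y \<in> X"
      have l: "linear (\<lambda>v. G y v - G x v)"
        using lin[OF y] lin[OF x] by (simp add: linear_compose_sub)
      have "(\<Sum>b\<in>Basis. (h y \<bullet> b) *\<^sub>R (G y b - G x b)) = G y (h y) - G x (h y)"
        by (rule linear_Basis_expand[OF l, symmetric])
      then show "Gi x (k y - (\<Sum>b\<in>Basis. (h y \<bullet> b) *\<^sub>R (G y b - G x b))) = h y"
        using Suc.prems(2)[OF y] Gi(2)[OF x] by simp
    qed
  qed
  show ?case
  proof (rule Ck_on_SucI[OF X D])
    fix v
    have "Ck_on j X (\<lambda>x. Dat k x v + (- 1) *\<^sub>R (\<Sum>b\<in>Basis. (h x \<bullet> b) *\<^sub>R Dat (\<lambda>y. G y b) x v))"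
      by (intro Ck_on_add X Ck_on_SucE(2)[OF Suc.prems(1)]
          Ck_on_bilinear[OF X bounded_bilinear_scaleR] Ck_on_const Ck_on_sum
          Ck_on_linear_comp[OF bounded_linear_inner_left X hj] smooth_on_Ck[OF smooth_on_Dat[OF G]])
    then have "Ck_on j X (k' v)" by (simp add: k'_def[abs_def])
    \<comment> \<open>The directional derivative of the solution solves the same linear system with
      right-hand side \<open>k' v\<close>, so the induction hypothesis applies to it; hence the
      induction is over arbitrary \<open>k\<close> and \<open>h\<close>.\<close>
    then show "Ck_on j X (\<lambda>x. Gi x (k' v x))"
      by (rule Suc.IH) (simp add: Gi(3))
  qed
qed

text \<open>This is how the Christoffel symbol, known only through linear equations with smooth
  coefficients, becomes smooth.\<close>

lemma smooth_on_linear_solution: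
  fixes G :: "'a::euclidean_space \<Rightarrow> 'e::euclidean_space \<Rightarrow> 'e"
  assumes "open X" "\<And>x. x \<in> X \<Longrightarrow> linear (G x)" "\<And>x. x \<in> X \<Longrightarrow> inj (G x)"
    "\<And>a. smooth_on X (\<lambda>x. G x a)" "smooth_on X k" "\<And>x. x \<in> X \<Longrightarrow> G x (h x) = k x"
  shows "smooth_on X h"
  unfolding smooth_on_def
  using Ck_on_linear_solution[OF assms(1-4) smooth_on_Ck[OF assms(5)] assms(6)] by simp

section \<open>Charts and tangent vectors\<close>

lemma charts_at_iff: "c \<in> charts_at A p \<longleftrightarrow> c \<in> A \<and> p \<in> fst c"
  by (auto simp: charts_at_def)

lemma charts_at_nonempty: "p \<in> points A \<longleftrightarrow> (\<exists>c. c \<in> charts_at A p)"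
  unfolding points_def charts_at_def by blast

lemma charts_at_std [simp]: "charts_at std_atlas x = {(UNIV, id)}"
  by (auto simp: charts_at_def std_atlas_def)

lemma points_std [simp]: "points std_atlas = UNIV"
  by (auto simp: points_def std_atlas_def)

lemma Dat_vector_derivative:
  assumes "f differentiable (at (t::real))" shows "Dat f t r = r *\<^sub>R vector_derivative f (at t)"
  using frechet_derivative_eq_vector_derivative[OF assms] by simp

lemma smooth_on_vector_derivative:
  fixes f :: "real \<Rightarrow> 'b::real_normed_vector"
  assumes "open X" "smooth_on X f"
  shows "t \<in> X \<Longrightarrow> (f has_vector_derivative vector_derivative f (at t)) (at t)"
    "smooth_on X (\<lambda>t. vector_derivative f (at t))"
proof -
  show "t \<in> X \<Longrightarrow> (f has_vector_derivative vector_derivative f (at t)) (at t)"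
    using smooth_on_differentiable[OF assms(2)] vector_derivative_works by blast
  show "smooth_on X (\<lambda>t. vector_derivative f (at t))"
    by (rule smooth_on_cong[OF assms(1) smooth_on_Dat[OF assms(2), of 1]])
      (simp add: Dat_vector_derivative smooth_on_differentiable[OF assms(2)])
qed

lemma vector_derivative_cong:
  fixes f g :: "real \<Rightarrow> 'b::real_normed_vector"
  assumes "open X" "t \<in> X" "\<And>s. s \<in> X \<Longrightarrow> f s = g s"
  shows "vector_derivative f (at t) = vector_derivative g (at t)"
proof -
  have "(f has_vector_derivative L) (at t) \<longleftrightarrow> (g has_vector_derivative L) (at t)" for L
    using assms has_vector_derivative_transform_within_open[of f L t X g]
      has_vector_derivative_transform_within_open[of g L t X f] by auto
  then show ?thesis by (simp add: vector_derivative_def)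
qed

lemma has_vector_derivative_comp_Dat:
  fixes f :: "'a::euclidean_space \<Rightarrow> 'b::real_normed_vector"
  assumes "smooth_on Y f" "(g has_vector_derivative g') (at t)" "g t \<in> Y"
  shows "((\<lambda>s. f (g s)) has_vector_derivative Dat f (g t) g') (at t)"
proof -
  note l = linear_scale[OF smooth_on_linear_Dat[OF assms(1,3)]]
  show ?thesis
    using has_derivative_compose[OF assms(2)[unfolded has_vector_derivative_def]
        smooth_on_has_derivative[OF assms(1,3)]]
    by (simp add: has_vector_derivative_def l)
qed

section \<open>The chart topology and the charts of the tangent bundle\<close>

lemma istopology_charts:
  assumes "\<And>c. c \<in> A \<Longrightarrow> inj_on (snd c) (fst c)"
  shows "istopology (\<lambda>W. W \<subseteq> points A \<and> (\<forall>c\<in>A. open (snd c ` (W \<inter> fst c))))"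
  unfolding istopology_def
proof (intro conjI allI impI ballI)
  fix V W c assume h: "V \<subseteq> points A \<and> (\<forall>c\<in>A. open (snd c ` (V \<inter> fst c)))"
    "W \<subseteq> points A \<and> (\<forall>c\<in>A. open (snd c ` (W \<inter> fst c)))" and c: "c \<in> A"
  have "snd c ` (V \<inter> W \<inter> fst c) = snd c ` (V \<inter> fst c) \<inter> snd c ` (W \<inter> fst c)"
    using assms[OF c] by (auto simp: inj_on_def)
  then show "open (snd c ` (V \<inter> W \<inter> fst c))" using h c by auto
next
  fix \<K> c assume h: "\<forall>W\<in>\<K>. W \<subseteq> points A \<and> (\<forall>c\<in>A. open (snd c ` (W \<inter> fst c)))" and c: "c \<in> A"
  have "snd c ` (\<Union>\<K> \<inter> fst c) = (\<Union>W\<in>\<K>. snd c ` (W \<inter> fst c))" by auto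
  then show "open (snd c ` (\<Union>\<K> \<inter> fst c))" using h c by auto
qed auto

lemma openin_manifold_topology:
  assumes "\<And>c. c \<in> A \<Longrightarrow> inj_on (snd c) (fst c)"
  shows "openin (manifold_topology A) W \<longleftrightarrow> W \<subseteq> points A \<and> (\<forall>c\<in>A. open (snd c ` (W \<inter> fst c)))"
  unfolding manifold_topology_def by (subst topology_inverse'[OF istopology_charts[OF assms]]) auto

definition tchart :: "('m, 'e::euclidean_space) chart set \<Rightarrow> ('m, 'e) chart \<Rightarrow>
    ('m \<times> ('m, 'e) tvec, 'e \<times> 'e) chart" where
  "tchart A c = ({(p, v). p \<in> fst c \<and> v \<in> tangent_space A p}, \<lambda>(p, v). (snd c p, v c))"

lemma tangent_atlas_eq: "tangent_atlas A = tchart A ` A"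
  by (simp add: tangent_atlas_def tchart_def)

lemma charts_at_tangent_atlas:
  assumes "v \<in> tangent_space A p"
  shows "charts_at (tangent_atlas A) (p, v) = tchart A ` charts_at A p"
  using assms by (auto simp: charts_at_def tangent_atlas_eq tchart_def)

text \<open>\<open>smooth_map\<close> speaks of a local extension. On an open parameter set,
  shrinking its domain makes the extension equal to the coordinate curve itself, so the latter is
  smooth in the ordinary sense.\<close>

lemma smooth_map_curve:
  assumes "smooth_map std_atlas A I \<gamma>" "open I" "t \<in> I" "c \<in> charts_at A (\<gamma> t)"
  obtains N where "open N" "t \<in> N" "N \<subseteq> I" "\<And>s. s \<in> N \<Longrightarrow> \<gamma> s \<in> fst c"
    "smooth_on N (\<lambda>s. snd c (\<gamma> s))"
proof -
  from assms(1,3,4) obtain N F where N: "open N" "t \<in> N" "smooth_on N F"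
    "\<And>y. y \<in> I \<Longrightarrow> y \<in> N \<Longrightarrow> \<gamma> y \<in> fst c \<and> snd c (\<gamma> y) = F y"
    unfolding smooth_map_def by fastforce
  have "smooth_on (N \<inter> I) (\<lambda>s. snd c (\<gamma> s))"
    by (rule smooth_on_cong[of _ F]) (use N assms(2) in \<open>auto intro: smooth_on_subset\<close>)
  then show ?thesis using that[of "N \<inter> I"] N assms(2,3) by auto
qed

lemma smooth_map_point:
  assumes "smooth_map A B X f" "x \<in> X" shows "\<exists>c. c \<in> charts_at B (f x)"
  using assms unfolding smooth_map_def charts_at_nonempty[symmetric] by blast

lemma smooth_map_std_subset:
  "smooth_map std_atlas A I \<gamma> \<Longrightarrow> J \<subseteq> I \<Longrightarrow> smooth_map std_atlas A J \<gamma>"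
  unfolding smooth_map_def
proof (elim conjE, intro conjI ballI)
  fix x c d
  assume J: "J \<subseteq> I" and x: "x \<in> J" "c \<in> charts_at std_atlas x" "d \<in> charts_at A (\<gamma> x)"
    and "\<forall>x\<in>I. \<forall>c\<in>charts_at std_atlas x. \<forall>d\<in>charts_at A (\<gamma> x). \<exists>N F. open N \<and> snd c x \<in> N \<and>
      smooth_on N F \<and> (\<forall>y\<in>I \<inter> fst c. snd c y \<in> N \<longrightarrow> \<gamma> y \<in> fst d \<and> snd d (\<gamma> y) = F (snd c y))"
  then obtain N F where "open N" "snd c x \<in> N" "smooth_on N F"
    "\<forall>y\<in>I \<inter> fst c. snd c y \<in> N \<longrightarrow> \<gamma> y \<in> fst d \<and> snd d (\<gamma> y) = F (snd c y)"
    by (meson subsetD)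
  then show "\<exists>N F. open N \<and> snd c x \<in> N \<and>
      smooth_on N F \<and> (\<forall>y\<in>J \<inter> fst c. snd c y \<in> N \<longrightarrow> \<gamma> y \<in> fst d \<and> snd d (\<gamma> y) = F (snd c y))"
    using J by (intro exI[of _ N] exI[of _ F]) auto
qed auto

section \<open>Transition maps and tangent spaces of a smooth atlas\<close>

locale atlas =
  fixes A :: "('m, 'e::euclidean_space) chart set"
  assumes atlas: "smooth_atlas A"
begin

lemma chart_inj: "c \<in> A \<Longrightarrow> inj_on (snd c) (fst c)"
  using atlas by (auto simp: smooth_atlas_def)

lemma chart_open: "c \<in> A \<Longrightarrow> open (snd c ` fst c)"
  using atlas by (auto simp: smooth_atlas_def)

lemma overlap_open: "c \<in> A \<Longrightarrow> d \<in> A \<Longrightarrow> open (snd c ` (fst c \<inter> fst d))"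
  using atlas by (auto simp: smooth_atlas_def)

lemma transition_smooth: "c \<in> A \<Longrightarrow> d \<in> A \<Longrightarrow> smooth_on (snd c ` (fst c \<inter> fst d)) (transition c d)"
  using atlas by (auto simp: smooth_atlas_def)

lemma inv_chart [simp]: "c \<in> A \<Longrightarrow> p \<in> fst c \<Longrightarrow> inv_into (fst c) (snd c) (snd c p) = p"
  by (simp add: chart_inj)

lemma transition_apply: "c \<in> A \<Longrightarrow> p \<in> fst c \<Longrightarrow> transition c d (snd c p) = snd d p"
  by (simp add: transition_def)

lemma transition_Dat:
  assumes "c \<in> charts_at A p" "d \<in> charts_at A p"
  shows "(transition c d has_derivative Dat (transition c d) (snd c p)) (at (snd c p))"
  by (rule smooth_on_has_derivative[OF transition_smooth]) (use assms in \<open>auto simp: charts_at_iff\<close>)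

lemma transition_linear:
  assumes "c \<in> charts_at A p" "d \<in> charts_at A p"
  shows "linear (Dat (transition c d) (snd c p))"
  using transition_Dat[OF assms] has_derivative_linear by blast

text \<open>The chain rule on the triple overlap, where the composite of two transition maps is the
  third. It makes the coordinate definition of tangent vectors consistent.\<close>

lemma transition_chain:
  assumes c: "c \<in> charts_at A p" and d: "d \<in> charts_at A p" and e: "e \<in> charts_at A p"
  shows "Dat (transition d e) (snd d p) (Dat (transition c d) (snd c p) v) = Dat (transition c e) (snd c p) v"
proof -
  let ?X = "snd c ` (fst c \<inter> fst d) \<inter> snd c ` (fst c \<inter> fst e)"
  have X: "open ?X" "snd c p \<in> ?X"
    using assms by (auto simp only: charts_at_iff Int_iff intro!: open_Int overlap_open)
  have "((\<lambda>x. transition d e (transition c d x)) has_derivative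
      (\<lambda>v. Dat (transition d e) (snd d p) (Dat (transition c d) (snd c p) v))) (at (snd c p))"
    by (rule has_derivative_compose[OF transition_Dat[OF c d]])
      (use transition_Dat[OF d e] c in \<open>simp add: transition_apply charts_at_iff\<close>)
  then have "(transition c e has_derivative
      (\<lambda>v. Dat (transition d e) (snd d p) (Dat (transition c d) (snd c p) v))) (at (snd c p))"
  proof (rule has_derivative_transform_within_open[OF _ X])
    fix y assume "y \<in> ?X"
    then obtain q where "q \<in> fst c" "q \<in> fst d" "y = snd c q"
      by auto
    then show "transition d e (transition c d y) = transition c e y"
      using c d by (simp add: transition_apply charts_at_iff)
  qed
  then show ?thesis by (simp add: Dat_eq)
qed

lemma transition_self:
  assumes c: "c \<in> charts_at A p"
  shows "Dat (transition c c) (snd c p) v = v"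
proof -
  have "Dat (transition c c) (snd c p) = Dat (\<lambda>x. x) (snd c p)"
    by (rule Dat_cong[OF chart_open]) (use c in \<open>auto simp: transition_apply charts_at_iff\<close>)
  then show ?thesis by simp
qed

lemma transition_inverse:
  assumes "c \<in> charts_at A p" "d \<in> charts_at A p"
  shows "Dat (transition d c) (snd d p) (Dat (transition c d) (snd c p) v) = v"
  by (simp add: transition_chain[OF assms assms(1)] transition_self[OF assms(1)])

lemma tangent_outside: "v \<in> tangent_space A p \<Longrightarrow> c \<notin> charts_at A p \<Longrightarrow> v c = 0"
  unfolding tangent_space_def by blast

lemma tangentI:
  assumes "\<And>c. c \<notin> charts_at A p \<Longrightarrow> v c = 0"
    and "\<And>c d. c \<in> charts_at A p \<Longrightarrow> d \<in> charts_at A p \<Longrightarrow>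
      v d = Dat (transition c d) (snd c p) (v c)"
  shows "v \<in> tangent_space A p"
  unfolding tangent_space_def by (intro CollectI conjI allI impI ballI assms)

lemma coord_vec_tangent:
  assumes c: "c \<in> charts_at A p" shows "coord_vec A p c a \<in> tangent_space A p"
  unfolding tangent_space_def coord_vec_def using c
  by (auto simp: transition_chain[OF c])

lemma coord_vec_self:
  assumes c: "c \<in> charts_at A p" shows "coord_vec A p c a c = a"
  by (simp add: coord_vec_def c transition_self[OF c])

lemma tangent_transform:
  assumes "v \<in> tangent_space A p" "c \<in> charts_at A p" "d \<in> charts_at A p"
  shows "v d = Dat (transition c d) (snd c p) (v c)"
  using assms unfolding tangent_space_def by blast

lemma coord_vec_of_tangent:
  assumes "v \<in> tangent_space A p" "c \<in> charts_at A p"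
  shows "coord_vec A p c (v c) = v"
proof
  show "coord_vec A p c (v c) d = v d" for d
    unfolding coord_vec_def
    using tangent_transform[OF assms, of d, symmetric] tangent_outside[OF assms(1), of d]
    by (cases "d \<in> charts_at A p") auto
qed

lemma tangent_eqI:
  assumes "v \<in> tangent_space A p" "w \<in> tangent_space A p" "c \<in> charts_at A p" "v c = w c"
  shows "v = w"
  using assms coord_vec_of_tangent by metis

lemma tangent_space_lincomb:
  assumes "v \<in> tangent_space A p" "w \<in> tangent_space A p"
  shows "(\<lambda>c. r *\<^sub>R v c + s *\<^sub>R w c) \<in> tangent_space A p"
proof (rule tangentI)
  fix c d assume cd: "c \<in> charts_at A p" "d \<in> charts_at A p"
  show "r *\<^sub>R v d + s *\<^sub>R w d = Dat (transition c d) (snd c p) (r *\<^sub>R v c + s *\<^sub>R w c)"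
    unfolding tangent_transform[OF assms(1) cd] tangent_transform[OF assms(2) cd]
    by (simp add: linear_add[OF transition_linear[OF cd]] linear_scale[OF transition_linear[OF cd]])
qed (simp add: assms[THEN tangent_outside])

lemma tangent_space_scale:
  "v \<in> tangent_space A p \<Longrightarrow> (\<lambda>c. r *\<^sub>R v c) \<in> tangent_space A p"
  using tangent_space_lincomb[of v p v r 0] by simp

lemma zero_tangent: "(\<lambda>_. 0) \<in> tangent_space A p"
  by (rule tangentI) (simp_all add: linear_0[OF transition_linear])

lemma tangent_neq_zero:
  assumes "v \<in> tangent_space A p" "v \<noteq> (\<lambda>_. 0)" "c \<in> charts_at A p" shows "v c \<noteq> 0"
  using tangent_eqI[OF assms(1) zero_tangent assms(3)] assms(2) by auto

lemma tchart_inj: "c \<in> A \<Longrightarrow> inj_on (snd (tchart A c)) (fst (tchart A c))"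
proof (rule inj_onI, clarsimp simp: tchart_def)
  fix p v q w assume "c \<in> A" "p \<in> fst c" "v \<in> tangent_space A p" "q \<in> fst c" "w \<in> tangent_space A q"
    "snd c p = snd c q" "v c = w c"
  then show "p = q \<and> v = w"
    using chart_inj[of c] tangent_eqI[of v p w c] by (auto simp: inj_on_def charts_at_iff)
qed

lemma tchart_image:
  fixes c :: "('m, 'e) chart"
  assumes "c \<in> A" shows "snd (tchart A c) ` fst (tchart A c) = (snd c ` fst c) \<times> (UNIV :: 'e set)"
proof (intro equalityI subsetI)
  fix x :: "'e \<times> 'e" assume "x \<in> (snd c ` fst c) \<times> UNIV"
  then obtain p and a :: 'e where p: "p \<in> fst c" "x = (snd c p, a)" by auto
  then have "(p, coord_vec A p c a) \<in> fst (tchart A c)" "snd (tchart A c) (p, coord_vec A p c a) = x"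
    using assms by (auto simp: tchart_def coord_vec_tangent coord_vec_self charts_at_iff)
  then show "x \<in> snd (tchart A c) ` fst (tchart A c)" by (metis imageI)
qed (auto simp: tchart_def)

lemma openin_tangent:
  "openin (manifold_topology (tangent_atlas A)) W \<longleftrightarrow>
    W \<subseteq> points (tangent_atlas A) \<and> (\<forall>c\<in>A. open (snd (tchart A c) ` (W \<inter> fst (tchart A c))))"
  by (subst openin_manifold_topology) (auto simp: tangent_atlas_eq tchart_inj)

lemma points_tangent: "points (tangent_atlas A) = {(p, v). p \<in> points A \<and> v \<in> tangent_space A p}"
  by (auto simp: points_def tangent_atlas_eq tchart_def)

lemma openin_manifold:
  "openin (manifold_topology A) W \<longleftrightarrow> W \<subseteq> points A \<and> (\<forall>c\<in>A. open (snd c ` (W \<inter> fst c)))"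
  by (rule openin_manifold_topology[OF chart_inj])

lemma smooth_curve_chart_change:
  assumes c: "c \<in> A" and d: "d \<in> A" and N: "open N" "t \<in> N" "\<And>s. s \<in> N \<Longrightarrow> \<gamma> s \<in> fst c"
    "smooth_on N (\<lambda>s::real. snd c (\<gamma> s))" and t: "\<gamma> t \<in> fst d"
  obtains N' where "open N'" "t \<in> N'" "N' \<subseteq> N" "\<And>s. s \<in> N' \<Longrightarrow> \<gamma> s \<in> fst d"
    "smooth_on N' (\<lambda>s. snd d (\<gamma> s))"
proof -
  define N' where "N' = N \<inter> (\<lambda>s. snd c (\<gamma> s)) -` (snd c ` (fst c \<inter> fst d))"
  have op: "open N'" unfolding N'_def
    by (rule continuous_open_preimage[OF smooth_on_continuous[OF N(4)] N(1) overlap_open[OF c d]])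
  have d': "\<gamma> s \<in> fst d" if "s \<in> N'" for s
    using that N(3) chart_inj[OF c] by (auto simp: N'_def inj_on_def)
  have "smooth_on N' (\<lambda>s. transition c d (snd c (\<gamma> s)))"
    by (rule smooth_on_compose[OF op overlap_open[OF c d] transition_smooth[OF c d]])
      (use smooth_on_subset[OF N(4)] in \<open>auto simp: N'_def\<close>)
  then have "smooth_on N' (\<lambda>s. snd d (\<gamma> s))"
    by (rule smooth_on_cong[OF op]) (use N(3) c in \<open>auto simp: N'_def transition_apply\<close>)
  then show ?thesis using that[of N'] op d' N t c by (auto simp: N'_def)
qed

text \<open>\<open>smooth_map\<close> quantifies over all charts around the point; smooth transition
  maps carry smoothness over from the one chart in which it is checked.\<close>

lemma smooth_map_curveI:
  fixes I :: "real set"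
  assumes "\<And>t. t \<in> I \<Longrightarrow> \<exists>c N. c \<in> charts_at A (\<gamma> t) \<and> open N \<and> t \<in> N \<and>
      (\<forall>s\<in>N. \<gamma> s \<in> fst c) \<and> smooth_on N (\<lambda>s. snd c (\<gamma> s))"
  shows "smooth_map std_atlas A I \<gamma>"
  unfolding smooth_map_def
proof (intro conjI ballI)
  show "\<gamma> ` I \<subseteq> points A" using assms charts_at_nonempty by fast
  fix t c' d assume t: "t \<in> I" and c': "c' \<in> charts_at std_atlas t" and d: "d \<in> charts_at A (\<gamma> t)"
  obtain c N where c: "c \<in> charts_at A (\<gamma> t)" and N: "open N" "t \<in> N" "\<And>s. s \<in> N \<Longrightarrow> \<gamma> s \<in> fst c"
    "smooth_on N (\<lambda>s. snd c (\<gamma> s))" using assms[OF t] by blast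
  have cd: "c \<in> A" "d \<in> A" "\<gamma> t \<in> fst d" using c d by (auto simp: charts_at_iff)
  obtain N' where "open N'" "t \<in> N'" "N' \<subseteq> N" "\<And>s. s \<in> N' \<Longrightarrow> \<gamma> s \<in> fst d" "smooth_on N' (\<lambda>s. snd d (\<gamma> s))"
    using smooth_curve_chart_change[OF cd(1,2) N cd(3)] that by (smt (verit, ccfv_SIG))
  then show "\<exists>N F. open N \<and> snd c' t \<in> N \<and> smooth_on N F \<and>
      (\<forall>y\<in>I \<inter> fst c'. snd c' y \<in> N \<longrightarrow> \<gamma> y \<in> fst d \<and> snd d (\<gamma> y) = F (snd c' y))"
    using c' by (intro exI[of _ N'] exI[of _ "\<lambda>s. snd d (\<gamma> s)"]) auto
qed simp

text \<open>Continuity of smooth curves for the chart topology, in the form needed to combine it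
  with the Hausdorff property when two geodesics are compared.\<close>

lemma curve_open_preimage:
  assumes \<gamma>: "smooth_map std_atlas A I \<gamma>" "open I" "t \<in> I"
    and W: "openin (manifold_topology A) W" "\<gamma> t \<in> W"
  obtains N where "open N" "t \<in> N" "N \<subseteq> I" "\<And>s. s \<in> N \<Longrightarrow> \<gamma> s \<in> W"
proof -
  obtain c where c: "c \<in> charts_at A (\<gamma> t)"
    using W charts_at_nonempty[of "\<gamma> t" A] by (auto simp: openin_manifold)
  obtain N where N: "open N" "t \<in> N" "N \<subseteq> I" "\<And>s. s \<in> N \<Longrightarrow> \<gamma> s \<in> fst c"
    "smooth_on N (\<lambda>s. snd c (\<gamma> s))" using smooth_map_curve[OF \<gamma> c] by blast
  have cA: "c \<in> A" using c by (simp add: charts_at_iff)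
  let ?N = "N \<inter> (\<lambda>s. snd c (\<gamma> s)) -` (snd c ` (W \<inter> fst c))"
  have "open ?N"
    by (rule continuous_open_preimage[OF smooth_on_continuous[OF N(5)] N(1)])
      (use W openin_manifold cA in blast)
  moreover have "\<gamma> s \<in> W" if "s \<in> ?N" for s
    using that N(4) chart_inj[OF cA] by (auto simp: inj_on_def)
  ultimately show ?thesis using that[of ?N] N(2,3,4) W(2) by auto
qed

section \<open>Velocities and fields along curves\<close>

lemma velocity_eq: "c \<in> charts_at A (\<gamma> t) \<Longrightarrow> velocity A \<gamma> t c = vector_derivative (\<lambda>s. snd c (\<gamma> s)) (at t)"
  by (simp add: velocity_def)

lemma has_velocity:
  assumes "smooth_map std_atlas A I \<gamma>" "open I" "t \<in> I" "c \<in> charts_at A (\<gamma> t)"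
  shows "((\<lambda>s. snd c (\<gamma> s)) has_vector_derivative velocity A \<gamma> t c) (at t)"
proof -
  obtain N where N: "open N" "t \<in> N" "N \<subseteq> I" "\<And>s. s \<in> N \<Longrightarrow> \<gamma> s \<in> fst c"
    "smooth_on N (\<lambda>s. snd c (\<gamma> s))"
    using smooth_map_curve[OF assms] by blast
  show ?thesis using smooth_on_vector_derivative(1)[OF N(1,5,2)] assms(4) by (simp add: velocity_eq)
qed

lemma velocity_tangent:
  assumes \<gamma>: "smooth_map std_atlas A I \<gamma>" "open I" "t \<in> I"
  shows "velocity A \<gamma> t \<in> tangent_space A (\<gamma> t)"
proof -
  have "velocity A \<gamma> t d = Dat (transition c d) (snd c (\<gamma> t)) (velocity A \<gamma> t c)"
    if c: "c \<in> charts_at A (\<gamma> t)" and d: "d \<in> charts_at A (\<gamma> t)" for c d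
  proof -
    have cd: "c \<in> A" "d \<in> A" "\<gamma> t \<in> fst c" "\<gamma> t \<in> fst d" using c d by (auto simp: charts_at_iff)
    obtain N where N: "open N" "t \<in> N" "N \<subseteq> I" "\<And>s. s \<in> N \<Longrightarrow> \<gamma> s \<in> fst c"
      "smooth_on N (\<lambda>s. snd c (\<gamma> s))" using smooth_map_curve[OF \<gamma> c] by blast
    have "((\<lambda>s. transition c d (snd c (\<gamma> s))) has_vector_derivative
        Dat (transition c d) (snd c (\<gamma> t)) (velocity A \<gamma> t c)) (at t)"
      by (rule has_vector_derivative_comp_Dat[OF transition_smooth[OF cd(1,2)] has_velocity[OF \<gamma> c]])
        (use cd in auto)
    then have "((\<lambda>s. snd d (\<gamma> s)) has_vector_derivative
        Dat (transition c d) (snd c (\<gamma> t)) (velocity A \<gamma> t c)) (at t)"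
      by (rule has_vector_derivative_transform_within_open[OF _ N(1,2)])
        (use N(4) cd(1) in \<open>simp add: transition_apply\<close>)
    then show ?thesis using velocity_eq[of d \<gamma> t, OF d] vector_derivative_at by metis
  qed
  note tr = this
  show ?thesis
  proof (rule tangentI)
    show "velocity A \<gamma> t c = 0" if "c \<notin> charts_at A (\<gamma> t)" for c
      using that by (simp add: velocity_def)
  qed (rule tr)
qed

lemma velocity_cong:
  fixes \<gamma> \<eta> :: "real \<Rightarrow> 'm"
  assumes "open N" "t \<in> N" "\<And>s. s \<in> N \<Longrightarrow> \<gamma> s = \<eta> s"
  shows "velocity A \<gamma> t = velocity A \<eta> t"
proof
  fix c :: "('m, 'e) chart"
  have "vector_derivative (\<lambda>s. snd c (\<gamma> s)) (at t) = vector_derivative (\<lambda>s. snd c (\<eta> s)) (at t)"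
    by (rule vector_derivative_cong[OF assms(1,2)]) (simp add: assms(3))
  then show "velocity A \<gamma> t c = velocity A \<eta> t c"
    using assms(2,3) by (simp add: velocity_def)
qed

lemma sub_tangent_tangent:
  assumes "x \<in> sub_tangent A X p" shows "x \<in> tangent_space A p"
proof -
  obtain \<sigma> \<epsilon> where "x = velocity A \<sigma> 0" "\<sigma> 0 = p" "\<epsilon> > 0" "smooth_map std_atlas A {-\<epsilon><..<\<epsilon>} \<sigma>"
    using assms by (auto simp: sub_tangent_def curves_through_def)
  then show ?thesis using velocity_tangent[of "{-\<epsilon><..<\<epsilon>}" \<sigma> 0] by auto
qed

text \<open>A smooth field along a curve is a smooth curve in the tangent bundle. In the bundle
  chart of \<open>c\<close> its two components are the coordinate curve and the components of the
  field.\<close>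

lemma field_along_chart:
  assumes Y: "smooth_field_along A I \<gamma> Y" and I: "open I" "t \<in> I" and c: "c \<in> charts_at A (\<gamma> t)"
  obtains N where "open N" "t \<in> N" "N \<subseteq> I" "\<And>s. s \<in> N \<Longrightarrow> \<gamma> s \<in> fst c"
    "smooth_on N (\<lambda>s. snd c (\<gamma> s))" "smooth_on N (\<lambda>s. Y s c)"
proof -
  have sm: "smooth_map std_atlas (tangent_atlas A) I (\<lambda>t. (\<gamma> t, Y t))" and T: "Y t \<in> tangent_space A (\<gamma> t)"
    using Y I by (auto simp: smooth_field_along_def)
  have "tchart A c \<in> charts_at (tangent_atlas A) (\<gamma> t, Y t)"
    using c by (simp add: charts_at_tangent_atlas[OF T])
  from smooth_map_curve[OF sm I this] obtain N where N: "open N" "t \<in> N" "N \<subseteq> I"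
    "\<And>s. s \<in> N \<Longrightarrow> (\<gamma> s, Y s) \<in> fst (tchart A c)" "smooth_on N (\<lambda>s. snd (tchart A c) (\<gamma> s, Y s))"
    by blast
  have "smooth_on N (\<lambda>s. (snd c (\<gamma> s), Y s c))" using N(5) by (simp add: tchart_def)
  then have "smooth_on N (\<lambda>s. snd c (\<gamma> s))" "smooth_on N (\<lambda>s. Y s c)"
    using smooth_on_fst[OF N(1)] smooth_on_snd[OF N(1)] by fastforce+
  then show ?thesis using that[of N] N by (auto simp: tchart_def)
qed

lemma field_along_curve:
  assumes Y: "smooth_field_along A I \<gamma> Y" and I: "open I"
  shows "smooth_map std_atlas A I \<gamma>"
proof (rule smooth_map_curveI)
  fix t assume t: "t \<in> I"
  have "(\<gamma> t, Y t) \<in> points (tangent_atlas A)"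
    using Y t by (auto simp: smooth_field_along_def smooth_map_def)
  then obtain c where c: "c \<in> charts_at A (\<gamma> t)" 
    by (auto simp: points_tangent charts_at_nonempty simp del: split_paired_Ex)
  show "\<exists>c N. c \<in> charts_at A (\<gamma> t) \<and> open N \<and> t \<in> N \<and> (\<forall>s\<in>N. \<gamma> s \<in> fst c) \<and> smooth_on N (\<lambda>s. snd c (\<gamma> s))"
    by (rule field_along_chart[OF Y I t c]) (use c in blast)
qed

lemma field_along_chart_change:
  assumes c: "c \<in> A" and d: "d \<in> A" and N: "open N" "t \<in> N" "\<And>s. s \<in> N \<Longrightarrow> \<gamma> s \<in> fst c"
    "smooth_on N (\<lambda>s::real. snd c (\<gamma> s))" "smooth_on N (\<lambda>s. Y s c)"
    "\<And>s. s \<in> N \<Longrightarrow> Y s \<in> tangent_space A (\<gamma> s)" and t: "\<gamma> t \<in> fst d"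
  obtains N' where "open N'" "t \<in> N'" "N' \<subseteq> N" "\<And>s. s \<in> N' \<Longrightarrow> \<gamma> s \<in> fst d"
    "smooth_on N' (\<lambda>s. snd d (\<gamma> s))" "smooth_on N' (\<lambda>s. Y s d)"
proof -
  obtain N' where N': "open N'" "t \<in> N'" "N' \<subseteq> N" "\<And>s. s \<in> N' \<Longrightarrow> \<gamma> s \<in> fst d"
    "smooth_on N' (\<lambda>s. snd d (\<gamma> s))" using smooth_curve_chart_change[OF c d N(1-4) t] by blast
  have "smooth_on N' (\<lambda>s. Dat (transition c d) (snd c (\<gamma> s)) (Y s c))"
    by (rule smooth_on_Dat_apply[OF N'(1) overlap_open[OF c d] transition_smooth[OF c d]])
      (use N N' smooth_on_subset in auto)
  then have "smooth_on N' (\<lambda>s. Y s d)"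
  proof (rule smooth_on_cong[OF N'(1)])
    fix s assume s: "s \<in> N'"
    show "Dat (transition c d) (snd c (\<gamma> s)) (Y s c) = Y s d"
      by (rule tangent_transform[symmetric, of _ "\<gamma> s"]) (use s N' N c d in \<open>auto simp: charts_at_iff\<close>)
  qed
  then show ?thesis using that N' by blast
qed

text \<open>The analogue of \<open>smooth_map_curveI\<close> for fields: their components change by
  the derivative of the transition map along the curve, which is again smooth.\<close>

lemma field_alongI:
  fixes I :: "real set"
  assumes I: "open I" and T: "\<And>t. t \<in> I \<Longrightarrow> Y t \<in> tangent_space A (\<gamma> t)"
    and ex: "\<And>t. t \<in> I \<Longrightarrow> \<exists>c N. c \<in> charts_at A (\<gamma> t) \<and> open N \<and> t \<in> N \<and>
      (\<forall>s\<in>N. \<gamma> s \<in> fst c) \<and> smooth_on N (\<lambda>s. snd c (\<gamma> s)) \<and> smooth_on N (\<lambda>s. Y s c)"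
  shows "smooth_field_along A I \<gamma> Y"
  unfolding smooth_field_along_def smooth_map_def
proof (intro conjI ballI T)
  show "(\<lambda>t. (\<gamma> t, Y t)) ` I \<subseteq> points (tangent_atlas A)"
    using ex T charts_at_nonempty by (auto simp: points_tangent) fast
  fix t c' d' assume t: "t \<in> I" and c': "c' \<in> charts_at std_atlas t"
    and d': "d' \<in> charts_at (tangent_atlas A) (\<gamma> t, Y t)"
  obtain d where d: "d \<in> charts_at A (\<gamma> t)" "d' = tchart A d"
    using d' by (auto simp: charts_at_tangent_atlas[OF T[OF t]])
  obtain c N where c: "c \<in> charts_at A (\<gamma> t)" and N: "open N" "t \<in> N" "\<And>s. s \<in> N \<Longrightarrow> \<gamma> s \<in> fst c"
    "smooth_on N (\<lambda>s. snd c (\<gamma> s))" "smooth_on N (\<lambda>s. Y s c)" using ex[OF t] by blast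
  have sub: "smooth_on (N \<inter> I) (\<lambda>s. snd c (\<gamma> s))" "smooth_on (N \<inter> I) (\<lambda>s. Y s c)"
    using N(4,5) smooth_on_subset by blast+
  obtain N' where N': "open N'" "t \<in> N'" "N' \<subseteq> N \<inter> I" "\<And>s. s \<in> N' \<Longrightarrow> \<gamma> s \<in> fst d"
    "smooth_on N' (\<lambda>s. snd d (\<gamma> s))" "smooth_on N' (\<lambda>s. Y s d)"
    using field_along_chart_change[of c d "N \<inter> I" t \<gamma> Y] sub N c d t I T
    by (auto simp: charts_at_iff)
  then show "\<exists>N F. open N \<and> snd c' t \<in> N \<and> smooth_on N F \<and>
      (\<forall>y\<in>I \<inter> fst c'. snd c' y \<in> N \<longrightarrow> (\<gamma> y, Y y) \<in> fst d' \<and> snd d' (\<gamma> y, Y y) = F (snd c' y))"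
    using c' T smooth_on_Pair[OF N'(1,5,6)] unfolding d(2)
    by (intro exI[of _ N'] exI[of _ "\<lambda>s. (snd d (\<gamma> s), Y s d)"]) (auto simp: tchart_def)
qed (auto simp: points_std)

lemma velocity_smooth_field:
  assumes \<gamma>: "smooth_map std_atlas A I \<gamma>" and I: "open I"
  shows "smooth_field_along A I \<gamma> (velocity A \<gamma>)"
proof (rule field_alongI[OF I velocity_tangent[OF \<gamma> I]])
  fix t assume t: "t \<in> I"
  then obtain c where c: "c \<in> charts_at A (\<gamma> t)"
    using smooth_map_point[OF \<gamma>] by blast
  obtain N where N: "open N" "t \<in> N" "N \<subseteq> I" "\<And>s. s \<in> N \<Longrightarrow> \<gamma> s \<in> fst c"
    "smooth_on N (\<lambda>s. snd c (\<gamma> s))" using smooth_map_curve[OF \<gamma> I t c] by blast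
  have "smooth_on N (\<lambda>s. velocity A \<gamma> s c)"
    by (rule smooth_on_cong[OF N(1) smooth_on_vector_derivative(2)[OF N(1,5)]])
      (use N c in \<open>simp add: velocity_def charts_at_iff\<close>)
  then show "\<exists>c N. c \<in> charts_at A (\<gamma> t) \<and> open N \<and> t \<in> N \<and> (\<forall>s\<in>N. \<gamma> s \<in> fst c) \<and>
      smooth_on N (\<lambda>s. snd c (\<gamma> s)) \<and> smooth_on N (\<lambda>s. velocity A \<gamma> s c)"
    using c N by blast
qed

end

section \<open>The Levi-Civita connection in charts\<close>

text \<open>A product rule for a moving linear map at a moving argument when smoothness is known for
  fixed arguments only. The argument is expanded in the basis, the sum differentiated, and both
  parts reassembled; the first part is the derivative with the argument frozen at
  \<open>a z\<close>.\<close>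

lemma has_derivative_linear_family:
  fixes L :: "'a::euclidean_space \<Rightarrow> 'b::euclidean_space \<Rightarrow> 'c::real_normed_vector"
  assumes Y: "open Y" and lin: "\<And>y. y \<in> Y \<Longrightarrow> linear (L y)" and L: "\<And>b. smooth_on Y (\<lambda>y. L y b)"
    and X: "(X has_derivative X') (at z)" "X z \<in> Y" and a: "(a has_derivative a') (at z)"
  shows "((\<lambda>z. L (X z) (a z)) has_derivative
    (\<lambda>h. Dat (\<lambda>y. L y (a z)) (X z) (X' h) + L (X z) (a' h))) (at z)"
proof -
  have "((\<lambda>z. L (X z) b) has_derivative (\<lambda>h. Dat (\<lambda>y. L y b) (X z) (X' h))) (at z)" for b
    by (rule has_derivative_compose[OF X(1) smooth_on_has_derivative[OF L X(2)]])
  moreover have "((\<lambda>z. a z \<bullet> b) has_derivative (\<lambda>h. a' h \<bullet> b)) (at z)" for b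
    by (rule bounded_linear.has_derivative[OF bounded_linear_inner_left a])
  ultimately have "((\<lambda>z. \<Sum>b\<in>Basis. (a z \<bullet> b) *\<^sub>R L (X z) b) has_derivative
      (\<lambda>h. \<Sum>b\<in>Basis. (a z \<bullet> b) *\<^sub>R Dat (\<lambda>y. L y b) (X z) (X' h) + (a' h \<bullet> b) *\<^sub>R L (X z) b)) (at z)"
    by (intro has_derivative_sum has_derivative_scaleR)
  moreover have "(\<Sum>b\<in>Basis. (a' h \<bullet> b) *\<^sub>R L (X z) b) = L (X z) (a' h)" for h
    by (rule linear_Basis_expand[OF lin[OF X(2)], symmetric])
  moreover have "(\<Sum>b\<in>Basis. (a z \<bullet> b) *\<^sub>R Dat (\<lambda>y. L y b) (X z) v) = Dat (\<lambda>y. L y (a z)) (X z) v" for v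
  proof -
    have "((\<lambda>y. \<Sum>b\<in>Basis. (a z \<bullet> b) *\<^sub>R L y b) has_derivative
        (\<lambda>v. \<Sum>b\<in>Basis. (a z \<bullet> b) *\<^sub>R Dat (\<lambda>y. L y b) (X z) v)) (at (X z))"
      by (intro has_derivative_sum has_derivative_scaleR_right smooth_on_has_derivative[OF L X(2)])
    then have "((\<lambda>y. L y (a z)) has_derivative
        (\<lambda>v. \<Sum>b\<in>Basis. (a z \<bullet> b) *\<^sub>R Dat (\<lambda>y. L y b) (X z) v)) (at (X z))"
    proof (rule has_derivative_transform_within_open[OF _ Y X(2)])
      show "(\<Sum>b\<in>Basis. (a z \<bullet> b) *\<^sub>R L y b) = L y (a z)" if "y \<in> Y" for y
        by (rule linear_Basis_expand[OF lin[OF that], symmetric])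
    qed
    then show ?thesis by (simp add: Dat_eq)
  qed
  ultimately have D: "((\<lambda>z. \<Sum>b\<in>Basis. (a z \<bullet> b) *\<^sub>R L (X z) b) has_derivative
      (\<lambda>h. Dat (\<lambda>y. L y (a z)) (X z) (X' h) + L (X z) (a' h))) (at z)"
    by (simp add: sum.distrib)
  have "isCont X z" using X(1) has_derivative_continuous by blast
  then have "\<forall>\<^sub>F w in at z. X w \<in> Y"
    using topological_tendstoD[of X "X z" "at z" Y] Y X(2) by (simp add: isCont_def)
  then have ev: "\<forall>\<^sub>F w in at z. (\<Sum>b\<in>Basis. (a w \<bullet> b) *\<^sub>R L (X w) b) = L (X w) (a w)"
  proof eventually_elim
    case (elim w)
    show ?case by (rule linear_Basis_expand[OF lin[OF elim], symmetric])
  qed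
  have e0: "(\<Sum>b\<in>Basis. (a z \<bullet> b) *\<^sub>R L (X z) b) = L (X z) (a z)"
    by (rule linear_Basis_expand[OF lin[OF X(2)], symmetric])
  show ?thesis
    by (rule has_derivative_transform_eventually[OF D ev e0]) simp
qed

lemma bilinear_left: "bilinear h \<Longrightarrow> linear (\<lambda>x. h x y)" and bilinear_right: "bilinear h \<Longrightarrow> linear (h x)"
  by (auto simp: bilinear_def)

lemma bilinearI:
  assumes "\<And>b. linear (\<lambda>a. h a b)" "\<And>a. linear (\<lambda>b. h a b)" shows "bilinear h"
  using assms by (auto simp: bilinear_def)

text \<open>The linear case used twice: once with the pair of point and first argument as parameter,
  and once to split the resulting derivative with the point alone as parameter.\<close>

lemma has_derivative_bilinear_family:
  fixes B :: "'a::euclidean_space \<Rightarrow> 'b::euclidean_space \<Rightarrow> 'd::euclidean_space \<Rightarrow> 'c::real_normed_vector"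
  assumes Y: "open Y" and lin: "\<And>y. y \<in> Y \<Longrightarrow> bilinear (B y)" and B: "\<And>a b. smooth_on Y (\<lambda>y. B y a b)"
    and X: "(X has_derivative X') (at z)" "X z \<in> Y"
    and a: "(a has_derivative a') (at z)" and b: "(b has_derivative b') (at z)"
  shows "((\<lambda>z. B (X z) (a z) (b z)) has_derivative
    (\<lambda>h. Dat (\<lambda>y. B y (a z) (b z)) (X z) (X' h) + B (X z) (a' h) (b z) + B (X z) (a z) (b' h))) (at z)"
proof -
  define L where "L y p = B (fst y) (snd y) p" for y :: "'a \<times> 'b" and p
  have sm: "smooth_on (Y \<times> UNIV) (\<lambda>y. L y p)" for p
    unfolding L_def
  proof (rule smooth_on_family_apply[where L = "\<lambda>x q. B (fst x) q p" and h = snd])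
    show op: "open (Y \<times> (UNIV :: 'b set))" using Y by (simp add: open_Times)
    show "linear (\<lambda>q. B (fst x) q p)" if "x \<in> Y \<times> (UNIV :: 'b set)" for x
    proof -
      have "fst x \<in> Y" using that by auto
      then show ?thesis by (rule bilinear_left[OF lin])
    qed
    show "smooth_on (Y \<times> UNIV) (\<lambda>x::'a \<times> 'b. B (fst x) q p)" for q
      by (rule smooth_on_compose[OF op Y B smooth_on_fst[OF op smooth_on_ident[OF op]]]) auto
    show "smooth_on (Y \<times> UNIV) (snd :: 'a \<times> 'b \<Rightarrow> 'b)"
      by (rule smooth_on_bounded_linear[OF bounded_linear_snd op])
  qed
  have op: "open (Y \<times> (UNIV :: 'b set))" using Y by (simp add: open_Times)
  have D: "((\<lambda>z. L (X z, a z) (b z)) has_derivative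
    (\<lambda>h. Dat (\<lambda>y. L y (b z)) (X z, a z) (X' h, a' h) + L (X z, a z) (b' h))) (at z)"
  proof (rule has_derivative_linear_family[OF op _ sm has_derivative_Pair[OF X(1) a] _ b])
    show "linear (L y)" if "y \<in> Y \<times> UNIV" for y
      unfolding L_def by (rule bilinear_right[OF lin]) (use that in auto)
  qed (simp add: X(2))
  have E: "((\<lambda>y. B (fst y) (snd y) (b z)) has_derivative
     (\<lambda>h. Dat (\<lambda>y. B y (a z) (b z)) (X z) (fst h) + B (X z) (snd h) (b z))) (at (X z, a z))"
  proof -
    have "((\<lambda>y. B (fst y) (snd y) (b z)) has_derivative
     (\<lambda>h. Dat (\<lambda>y'. B y' (snd (X z, a z)) (b z)) (fst (X z, a z)) (fst h) + B (fst (X z, a z)) (snd h) (b z))) (at (X z, a z))"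
      by (rule has_derivative_linear_family[where L = "\<lambda>y q. B y q (b z)" and X = fst and a = snd, OF Y bilinear_left[OF lin] B])
        (simp_all add: X(2) bounded_linear_imp_has_derivative bounded_linear_fst bounded_linear_snd)
    then show ?thesis by simp
  qed
  show ?thesis using D unfolding L_def Dat_eq[OF E] by (simp only: fst_conv snd_conv)
qed

section \<open>Metric coefficients and the Christoffel symbol of a Lorentzian metric\<close>

locale lorentz = atlas A for A :: "('m, 'e::euclidean_space) chart set" +
  fixes g :: "('m, 'e) metric"
  assumes lorentzian: "lorentzian_metric A g"
begin

abbreviation mc where "mc \<equiv> metric_coeff A g"
abbreviation chr where "chr \<equiv> christoffel A g"

lemma points_charts_at: "c \<in> charts_at A p \<Longrightarrow> p \<in> points A"
  unfolding charts_at_def points_def by blast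

lemma g_sym:
  "p \<in> points A \<Longrightarrow> u \<in> tangent_space A p \<Longrightarrow> v \<in> tangent_space A p \<Longrightarrow> g p u v = g p v u"
  using lorentzian unfolding lorentzian_metric_def by blast

lemma g_lin:
  "p \<in> points A \<Longrightarrow> u \<in> tangent_space A p \<Longrightarrow> v \<in> tangent_space A p \<Longrightarrow> w \<in> tangent_space A p \<Longrightarrow>
    g p (\<lambda>c. r *\<^sub>R u c + s *\<^sub>R v c) w = r * g p u w + s * g p v w"
  using lorentzian unfolding lorentzian_metric_def by blast

lemma mc_eq:
  "c \<in> charts_at A p \<Longrightarrow> mc c (snd c p) a b = g p (coord_vec A p c a) (coord_vec A p c b)"
  by (simp add: metric_coeff_def charts_at_iff)

lemma g_eq_mc:
  assumes "c \<in> charts_at A p" "v \<in> tangent_space A p" "w \<in> tangent_space A p"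
  shows "g p v w = mc c (snd c p) (v c) (w c)"
  by (simp add: mc_eq assms coord_vec_of_tangent)

lemma mc_sym: 
  assumes "c \<in> charts_at A p" shows "mc c (snd c p) a b = mc c (snd c p) b a"
  using g_sym[OF points_charts_at[OF assms] coord_vec_tangent[OF assms] coord_vec_tangent[OF assms]]
  by (simp add: mc_eq[OF assms])

lemma coord_vec_lincomb:
  assumes c: "c \<in> charts_at A p"
  shows "coord_vec A p c (r *\<^sub>R a + s *\<^sub>R b) = (\<lambda>d. r *\<^sub>R coord_vec A p c a d + s *\<^sub>R coord_vec A p c b d)"
  by (rule ext) (simp add: coord_vec_def linear_add[OF transition_linear[OF c]] linear_scale[OF transition_linear[OF c]])

lemma linearI_lincomb:
  assumes "\<And>r s a b. h (r *\<^sub>R a + s *\<^sub>R b) = r *\<^sub>R h a + s *\<^sub>R h b"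
  shows "linear h"
proof (rule linearI)
  show "h (a + b) = h a + h b" for a b using assms[of 1 a 1 b] by simp
  show "h (r *\<^sub>R a) = r *\<^sub>R h a" for r a using assms[of r a 0 a] by simp
qed

lemma mc_bilinear:
  assumes c: "c \<in> charts_at A p" shows "bilinear (mc c (snd c p))"
proof (rule bilinearI)
  show l: "linear (\<lambda>a. mc c (snd c p) a b)" for b
    by (rule linearI_lincomb) (simp add: mc_eq[OF c] coord_vec_lincomb[OF c]
        g_lin points_charts_at[OF c] coord_vec_tangent[OF c])
  show "linear (\<lambda>b. mc c (snd c p) a b)" for a
    by (subst mc_sym[OF c]) (rule l)
qed

lemma mc_smooth: "c \<in> A \<Longrightarrow> smooth_on (snd c ` fst c) (\<lambda>x. mc c x a b)"
  using lorentzian unfolding lorentzian_metric_def by blast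

text \<open>Pairing with the orthonormal family shows that its members are independent in the chart;
  being as many as the dimension, they span. The coefficients of \<open>a\<close> in this basis are,
  up to sign, its pairings with the family, all zero.\<close>

lemma mc_nondegenerate:
  assumes c: "c \<in> charts_at A p" and a: "\<And>b. mc c (snd c p) a b = 0"
  shows "a = 0"
proof -
  have "\<exists>b0\<in>(Basis :: 'e set). \<exists>E. \<forall>b\<in>Basis. E b \<in> tangent_space A p \<and>
        (\<forall>b'\<in>Basis. g p (E b) (E b') = (if b \<noteq> b' then 0 else if b = b0 then -1 else 1))"
    using lorentzian points_charts_at[OF c] unfolding lorentzian_metric_def by blast
  then obtain b0 E where bE: "\<forall>b\<in>(Basis :: 'e set). E b \<in> tangent_space A p \<and>
        (\<forall>b'\<in>Basis. g p (E b) (E b') = (if b \<noteq> b' then 0 else if b = b0 then -1 else (1::real)))"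
    by blast
  have T: "E b \<in> tangent_space A p" if "b \<in> Basis" for b using bE that by blast
  have E: "g p (E b) (E b') = (if b \<noteq> b' then 0 else if b = b0 then -1 else (1::real))"
    if "b \<in> Basis" "b' \<in> Basis" for b b' using bE that by blast
  define F where "F b = E b c" for b :: 'e
  define M where "M = mc c (snd c p)"
  have bil: "bilinear M" unfolding M_def by (rule mc_bilinear[OF c])
  have M: "M (F b) (F b') = (if b \<noteq> b' then 0 else if b = b0 then -1 else 1)"
    if "b \<in> Basis" "b' \<in> Basis" for b b'
    using E[OF that] g_eq_mc[OF c T[OF that(1)] T[OF that(2)]] by (simp add: M_def F_def)
  have inj: "inj_on F Basis"
  proof (rule inj_onI, rule ccontr)
    fix b b' :: 'e assume h: "b \<in> Basis" "b' \<in> Basis" "F b = F b'" "b \<noteq> b'"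
    then have "M (F b) (F b) = 0" using M[of b b'] by simp
    then show False using M[of b b] h by (simp split: if_splits)
  qed
  have coef: "u b = 0" if "(\<Sum>b\<in>Basis. u b *\<^sub>R F b) = 0" "b \<in> Basis" for u b
  proof -
    have "0 = M (\<Sum>b\<in>Basis. u b *\<^sub>R F b) (F b)"
      using that(1) linear_0[OF bilinear_left[OF bil]] by simp
    also have "\<dots> = (\<Sum>b'\<in>Basis. u b' * M (F b') (F b))"
      by (simp add: linear_sum[OF bilinear_left[OF bil]] linear_scale[OF bilinear_left[OF bil]])
    also have "\<dots> = u b * M (F b) (F b)"
      by (subst sum.remove[OF finite_Basis that(2)]) (use M that(2) in \<open>auto intro!: sum.neutral\<close>)
    finally show ?thesis using M[OF that(2,2)] by (auto split: if_splits)
  qed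
  have ind: "independent (F ` Basis)"
  proof (rule independent_if_scalars_zero)
    fix f x assume s: "(\<Sum>x\<in>F ` Basis. f x *\<^sub>R x) = 0" and x: "x \<in> F ` (Basis :: 'e set)"
    from x obtain b where b: "b \<in> Basis" "x = F b" by auto
    have "(\<Sum>b\<in>Basis. f (F b) *\<^sub>R F b) = 0"
      using s by (simp add: sum.reindex[OF inj] o_def)
    from coef[OF this b(1)] show "f x = 0" by (simp add: b)
  qed simp
  have "card (F ` Basis) = DIM('e)" using card_image[OF inj] by simp
  then have "span (F ` Basis) = UNIV"
    using ind by (metis basis_card_eq_dim card_eq_dim dim_UNIV independent_imp_finite subset_UNIV top.extremum_unique)
  then have "a \<in> span (F ` Basis)" by simp
  then obtain u where "a = (\<Sum>x\<in>F ` Basis. u x *\<^sub>R x)"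
    by (auto simp: span_finite)
  then have au: "a = (\<Sum>b\<in>Basis. u (F b) *\<^sub>R F b)" by (simp add: sum.reindex[OF inj] o_def)
  have "u (F b) = 0" if b: "b \<in> Basis" for b
  proof -
    have "0 = M a (F b)" using a by (simp add: M_def)
    also have "\<dots> = (\<Sum>b'\<in>Basis. u (F b') * M (F b') (F b))"
      by (subst au) (simp add: linear_sum[OF bilinear_left[OF bil]] linear_scale[OF bilinear_left[OF bil]])
    also have "\<dots> = u (F b) * M (F b) (F b)"
      by (subst sum.remove[OF finite_Basis b]) (use M b in \<open>auto intro!: sum.neutral\<close>)
    finally show ?thesis using M[OF b b] by (auto split: if_splits)
  qed
  then show ?thesis unfolding au by simp
qed

lemma mc_eqI:
  assumes c: "c \<in> charts_at A p" and "\<And>b. mc c (snd c p) a b = mc c (snd c p) a' b"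
  shows "a = a'"
  using mc_nondegenerate[OF c, of "a - a'"] assms(2)
  by (simp add: linear_diff[OF bilinear_left[OF mc_bilinear[OF c]]])

lemma mc_transform:
  assumes c: "c \<in> charts_at A p" and d: "d \<in> charts_at A p"
  shows "mc c (snd c p) a b =
    mc d (snd d p) (Dat (transition c d) (snd c p) a) (Dat (transition c d) (snd c p) b)"
  unfolding mc_eq[OF c]
  by (subst g_eq_mc[OF d coord_vec_tangent[OF c] coord_vec_tangent[OF c]]) (simp add: coord_vec_def d)

text \<open>The Koszul expression for g(\<nabla>_a b, e) on coordinate fields with constant
  components, whose brackets vanish.\<close>

definition koszul :: "('m, 'e) chart \<Rightarrow> 'e \<Rightarrow> 'e \<Rightarrow> 'e \<Rightarrow> 'e \<Rightarrow> real" where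
  "koszul c x a b e = (Dat (\<lambda>y. mc c y b e) x a + Dat (\<lambda>y. mc c y a e) x b - Dat (\<lambda>y. mc c y a b) x e) / 2"

text \<open>The property inside the definite description of \<open>christoffel\<close>, named so
  that existence and uniqueness can be treated separately.\<close>

definition is_christoffel :: "('m, 'e) chart \<Rightarrow> 'e \<Rightarrow> ('e \<Rightarrow> 'e \<Rightarrow> 'e) \<Rightarrow> bool" where
  "is_christoffel c x \<Gamma> \<longleftrightarrow> bilinear \<Gamma> \<and> (\<forall>a b. \<Gamma> a b = \<Gamma> b a) \<and>
     (\<forall>v a b. Dat (\<lambda>y. mc c y a b) x v = mc c x (\<Gamma> v a) b + mc c x a (\<Gamma> v b))"

text \<open>Linearity and symmetry in the arguments survive differentiation in the base point
  because they hold at every point of the open chart image.\<close>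

lemma Dat_mc_linear:
  assumes c: "c \<in> charts_at A p"
  shows "linear (\<lambda>v. Dat (\<lambda>y. mc c y a b) (snd c p) v)"
    "linear (\<lambda>a. Dat (\<lambda>y. mc c y a b) (snd c p) v)"
    "linear (\<lambda>b. Dat (\<lambda>y. mc c y a b) (snd c p) v)"
    "Dat (\<lambda>y. mc c y a b) (snd c p) v = Dat (\<lambda>y. mc c y b a) (snd c p) v"
proof -
  have x: "snd c p \<in> snd c ` fst c" and cA: "c \<in> A" using c by (auto simp: charts_at_iff)
  have sym: "Dat (\<lambda>y. mc c y a b) (snd c p) v = Dat (\<lambda>y. mc c y b a) (snd c p) v" for a b v
  proof -
    have "Dat (\<lambda>y. mc c y a b) (snd c p) = Dat (\<lambda>y. mc c y b a) (snd c p)"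
      by (rule Dat_cong[OF chart_open[OF cA] x]) (auto intro!: mc_sym simp: charts_at_iff cA)
    then show ?thesis by simp
  qed
  have l2: "linear (\<lambda>a. Dat (\<lambda>y. mc c y a b) (snd c p) v)" for b v
  proof (rule linearI_lincomb)
    fix r s and a1 a2 :: 'e
    have "((\<lambda>y. r * mc c y a1 b + s * mc c y a2 b) has_derivative
        (\<lambda>v. r * Dat (\<lambda>y. mc c y a1 b) (snd c p) v + s * Dat (\<lambda>y. mc c y a2 b) (snd c p) v)) (at (snd c p))"
      by (intro has_derivative_add has_derivative_mult_right smooth_on_has_derivative[OF mc_smooth[OF cA] x])
    then have "((\<lambda>y. mc c y (r *\<^sub>R a1 + s *\<^sub>R a2) b) has_derivative
        (\<lambda>v. r * Dat (\<lambda>y. mc c y a1 b) (snd c p) v + s * Dat (\<lambda>y. mc c y a2 b) (snd c p) v)) (at (snd c p))"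
    proof (rule has_derivative_transform_within_open[OF _ chart_open[OF cA] x])
      fix y assume "y \<in> snd c ` fst c"
      then obtain q where q: "c \<in> charts_at A q" "y = snd c q" using cA by (auto simp: charts_at_iff)
      show "r * mc c y a1 b + s * mc c y a2 b = mc c y (r *\<^sub>R a1 + s *\<^sub>R a2) b"
        unfolding q(2) by (simp add: linear_add[OF bilinear_left[OF mc_bilinear[OF q(1)]]]
            linear_scale[OF bilinear_left[OF mc_bilinear[OF q(1)]]])
    qed
    then show "Dat (\<lambda>y. mc c y (r *\<^sub>R a1 + s *\<^sub>R a2) b) (snd c p) v =
        r *\<^sub>R Dat (\<lambda>y. mc c y a1 b) (snd c p) v + s *\<^sub>R Dat (\<lambda>y. mc c y a2 b) (snd c p) v"
      by (simp add: Dat_eq)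
  qed
  show "linear (\<lambda>v. Dat (\<lambda>y. mc c y a b) (snd c p) v)"
    by (rule smooth_on_linear_Dat[OF mc_smooth[OF cA] x])
  show "linear (\<lambda>a. Dat (\<lambda>y. mc c y a b) (snd c p) v)" by (rule l2)
  show "linear (\<lambda>b. Dat (\<lambda>y. mc c y a b) (snd c p) v)" by (subst sym) (rule l2)
  show "Dat (\<lambda>y. mc c y a b) (snd c p) v = Dat (\<lambda>y. mc c y b a) (snd c p) v" by (rule sym)
qed

lemma koszul_linear:
  assumes c: "c \<in> charts_at A p"
  shows "linear (\<lambda>a. koszul c (snd c p) a b e)" "linear (\<lambda>b. koszul c (snd c p) a b e)"
    "linear (\<lambda>e. koszul c (snd c p) a b e)"
proof -
  note l = Dat_mc_linear(1-3)[OF c]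
  have div: "linear (\<lambda>x. h x / 2)" if "linear h" for h :: "'e \<Rightarrow> real"
    using linear_compose_scale_right[OF that, of "1/2"] by simp
  show "linear (\<lambda>a. koszul c (snd c p) a b e)" "linear (\<lambda>b. koszul c (snd c p) a b e)"
    "linear (\<lambda>e. koszul c (snd c p) a b e)"
    unfolding koszul_def by (intro div linear_compose_sub linear_compose_add l)+
qed

text \<open>Two instances of metric compatibility minus a third; by the symmetry of the symbol and
  the metric everything cancels except twice the left side.\<close>

lemma is_christoffel_koszul:
  assumes c: "c \<in> charts_at A p" and \<Gamma>: "is_christoffel c (snd c p) \<Gamma>"
  shows "mc c (snd c p) (\<Gamma> a b) e = koszul c (snd c p) a b e"
proof -
  have s: "\<Gamma> a b = \<Gamma> b a" for a b using \<Gamma> unfolding is_christoffel_def by blast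
  have k: "Dat (\<lambda>y. mc c y a b) (snd c p) v = mc c (snd c p) (\<Gamma> v a) b + mc c (snd c p) a (\<Gamma> v b)" for v a b
    using \<Gamma> unfolding is_christoffel_def by blast
  show ?thesis
    unfolding koszul_def k mc_sym[OF c, of b] mc_sym[OF c, of a] s[of b a] s[of e a] s[of e b] by simp
qed

text \<open>Index lowering, with the one-form of \<open>a\<close> represented by a vector through
  the Euclidean inner product. Nondegeneracy of the metric becomes injectivity of a linear map of
  the model space into itself.\<close>

definition lower :: "('m, 'e) chart \<Rightarrow> 'e \<Rightarrow> 'e \<Rightarrow> 'e" where
  "lower c x a = (\<Sum>b\<in>Basis. mc c x a b *\<^sub>R b)"

lemma lower:
  assumes c: "c \<in> charts_at A p"
  shows "linear (lower c (snd c p))" "inj (lower c (snd c p))" "lower c (snd c p) a \<bullet> b = mc c (snd c p) a b"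
proof -
  note bil = mc_bilinear[OF c]
  show l: "linear (lower c (snd c p))"
    unfolding lower_def[abs_def]
    by (rule linearI_lincomb) (simp add: linear_add[OF bilinear_left[OF bil]] linear_scale[OF bilinear_left[OF bil]]
        algebra_simps sum.distrib scaleR_sum_right)
  have e: "lower c (snd c p) a \<bullet> b = mc c (snd c p) a b" for a b
    unfolding lower_def inner_sum_left
    by (subst linear_Basis_expand[OF bilinear_right[OF bil], of a b]) (simp add: inner_commute mult.commute)
  then show "lower c (snd c p) a \<bullet> b = mc c (snd c p) a b" .
  show "inj (lower c (snd c p))"
    unfolding linear_injective_0[OF l]
    by (intro allI impI mc_nondegenerate[OF c]) (simp add: e[symmetric])
qed

text \<open>The Koszul formula is read as a definition: the index \<open>e\<close> is raised by
  inverting \<open>lower\<close>. Bilinearity and symmetry are then checked after pairing with the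
  metric.\<close>

lemma christoffel_exists:
  assumes c: "c \<in> charts_at A p"
  shows "\<exists>\<Gamma>. is_christoffel c (snd c p) \<Gamma>"
proof -
  let ?x = "snd c p"
  have surj: "surj (lower c ?x)"
    using linear_injective_imp_surjective[OF lower(1,2)[OF c]] by simp
  define K where "K a b = (\<Sum>e\<in>Basis. koszul c ?x a b e *\<^sub>R e)" for a b
  have K: "K a b \<bullet> e = koszul c ?x a b e" for a b e
    unfolding K_def inner_sum_left
    by (subst linear_Basis_expand[OF koszul_linear(3)[OF c], of a b e]) (simp add: inner_commute mult.commute)
  define \<Gamma> where "\<Gamma> a b = inv (lower c ?x) (K a b)" for a b
  have m: "mc c ?x (\<Gamma> a b) e = koszul c ?x a b e" for a b e
    unfolding \<Gamma>_def lower(3)[OF c, symmetric] by (simp add: surj_f_inv_f[OF surj] K)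
  have "bilinear \<Gamma>"
  proof (rule bilinearI)
    show "linear (\<lambda>a. \<Gamma> a b)" for b
      by (rule linearI_lincomb, rule mc_eqI[OF c])
        (simp add: m linear_add[OF bilinear_left[OF mc_bilinear[OF c]]] linear_scale[OF bilinear_left[OF mc_bilinear[OF c]]]
          linear_add[OF koszul_linear(1)[OF c]] linear_scale[OF koszul_linear(1)[OF c]])
    show "linear (\<lambda>b. \<Gamma> a b)" for a
      by (rule linearI_lincomb, rule mc_eqI[OF c])
        (simp add: m linear_add[OF bilinear_left[OF mc_bilinear[OF c]]] linear_scale[OF bilinear_left[OF mc_bilinear[OF c]]]
          linear_add[OF koszul_linear(2)[OF c]] linear_scale[OF koszul_linear(2)[OF c]])
  qed
  moreover have "\<Gamma> a b = \<Gamma> b a" for a b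
    by (rule mc_eqI[OF c]) (simp add: m koszul_def Dat_mc_linear(4)[OF c, of a b])
  moreover have "Dat (\<lambda>y. mc c y a b) ?x v = mc c ?x (\<Gamma> v a) b + mc c ?x a (\<Gamma> v b)" for v a b
    unfolding mc_sym[OF c, of a] m koszul_def
    by (simp add: Dat_mc_linear(4)[OF c, of b a] Dat_mc_linear(4)[OF c, of _ v] field_simps)
  ultimately have "is_christoffel c ?x \<Gamma>" unfolding is_christoffel_def by blast
  then show ?thesis by (rule exI[where P = "is_christoffel c ?x"])
qed

lemma is_christoffel_unique:
  assumes c: "c \<in> charts_at A p" and "is_christoffel c (snd c p) \<Gamma>" "is_christoffel c (snd c p) \<Gamma>'"
  shows "\<Gamma> = \<Gamma>'"
  by (intro ext mc_eqI[OF c]) (simp add: is_christoffel_koszul[OF c assms(2)] is_christoffel_koszul[OF c assms(3)])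

lemma christoffel:
  assumes c: "c \<in> charts_at A p" shows "is_christoffel c (snd c p) (chr c (snd c p))"
proof -
  obtain \<Gamma> where \<Gamma>: "is_christoffel c (snd c p) \<Gamma>" using christoffel_exists[OF c] ..
  have "\<exists>!\<Gamma>. is_christoffel c (snd c p) \<Gamma>"
    by (rule ex1I[where P = "is_christoffel c (snd c p)", OF \<Gamma>]) (rule is_christoffel_unique[OF c _ \<Gamma>])
  then have "is_christoffel c (snd c p) (THE \<Gamma>. is_christoffel c (snd c p) \<Gamma>)" by (rule theI')
  moreover have "chr c (snd c p) = (THE \<Gamma>. is_christoffel c (snd c p) \<Gamma>)"
    unfolding christoffel_def is_christoffel_def ..
  ultimately show ?thesis by (rule back_subst[OF _ sym])
qed

lemma chr_bilinear: "c \<in> charts_at A p \<Longrightarrow> bilinear (chr c (snd c p))"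
  and chr_sym: "c \<in> charts_at A p \<Longrightarrow> chr c (snd c p) a b = chr c (snd c p) b a"
  and chr_compat: "c \<in> charts_at A p \<Longrightarrow> Dat (\<lambda>y. mc c y a b) (snd c p) v =
    mc c (snd c p) (chr c (snd c p) v a) b + mc c (snd c p) a (chr c (snd c p) v b)"
  using christoffel unfolding is_christoffel_def by blast+

lemma chart_range:
  assumes "x \<in> snd c ` fst c" "c \<in> A" obtains p where "c \<in> charts_at A p" "x = snd c p"
  using assms by (auto simp: charts_at_iff)

lemma mc_bilinear': "c \<in> A \<Longrightarrow> x \<in> snd c ` fst c \<Longrightarrow> bilinear (mc c x)"
  using mc_bilinear[unfolded charts_at_iff] by blast

lemma chr_bilinear': "c \<in> A \<Longrightarrow> x \<in> snd c ` fst c \<Longrightarrow> bilinear (chr c x)"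
  using chr_bilinear[unfolded charts_at_iff] by blast

text \<open>The definite description offers no formula to differentiate. The symbol solves a linear
  system whose matrix \<open>lower\<close> and whose Koszul right-hand side are smooth.\<close>

lemma chr_smooth:
  assumes c: "c \<in> A" shows "smooth_on (snd c ` fst c) (\<lambda>x. chr c x a b)"
proof (rule smooth_on_linear_solution[where G = "lower c" and k = "\<lambda>x. \<Sum>e\<in>Basis. koszul c x a b e *\<^sub>R e"])
  note op = chart_open[OF c]
  show "open (snd c ` fst c)" by (rule op)
  show "linear (lower c x)" "inj (lower c x)" if "x \<in> snd c ` fst c" for x
  proof -
    from chart_range[OF that c] obtain p where p: "c \<in> charts_at A p" "x = snd c p" by blast
    show "linear (lower c x)" "inj (lower c x)" unfolding p(2) by (rule lower[OF p(1)])+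
  qed
  show "smooth_on (snd c ` fst c) (\<lambda>x. lower c x a)" for a
    unfolding lower_def by (intro smooth_on_sum op smooth_on_scaleR mc_smooth c smooth_on_const)
  have "smooth_on (snd c ` fst c) (\<lambda>x. (Dat (\<lambda>y. mc c y b e) x a + Dat (\<lambda>y. mc c y a e) x b
      - Dat (\<lambda>y. mc c y a b) x e) * (1 / 2))" for e
    by (intro smooth_on_mult smooth_on_diff smooth_on_add smooth_on_Dat op mc_smooth c smooth_on_const)
  then have k: "smooth_on (snd c ` fst c) (\<lambda>x. koszul c x a b e)" for e
    by (simp add: koszul_def)
  show "smooth_on (snd c ` fst c) (\<lambda>x. \<Sum>e\<in>Basis. koszul c x a b e *\<^sub>R e)"
    by (intro smooth_on_sum op smooth_on_scaleR k smooth_on_const)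
  show "lower c x (chr c x a b) = (\<Sum>e\<in>Basis. koszul c x a b e *\<^sub>R e)" if "x \<in> snd c ` fst c" for x
  proof -
    from chart_range[OF that c] obtain p where p: "c \<in> charts_at A p" "x = snd c p" by blast
    show ?thesis unfolding p(2)
      by (simp add: lower_def is_christoffel_koszul[OF p(1) christoffel[OF p(1)]])
  qed
qed

lemma smooth_on_chr_apply:
  assumes c: "c \<in> A" and X: "open X" and h: "smooth_on X h" "h ` X \<subseteq> snd c ` fst c"
    and a: "smooth_on X a" and b: "smooth_on X b"
  shows "smooth_on X (\<lambda>x. chr c (h x) (a x) (b x))"
proof -
  have bil: "bilinear (chr c (h x))" if "x \<in> X" for x using chr_bilinear'[OF c] h(2) that by blast
  have "smooth_on X (\<lambda>x. chr c (h x) e (b x))" for e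
    by (rule smooth_on_family_apply[OF X bilinear_right[OF bil] _ b],
        assumption, rule smooth_on_compose[OF X chart_open[OF c] chr_smooth[OF c] h])
  note sm = this
  show ?thesis
    by (rule smooth_on_family_apply[OF X bilinear_left[OF bil] sm a])
qed

text \<open>Metric compatibility absorbs the derivative of the coefficients, so that covariant
  derivatives of \<open>a\<close> and \<open>b\<close> appear in place of plain ones.\<close>

lemma has_derivative_mc:
  assumes c: "c \<in> A" and X: "(X has_derivative X') (at z)" "X z \<in> snd c ` fst c"
    and a: "(a has_derivative a') (at z)" and b: "(b has_derivative b') (at z)"
  shows "((\<lambda>z. mc c (X z) (a z) (b z)) has_derivative
    (\<lambda>h. mc c (X z) (a' h + chr c (X z) (X' h) (a z)) (b z)
       + mc c (X z) (a z) (b' h + chr c (X z) (X' h) (b z)))) (at z)"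
proof -
  from chart_range[OF X(2) c] obtain p where p: "c \<in> charts_at A p" "X z = snd c p" by blast
  show ?thesis
    by (rule has_derivative_eq_rhs[OF has_derivative_bilinear_family[OF chart_open[OF c] mc_bilinear'[OF c] mc_smooth[OF c] X a b]])
      (simp_all add: p(2) chr_compat[OF p(1)] linear_add[OF bilinear_left[OF mc_bilinear[OF p(1)]]]
        linear_add[OF bilinear_right[OF mc_bilinear[OF p(1)]]] fun_eq_iff)
qed

text \<open>The symbol of \<open>d\<close>, pulled back by the transition map and corrected by the
  Hessian of that map, is symmetric by Schwarz's theorem and compatible with the metric in
  \<open>c\<close>. Uniqueness identifies it with the symbol of \<open>c\<close>.\<close>

lemma christoffel_transform:
  assumes c: "c \<in> charts_at A p" and d: "d \<in> charts_at A p"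
  defines "T \<equiv> transition c d"
  shows "Dat T (snd c p) (chr c (snd c p) v a) =
    chr d (snd d p) (Dat T (snd c p) v) (Dat T (snd c p) a) + Dat (\<lambda>y. Dat T y a) (snd c p) v"
proof -
  let ?x = "snd c p" and ?\<phi> = "Dat T (snd c p)" and ?\<psi> = "Dat (transition d c) (snd d p)"
  let ?O = "snd c ` (fst c \<inter> fst d)"
  have cd: "c \<in> A" "d \<in> A" "p \<in> fst c" "p \<in> fst d" using c d by (auto simp: charts_at_iff)
  have O: "open ?O" "?x \<in> ?O" "smooth_on ?O T"
    using cd overlap_open transition_smooth by (auto simp: T_def)
  define B where "B v a = Dat (\<lambda>y. Dat T y a) ?x v" for v a
  have Bs: "B v a = B a v" for v a
    unfolding B_def by (rule Dat_commute[OF O(3,1,2)])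
  have Bl: "linear (\<lambda>v. B v a)" for a
    unfolding B_def by (rule smooth_on_linear_Dat[OF smooth_on_Dat[OF O(3)] O(2)])
  have Bl': "linear (B a)" for a using Bl[of a] by (subst (asm) Bs)
  have \<phi>l: "linear ?\<phi>" unfolding T_def by (rule transition_linear[OF c d])
  have \<psi>l: "linear ?\<psi>" by (rule transition_linear[OF d c])
  have \<phi>\<psi>: "?\<phi> (?\<psi> w) = w" for w unfolding T_def by (rule transition_inverse[OF d c])
  define \<Gamma>' where "\<Gamma>' v a = ?\<psi> (chr d (snd d p) (?\<phi> v) (?\<phi> a) + B v a)" for v a
  note dl = bilinear_left[OF chr_bilinear[OF d]] bilinear_right[OF chr_bilinear[OF d]]
  have "is_christoffel c ?x \<Gamma>'"
    unfolding is_christoffel_def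
  proof (intro conjI allI)
    show "bilinear \<Gamma>'"
    proof (rule bilinearI)
      show "linear (\<lambda>a. \<Gamma>' a b)" for b unfolding \<Gamma>'_def
        by (rule linearI_lincomb) (simp add: linear_add[OF \<phi>l] linear_scale[OF \<phi>l] linear_add[OF \<psi>l] linear_scale[OF \<psi>l]
            linear_add[OF dl(1)] linear_scale[OF dl(1)] linear_add[OF Bl] linear_scale[OF Bl] algebra_simps)
      show "linear (\<lambda>b. \<Gamma>' a b)" for a unfolding \<Gamma>'_def
        by (rule linearI_lincomb) (simp add: linear_add[OF \<phi>l] linear_scale[OF \<phi>l] linear_add[OF \<psi>l] linear_scale[OF \<psi>l]
            linear_add[OF dl(2)] linear_scale[OF dl(2)] linear_add[OF Bl'] linear_scale[OF Bl'] algebra_simps)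
    qed
    show "\<Gamma>' a b = \<Gamma>' b a" for a b
      unfolding \<Gamma>'_def using chr_sym[OF d, of "?\<phi> a"] Bs[of a b] by simp
    fix v a b
    have Tx: "T ?x = snd d p" using cd by (simp add: T_def transition_apply)
    have Dm: "((\<lambda>y. mc d (T y) (Dat T y a) (Dat T y b)) has_derivative
      (\<lambda>h. mc d (T ?x) (B h a + chr d (T ?x) (?\<phi> h) (?\<phi> a)) (?\<phi> b)
        + mc d (T ?x) (?\<phi> a) (B h b + chr d (T ?x) (?\<phi> h) (?\<phi> b)))) (at ?x)"
      unfolding B_def
      by (rule has_derivative_mc[OF cd(2) smooth_on_has_derivative[OF O(3,2)] _
            smooth_on_has_derivative[OF smooth_on_Dat[OF O(3)] O(2)]
            smooth_on_has_derivative[OF smooth_on_Dat[OF O(3)] O(2)]])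
        (use cd in \<open>simp add: Tx\<close>)
    have "((\<lambda>y. mc c y a b) has_derivative
      (\<lambda>h. mc d (T ?x) (B h a + chr d (T ?x) (?\<phi> h) (?\<phi> a)) (?\<phi> b)
        + mc d (T ?x) (?\<phi> a) (B h b + chr d (T ?x) (?\<phi> h) (?\<phi> b)))) (at ?x)"
    proof (rule has_derivative_transform_within_open[OF Dm O(1,2)])
      fix y assume "y \<in> ?O"
      then obtain q where q: "q \<in> fst c" "q \<in> fst d" "y = snd c q" by auto
      then have "c \<in> charts_at A q" "d \<in> charts_at A q" using cd by (auto simp: charts_at_iff)
      from mc_transform[OF this] show "mc d (T y) (Dat T y a) (Dat T y b) = mc c y a b"
        using q cd by (simp add: T_def transition_apply)
    qed
    then have "Dat (\<lambda>y. mc c y a b) ?x v = mc d (snd d p) (?\<phi> (\<Gamma>' v a)) (?\<phi> b) + mc d (snd d p) (?\<phi> a) (?\<phi> (\<Gamma>' v b))"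
      unfolding \<Gamma>'_def \<phi>\<psi> by (simp add: Dat_eq Tx add.commute)
    then show "Dat (\<lambda>y. mc c y a b) ?x v = mc c ?x (\<Gamma>' v a) b + mc c ?x a (\<Gamma>' v b)"
      unfolding mc_transform[OF c d] T_def .
  qed
  from is_christoffel_unique[OF c christoffel[OF c] this]
  have "chr c ?x v a = \<Gamma>' v a" by simp
  then show ?thesis by (simp add: \<Gamma>'_def \<phi>\<psi> B_def)
qed

section \<open>The covariant derivative along a curve\<close>

lemma cov_along_eq:
  "c \<in> charts_at A (\<gamma> t) \<Longrightarrow> cov_along A g \<gamma> Y t c =
    vector_derivative (\<lambda>s. Y s c) (at t) + chr c (snd c (\<gamma> t)) (velocity A \<gamma> t c) (Y t c)"
  by (simp add: cov_along_def)

lemma cov_along_cong: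
  assumes "open N" "t \<in> N" "\<And>s. s \<in> N \<Longrightarrow> \<gamma> s = \<eta> s" "\<And>s. s \<in> N \<Longrightarrow> Y s = Z s"
  shows "cov_along A g \<gamma> Y t = cov_along A g \<eta> Z t"
proof
  fix c :: "('m, 'e) chart"
  have "vector_derivative (\<lambda>s. Y s c) (at t) = vector_derivative (\<lambda>s. Z s c) (at t)"
    by (rule vector_derivative_cong[OF assms(1,2)]) (simp add: assms(4))
  then show "cov_along A g \<gamma> Y t c = cov_along A g \<eta> Z t c"
    using velocity_cong[OF assms(1-3)] assms(2-4) by (simp add: cov_along_def)
qed

text \<open>Differentiating the transformed components produces a Hessian term of the transition
  map, which cancels the one in \<open>christoffel_transform\<close>.\<close>

lemma cov_along_tangent:
  assumes Y: "smooth_field_along A I \<gamma> Y" and I: "open I" "t \<in> I"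
  shows "cov_along A g \<gamma> Y t \<in> tangent_space A (\<gamma> t)"
proof (rule tangentI)
  show "cov_along A g \<gamma> Y t c = 0" if "c \<notin> charts_at A (\<gamma> t)" for c
    using that by (simp add: cov_along_def)
next
  fix c d assume c: "c \<in> charts_at A (\<gamma> t)" and d: "d \<in> charts_at A (\<gamma> t)"
  let ?T = "transition c d" and ?x = "\<lambda>s. snd c (\<gamma> s)" and ?v = "velocity A \<gamma> t"
  have cd: "c \<in> A" "d \<in> A" "\<gamma> t \<in> fst c" "\<gamma> t \<in> fst d" using c d by (auto simp: charts_at_iff)
  obtain N where N: "open N" "t \<in> N" "N \<subseteq> I" "\<And>s. s \<in> N \<Longrightarrow> \<gamma> s \<in> fst c"
    "smooth_on N (\<lambda>s. snd c (\<gamma> s))" "smooth_on N (\<lambda>s. Y s c)"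
    using field_along_chart[OF Y I c] by blast
  obtain M where M: "open M" "t \<in> M" "M \<subseteq> I" "\<And>s. s \<in> M \<Longrightarrow> \<gamma> s \<in> fst d"
    "smooth_on M (\<lambda>s. snd d (\<gamma> s))" "smooth_on M (\<lambda>s. Y s d)"
    using field_along_chart[OF Y I d] by blast
  have T: "\<And>s. s \<in> I \<Longrightarrow> Y s \<in> tangent_space A (\<gamma> s)" using Y by (simp add: smooth_field_along_def)
  have v: "?v \<in> tangent_space A (\<gamma> t)"
    by (rule velocity_tangent[OF field_along_curve[OF Y I(1)] I])
  let ?O = "snd c ` (fst c \<inter> fst d)"
  have O: "open ?O" "?x t \<in> ?O" "smooth_on ?O ?T"
    using cd overlap_open transition_smooth by auto
  have x': "(?x has_vector_derivative ?v c) (at t)"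
    by (rule has_velocity[OF field_along_curve[OF Y I(1)] I c])
  have yc: "((\<lambda>s. Y s c) has_vector_derivative vector_derivative (\<lambda>s. Y s c) (at t)) (at t)"
    by (rule smooth_on_vector_derivative(1)[OF N(1,6,2)])
  have lT: "linear (Dat ?T y)" if "y \<in> ?O" for y using smooth_on_linear_Dat[OF O(3) that] .
  note D = has_derivative_linear_family[OF O(1) lT smooth_on_Dat[OF O(3)]
      x'[unfolded has_vector_derivative_def] O(2) yc[unfolded has_vector_derivative_def]]
  have lB: "linear (\<lambda>v. Dat (\<lambda>y. Dat ?T y (Y t c)) (?x t) v)"
    by (rule smooth_on_linear_Dat[OF smooth_on_Dat[OF O(3)] O(2)])
  have "((\<lambda>s. Dat ?T (?x s) (Y s c)) has_vector_derivative
     (Dat (\<lambda>y. Dat ?T y (Y t c)) (?x t) (?v c) + Dat ?T (?x t) (vector_derivative (\<lambda>s. Y s c) (at t)))) (at t)"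
    unfolding has_vector_derivative_def
    by (rule has_derivative_eq_rhs[OF D])
      (auto simp: fun_eq_iff linear_scale[OF lB] linear_scale[OF lT[OF O(2)]] scaleR_add_right)
  then have "((\<lambda>s. Y s d) has_vector_derivative
     (Dat (\<lambda>y. Dat ?T y (Y t c)) (?x t) (?v c) + Dat ?T (?x t) (vector_derivative (\<lambda>s. Y s c) (at t)))) (at t)"
  proof (rule has_vector_derivative_transform_within_open[OF _ open_Int[OF N(1) M(1)]])
    show "t \<in> N \<inter> M" using N M by simp
    fix s assume s: "s \<in> N \<inter> M"
    show "Dat ?T (?x s) (Y s c) = Y s d"
      by (rule tangent_transform[OF T, symmetric]) (use s N M cd in \<open>auto simp: charts_at_iff\<close>)
  qed
  then have yd: "vector_derivative (\<lambda>s. Y s d) (at t) =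
     Dat (\<lambda>y. Dat ?T y (Y t c)) (?x t) (?v c) + Dat ?T (?x t) (vector_derivative (\<lambda>s. Y s c) (at t))"
    by (rule vector_derivative_at)
  have 1: "?v d = Dat ?T (?x t) (?v c)" "Y t d = Dat ?T (?x t) (Y t c)"
    by (rule tangent_transform[OF v c d], rule tangent_transform[OF T[OF I(2)] c d])
  show "cov_along A g \<gamma> Y t d = Dat ?T (snd c (\<gamma> t)) (cov_along A g \<gamma> Y t c)"
    unfolding cov_along_eq[of c \<gamma> t, OF c] cov_along_eq[of d \<gamma> t, OF d] yd 1
      linear_add[OF transition_linear[OF c d]] christoffel_transform[OF c d] by simp
qed

lemma cov_along_smooth:
  assumes Y: "smooth_field_along A I \<gamma> Y" and I: "open I"
  shows "smooth_field_along A I \<gamma> (cov_along A g \<gamma> Y)"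
proof (rule field_alongI[OF I cov_along_tangent[OF Y I]])
  fix t assume t: "t \<in> I"
  obtain c where c: "c \<in> charts_at A (\<gamma> t)" using smooth_map_point[OF field_along_curve[OF Y I] t] by blast
  obtain N where N: "open N" "t \<in> N" "N \<subseteq> I" "\<And>s. s \<in> N \<Longrightarrow> \<gamma> s \<in> fst c"
    "smooth_on N (\<lambda>s. snd c (\<gamma> s))" "smooth_on N (\<lambda>s. Y s c)"
    using field_along_chart[OF Y I t c] by blast
  have cA: "c \<in> A" using c by (simp add: charts_at_iff)
  have "smooth_on N (\<lambda>s. vector_derivative (\<lambda>s. Y s c) (at s)
      + chr c (snd c (\<gamma> s)) (vector_derivative (\<lambda>s. snd c (\<gamma> s)) (at s)) (Y s c))"
    by (intro smooth_on_add smooth_on_chr_apply cA N(1,5,6) smooth_on_vector_derivative(2)) (use N(4) in auto)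
  then have "smooth_on N (\<lambda>s. cov_along A g \<gamma> Y s c)"
    by (rule smooth_on_cong[OF N(1)]) (use N(4) cA in \<open>simp add: cov_along_def velocity_def charts_at_iff\<close>)
  then show "\<exists>c N. c \<in> charts_at A (\<gamma> t) \<and> open N \<and> t \<in> N \<and> (\<forall>s\<in>N. \<gamma> s \<in> fst c) \<and>
      smooth_on N (\<lambda>s. snd c (\<gamma> s)) \<and> smooth_on N (\<lambda>s. cov_along A g \<gamma> Y s c)"
    using c N(1,2,4,5) by blast
qed

lemma metric_along:
  assumes Y: "smooth_field_along A I \<gamma> Y" and Z: "smooth_field_along A I \<gamma> Z" and I: "open I" "t \<in> I"
  shows "((\<lambda>s. g (\<gamma> s) (Y s) (Z s)) has_real_derivative
    g (\<gamma> t) (cov_along A g \<gamma> Y t) (Z t) + g (\<gamma> t) (Y t) (cov_along A g \<gamma> Z t)) (at t)"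
proof -
  obtain c where c: "c \<in> charts_at A (\<gamma> t)" using smooth_map_point[OF field_along_curve[OF Y I(1)] I(2)] by blast
  have cA: "c \<in> A" using c by (simp add: charts_at_iff)
  obtain N where N: "open N" "t \<in> N" "N \<subseteq> I" "\<And>s. s \<in> N \<Longrightarrow> \<gamma> s \<in> fst c"
    "smooth_on N (\<lambda>s. snd c (\<gamma> s))" "smooth_on N (\<lambda>s. Y s c)"
    using field_along_chart[OF Y I c] by blast
  obtain M where M: "open M" "t \<in> M" "M \<subseteq> I" "\<And>s. s \<in> M \<Longrightarrow> \<gamma> s \<in> fst c"
    "smooth_on M (\<lambda>s. snd c (\<gamma> s))" "smooth_on M (\<lambda>s. Z s c)"
    using field_along_chart[OF Z I c] by blast
  have TY: "\<And>s. s \<in> I \<Longrightarrow> Y s \<in> tangent_space A (\<gamma> s)" using Y by (simp add: smooth_field_along_def)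
  have TZ: "\<And>s. s \<in> I \<Longrightarrow> Z s \<in> tangent_space A (\<gamma> s)" using Z by (simp add: smooth_field_along_def)
  have x': "((\<lambda>s. snd c (\<gamma> s)) has_vector_derivative velocity A \<gamma> t c) (at t)"
    by (rule has_velocity[OF field_along_curve[OF Y I(1)] I c])
  have yc: "((\<lambda>s. Y s c) has_vector_derivative vector_derivative (\<lambda>s. Y s c) (at t)) (at t)"
    by (rule smooth_on_vector_derivative(1)[OF N(1,6,2)])
  have zc: "((\<lambda>s. Z s c) has_vector_derivative vector_derivative (\<lambda>s. Z s c) (at t)) (at t)"
    by (rule smooth_on_vector_derivative(1)[OF M(1,6,2)])
  let ?xt = "snd c (\<gamma> t)"
  have x: "?xt \<in> snd c ` fst c" using c by (auto simp: charts_at_iff)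
  note D = has_derivative_mc[OF cA x'[unfolded has_vector_derivative_def] x
      yc[unfolded has_vector_derivative_def] zc[unfolded has_vector_derivative_def]]
  note l = linear_scale[OF bilinear_left[OF chr_bilinear[OF c]]] linear_scale[OF bilinear_left[OF mc_bilinear[OF c]]]
    linear_scale[OF bilinear_right[OF mc_bilinear[OF c]]]
    linear_add[OF bilinear_left[OF mc_bilinear[OF c]]] linear_add[OF bilinear_right[OF mc_bilinear[OF c]]]
  have "((\<lambda>s. mc c (snd c (\<gamma> s)) (Y s c) (Z s c)) has_real_derivative
    (mc c ?xt (cov_along A g \<gamma> Y t c) (Z t c) + mc c ?xt (Y t c) (cov_along A g \<gamma> Z t c))) (at t)"
    unfolding has_field_derivative_def
    by (rule has_derivative_eq_rhs[OF D]) (simp add: fun_eq_iff cov_along_eq[of c \<gamma> t, OF c] l algebra_simps)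
  then have "((\<lambda>s. g (\<gamma> s) (Y s) (Z s)) has_real_derivative
    (mc c ?xt (cov_along A g \<gamma> Y t c) (Z t c) + mc c ?xt (Y t c) (cov_along A g \<gamma> Z t c))) (at t)"
  proof (rule has_field_derivative_transform_within_open[OF _ N(1,2)])
    fix s assume s: "s \<in> N"
    then have "c \<in> charts_at A (\<gamma> s)" using N(4) cA by (simp add: charts_at_iff)
    then show "mc c (snd c (\<gamma> s)) (Y s c) (Z s c) = g (\<gamma> s) (Y s) (Z s)"
      by (rule g_eq_mc[symmetric]) (use s N(3) TY TZ in auto)
  qed
  then show ?thesis
    by (simp add: g_eq_mc[OF c cov_along_tangent[OF Y I] TZ[OF I(2)]]
        g_eq_mc[OF c TY[OF I(2)] cov_along_tangent[OF Z I]])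
qed

end

section \<open>Geodesics\<close>

context lorentz
begin

lemma geodesic_smooth: "geodesic A g I \<gamma> \<Longrightarrow> smooth_map std_atlas A I \<gamma>"
  by (simp add: geodesic_def)

lemma geodesic_subset: "geodesic A g I \<gamma> \<Longrightarrow> J \<subseteq> I \<Longrightarrow> geodesic A g J \<gamma>"
  by (auto simp: geodesic_def intro: smooth_map_std_subset)

lemma geodesic_ode:
  assumes \<gamma>: "geodesic A g I \<gamma>" and I: "open I" "t \<in> I" and c: "c \<in> charts_at A (\<gamma> t)"
  shows "((\<lambda>s. velocity A \<gamma> s c) has_vector_derivative
    - chr c (snd c (\<gamma> t)) (velocity A \<gamma> t c) (velocity A \<gamma> t c)) (at t)"
proof -
  have "smooth_field_along A I \<gamma> (velocity A \<gamma>)"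
    by (rule velocity_smooth_field[OF geodesic_smooth[OF \<gamma>] I(1)])
  from field_along_chart[OF this I c] obtain N where N: "open N" "t \<in> N" "N \<subseteq> I"
    "\<And>s. s \<in> N \<Longrightarrow> \<gamma> s \<in> fst c" "smooth_on N (\<lambda>s. snd c (\<gamma> s))" "smooth_on N (\<lambda>s. velocity A \<gamma> s c)"
    by blast
  have "cov_along A g \<gamma> (velocity A \<gamma>) t c = 0" using \<gamma> I(2) by (simp add: geodesic_def)
  then have "vector_derivative (\<lambda>s. velocity A \<gamma> s c) (at t)
      = - chr c (snd c (\<gamma> t)) (velocity A \<gamma> t c) (velocity A \<gamma> t c)"
    unfolding cov_along_eq[of c \<gamma> t, OF c] by (simp add: eq_neg_iff_add_eq_0)
  then show ?thesis using smooth_on_vector_derivative(1)[OF N(1,6,2)] by simp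
qed

text \<open>In a chart the geodesic equation is an ordinary differential equation with smooth
  coefficients, so uniqueness of solutions applies; injectivity of the chart brings the result back
  to the manifold.\<close>

lemma geodesic_local_unique:
  assumes \<gamma>: "geodesic A g I \<gamma>" and \<eta>: "geodesic A g I \<eta>" and I: "open I" "t \<in> I"
    and eq: "\<gamma> t = \<eta> t" "velocity A \<gamma> t = velocity A \<eta> t"
  obtains N where "open N" "t \<in> N" "N \<subseteq> I" "\<And>s. s \<in> N \<Longrightarrow> \<gamma> s = \<eta> s"
    "\<And>s. s \<in> N \<Longrightarrow> velocity A \<gamma> s = velocity A \<eta> s"
proof -
  obtain c where c: "c \<in> charts_at A (\<gamma> t)" using smooth_map_point[OF geodesic_smooth[OF \<gamma>] I(2)] by blast
  have c': "c \<in> charts_at A (\<eta> t)" using c eq by simp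
  have cA: "c \<in> A" using c by (simp add: charts_at_iff)
  from smooth_map_curve[OF geodesic_smooth[OF \<gamma>] I c] obtain N1 where N1: "open N1" "t \<in> N1" "N1 \<subseteq> I"
    "\<And>s. s \<in> N1 \<Longrightarrow> \<gamma> s \<in> fst c" "smooth_on N1 (\<lambda>s. snd c (\<gamma> s))" by blast
  from smooth_map_curve[OF geodesic_smooth[OF \<eta>] I c'] obtain N2 where N2: "open N2" "t \<in> N2" "N2 \<subseteq> I"
    "\<And>s. s \<in> N2 \<Longrightarrow> \<eta> s \<in> fst c" "smooth_on N2 (\<lambda>s. snd c (\<eta> s))" by blast
  define N where "N = N1 \<inter> N2"
  have N: "open N" "t \<in> N" "N \<subseteq> I" using N1 N2 by (auto simp: N_def)
  \<comment> \<open>The geodesic equation as an autonomous first-order system for position and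
    velocity components; velocities range over the whole model space.\<close>
  define G where "G z = (snd z, - chr c (fst z) (snd z) (snd z))" for z :: "'e \<times> 'e"
  define W where "W = (snd c ` fst c) \<times> (UNIV :: 'e set)"
  have W: "open W" unfolding W_def by (intro open_Times chart_open cA open_UNIV)
  have G: "smooth_on W G"
  proof -
    have s1: "smooth_on W fst" by (rule smooth_on_bounded_linear[OF bounded_linear_fst W])
    have s2: "smooth_on W snd" by (rule smooth_on_bounded_linear[OF bounded_linear_snd W])
    have "fst ` W \<subseteq> snd c ` fst c" by (auto simp: W_def)
    from smooth_on_Pair[OF W s2 smooth_on_minus[OF W smooth_on_chr_apply[OF cA W s1 this s2 s2]]]
    show ?thesis unfolding G_def .
  qed
  have ode: "((\<lambda>s. (snd c (\<delta> s), velocity A \<delta> s c)) has_vector_derivative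
      G (snd c (\<delta> s), velocity A \<delta> s c)) (at s)"
    if \<delta>: "geodesic A g I \<delta>" and s: "s \<in> N" "\<delta> s \<in> fst c" for \<delta> s
  proof -
    have cs: "c \<in> charts_at A (\<delta> s)" using s cA by (simp add: charts_at_iff)
    have sI: "s \<in> I" using s N by auto
    show ?thesis unfolding G_def fst_conv snd_conv
      by (intro has_vector_derivative_Pair has_velocity[OF geodesic_smooth[OF \<delta>] I(1) sI cs] geodesic_ode[OF \<delta> I(1) sI cs])
  qed
  have ode1: "((\<lambda>s. (snd c (\<gamma> s), velocity A \<gamma> s c)) has_vector_derivative
      G (snd c (\<gamma> s), velocity A \<gamma> s c)) (at s)" if "s \<in> N" for s
    by (rule ode[OF \<gamma> that]) (use that N1 N_def in auto)
  have ode2: "((\<lambda>s. (snd c (\<eta> s), velocity A \<eta> s c)) has_vector_derivative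
      G (snd c (\<eta> s), velocity A \<eta> s c)) (at s)" if "s \<in> N" for s
    by (rule ode[OF \<eta> that]) (use that N2 N_def in auto)
  have "\<exists>\<delta>>0. \<forall>s. \<bar>s - t\<bar> < \<delta> \<longrightarrow> (snd c (\<gamma> s), velocity A \<gamma> s c) = (snd c (\<eta> s), velocity A \<eta> s c)"
    by (rule ode_locally_unique[OF G W N(1,2) ode1 ode2]) (use eq N2(4)[OF N2(2)] in \<open>auto simp: W_def\<close>)
  then obtain \<delta> where \<delta>: "\<delta> > 0" "\<And>s. \<bar>s - t\<bar> < \<delta> \<Longrightarrow> snd c (\<gamma> s) = snd c (\<eta> s) \<and> velocity A \<gamma> s c = velocity A \<eta> s c"
    by auto
  define M where "M = N \<inter> ball t \<delta>"
  have M: "s \<in> N" "\<gamma> s = \<eta> s" "velocity A \<gamma> s = velocity A \<eta> s" if "s \<in> M" for s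
  proof -
    have s: "\<bar>s - t\<bar> < \<delta>" "s \<in> N" using that by (auto simp: M_def dist_real_def)
    show "s \<in> N" by (rule s)
    have fc: "\<gamma> s \<in> fst c" "\<eta> s \<in> fst c" using s N1 N2 by (auto simp: N_def)
    show e: "\<gamma> s = \<eta> s" using inj_onD[OF chart_inj[OF cA] _ fc] \<delta>(2)[OF s(1)] by blast
    have "c \<in> charts_at A (\<gamma> s)" using fc cA by (simp add: charts_at_iff)
    moreover have "s \<in> I" using s N by auto
    ultimately show "velocity A \<gamma> s = velocity A \<eta> s"
      using tangent_eqI[OF velocity_tangent[OF geodesic_smooth[OF \<gamma>] I(1)]
        velocity_tangent[OF geodesic_smooth[OF \<eta>] I(1), of s, folded e]] \<delta>(2)[OF s(1)] by blast
  qed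
  show ?thesis
    by (rule that[of M]) (use M N \<delta>(1) in \<open>auto simp: M_def\<close>)
qed

text \<open>The set \<open>Z\<close> where positions and velocities agree is open by local
  uniqueness. Its complement in \<open>I\<close> is open too: distinct positions are kept apart by
  the Hausdorff property, equal positions with distinct velocities by continuity of the velocity
  components in a chart. Connectedness decides.\<close>

lemma geodesic_unique:
  assumes H: "Hausdorff_space (manifold_topology A)"
    and \<gamma>: "geodesic A g I \<gamma>" and \<eta>: "geodesic A g I \<eta>" and I: "open I" "connected I" "t0 \<in> I"
    and eq: "\<gamma> t0 = \<eta> t0" "velocity A \<gamma> t0 = velocity A \<eta> t0" and t: "t \<in> I"
  shows "\<gamma> t = \<eta> t"
proof -
  define Z where "Z = {t \<in> I. \<gamma> t = \<eta> t \<and> velocity A \<gamma> t = velocity A \<eta> t}"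
  note sm = geodesic_smooth[OF \<gamma>] geodesic_smooth[OF \<eta>]
  have "open Z"
    unfolding open_subopen[of Z]
  proof (rule ballI)
    fix t assume t: "t \<in> Z"
    then have tt: "t \<in> I" "\<gamma> t = \<eta> t" "velocity A \<gamma> t = velocity A \<eta> t" by (auto simp: Z_def)
    from geodesic_local_unique[OF \<gamma> \<eta> I(1) tt] obtain N where "open N" "t \<in> N" "N \<subseteq> I"
      "\<And>s. s \<in> N \<Longrightarrow> \<gamma> s = \<eta> s" "\<And>s. s \<in> N \<Longrightarrow> velocity A \<gamma> s = velocity A \<eta> s" by blast
    then show "\<exists>T. open T \<and> t \<in> T \<and> T \<subseteq> Z" by (intro exI[of _ N]) (auto simp: Z_def)
  qed
  moreover have "open (I - Z)"
    unfolding open_subopen[of "I - Z"]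
  proof (rule ballI)
    fix t assume "t \<in> I - Z"
    then have t: "t \<in> I" "t \<notin> Z" by auto
    show "\<exists>T. open T \<and> t \<in> T \<and> T \<subseteq> I - Z"
    proof (cases "\<gamma> t = \<eta> t")
      case False
      have tp: "topspace (manifold_topology A) = points A"
      proof -
        have "openin (manifold_topology A) (points A)"
          unfolding openin_manifold
        proof (intro conjI ballI)
          fix c assume c: "c \<in> A"
          then have "points A \<inter> fst c = fst c" by (auto simp: points_def)
          then show "open (snd c ` (points A \<inter> fst c))" using chart_open[OF c] by simp
        qed simp
        then show ?thesis
          using openin_manifold openin_topspace openin_subset by (metis subset_antisym)
      qed
      have "\<gamma> t \<in> points A" "\<eta> t \<in> points A" using sm t by (auto simp: smooth_map_def)
      then obtain U V where UV: "openin (manifold_topology A) U" "openin (manifold_topology A) V"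
        "\<gamma> t \<in> U" "\<eta> t \<in> V" "disjnt U V"
        using H False unfolding Hausdorff_space_def tp by blast
      from curve_open_preimage[OF sm(1) I(1) t(1) UV(1,3)] obtain N1 where N1: "open N1" "t \<in> N1" "N1 \<subseteq> I"
        "\<And>s. s \<in> N1 \<Longrightarrow> \<gamma> s \<in> U" by blast
      from curve_open_preimage[OF sm(2) I(1) t(1) UV(2,4)] obtain N2 where N2: "open N2" "t \<in> N2" "N2 \<subseteq> I"
        "\<And>s. s \<in> N2 \<Longrightarrow> \<eta> s \<in> V" by blast
      show ?thesis
        by (rule exI[of _ "N1 \<inter> N2"]) (use N1 N2 UV(5) in \<open>force simp: Z_def disjnt_def\<close>)
    next
      case True
      obtain c where c: "c \<in> charts_at A (\<gamma> t)" using smooth_map_point[OF sm(1) t(1)] by blast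
      have c': "c \<in> charts_at A (\<eta> t)" using c True by simp
      have cA: "c \<in> A" using c by (simp add: charts_at_iff)
      from field_along_chart[OF velocity_smooth_field[OF sm(1) I(1)] I(1) t(1) c]
      obtain N1 where N1: "open N1" "t \<in> N1" "N1 \<subseteq> I"
        "\<And>s. s \<in> N1 \<Longrightarrow> \<gamma> s \<in> fst c" "smooth_on N1 (\<lambda>s. snd c (\<gamma> s))" "smooth_on N1 (\<lambda>s. velocity A \<gamma> s c)" by blast
      from field_along_chart[OF velocity_smooth_field[OF sm(2) I(1)] I(1) t(1) c']
      obtain N2 where N2: "open N2" "t \<in> N2" "N2 \<subseteq> I"
        "\<And>s. s \<in> N2 \<Longrightarrow> \<eta> s \<in> fst c" "smooth_on N2 (\<lambda>s. snd c (\<eta> s))" "smooth_on N2 (\<lambda>s. velocity A \<eta> s c)" by blast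
      let ?N = "N1 \<inter> N2"
      have "smooth_on ?N (\<lambda>s. velocity A \<gamma> s c - velocity A \<eta> s c)"
        by (intro smooth_on_diff open_Int N1 N2 smooth_on_subset[OF N1(6)] smooth_on_subset[OF N2(6)]) auto
      then have "open (?N \<inter> (\<lambda>s. velocity A \<gamma> s c - velocity A \<eta> s c) -` (- {0}))"
        by (intro continuous_open_preimage smooth_on_continuous open_Int N1 N2) auto
      moreover have "velocity A \<gamma> t c \<noteq> velocity A \<eta> t c"
      proof
        assume "velocity A \<gamma> t c = velocity A \<eta> t c"
        from tangent_eqI[OF velocity_tangent[OF sm(1) I(1) t(1)]
            velocity_tangent[OF sm(2) I(1) t(1), folded True] c this] show False
          using t True by (simp add: Z_def)
      qed
      ultimately show ?thesis
        using N1 N2 by (intro exI[of _ "?N \<inter> (\<lambda>s. velocity A \<gamma> s c - velocity A \<eta> s c) -` (- {0})"])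
          (auto simp: Z_def)
    qed
  qed
  ultimately have "Z \<inter> I = {} \<or> (I - Z) \<inter> I = {}"
    by (intro connectedD[OF I(2)]) auto
  then show ?thesis using eq I(3) t by (auto simp: Z_def)
qed

section \<open>Reparametrization of geodesics and the exponential map\<close>

lemma smooth_map_scale:
  fixes J :: "real set"
  assumes \<gamma>: "smooth_map std_atlas A I \<gamma>" "open I" and J: "\<And>s. s \<in> J \<Longrightarrow> k * s \<in> I"
  shows "smooth_map std_atlas A J (\<lambda>s. \<gamma> (k * s))"
proof (rule smooth_map_curveI[of J "\<lambda>s. \<gamma> (k * s)"])
  fix t assume t: "t \<in> J"
  obtain c where c: "c \<in> charts_at A (\<gamma> (k * t))" using smooth_map_point[OF \<gamma>(1) J[OF t]] by blast
  from smooth_map_curve[OF \<gamma> J[OF t] c] obtain N where N: "open N" "k * t \<in> N" "N \<subseteq> I"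
    "\<And>s. s \<in> N \<Longrightarrow> \<gamma> s \<in> fst c" "smooth_on N (\<lambda>s. snd c (\<gamma> s))" by blast
  let ?M = "(\<lambda>s. k * s) -` N"
  have M: "open ?M" by (intro open_vimage N continuous_intros)
  have "smooth_on ?M (\<lambda>s. snd c (\<gamma> (k * s)))"
    by (rule smooth_on_compose[OF M N(1,5)])
      (auto intro: smooth_on_bounded_linear bounded_linear_mult_right M)
  then show "\<exists>c N. c \<in> charts_at A (\<gamma> (k * t)) \<and> open N \<and> t \<in> N \<and> (\<forall>s\<in>N. \<gamma> (k * s) \<in> fst c) \<and>
      smooth_on N (\<lambda>s. snd c (\<gamma> (k * s)))"
    using c M N(2,4) by (intro exI[of _ c] exI[of _ ?M]) auto
qed

lemma velocity_scale:
  assumes \<gamma>: "smooth_map std_atlas A I \<gamma>" "open I" and t: "k * t \<in> I"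
  shows "velocity A (\<lambda>s. \<gamma> (k * s)) t = (\<lambda>c. k *\<^sub>R velocity A \<gamma> (k * t) c)"
proof
  fix c :: "('m, 'e) chart"
  show "velocity A (\<lambda>s. \<gamma> (k * s)) t c = k *\<^sub>R velocity A \<gamma> (k * t) c"
  proof (cases "c \<in> charts_at A (\<gamma> (k * t))")
    case True
    have "((\<lambda>s. k * s) has_vector_derivative k) (at t)"
      by (auto intro!: derivative_eq_intros simp: has_real_derivative_iff_has_vector_derivative[symmetric])
    from vector_diff_chain_at[OF this has_velocity[OF \<gamma> t True]] show ?thesis
      using True by (simp add: velocity_def o_def vector_derivative_at)
  qed (simp add: velocity_def)
qed

text \<open>Both the derivative of the velocity and the quadratic Christoffel term acquire the
  factor \<open>k * k\<close>.\<close>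

lemma geodesic_scale:
  assumes \<gamma>: "geodesic A g I \<gamma>" and I: "open I" and J: "open J" "\<And>s. s \<in> J \<Longrightarrow> k * s \<in> I"
  shows "geodesic A g J (\<lambda>s. \<gamma> (k * s))"
  unfolding geodesic_def
proof (intro conjI ballI ext)
  note sm = geodesic_smooth[OF \<gamma>]
  show "smooth_map std_atlas A J (\<lambda>s. \<gamma> (k * s))" by (rule smooth_map_scale[OF sm I J(2)])
  fix t and c :: "('m, 'e) chart" assume t: "t \<in> J"
  show "cov_along A g (\<lambda>s. \<gamma> (k * s)) (velocity A (\<lambda>s. \<gamma> (k * s))) t c = 0"
  proof (cases "c \<in> charts_at A (\<gamma> (k * t))")
    case True
    have "((\<lambda>s. k * s) has_vector_derivative k) (at t)"
      by (auto intro!: derivative_eq_intros simp: has_real_derivative_iff_has_vector_derivative[symmetric])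
    note h = vector_diff_chain_at[OF this geodesic_ode[OF \<gamma> I J(2)[OF t] True]]
    from bounded_linear.has_vector_derivative[OF bounded_linear_scaleR_right h, of k]
    have "((\<lambda>s. k *\<^sub>R velocity A \<gamma> (k * s) c) has_vector_derivative
       (k * k) *\<^sub>R - chr c (snd c (\<gamma> (k * t))) (velocity A \<gamma> (k * t) c) (velocity A \<gamma> (k * t) c)) (at t)"
      by (simp add: o_def)
    then have "((\<lambda>s. velocity A (\<lambda>s. \<gamma> (k * s)) s c) has_vector_derivative
       (k * k) *\<^sub>R - chr c (snd c (\<gamma> (k * t))) (velocity A \<gamma> (k * t) c) (velocity A \<gamma> (k * t) c)) (at t)"
      by (rule has_vector_derivative_transform_within_open[OF _ J(1) t]) (simp add: velocity_scale[OF sm I J(2)])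
    from vector_derivative_at[OF this] show ?thesis
      using True by (simp add: cov_along_def velocity_scale[OF sm I J(2)[OF t]]
          linear_scale[OF bilinear_left[OF chr_bilinear[OF True]]] linear_scale[OF bilinear_right[OF chr_bilinear[OF True]]])
  qed (simp add: cov_along_def)
qed

lemma geodesic_localI:
  assumes I: "open I" and ex: "\<And>t. t \<in> I \<Longrightarrow> \<exists>J \<eta>. open J \<and> t \<in> J \<and> geodesic A g J \<eta> \<and> (\<forall>s\<in>J. \<gamma> s = \<eta> s)"
  shows "geodesic A g I \<gamma>"
  unfolding geodesic_def
proof (intro conjI ballI)
  show "smooth_map std_atlas A I \<gamma>"
  proof (rule smooth_map_curveI)
    fix t assume t: "t \<in> I"
    obtain J \<eta> where J: "open J" "t \<in> J" "geodesic A g J \<eta>" "\<And>s. s \<in> J \<Longrightarrow> \<gamma> s = \<eta> s"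
      using ex[OF t] by blast
    obtain c where c: "c \<in> charts_at A (\<eta> t)" using smooth_map_point[OF geodesic_smooth[OF J(3)] J(2)] by blast
    from smooth_map_curve[OF geodesic_smooth[OF J(3)] J(1,2) c] obtain N where N: "open N" "t \<in> N" "N \<subseteq> J"
      "\<And>s. s \<in> N \<Longrightarrow> \<eta> s \<in> fst c" "smooth_on N (\<lambda>s. snd c (\<eta> s))" by blast
    have eqN: "\<gamma> s = \<eta> s" if "s \<in> N" for s using J(4) N(3) that by blast
    have "smooth_on N (\<lambda>s. snd c (\<gamma> s))" by (rule smooth_on_cong[OF N(1,5)]) (simp add: eqN)
    then show "\<exists>c N. c \<in> charts_at A (\<gamma> t) \<and> open N \<and> t \<in> N \<and> (\<forall>s\<in>N. \<gamma> s \<in> fst c) \<and>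
        smooth_on N (\<lambda>s. snd c (\<gamma> s))"
      using c N(1,2,4) eqN by (intro exI[of _ c] exI[of _ N]) simp
  qed
  fix t assume t: "t \<in> I"
  obtain J \<eta> where J: "open J" "t \<in> J" "geodesic A g J \<eta>" "\<And>s. s \<in> J \<Longrightarrow> \<gamma> s = \<eta> s"
    using ex[OF t] by blast
  have "cov_along A g \<gamma> (velocity A \<gamma>) t = cov_along A g \<eta> (velocity A \<eta>) t"
    by (rule cov_along_cong[OF J(1,2,4)]) (auto intro: velocity_cong[OF J(1) _ J(4)])
  then show "cov_along A g \<gamma> (velocity A \<gamma>) t = (\<lambda>_. 0)" using J(2,3) by (simp add: geodesic_def)
qed

lemma exp_map_eq:
  assumes H: "Hausdorff_space (manifold_topology A)" and q: "exp_rel A g p v q"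
  shows "exp_map A g p v = q"
  unfolding exp_map_def
proof (rule the_equality[of "exp_rel A g p v", OF q])
  fix q' assume q': "exp_rel A g p v q'"
  obtain \<gamma> a b where \<gamma>: "a < 0" "1 < b" "geodesic A g {a<..<b} \<gamma>" "\<gamma> 0 = p" "velocity A \<gamma> 0 = v" "\<gamma> 1 = q"
    using q by (auto simp: exp_rel_def)
  obtain \<eta> a' b' where \<eta>: "a' < 0" "1 < b'" "geodesic A g {a'<..<b'} \<eta>" "\<eta> 0 = p" "velocity A \<eta> 0 = v" "\<eta> 1 = q'"
    using q' by (auto simp: exp_rel_def)
  let ?I = "{max a a'<..<min b b'}"
  have "\<gamma> 1 = \<eta> 1"
    by (rule geodesic_unique[OF H geodesic_subset[OF \<gamma>(3), of ?I] geodesic_subset[OF \<eta>(3), of ?I], of 0])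
      (use \<gamma> \<eta> in auto)
  then show "q' = q" using \<gamma> \<eta> by simp
qed

text \<open>\<open>exp_rel\<close> uses a separate geodesic for each vector. Running the geodesic of
  t v at speed 1 / t gives a single one with initial velocity v, and rescaling the original by r = s
  / t shows that its points are the exponentials of all s v nearby.\<close>

lemma exp_rel_ray:
  assumes q: "exp_rel A g p (\<lambda>c. t *\<^sub>R v c) q" and t: "t \<noteq> 0"
  obtains J \<eta> where "open J" "0 \<in> J" "t \<in> J" "geodesic A g J \<eta>" "\<eta> 0 = p" "velocity A \<eta> 0 = v"
    "\<And>s. s \<in> J \<Longrightarrow> exp_rel A g p (\<lambda>c. s *\<^sub>R v c) (\<eta> s)"
proof -
  obtain \<gamma> a b where \<gamma>: "a < 0" "1 < b" "geodesic A g {a<..<b} \<gamma>" "\<gamma> 0 = p"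
    "velocity A \<gamma> 0 = (\<lambda>c. t *\<^sub>R v c)" "\<gamma> 1 = q"
    using q by (auto simp: exp_rel_def)
  note sm = geodesic_smooth[OF \<gamma>(3)]
  define J where "J = (\<lambda>s. (1 / t) * s) -` {a<..<b}"
  define \<eta> where "\<eta> s = \<gamma> ((1 / t) * s)" for s
  have J: "open J" unfolding J_def by (intro open_vimage continuous_intros open_greaterThanLessThan)
  have "geodesic A g J \<eta>"
    unfolding \<eta>_def by (rule geodesic_scale[OF \<gamma>(3) _ J]) (auto simp: J_def)
  moreover have "velocity A \<eta> 0 = v"
  proof -
    have "velocity A \<eta> 0 = (\<lambda>c. (1 / t) *\<^sub>R velocity A \<gamma> ((1 / t) * 0) c)"
      unfolding \<eta>_def by (rule velocity_scale[OF sm]) (use \<gamma> in auto)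
    then show ?thesis using t \<gamma>(5) by simp
  qed
  moreover have "exp_rel A g p (\<lambda>c. s *\<^sub>R v c) (\<eta> s)" if s: "s \<in> J" for s
  proof -
    define r where "r = (1 / t) * s"
    have r: "a < r" "r < b" using s by (auto simp: J_def r_def)
    \<comment> \<open>The parameter interval is divided by \<open>r\<close>: a negative
      \<open>r\<close> exchanges the end points, and for \<open>r\<close> = 0 the rescaled curve is
      constant and any interval around [0, 1] serves.\<close>
    obtain a' b' where ab: "a' < 0" "1 < b'" "\<And>u. u \<in> {a'<..<b'} \<Longrightarrow> r * u \<in> {a<..<b}"
    proof (cases r "0 :: real" rule: linorder_cases)
      case less
      show ?thesis
        by (rule that[of "b / r" "a / r"]) (use less r \<gamma> in \<open>auto simp: field_simps\<close>)
    next
      case equal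
      show ?thesis by (rule that[of "-1" 2]) (use equal \<gamma> in auto)
    next
      case greater
      show ?thesis
        by (rule that[of "a / r" "b / r"]) (use greater r \<gamma> in \<open>auto simp: field_simps\<close>)
    qed
    have "geodesic A g {a'<..<b'} (\<lambda>u. \<gamma> (r * u))"
      by (rule geodesic_scale[OF \<gamma>(3) _ _ ab(3)]) auto
    moreover have "velocity A (\<lambda>u. \<gamma> (r * u)) 0 = (\<lambda>c. s *\<^sub>R v c)"
    proof -
      have "velocity A (\<lambda>u. \<gamma> (r * u)) 0 = (\<lambda>c. r *\<^sub>R velocity A \<gamma> (r * 0) c)"
        by (rule velocity_scale[OF sm]) (use \<gamma> in auto)
      then show ?thesis using t \<gamma>(5) by (simp add: r_def)
    qed
    ultimately show ?thesis
      unfolding exp_rel_def using ab(1,2) \<gamma>(4)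
      by (intro exI[of _ "\<lambda>u. \<gamma> (r * u)"] exI[of _ a'] exI[of _ b']) (auto simp: \<eta>_def r_def)
  qed
  ultimately show ?thesis
    using that[of J \<eta>] J \<gamma>(1,2,4) t by (auto simp: J_def \<eta>_def)
qed

lemma exp_ray_geodesic:
  assumes H: "Hausdorff_space (manifold_topology A)" and W: "open W" "0 \<in> W"
    and ex: "\<And>t. t \<in> W \<Longrightarrow> \<exists>q. exp_rel A g p (\<lambda>c. t *\<^sub>R v c) q"
  defines "\<gamma> \<equiv> \<lambda>t. exp_map A g p (\<lambda>c. t *\<^sub>R v c)"
  shows "geodesic A g W \<gamma>" "\<gamma> 0 = p" "velocity A \<gamma> 0 = v"
proof -
  have loc: "\<exists>J \<eta>. open J \<and> 0 \<in> J \<and> t \<in> J \<and> geodesic A g J \<eta> \<and> \<eta> 0 = p \<and> velocity A \<eta> 0 = v \<and>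
     (\<forall>s\<in>J. \<gamma> s = \<eta> s)" if t: "t \<in> W" "t \<noteq> 0" for t
  proof -
    obtain q where "exp_rel A g p (\<lambda>c. t *\<^sub>R v c) q" using ex t by blast
    from exp_rel_ray[OF this t(2)] obtain J \<eta> where "open J" "0 \<in> J" "t \<in> J" "geodesic A g J \<eta>" "\<eta> 0 = p"
      "velocity A \<eta> 0 = v" "\<And>s. s \<in> J \<Longrightarrow> exp_rel A g p (\<lambda>c. s *\<^sub>R v c) (\<eta> s)" by blast
    then show ?thesis by (intro exI[of _ J] exI[of _ \<eta>]) (simp add: \<gamma>_def exp_map_eq[OF H])
  qed
  obtain e where e: "e > 0" "ball 0 e \<subseteq> W" using W open_contains_ball by metis
  \<comment> \<open>Rescaling needs a nonzero parameter, so the behaviour at 0 is taken from the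
    geodesic belonging to a small positive one.\<close>
  have t0: "e / 2 \<in> W" "e / 2 \<noteq> 0" using e by (auto simp: subset_iff)
  obtain J \<eta> where J: "open J" "0 \<in> J" "geodesic A g J \<eta>" "\<eta> 0 = p" "velocity A \<eta> 0 = v"
    "\<And>s. s \<in> J \<Longrightarrow> \<gamma> s = \<eta> s" using loc[OF t0] by blast
  show "\<gamma> 0 = p" using J(2,4,6) by simp
  show "velocity A \<gamma> 0 = v" using velocity_cong[OF J(1,2,6)] J(5) by simp
  show "geodesic A g W \<gamma>"
  proof (rule geodesic_localI[OF W(1)])
    fix t assume "t \<in> W"
    then show "\<exists>J \<eta>. open J \<and> t \<in> J \<and> geodesic A g J \<eta> \<and> (\<forall>s\<in>J. \<gamma> s = \<eta> s)"
      using loc[of t] J(1,2,3,6) by (cases "t = 0") blast+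
  qed
qed

end

section \<open>Curvature in charts\<close>

context lorentz
begin

text \<open>The coordinate expression of R(u, v) w on fields with constant components: their bracket
  vanishes, and only derivatives and products of the Christoffel symbol remain.\<close>

definition curv :: "('m, 'e) chart \<Rightarrow> 'e \<Rightarrow> 'e \<Rightarrow> 'e \<Rightarrow> 'e \<Rightarrow> 'e" where
  "curv c x u v w = Dat (\<lambda>y. chr c y v w) x u - Dat (\<lambda>y. chr c y u w) x v
     + chr c x u (chr c x v w) - chr c x v (chr c x u w)"

lemma Dat_chr_linear:
  assumes c: "c \<in> charts_at A p"
  shows "linear (\<lambda>v. Dat (\<lambda>y. chr c y a b) (snd c p) v)" "linear (\<lambda>a. Dat (\<lambda>y. chr c y a b) (snd c p) v)"
proof -
  have x: "snd c p \<in> snd c ` fst c" and cA: "c \<in> A" using c by (auto simp: charts_at_iff)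
  show "linear (\<lambda>v. Dat (\<lambda>y. chr c y a b) (snd c p) v)"
    by (rule smooth_on_linear_Dat[OF chr_smooth[OF cA] x])
  show "linear (\<lambda>a. Dat (\<lambda>y. chr c y a b) (snd c p) v)"
  proof (rule linearI_lincomb)
    fix r s and a1 a2 :: 'e
    have "((\<lambda>y. r *\<^sub>R chr c y a1 b + s *\<^sub>R chr c y a2 b) has_derivative
        (\<lambda>v. r *\<^sub>R Dat (\<lambda>y. chr c y a1 b) (snd c p) v + s *\<^sub>R Dat (\<lambda>y. chr c y a2 b) (snd c p) v)) (at (snd c p))"
      by (intro has_derivative_add has_derivative_scaleR_right smooth_on_has_derivative[OF chr_smooth[OF cA] x])
    then have "((\<lambda>y. chr c y (r *\<^sub>R a1 + s *\<^sub>R a2) b) has_derivative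
        (\<lambda>v. r *\<^sub>R Dat (\<lambda>y. chr c y a1 b) (snd c p) v + s *\<^sub>R Dat (\<lambda>y. chr c y a2 b) (snd c p) v)) (at (snd c p))"
    proof (rule has_derivative_transform_within_open[OF _ chart_open[OF cA] x])
      fix y assume "y \<in> snd c ` fst c"
      note l = bilinear_left[OF chr_bilinear'[OF cA this], of b]
      show "r *\<^sub>R chr c y a1 b + s *\<^sub>R chr c y a2 b = chr c y (r *\<^sub>R a1 + s *\<^sub>R a2) b"
        by (simp add: linear_add[OF l] linear_scale[OF l])
    qed
    then show "Dat (\<lambda>y. chr c y (r *\<^sub>R a1 + s *\<^sub>R a2) b) (snd c p) v =
        r *\<^sub>R Dat (\<lambda>y. chr c y a1 b) (snd c p) v + s *\<^sub>R Dat (\<lambda>y. chr c y a2 b) (snd c p) v"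
      by (simp add: Dat_eq)
  qed
qed

lemma curvature_chart_eq_curv:
  assumes c: "c \<in> charts_at A p"
  shows "curvature_chart A g c (\<lambda>_. u) (\<lambda>_. v) (\<lambda>_. w) (snd c p) = curv c (snd c p) u v w"
proof -
  have nc: "nabla_chart A g c (\<lambda>_. v) (\<lambda>_. w) = (\<lambda>y. chr c y v w)" for v w
    by (rule ext) (simp add: nabla_chart_def)
  show ?thesis
    unfolding curvature_chart_def nc curv_def
    by (simp add: nabla_chart_def lie_bracket_def linear_0[OF bilinear_left[OF chr_bilinear[OF c]]])
qed

lemma curv_linear:
  assumes c: "c \<in> charts_at A p" shows "linear (\<lambda>u. curv c (snd c p) u v w)"
proof -
  note l = bilinear_left[OF chr_bilinear[OF c]] bilinear_right[OF chr_bilinear[OF c]]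
  show ?thesis
    unfolding curv_def
    by (rule linearI_lincomb) (simp add: linear_add[OF Dat_chr_linear(1)[OF c]] linear_scale[OF Dat_chr_linear(1)[OF c]]
      linear_add[OF Dat_chr_linear(2)[OF c]] linear_scale[OF Dat_chr_linear(2)[OF c]]
      linear_add[OF l(1)] linear_scale[OF l(1)] linear_add[OF l(2)] linear_scale[OF l(2)] algebra_simps)
qed

lemma curv_self: "curv c x u u w = 0"
  by (simp add: curv_def)

text \<open>For constant components \<open>w\<close>, covariant differentiation of g(w, w) twice and
  antisymmetrization give 2 g(R(u, v) w, w). The left side vanishes because second derivatives of a
  function commute.\<close>

lemma mc_curv_self:
  assumes c: "c \<in> charts_at A p"
  shows "mc c (snd c p) (curv c (snd c p) u v w) w = 0"
proof -
  let ?X = "snd c ` fst c" and ?x = "snd c p"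
  have cA: "c \<in> A" and x: "?x \<in> ?X" using c by (auto simp: charts_at_iff)
  note X = chart_open[OF cA]
  have first: "Dat (\<lambda>y. mc c y w w) y v = 2 * mc c y (chr c y v w) w" if "y \<in> ?X" for y v
  proof -
    from chart_range[OF that cA] obtain q where q: "c \<in> charts_at A q" "y = snd c q" by blast
    show ?thesis unfolding q(2) chr_compat[OF q(1)] mc_sym[OF q(1), of w] by simp
  qed
  have second: "Dat (\<lambda>y. Dat (\<lambda>y. mc c y w w) y v) ?x u =
    2 * (mc c ?x (Dat (\<lambda>y. chr c y v w) ?x u + chr c ?x u (chr c ?x v w)) w
       + mc c ?x (chr c ?x v w) (chr c ?x u w))" for u v
  proof -
    have "((\<lambda>y. mc c y (chr c y v w) w) has_derivative (\<lambda>u. mc c ?x (Dat (\<lambda>y. chr c y v w) ?x u + chr c ?x u (chr c ?x v w)) w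
       + mc c ?x (chr c ?x v w) (0 + chr c ?x u w))) (at ?x)"
      by (rule has_derivative_mc[OF cA has_derivative_ident x smooth_on_has_derivative[OF chr_smooth[OF cA] x] has_derivative_const])
    from has_derivative_mult_right[OF this, of 2]
    have "((\<lambda>y. Dat (\<lambda>y. mc c y w w) y v) has_derivative (\<lambda>u. 2 * (mc c ?x (Dat (\<lambda>y. chr c y v w) ?x u + chr c ?x u (chr c ?x v w)) w
       + mc c ?x (chr c ?x v w) (0 + chr c ?x u w)))) (at ?x)"
      by (rule has_derivative_transform_within_open[OF _ X x]) (simp add: first)
    then show ?thesis by (simp add: Dat_eq)
  qed
  note l = linear_add[OF bilinear_left[OF mc_bilinear[OF c]]] linear_diff[OF bilinear_left[OF mc_bilinear[OF c]]]
  have "Dat (\<lambda>y. Dat (\<lambda>y. mc c y w w) y v) ?x u = Dat (\<lambda>y. Dat (\<lambda>y. mc c y w w) y u) ?x v"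
    by (rule Dat_commute_real[OF mc_smooth[OF cA] X x])
  then show ?thesis
    unfolding second curv_def l using mc_sym[OF c, of "chr c ?x v w" "chr c ?x u w"] by simp
qed

text \<open>For a variation \<open>h\<close> through geodesics, with parameters \<open>(s, t)\<close>: the field
  \<open>\<nabla>\<^sub>s \<partial>\<^sub>t h = \<nabla>\<^sub>t \<partial>\<^sub>s h\<close> satisfies
  \<open>\<nabla>\<^sub>t \<nabla>\<^sub>s \<partial>\<^sub>t h = - R(\<partial>\<^sub>s h, \<partial>\<^sub>t h) \<partial>\<^sub>t h\<close>.\<close>

lemma geodesic_variation:
  fixes h :: "real \<times> real \<Rightarrow> 'e"
  assumes c: "c \<in> A" and Q: "open Q" "smooth_on Q h" "h ` Q \<subseteq> snd c ` fst c" and z: "z \<in> Q"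
  defines "hs \<equiv> \<lambda>y. Dat h y (1, 0)" and "ht \<equiv> \<lambda>y. Dat h y (0, 1)"
  assumes geo: "\<And>y. y \<in> Q \<Longrightarrow> Dat ht y (0, 1) + chr c (h y) (ht y) (ht y) = 0"
  defines "Y \<equiv> \<lambda>y. Dat ht y (1, 0) + chr c (h y) (hs y) (ht y)"
  shows "Dat Y z (0, 1) + chr c (h z) (ht z) (Y z) = - curv c (h z) (hs z) (ht z) (ht z)"
proof -
  have hz: "h z \<in> snd c ` fst c" using Q z by blast
  from chart_range[OF hz c] obtain q where q: "c \<in> charts_at A q" "h z = snd c q" by blast
  note bil = chr_bilinear[OF q(1), folded q(2)]
  note l = linear_add[OF bilinear_right[OF bil]] linear_add[OF bilinear_left[OF bil]]
    linear_neg[OF bilinear_right[OF bil]] linear_diff[OF bilinear_right[OF bil]]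
  have sm: "smooth_on Q hs" "smooth_on Q ht" unfolding hs_def ht_def by (rule smooth_on_Dat[OF Q(2)])+
  note D = smooth_on_has_derivative[OF _ z]
  have chrD: "((\<lambda>y. chr c (h y) (a y) (b y)) has_derivative
     (\<lambda>k. Dat (\<lambda>y. chr c y (a z) (b z)) (h z) (Dat h z k) + chr c (h z) (Dat a z k) (b z)
       + chr c (h z) (a z) (Dat b z k))) (at z)" if "smooth_on Q a" "smooth_on Q b" for a b
    by (rule has_derivative_bilinear_family[OF chart_open[OF c] chr_bilinear'[OF c] chr_smooth[OF c] D[OF Q(2)] hz D[OF that(1)] D[OF that(2)]])
  define a where "a = Dat ht z (1, 0)"
  have a2: "Dat hs z (0, 1) = a"
    unfolding a_def hs_def ht_def by (rule Dat_commute[OF Q(2,1) z])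
  have tt: "Dat ht z (0, 1) = - chr c (h z) (ht z) (ht z)"
    using geo[OF z] by (simp add: eq_neg_iff_add_eq_0)
  have "Dat (\<lambda>y. Dat ht y (1, 0)) z (0, 1) = Dat (\<lambda>y. Dat ht y (0, 1)) z (1, 0)"
    by (rule Dat_commute[OF sm(2) Q(1) z])
  also have "Dat (\<lambda>y. Dat ht y (0, 1)) z = Dat (\<lambda>y. - chr c (h y) (ht y) (ht y)) z"
    by (rule Dat_cong[OF Q(1) z]) (use geo in \<open>simp add: eq_neg_iff_add_eq_0\<close>)
  also have "\<dots> (1, 0) = - (Dat (\<lambda>y. chr c y (ht z) (ht z)) (h z) (hs z) + chr c (h z) a (ht z) + chr c (h z) (ht z) a)"
    by (subst Dat_eq[OF has_derivative_minus[OF chrD[OF sm(2,2)]]]) (simp add: a_def hs_def)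
  finally have st: "Dat (\<lambda>y. Dat ht y (1, 0)) z (0, 1) =
    - (Dat (\<lambda>y. chr c y (ht z) (ht z)) (h z) (hs z) + chr c (h z) a (ht z) + chr c (h z) (ht z) a)" .
  have "Dat Y z (0, 1) = Dat (\<lambda>y. Dat ht y (1, 0)) z (0, 1) + (Dat (\<lambda>y. chr c y (hs z) (ht z)) (h z) (ht z)
     + chr c (h z) a (ht z) + chr c (h z) (hs z) (- chr c (h z) (ht z) (ht z)))"
    unfolding Y_def
    by (subst Dat_eq[OF has_derivative_add[OF D[OF smooth_on_Dat[OF sm(2)]] chrD[OF sm(1,2)]]])
      (simp add: a2 tt, simp add: ht_def)
  then show ?thesis
    unfolding st curv_def Y_def l a_def[symmetric] by (simp add: algebra_simps)
qed

text \<open>Choose V with g(U, V) = 1. Subtracting l id from y -> R(y, U) U leaves M, which maps the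
  hyperplane of U into multiples of U, so M y = \<phi>(y) U + \<theta>(y) M V. Its trace is
  \<phi>(U) + \<theta>(M V) = - l - l, and adding back (n + 2) l gives n l.\<close>

lemma trace_curv:
  assumes c: "c \<in> charts_at A p" and dim: "DIM('e) = n + 2"
    and U: "U \<noteq> 0" "mc c (snd c p) U U = 0"
    and R: "\<And>y. mc c (snd c p) U y = 0 \<Longrightarrow> \<exists>k. curv c (snd c p) y U U = l *\<^sub>R y + k *\<^sub>R U"
  shows "(\<Sum>b\<in>Basis. curv c (snd c p) b U U \<bullet> b) = real n * l"
proof -
  let ?x = "snd c p"
  define \<theta> where "\<theta> y = mc c ?x U y" for y
  have \<theta>: "linear \<theta>" unfolding \<theta>_def[abs_def] by (rule bilinear_right[OF mc_bilinear[OF c]])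
  obtain V0 where "\<theta> V0 \<noteq> 0" using mc_nondegenerate[OF c, of U] U(1) by (auto simp: \<theta>_def)
  then have V: "\<theta> ((1 / \<theta> V0) *\<^sub>R V0) = 1" by (simp add: linear_scale[OF \<theta>])
  define V where "V = (1 / \<theta> V0) *\<^sub>R V0"
  define M where "M y = curv c ?x y U U - l *\<^sub>R y" for y
  have M: "linear M" unfolding M_def[abs_def] by (intro linear_compose_sub curv_linear[OF c] linear_scale_self)
  \<comment> \<open>The coefficient of \<open>U\<close>, read off by a Euclidean quotient so that
    \<phi> is visibly linear on the whole space.\<close>
  define \<phi> where "\<phi> y = (M (y - \<theta> y *\<^sub>R V) \<bullet> U) / (U \<bullet> U)" for y
  have \<phi>: "linear \<phi>"
    unfolding \<phi>_def
    by (rule linearI_lincomb) (simp add: linear_add[OF M] linear_diff[OF M] linear_scale[OF M] linear_add[OF \<theta>] linear_scale[OF \<theta>]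
      inner_add_left inner_diff_left algebra_simps add_divide_distrib diff_divide_distrib)
  have dec: "M y = \<phi> y *\<^sub>R U + \<theta> y *\<^sub>R M V" for y
  proof -
    have "\<theta> (y - \<theta> y *\<^sub>R V) = 0" using V by (simp add: linear_diff[OF \<theta>] linear_scale[OF \<theta>] V_def[symmetric])
    then obtain k where "curv c ?x (y - \<theta> y *\<^sub>R V) U U = l *\<^sub>R (y - \<theta> y *\<^sub>R V) + k *\<^sub>R U"
      using R[of "y - \<theta> y *\<^sub>R V"] unfolding \<theta>_def by blast
    then have k: "M (y - \<theta> y *\<^sub>R V) = k *\<^sub>R U" by (simp add: M_def)
    then have "\<phi> y = k" using U(1) by (simp add: \<phi>_def)
    then show ?thesis using k by (simp add: linear_diff[OF M] linear_scale[OF M] algebra_simps)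
  qed
  have tr: "(\<Sum>b\<in>Basis. f b * (w \<bullet> b)) = f w" if "linear f" for f :: "'e \<Rightarrow> real" and w
    using linear_Basis_expand[OF that, of w] by (simp add: mult.commute)
  have "(\<Sum>b\<in>Basis. M b \<bullet> b) = (\<Sum>b\<in>Basis. \<phi> b * (U \<bullet> b) + \<theta> b * (M V \<bullet> b))"
    by (subst dec) (simp add: inner_add_left)
  also have "\<dots> = \<phi> U + \<theta> (M V)" by (simp add: sum.distrib tr \<phi> \<theta>)
  also have "\<phi> U = - l" using U by (simp add: \<phi>_def \<theta>_def M_def curv_self)
  \<comment> \<open>Here g(R(V, U) U, U) = 0, so only - l g(V, U) remains.\<close>
  also have "\<theta> (M V) = - l"
    using V mc_curv_self[OF c, of V U U] mc_sym[OF c, of "curv c ?x V U U" U]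
    by (simp add: M_def linear_diff[OF \<theta>] linear_scale[OF \<theta>] V_def[symmetric]) (simp add: \<theta>_def)
  finally have 1: "(\<Sum>b\<in>Basis. M b \<bullet> b) = - 2 * l" by simp
  have "(\<Sum>b\<in>Basis. curv c ?x b U U \<bullet> b) = (\<Sum>b\<in>Basis. M b \<bullet> b + l)"
    by (rule sum.cong) (simp_all add: M_def inner_diff_left inner_Basis)
  also have "\<dots> = - 2 * l + real (n + 2) * l" using 1 dim by (simp add: sum.distrib)
  finally show ?thesis by (simp add: algebra_simps)
qed

lemma riemann_eq:
  "c \<in> charts_at A p \<Longrightarrow> riemann A g p u v w c = curv c (snd c p) (u c) (v c) (w c)"
  by (simp add: riemann_def curvature_chart_eq_curv)

text \<open>\<open>trace_at\<close> computes in an arbitrarily selected chart. Handing out that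
  chart lets later arguments work in it, so the trace need not be compared between charts.\<close>

lemma ricci_eq:
  assumes "p \<in> points A"
  obtains c where "c \<in> charts_at A p"
    "\<And>y z. ricci A g p y z = (\<Sum>b\<in>Basis. curv c (snd c p) b (y c) (z c) \<bullet> b)"
proof -
  define c where "c = (SOME c. c \<in> charts_at A p)"
  have c: "c \<in> charts_at A p" unfolding c_def using assms charts_at_nonempty by (metis someI_ex)
  show ?thesis
    by (rule that[OF c]) (simp add: ricci_def trace_at_def c_def[symmetric] riemann_eq[OF c] coord_vec_self[OF c])
qed

end

section \<open>The null hypersurface in adapted coordinates\<close>

locale null_generated =
  fixes n :: nat and A :: "('m, 'e::euclidean_space) chart set" and g T S \<xi> \<V>
  assumes generation: "null_generation n A g T S \<xi> \<V>"

sublocale null_generated \<subseteq> lorentz A g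
  using generation
  by unfold_locales (auto simp: null_generation_def spacetime_def smooth_manifold_def)

context null_generated
begin

abbreviation "flow \<equiv> generator A g \<xi>"
abbreviation "flow_dom \<equiv> flow_domain S \<xi> \<V>"
abbreviation "life \<equiv> generator_interval S \<xi> \<V>"
abbreviation "\<Sigma> \<equiv> null_hypersurface A g S \<xi> \<V>"
abbreviation "U \<equiv> null_field A g S \<xi> \<V>"
abbreviation "NB \<equiv> normal_bundle A g S"

section \<open>Consequences of the hypotheses on the submanifold, the normal field and the
  exponential domain\<close>

lemma Hausdorff: "Hausdorff_space (manifold_topology A)"
  using generation by (auto simp: null_generation_def spacetime_def smooth_manifold_def)

lemma dim: "DIM('e) = n + 2"
  using generation by (simp add: null_generation_def)

lemma S_points: "S \<subseteq> points A"
  using generation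
  by (auto simp: null_generation_def spacelike_submanifold_def embedded_submanifold_def)

lemma S_chart: "p \<in> S \<Longrightarrow> \<exists>c. c \<in> charts_at A p"
  using S_points charts_at_nonempty[of p A] by (simp add: subset_iff)

lemma xi_field: "smooth_field A S \<xi>"
  using generation by (simp add: null_generation_def lightlike_normal_field_def)

lemma xi_tangent: "p \<in> S \<Longrightarrow> \<xi> p \<in> tangent_space A p"
  using xi_field by (simp add: smooth_field_def)

lemma xi_lightlike: "p \<in> S \<Longrightarrow> \<xi> p \<noteq> (\<lambda>_. 0) \<and> g p (\<xi> p) (\<xi> p) = 0"
  using generation by (simp add: null_generation_def lightlike_normal_field_def)

lemma xi_normal: "p \<in> S \<Longrightarrow> x \<in> sub_tangent A S p \<Longrightarrow> g p (\<xi> p) x = 0"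
  using generation by (simp add: null_generation_def lightlike_normal_field_def normal_bundle_def)

lemma xi_chart_nonzero: "p \<in> S \<Longrightarrow> c \<in> charts_at A p \<Longrightarrow> \<xi> p c \<noteq> 0"
  using tangent_neq_zero[OF xi_tangent] xi_lightlike by blast

lemma normal_scale: assumes p: "p \<in> S" shows "(p, \<lambda>c. t *\<^sub>R \<xi> p c) \<in> NB"
proof -
  have "g p (\<lambda>c. t *\<^sub>R \<xi> p c) x = 0" if x: "x \<in> sub_tangent A S p" for x
    using g_lin[of p "\<xi> p" "\<xi> p" x t 0] p S_points xi_tangent[OF p] sub_tangent_tangent[OF x] xi_normal[OF p x]
    by auto
  then show ?thesis using p tangent_space_scale[OF xi_tangent[OF p]] by (simp add: normal_bundle_def)
qed

lemma V_open:
  obtains \<O> where "openin (manifold_topology (tangent_atlas A)) \<O>" "\<V> = \<O> \<inter> NB"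
  using generation by (auto simp: null_generation_def normal_exp_domain_def openin_subtopology)

lemma V_zero: "p \<in> S \<Longrightarrow> (p, \<lambda>_. 0) \<in> \<V>"
  using generation unfolding null_generation_def normal_exp_domain_def by blast

lemma V_star: "(p, v) \<in> \<V> \<Longrightarrow> s \<in> {0..1} \<Longrightarrow> (p, \<lambda>c. s *\<^sub>R v c) \<in> \<V>"
  using generation unfolding null_generation_def normal_exp_domain_def by blast

lemma V_exp: "(p, v) \<in> \<V> \<Longrightarrow> \<exists>q. exp_rel A g p v q"
  using generation unfolding null_generation_def normal_exp_domain_def by blast

lemma exp_diffeo:
  obtains W where "diffeo (tangent_atlas A) A \<V> W (\<lambda>(p, v). exp_map A g p v)"
  using generation unfolding null_generation_def normal_exp_domain_def by blast

lemma life_iff: "t \<in> life p \<longleftrightarrow> p \<in> S \<and> (p, \<lambda>c. t *\<^sub>R \<xi> p c) \<in> \<V>"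
  by (auto simp: generator_interval_def flow_domain_def)

lemma flow_dom_iff: "(p, t) \<in> flow_dom \<longleftrightarrow> t \<in> life p"
  by (simp add: generator_interval_def)

lemma life_S: "t \<in> life p \<Longrightarrow> p \<in> S"
  by (simp add: life_iff)

lemma zero_life: "p \<in> S \<Longrightarrow> 0 \<in> life p"
  using V_zero by (simp add: life_iff)

text \<open>The exponential domain is open only relative to the normal bundle. \<open>P\<close> is
  the coordinate image of an open set that cuts it out, so the converse is asserted for multiples of
  the normal field.\<close>

lemma V_chart:
  assumes c: "c \<in> A"
  obtains P where "open P" "\<And>p v. p \<in> fst c \<Longrightarrow> (p, v) \<in> \<V> \<Longrightarrow> (snd c p, v c) \<in> P"
    "\<And>p t. p \<in> S \<Longrightarrow> p \<in> fst c \<Longrightarrow> (snd c p, t *\<^sub>R \<xi> p c) \<in> P \<Longrightarrow> t \<in> life p"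
proof -
  obtain \<O> where \<O>: "openin (manifold_topology (tangent_atlas A)) \<O>" "\<V> = \<O> \<inter> NB" by (rule V_open)
  define P where "P = snd (tchart A c) ` (\<O> \<inter> fst (tchart A c))"
  have "open P" using \<O>(1) c unfolding openin_tangent P_def by blast
  moreover have "(snd c p, v c) \<in> P" if "p \<in> fst c" "(p, v) \<in> \<V>" for p v
  proof -
    have "(p, v) \<in> \<O> \<inter> fst (tchart A c)"
      using that \<O>(2) by (auto simp: tchart_def normal_bundle_def)
    then have "snd (tchart A c) (p, v) \<in> P" unfolding P_def by (rule imageI)
    then show ?thesis by (simp add: tchart_def)
  qed
  moreover have "t \<in> life p" if p: "p \<in> S" "p \<in> fst c" "(snd c p, t *\<^sub>R \<xi> p c) \<in> P" for p t
  proof -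
    let ?w = "(p, \<lambda>c. t *\<^sub>R \<xi> p c)"
    have w: "?w \<in> fst (tchart A c)" "snd (tchart A c) ?w = (snd c p, t *\<^sub>R \<xi> p c)"
      using p(2) tangent_space_scale[OF xi_tangent[OF p(1)]] by (simp_all add: tchart_def)
    obtain y where y: "y \<in> \<O>" "y \<in> fst (tchart A c)" "snd (tchart A c) y = (snd c p, t *\<^sub>R \<xi> p c)"
      using p(3) unfolding P_def by auto
    have "y = ?w" using inj_onD[OF tchart_inj[OF c] _ y(2) w(1)] y(3) w(2) by simp
    then have "?w \<in> \<V>" using y(1) normal_scale[OF p(1)] unfolding \<O>(2) by simp
    then show ?thesis using p(1) by (simp add: life_iff)
  qed
  ultimately show ?thesis by (rule that)
qed

section \<open>The generators as an injective family of geodesics\<close>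

lemma life_open: "open (life p)"
proof (cases "p \<in> S")
  case True
  obtain c where c: "c \<in> charts_at A p" using S_chart[OF True] by (elim exE)
  then have cA: "c \<in> A" "p \<in> fst c" by (auto simp: charts_at_iff)
  obtain P where P: "open P" "\<And>p v. p \<in> fst c \<Longrightarrow> (p, v) \<in> \<V> \<Longrightarrow> (snd c p, v c) \<in> P"
    "\<And>p t. p \<in> S \<Longrightarrow> p \<in> fst c \<Longrightarrow> (snd c p, t *\<^sub>R \<xi> p c) \<in> P \<Longrightarrow> t \<in> life p"
    using V_chart[OF cA(1)] by blast
  have "life p = (\<lambda>t. (snd c p, t *\<^sub>R \<xi> p c)) -` P"
    using P(2)[OF cA(2)] P(3)[OF True cA(2)] by (auto simp: life_iff)
  then show ?thesis by (simp add: open_vimage[OF P(1)] continuous_intros)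
next
  case False
  then have "life p = {}" by (auto simp: life_iff)
  then show ?thesis by simp
qed

text \<open>Fibrewise star-shapedness puts the whole segment from 0 to t into the set together with
  t, so the set is an interval.\<close>

lemma life_connected: "connected (life p)"
proof -
  have seg: "s * t \<in> life p" if "t \<in> life p" "s \<in> {0..1}" for s t
    using that V_star[of p "\<lambda>c. t *\<^sub>R \<xi> p c" s] by (simp add: life_iff)
  have "is_interval (life p)"
    unfolding is_interval_1
  proof (intro ballI allI impI, elim conjE)
    fix a b x assume h: "a \<in> life p" "b \<in> life p" "a \<le> x" "x \<le> b"
    show "x \<in> life p"
    proof (cases x "0 :: real" rule: linorder_cases)
      case less
      then show ?thesis using seg[OF h(1), of "x / a"] h by (simp add: divide_simps)
    next
      case equal
      then show ?thesis using zero_life life_S[OF h(1)] by simp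
    next
      case greater
      then show ?thesis using seg[OF h(2), of "x / b"] h by (simp add: divide_simps)
    qed
  qed
  then show ?thesis by (simp add: is_interval_connected_1)
qed

lemma flow_geodesic:
  assumes p: "p \<in> S"
  shows "geodesic A g (life p) (flow p)" "flow p 0 = p" "velocity A (flow p) 0 = \<xi> p"
proof -
  have "\<exists>q. exp_rel A g p (\<lambda>c. t *\<^sub>R \<xi> p c) q" if "t \<in> life p" for t
    using that V_exp by (simp add: life_iff)
  from exp_ray_geodesic[OF Hausdorff life_open zero_life[OF p] this]
  show "geodesic A g (life p) (flow p)" "flow p 0 = p" "velocity A (flow p) 0 = \<xi> p"
    by (simp_all add: generator_def[abs_def])
qed

lemma flow_smooth: "p \<in> S \<Longrightarrow> smooth_map std_atlas A (life p) (flow p)"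
  using geodesic_smooth[OF flow_geodesic(1)] .

lemma flow_points: "t \<in> life p \<Longrightarrow> flow p t \<in> points A"
  using flow_smooth[OF life_S] by (auto simp: smooth_map_def)

lemma V_xi: "t \<in> life p \<Longrightarrow> (p, \<lambda>c. t *\<^sub>R \<xi> p c) \<in> \<V>"
  by (simp add: life_iff)

text \<open>The exponential diffeomorphism is injective on normal vectors, and the nonzero normal
  field recovers the parameter from its multiple.\<close>

lemma flow_inj: "inj_on (\<lambda>(p, t). flow p t) flow_dom"
proof (rule inj_onI)
  fix x y assume xy: "x \<in> flow_dom" "y \<in> flow_dom" "(case x of (p, t) \<Rightarrow> flow p t) = (case y of (p, t) \<Rightarrow> flow p t)"
  obtain p t q s where e: "x = (p, t)" "y = (q, s)" by (cases x, cases y)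
  have h: "t \<in> life p" "s \<in> life q" "flow p t = flow q s" using xy by (auto simp: e flow_dom_iff)
  obtain W where W: "diffeo (tangent_atlas A) A \<V> W (\<lambda>(p, v). exp_map A g p v)" by (rule exp_diffeo)
  then have "inj_on (\<lambda>(p, v). exp_map A g p v) \<V>" by (simp add: diffeo_def bij_betw_def)
  from inj_onD[OF this _ V_xi[OF h(1)] V_xi[OF h(2)]]
  have e': "p = q" "(\<lambda>c. t *\<^sub>R \<xi> p c) = (\<lambda>c. s *\<^sub>R \<xi> q c)" using h(3) by (auto simp: generator_def)
  obtain c where c: "c \<in> charts_at A p" using S_chart[OF life_S[OF h(1)]] by (elim exE)
  have "t *\<^sub>R \<xi> p c = s *\<^sub>R \<xi> p c" using fun_cong[OF e'(2), of c] e'(1) by simp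
  then show "x = y" unfolding e using e'(1) xi_chart_nonzero[OF life_S[OF h(1)] c] by simp
qed

lemma flow_coords: "t \<in> life p \<Longrightarrow> flow_coords A g S \<xi> \<V> (flow p t) = (p, t)"
  using inv_into_f_f[OF flow_inj, of "(p, t)"] by (simp add: flow_coords_def flow_dom_iff)

lemma U_eq: "t \<in> life p \<Longrightarrow> U (flow p t) = velocity A (flow p) t"
  by (simp add: null_field_def flow_coords)

lemma \<Sigma>_iff: "q \<in> \<Sigma> \<longleftrightarrow> (\<exists>p t. t \<in> life p \<and> q = flow p t)"
  unfolding null_hypersurface_def by (force simp: flow_dom_iff simp del: split_paired_Ex)

text \<open>The normal field is given on \<open>S\<close> alone; its extension \<Xi> to an open set
  of coordinates is what calculus can be applied to.\<close>

lemma xi_chart: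
  assumes p: "p \<in> S" and c: "c \<in> charts_at A p"
  obtains N \<Xi> where "open N" "snd c p \<in> N" "smooth_on N \<Xi>"
    "\<And>p'. p' \<in> S \<Longrightarrow> p' \<in> fst c \<Longrightarrow> snd c p' \<in> N \<Longrightarrow> \<Xi> (snd c p') = \<xi> p' c"
proof -
  have sm: "smooth_map A (tangent_atlas A) S (\<lambda>p. (p, \<xi> p))"
    using xi_field by (simp add: smooth_field_def)
  have "tchart A c \<in> charts_at (tangent_atlas A) (p, \<xi> p)"
    using c by (simp add: charts_at_tangent_atlas[OF xi_tangent[OF p]])
  then obtain N F where N: "open N" "snd c p \<in> N" "smooth_on N F"
    "\<forall>y\<in>S \<inter> fst c. snd c y \<in> N \<longrightarrow> (y, \<xi> y) \<in> fst (tchart A c) \<and> snd (tchart A c) (y, \<xi> y) = F (snd c y)"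
    using sm p c unfolding smooth_map_def by meson
  show ?thesis
  proof (rule that[OF N(1,2) smooth_on_snd[OF N(1,3)]])
    fix p' assume "p' \<in> S" "p' \<in> fst c" "snd c p' \<in> N"
    then have "snd (tchart A c) (p', \<xi> p') = F (snd c p')" using N(4) by blast
    then show "snd (F (snd c p')) = \<xi> p' c" by (simp add: tchart_def flip: \<open>snd (tchart A c) (p', \<xi> p') = F (snd c p')\<close>)
  qed
qed

text \<open>The map \<open>H\<close> represents the flow at the
  coordinates of points of \<open>S\<close> only, and \<open>\<Theta>\<close> inverts it on the coordinates of points of the null
  hypersurface only.\<close>

definition local_flow :: "('m, 'e) chart \<Rightarrow> ('m, 'e) chart \<Rightarrow> ('e \<times> real) set \<Rightarrow> ('e \<times> real \<Rightarrow> 'e) \<Rightarrow>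
    'e set \<Rightarrow> ('e \<Rightarrow> 'e \<times> real) \<Rightarrow> bool" where
  "local_flow c0 c Q H R \<Theta> \<longleftrightarrow> c0 \<in> A \<and> c \<in> A \<and> open Q \<and> smooth_on Q H \<and> open R \<and> smooth_on R \<Theta> \<and> \<Theta> ` R \<subseteq> Q \<and>
    (\<forall>p\<in>S. \<forall>t. p \<in> fst c0 \<longrightarrow> (snd c0 p, t) \<in> Q \<longrightarrow>
      t \<in> life p \<and> flow p t \<in> fst c \<and> snd c (flow p t) = H (snd c0 p, t)) \<and>
    (\<forall>p t. t \<in> life p \<longrightarrow> flow p t \<in> fst c \<longrightarrow> snd c (flow p t) \<in> R \<longrightarrow>
      p \<in> fst c0 \<and> \<Theta> (snd c (flow p t)) = (snd c0 p, t))"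

text \<open>\<open>H\<close> extends the exponential map in charts, composed with (x, t) -> (x, t
  \<Xi> x). The map \<Theta> comes from the inverse of the exponential diffeomorphism, which returns
  a base point and a normal vector.\<close>

lemma local_flow_exists:
  assumes t0: "t0 \<in> life p0" and c0: "c0 \<in> charts_at A p0" and c: "c \<in> charts_at A (flow p0 t0)"
  obtains Q H R \<Theta> where "local_flow c0 c Q H R \<Theta>" "(snd c0 p0, t0) \<in> Q" "snd c (flow p0 t0) \<in> R"
proof -
  have p0: "p0 \<in> S" using t0 by (rule life_S)
  have cA: "c0 \<in> A" "p0 \<in> fst c0" "c \<in> A" "flow p0 t0 \<in> fst c" using c0 c by (auto simp: charts_at_iff)
  let ?E0 = "\<lambda>(p, v). exp_map A g p v" and ?w0 = "(p0, \<lambda>c. t0 *\<^sub>R \<xi> p0 c)"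
  obtain W where W: "diffeo (tangent_atlas A) A \<V> W ?E0" by (rule exp_diffeo)
  then have bij: "bij_betw ?E0 \<V> W" and smE: "smooth_map (tangent_atlas A) A \<V> ?E0"
    and smI: "smooth_map A (tangent_atlas A) W (inv_into \<V> ?E0)" by (auto simp: diffeo_def)
  have E0: "?E0 (p, \<lambda>c. t *\<^sub>R \<xi> p c) = flow p t" for p t by (simp add: generator_def)
  have inv: "flow p t \<in> W" "inv_into \<V> ?E0 (flow p t) = (p, \<lambda>c. t *\<^sub>R \<xi> p c)" if "t \<in> life p" for p t
  proof -
    show "flow p t \<in> W"
      unfolding E0[symmetric] by (rule bij_betwE[OF bij, rule_format, OF V_xi[OF that]])
    show "inv_into \<V> ?E0 (flow p t) = (p, \<lambda>c. t *\<^sub>R \<xi> p c)"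
      unfolding E0[symmetric] by (rule inv_into_f_f[OF bij_betw_imp_inj_on[OF bij] V_xi[OF that]])
  qed
  have w0: "tchart A c0 \<in> charts_at (tangent_atlas A) ?w0"
    using c0 by (simp add: charts_at_tangent_atlas[OF tangent_space_scale[OF xi_tangent[OF p0]]])
  have "c \<in> charts_at A (?E0 ?w0)" using c by (simp only: E0)
  with smE V_xi[OF t0] w0 obtain N E where N: "open N" "snd (tchart A c0) ?w0 \<in> N" "smooth_on N E"
    "\<forall>y\<in>\<V> \<inter> fst (tchart A c0). snd (tchart A c0) y \<in> N \<longrightarrow> ?E0 y \<in> fst c \<and> snd c (?E0 y) = E (snd (tchart A c0) y)"
    unfolding smooth_map_def by meson
  obtain N1 \<Xi> where N1: "open N1" "snd c0 p0 \<in> N1" "smooth_on N1 \<Xi>"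
    "\<And>p'. p' \<in> S \<Longrightarrow> p' \<in> fst c0 \<Longrightarrow> snd c0 p' \<in> N1 \<Longrightarrow> \<Xi> (snd c0 p') = \<xi> p' c0"
    using xi_chart[OF p0 c0] by blast
  obtain P where P: "open P" "\<And>p v. p \<in> fst c0 \<Longrightarrow> (p, v) \<in> \<V> \<Longrightarrow> (snd c0 p, v c0) \<in> P"
    "\<And>p t. p \<in> S \<Longrightarrow> p \<in> fst c0 \<Longrightarrow> (snd c0 p, t *\<^sub>R \<xi> p c0) \<in> P \<Longrightarrow> t \<in> life p"
    using V_chart[OF cA(1)] by blast
  define \<psi> where "\<psi> z = (fst z, snd z *\<^sub>R \<Xi> (fst z))" for z :: "'e \<times> real"
  have opN1: "open (N1 \<times> (UNIV :: real set))" using N1(1) by (simp add: open_Times)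
  have f1: "smooth_on (N1 \<times> (UNIV :: real set)) fst" "smooth_on (N1 \<times> (UNIV :: real set)) snd"
    by (rule smooth_on_bounded_linear[OF bounded_linear_fst opN1],
        rule smooth_on_bounded_linear[OF bounded_linear_snd opN1])
  have f2: "smooth_on (N1 \<times> (UNIV :: real set)) (\<lambda>z. \<Xi> (fst z))"
    by (rule smooth_on_compose[OF opN1 N1(1,3) f1(1)]) auto
  have \<psi>: "smooth_on (N1 \<times> UNIV) \<psi>"
    unfolding \<psi>_def by (rule smooth_on_Pair[OF opN1 f1(1) smooth_on_scaleR[OF opN1 f1(2) f2]])
  define Q where "Q = (N1 \<times> UNIV) \<inter> \<psi> -` (N \<inter> P)"
  have Q: "open Q" unfolding Q_def
    by (rule continuous_open_preimage[OF smooth_on_continuous[OF \<psi>] opN1]) (use N P in auto)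
  define H where "H z = E (\<psi> z)" for z
  have H: "smooth_on Q H" unfolding H_def
    by (rule smooth_on_compose[OF Q N(1,3) smooth_on_subset[OF \<psi>]]) (auto simp: Q_def)
  have \<psi>c: "\<psi> (snd c0 p, t) = (snd c0 p, t *\<^sub>R \<xi> p c0)" if "p \<in> S" "p \<in> fst c0" "snd c0 p \<in> N1" for p t
    using N1(4)[OF that] by (simp add: \<psi>_def)
  have z0: "(snd c0 p0, t0) \<in> Q"
    using N1(2) N(2) P(2)[OF cA(2) V_xi[OF t0]] \<psi>c[OF p0 cA(2) N1(2)] by (simp add: Q_def tchart_def)
  have QH: "t \<in> life p \<and> flow p t \<in> fst c \<and> snd c (flow p t) = H (snd c0 p, t)"
    if p: "p \<in> S" "p \<in> fst c0" "(snd c0 p, t) \<in> Q" for p t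
  proof -
    have pN: "snd c0 p \<in> N1" using p(3) by (simp add: Q_def)
    have "(snd c0 p, t *\<^sub>R \<xi> p c0) \<in> N \<inter> P" using p(3) \<psi>c[OF p(1,2) pN] by (simp add: Q_def)
    then have d: "t \<in> life p" and inN: "(snd c0 p, t *\<^sub>R \<xi> p c0) \<in> N" using P(3)[OF p(1,2)] by auto
    let ?w = "(p, \<lambda>c. t *\<^sub>R \<xi> p c)"
    have "?w \<in> \<V> \<inter> fst (tchart A c0)" "snd (tchart A c0) ?w = (snd c0 p, t *\<^sub>R \<xi> p c0)"
      using V_xi[OF d] p(2) tangent_space_scale[OF xi_tangent[OF p(1)]] by (simp_all add: tchart_def)
    with N(4) inN have "?E0 ?w \<in> fst c \<and> snd c (?E0 ?w) = E (snd c0 p, t *\<^sub>R \<xi> p c0)" by metis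
    then show ?thesis using d \<psi>c[OF p(1,2) pN] unfolding E0 H_def by simp
  qed
  have "tchart A c0 \<in> charts_at (tangent_atlas A) (inv_into \<V> ?E0 (flow p0 t0))"
    using w0 by (simp only: inv(2)[OF t0])
  with smI inv(1)[OF t0] c obtain N2 G where N2: "open N2" "snd c (flow p0 t0) \<in> N2" "smooth_on N2 G"
    "\<forall>y\<in>W \<inter> fst c. snd c y \<in> N2 \<longrightarrow> inv_into \<V> ?E0 y \<in> fst (tchart A c0) \<and>
      snd (tchart A c0) (inv_into \<V> ?E0 y) = G (snd c y)"
    unfolding smooth_map_def by meson
  have G: "p \<in> fst c0" "G (snd c (flow p t)) = (snd c0 p, t *\<^sub>R \<xi> p c0)"
    if "t \<in> life p" "flow p t \<in> fst c" "snd c (flow p t) \<in> N2" for p t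
    using N2(4)[rule_format, of "flow p t"] inv[OF that(1)] that(2,3) by (auto simp: tchart_def)
  define N1' where "N1' = N1 \<inter> \<Xi> -` (- {0})"
  have N1': "open N1'" unfolding N1'_def
    by (rule continuous_open_preimage[OF smooth_on_continuous[OF N1(3)] N1(1)]) auto
  define R0 where "R0 = N2 \<inter> G -` (N1' \<times> UNIV)"
  have R0: "open R0" unfolding R0_def
    by (rule continuous_open_preimage[OF smooth_on_continuous[OF N2(3)] N2(1)]) (simp add: open_Times N1')
  have GR: "smooth_on R0 G" using smooth_on_subset[OF N2(3)] by (simp add: R0_def)
  \<comment> \<open>The inverse exponential map returns the vector t \<xi>; a Euclidean quotient
    against \<Xi> extracts t. Restricting to \<open>R0\<close> keeps \<Xi> away from zero.\<close>
  define \<Theta> where "\<Theta> y = (fst (G y), (snd (G y) \<bullet> \<Xi> (fst (G y))) / (\<Xi> (fst (G y)) \<bullet> \<Xi> (fst (G y))))" for y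
  note s1 = smooth_on_fst[OF R0 GR] and s2 = smooth_on_snd[OF R0 GR]
  have s3: "smooth_on R0 (\<lambda>y. \<Xi> (fst (G y)))"
    by (rule smooth_on_compose[OF R0 N1(1,3) s1]) (auto simp: R0_def N1'_def)
  have \<Theta>: "smooth_on R0 \<Theta>" unfolding \<Theta>_def
    by (rule smooth_on_Pair[OF R0 s1 smooth_on_divide[OF R0 smooth_on_inner[OF R0 s2 s3] smooth_on_inner[OF R0 s3 s3]]])
      (auto simp: R0_def N1'_def)
  have \<Theta>c: "\<Theta> (snd c (flow p t)) = (snd c0 p, t)" "p \<in> fst c0"
    if h: "t \<in> life p" "flow p t \<in> fst c" "snd c (flow p t) \<in> R0" for p t
  proof -
    have "snd c (flow p t) \<in> N2" using h(3) by (simp add: R0_def)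
    note Gp = G[OF h(1,2) this]
    have "snd c0 p \<in> N1" using h(3) Gp(2) by (simp add: R0_def N1'_def)
    then have "\<Xi> (snd c0 p) = \<xi> p c0" using N1(4)[OF life_S[OF h(1)] Gp(1)] by simp
    moreover have "\<xi> p c0 \<noteq> 0"
      by (rule xi_chart_nonzero[OF life_S[OF h(1)]]) (use Gp(1) cA(1) in \<open>simp add: charts_at_iff\<close>)
    ultimately show "\<Theta> (snd c (flow p t)) = (snd c0 p, t)" by (simp add: \<Theta>_def Gp(2))
    show "p \<in> fst c0" by (rule Gp(1))
  qed
  define R where "R = R0 \<inter> \<Theta> -` Q"
  have R: "open R" unfolding R_def
    by (rule continuous_open_preimage[OF smooth_on_continuous[OF \<Theta>] R0 Q])
  have q0: "snd c (flow p0 t0) \<in> R0"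
    using N2(2) G[OF t0 cA(4) N2(2)] N1(2) N1(4)[OF p0 cA(2) N1(2)] xi_chart_nonzero[OF p0 c0]
    by (simp add: R0_def N1'_def)
  show ?thesis
  proof (rule that)
    show "local_flow c0 c Q H R \<Theta>"
      unfolding local_flow_def
      using cA Q H R smooth_on_subset[OF \<Theta>, of R] QH \<Theta>c by (auto simp: R_def)
    show "(snd c0 p0, t0) \<in> Q" by (rule z0)
    show "snd c (flow p0 t0) \<in> R" using q0 \<Theta>c(1)[OF t0 cA(4) q0] z0 by (simp add: R_def)
  qed
qed

lemma local_flowD:
  assumes "local_flow c0 c Q H R \<Theta>"
  shows "c0 \<in> A" "c \<in> A" "open Q" "smooth_on Q H" "open R" "smooth_on R \<Theta>" "\<Theta> ` R \<subseteq> Q"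
    "\<And>p t. p \<in> S \<Longrightarrow> p \<in> fst c0 \<Longrightarrow> (snd c0 p, t) \<in> Q \<Longrightarrow> t \<in> life p"
    "\<And>p t. p \<in> S \<Longrightarrow> p \<in> fst c0 \<Longrightarrow> (snd c0 p, t) \<in> Q \<Longrightarrow> flow p t \<in> fst c"
    "\<And>p t. p \<in> S \<Longrightarrow> p \<in> fst c0 \<Longrightarrow> (snd c0 p, t) \<in> Q \<Longrightarrow> snd c (flow p t) = H (snd c0 p, t)"
    "\<And>p t. t \<in> life p \<Longrightarrow> flow p t \<in> fst c \<Longrightarrow> snd c (flow p t) \<in> R \<Longrightarrow> p \<in> fst c0"
    "\<And>p t. t \<in> life p \<Longrightarrow> flow p t \<in> fst c \<Longrightarrow> snd c (flow p t) \<in> R \<Longrightarrow> \<Theta> (snd c (flow p t)) = (snd c0 p, t)"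
  using assms unfolding local_flow_def by blast+

text \<open>\<open>H\<close> represents the flow only over points of \<open>S\<close>, but the line
  along which t varies with fixed base point stays there, so the t-derivative of \<open>H\<close> is
  meaningful.\<close>

lemma velocity_flow_chart:
  assumes L: "local_flow c0 c Q H R \<Theta>" and p: "p \<in> S" "p \<in> fst c0" "(snd c0 p, t) \<in> Q"
  shows "velocity A (flow p) t c = Dat H (snd c0 p, t) (0, 1)"
proof -
  note D = local_flowD[OF L]
  have t: "t \<in> life p" "flow p t \<in> fst c" using D(8,9) p by auto
  have "((\<lambda>s. (snd c0 p, s)) has_vector_derivative (0, 1)) (at t)"
    by (auto intro!: derivative_eq_intros simp: has_vector_derivative_def)
  from has_vector_derivative_comp_Dat[OF D(4) this p(3)]
  have "((\<lambda>s. H (snd c0 p, s)) has_vector_derivative Dat H (snd c0 p, t) (0, 1)) (at t)" .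
  moreover have "open ((\<lambda>s. (snd c0 p, s)) -` Q)"
    by (intro open_vimage D(3) continuous_intros)
  ultimately have "((\<lambda>s. snd c (flow p s)) has_vector_derivative Dat H (snd c0 p, t) (0, 1)) (at t)"
    by (rule has_vector_derivative_transform_within_open) (use p D(10) in auto)
  then show ?thesis using t D(2) by (simp add: velocity_def charts_at_iff vector_derivative_at)
qed

text \<open>The right side is a smooth function of the coordinates on the open set \<open>R\<close>;
  it extends \<open>U\<close> off the hypersurface and makes it differentiable there.\<close>

lemma U_chart:
  assumes L: "local_flow c0 c Q H R \<Theta>" and q: "q \<in> \<Sigma>" "q \<in> fst c" "snd c q \<in> R"
  shows "U q c = Dat H (\<Theta> (snd c q)) (0, 1)"
proof -
  note D = local_flowD[OF L]
  obtain p t where t: "t \<in> life p" "q = flow p t" using q(1) \<Sigma>_iff by blast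
  have p: "p \<in> fst c0" "\<Theta> (snd c q) = (snd c0 p, t)" using D(11,12)[OF t(1)] q t(2) by auto
  have "(snd c0 p, t) \<in> Q" using D(7) q(3) p(2) by force
  from velocity_flow_chart[OF L life_S[OF t(1)] p(1) this] show ?thesis
    using U_eq[OF t(1)] t(2) p(2) by simp
qed

lemma U_chart_smooth:
  assumes L: "local_flow c0 c Q H R \<Theta>"
  shows "smooth_on R (\<lambda>y. Dat H (\<Theta> y) (0, 1))"
  using local_flowD[OF L] by (intro smooth_on_Dat_apply smooth_on_const)

lemma U_tangent: "q \<in> \<Sigma> \<Longrightarrow> U q \<in> tangent_space A q"
  using U_eq velocity_tangent[OF flow_smooth[OF life_S] life_open] by (auto simp: \<Sigma>_iff)

lemma local_flow_at:
  assumes q: "q \<in> \<Sigma>" and c: "c \<in> charts_at A q"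
  obtains c0 Q H R \<Theta> where "local_flow c0 c Q H R \<Theta>" "snd c q \<in> R"
proof -
  obtain p t where t: "t \<in> life p" "q = flow p t" using q \<Sigma>_iff by blast
  obtain c0 where c0: "c0 \<in> charts_at A p" using S_chart[OF life_S[OF t(1)]] by (elim exE)
  obtain Q H R \<Theta> where L: "local_flow c0 c Q H R \<Theta>" "snd c (flow p t) \<in> R"
    by (rule local_flow_exists[OF t(1) c0 c[unfolded t(2)]])
  show ?thesis by (rule that[OF L(1)]) (simp add: L(2) t(2))
qed

text \<open>Both claims rest on the extension of \<open>U\<close> by a smooth function on
  \<open>R\<close>. The chart formula in the second shows that the covariant derivative depends on
  the curve only through its point and its velocity.\<close>

lemma U_along:
  assumes \<sigma>: "smooth_map std_atlas A I \<sigma>" "\<sigma> ` I \<subseteq> \<Sigma>" and I: "open I"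
  shows "smooth_field_along A I \<sigma> (\<lambda>s. U (\<sigma> s))"
    "t \<in> I \<Longrightarrow> c \<in> charts_at A (\<sigma> t) \<Longrightarrow> local_flow c0 c Q H R \<Theta> \<Longrightarrow> snd c (\<sigma> t) \<in> R \<Longrightarrow>
      cov_along A g \<sigma> (\<lambda>s. U (\<sigma> s)) t c = Dat (\<lambda>y. Dat H (\<Theta> y) (0, 1)) (snd c (\<sigma> t)) (velocity A \<sigma> t c)
        + chr c (snd c (\<sigma> t)) (velocity A \<sigma> t c) (U (\<sigma> t) c)"
proof -
  have loc: "\<exists>N. open N \<and> t \<in> N \<and> N \<subseteq> I \<and> (\<forall>s\<in>N. \<sigma> s \<in> fst c \<and> snd c (\<sigma> s) \<in> R \<and>
      U (\<sigma> s) c = Dat H (\<Theta> (snd c (\<sigma> s))) (0, 1)) \<and> smooth_on N (\<lambda>s. snd c (\<sigma> s))"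
    if t: "t \<in> I" "c \<in> charts_at A (\<sigma> t)" and L: "local_flow c0 c Q H R \<Theta>" "snd c (\<sigma> t) \<in> R" for t c c0 Q H R \<Theta>
  proof -
    note D = local_flowD[OF L(1)]
    from smooth_map_curve[OF \<sigma>(1) I t] obtain N where N: "open N" "t \<in> N" "N \<subseteq> I" "\<And>s. s \<in> N \<Longrightarrow> \<sigma> s \<in> fst c"
      "smooth_on N (\<lambda>s. snd c (\<sigma> s))" by blast
    let ?N = "N \<inter> (\<lambda>s. snd c (\<sigma> s)) -` R"
    have op: "open ?N" by (rule continuous_open_preimage[OF smooth_on_continuous[OF N(5)] N(1) D(5)])
    have "U (\<sigma> s) c = Dat H (\<Theta> (snd c (\<sigma> s))) (0, 1)" if "s \<in> ?N" for s
      by (rule U_chart[OF L(1)]) (use that N(3,4) \<sigma>(2) in auto)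
    then show ?thesis
      using op N L(2) smooth_on_subset[OF N(5), of ?N] by (intro exI[of _ ?N]) auto
  qed
  show "smooth_field_along A I \<sigma> (\<lambda>s. U (\<sigma> s))"
  proof (rule field_alongI[OF I])
    show "U (\<sigma> t) \<in> tangent_space A (\<sigma> t)" if "t \<in> I" for t using that \<sigma>(2) by (intro U_tangent) auto
    fix t assume t: "t \<in> I"
    obtain c where c: "c \<in> charts_at A (\<sigma> t)" using smooth_map_point[OF \<sigma>(1) t] by blast
    have "\<sigma> t \<in> \<Sigma>" using \<sigma>(2) t by auto
    from local_flow_at[OF this c] obtain c0 Q H R \<Theta> where L: "local_flow c0 c Q H R \<Theta>" "snd c (\<sigma> t) \<in> R"
      by blast
    from loc[OF t c L] obtain N where N: "open N" "t \<in> N" "N \<subseteq> I" "\<forall>s\<in>N. \<sigma> s \<in> fst c \<and> snd c (\<sigma> s) \<in> R \<and>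
      U (\<sigma> s) c = Dat H (\<Theta> (snd c (\<sigma> s))) (0, 1)" "smooth_on N (\<lambda>s. snd c (\<sigma> s))" by blast
    have "smooth_on N (\<lambda>s. Dat H (\<Theta> (snd c (\<sigma> s))) (0, 1))"
      by (rule smooth_on_compose[OF N(1) local_flowD(5)[OF L(1)] U_chart_smooth[OF L(1)] N(5)]) (use N(4) in auto)
    then have "smooth_on N (\<lambda>s. U (\<sigma> s) c)" by (rule smooth_on_cong[OF N(1)]) (use N(4) in auto)
    then show "\<exists>c N. c \<in> charts_at A (\<sigma> t) \<and> open N \<and> t \<in> N \<and> (\<forall>s\<in>N. \<sigma> s \<in> fst c) \<and>
      smooth_on N (\<lambda>s. snd c (\<sigma> s)) \<and> smooth_on N (\<lambda>s. U (\<sigma> s) c)"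
      using c N by (intro exI[of _ c] exI[of _ N]) auto
  qed
  assume t: "t \<in> I" and c: "c \<in> charts_at A (\<sigma> t)" and L: "local_flow c0 c Q H R \<Theta>" "snd c (\<sigma> t) \<in> R"
  from loc[OF t c L] obtain N where N: "open N" "t \<in> N" "N \<subseteq> I" "\<forall>s\<in>N. \<sigma> s \<in> fst c \<and> snd c (\<sigma> s) \<in> R \<and>
    U (\<sigma> s) c = Dat H (\<Theta> (snd c (\<sigma> s))) (0, 1)" "smooth_on N (\<lambda>s. snd c (\<sigma> s))" by blast
  have "((\<lambda>s. Dat H (\<Theta> (snd c (\<sigma> s))) (0, 1)) has_vector_derivative
      Dat (\<lambda>y. Dat H (\<Theta> y) (0, 1)) (snd c (\<sigma> t)) (velocity A \<sigma> t c)) (at t)"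
    by (rule has_vector_derivative_comp_Dat[OF U_chart_smooth[OF L(1)] has_velocity[OF \<sigma>(1) I t c] L(2)])
  then have "((\<lambda>s. U (\<sigma> s) c) has_vector_derivative
      Dat (\<lambda>y. Dat H (\<Theta> y) (0, 1)) (snd c (\<sigma> t)) (velocity A \<sigma> t c)) (at t)"
    by (rule has_vector_derivative_transform_within_open[OF _ N(1,2)]) (use N(4) in auto)
  then show "cov_along A g \<sigma> (\<lambda>s. U (\<sigma> s)) t c = Dat (\<lambda>y. Dat H (\<Theta> y) (0, 1)) (snd c (\<sigma> t)) (velocity A \<sigma> t c)
        + chr c (snd c (\<sigma> t)) (velocity A \<sigma> t c) (U (\<sigma> t) c)"
    using c by (simp add: cov_along_def vector_derivative_at)
qed

section \<open>Covariant derivatives of \<open>U\<close> in directions tangent to the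
  hypersurface\<close>

lemma curves_throughE:
  assumes "\<sigma> \<in> curves_through A X p"
  obtains I where "open I" "0 \<in> I" "connected I" "\<sigma> ` I \<subseteq> X" "smooth_map std_atlas A I \<sigma>" "\<sigma> 0 = p"
proof -
  obtain \<epsilon> where "\<epsilon> > 0" "\<sigma> ` {-\<epsilon><..<\<epsilon>} \<subseteq> X" "smooth_map std_atlas A {-\<epsilon><..<\<epsilon>} \<sigma>" "\<sigma> 0 = p"
    using assms by (auto simp: curves_through_def)
  then show ?thesis by (intro that[of "{-\<epsilon><..<\<epsilon>}"]) auto
qed

lemma curves_throughI:
  assumes "open I" "0 \<in> I" "\<sigma> ` I \<subseteq> X" "smooth_map std_atlas A I \<sigma>" "\<sigma> 0 = p"
  shows "\<sigma> \<in> curves_through A X p"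
proof -
  obtain e where e: "e > 0" "ball 0 e \<subseteq> I" using assms(1,2) open_contains_ball by metis
  have "{-e<..<e} \<subseteq> I" using e(2) by (auto simp: subset_iff dist_real_def)
  then show ?thesis
    using e(1) assms smooth_map_std_subset[OF assms(4)] by (auto simp: curves_through_def intro!: exI[of _ e])
qed

text \<open>The definite description in \<open>nabla_sub\<close> requires all curves with the same
  velocity to give the same value, which the chart formula of \<open>U_along\<close>
  provides.\<close>

lemma nabla_sub_eq:
  assumes \<sigma>: "\<sigma> \<in> curves_through A \<Sigma> q"
  shows "nabla_sub A g \<Sigma> U q (velocity A \<sigma> 0) = cov_along A g \<sigma> (\<lambda>s. U (\<sigma> s)) 0"
    "cov_along A g \<sigma> (\<lambda>s. U (\<sigma> s)) 0 \<in> tangent_space A q"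
proof -
  have key: "cov_along A g \<sigma>' (\<lambda>s. U (\<sigma>' s)) 0 = cov_along A g \<sigma> (\<lambda>s. U (\<sigma> s)) 0"
    if \<sigma>': "\<sigma>' \<in> curves_through A \<Sigma> q" and v: "velocity A \<sigma>' 0 = velocity A \<sigma> 0" for \<sigma>'
  proof
    from curves_throughE[OF \<sigma>] obtain I where I: "open I" "0 \<in> I" "connected I" "\<sigma> ` I \<subseteq> \<Sigma>" "smooth_map std_atlas A I \<sigma>" "\<sigma> 0 = q" by blast
    from curves_throughE[OF \<sigma>'] obtain I' where I': "open I'" "0 \<in> I'" "connected I'" "\<sigma>' ` I' \<subseteq> \<Sigma>" "smooth_map std_atlas A I' \<sigma>'" "\<sigma>' 0 = q" by blast
    have q: "q \<in> \<Sigma>" using I by auto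
    fix c :: "('m, 'e) chart"
    show "cov_along A g \<sigma>' (\<lambda>s. U (\<sigma>' s)) 0 c = cov_along A g \<sigma> (\<lambda>s. U (\<sigma> s)) 0 c"
    proof (cases "c \<in> charts_at A q")
      case True
      from local_flow_at[OF q True] obtain c0 Q H R \<Theta> where L: "local_flow c0 c Q H R \<Theta>" "snd c q \<in> R" by blast
      show ?thesis
        using U_along(2)[OF I(5,4,1,2) _ L(1)] U_along(2)[OF I'(5,4,1,2) _ L(1)] True L(2) I(6) I'(6) v by simp
    qed (use I(6) I'(6) in \<open>simp add: cov_along_def\<close>)
  qed
  show "nabla_sub A g \<Sigma> U q (velocity A \<sigma> 0) = cov_along A g \<sigma> (\<lambda>s. U (\<sigma> s)) 0"
    unfolding nabla_sub_def
  proof (rule the_equality)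
    show "\<forall>\<sigma>'\<in>curves_through A \<Sigma> q. velocity A \<sigma>' 0 = velocity A \<sigma> 0 \<longrightarrow>
        cov_along A g \<sigma>' (\<lambda>s. U (\<sigma>' s)) 0 = cov_along A g \<sigma> (\<lambda>s. U (\<sigma> s)) 0"
      by (intro ballI impI) (rule key)
    show "w = cov_along A g \<sigma> (\<lambda>s. U (\<sigma> s)) 0"
      if "\<forall>\<sigma>'\<in>curves_through A \<Sigma> q. velocity A \<sigma>' 0 = velocity A \<sigma> 0 \<longrightarrow>
        cov_along A g \<sigma>' (\<lambda>s. U (\<sigma>' s)) 0 = w" for w
      using bspec[OF that \<sigma>] by simp
  qed
  from curves_throughE[OF \<sigma>] obtain I where I: "open I" "0 \<in> I" "connected I" "\<sigma> ` I \<subseteq> \<Sigma>" "smooth_map std_atlas A I \<sigma>" "\<sigma> 0 = q" by blast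
  show "cov_along A g \<sigma> (\<lambda>s. U (\<sigma> s)) 0 \<in> tangent_space A q"
    using cov_along_tangent[OF U_along(1)[OF I(5,4,1)] I(1,2)] I(6) by simp
qed

end

lemma smooth_map_atlas_mono:
  assumes f: "smooth_map X B I f" and "A \<subseteq> B" and "f ` I \<subseteq> points A"
  shows "smooth_map X A I f"
proof -
  have "charts_at A q \<subseteq> charts_at B q" for q using assms(2) by (auto simp: charts_at_def)
  then show ?thesis using f assms(3) unfolding smooth_map_def by (meson subsetD)
qed

section \<open>Curves in the submanifold transported along the generators\<close>

context null_generated
begin

lemma S_embedded: "embedded_submanifold A n S"
  using generation by (simp add: null_generation_def spacelike_submanifold_def)

text \<open>In a slice chart, straight lines inside \<open>L\<close> are curves in \<open>S\<close>.
  The slice chart need not belong to \<open>A\<close>, so the argument runs in the atlas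
  \<open>insert d A\<close>, and the derivative of the transition to \<open>c0\<close>, which is
  injective, transports \<open>L\<close>.\<close>

lemma slice_directions:
  assumes p: "p \<in> S" and c0: "c0 \<in> charts_at A p"
  obtains L where "subspace L" "dim L = n" "\<And>w. w \<in> L \<Longrightarrow> \<exists>\<sigma>\<in>curves_through A S p. velocity A \<sigma> 0 c0 = w"
proof -
  obtain d L where d: "p \<in> fst d" "fst d \<subseteq> points A" "smooth_atlas (insert d A)" and L: "subspace L" "dim L = n"
    and slice: "snd d ` (S \<inter> fst d) = L \<inter> snd d ` fst d"
    using S_embedded p unfolding embedded_submanifold_def by blast
  interpret B: atlas "insert d A" by unfold_locales (rule d(3))
  have dc: "d \<in> charts_at (insert d A) p" "c0 \<in> charts_at (insert d A) p"
    using d(1) c0 by (auto simp: charts_at_iff)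
  define \<tau> where "\<tau> = Dat (transition d c0) (snd d p)"
  have \<tau>: "linear \<tau>" unfolding \<tau>_def by (rule B.transition_linear[OF dc])
  have inj: "inj \<tau>" unfolding \<tau>_def by (rule inj_on_inverseI, rule B.transition_inverse[OF dc])
  have dpL: "snd d p \<in> L" using slice p d(1) by blast
  have "\<exists>\<sigma>\<in>curves_through A S p. velocity A \<sigma> 0 c0 = w" if w: "w \<in> \<tau> ` L" for w
  proof -
    obtain w0 where w0: "w0 \<in> L" "w = \<tau> w0" using w by blast
    define I where "I = (\<lambda>s. snd d p + s *\<^sub>R w0) -` (snd d ` fst d)"
    define \<sigma> where "\<sigma> s = inv_into (fst d) (snd d) (snd d p + s *\<^sub>R w0)" for s :: real
    have I: "open I" "0 \<in> I"
      unfolding I_def using d(1) by (auto intro!: open_vimage continuous_intros B.chart_open)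
    have \<sigma>: "\<sigma> s \<in> fst d" "snd d (\<sigma> s) = snd d p + s *\<^sub>R w0" "\<sigma> s \<in> S" if "s \<in> I" for s
    proof -
      have r: "snd d p + s *\<^sub>R w0 \<in> snd d ` fst d" using that by (simp add: I_def)
      show 1: "\<sigma> s \<in> fst d" "snd d (\<sigma> s) = snd d p + s *\<^sub>R w0"
        unfolding \<sigma>_def using inv_into_into[OF r] f_inv_into_f[OF r] by auto
      have "snd d p + s *\<^sub>R w0 \<in> L" using dpL w0(1) L(1) by (simp add: subspace_add subspace_scale)
      then have "snd d (\<sigma> s) \<in> snd d ` (S \<inter> fst d)" using slice r 1 by simp
      then obtain q where "q \<in> S" "q \<in> fst d" "snd d (\<sigma> s) = snd d q" by auto
      then show "\<sigma> s \<in> S" using inj_onD[OF B.chart_inj, of d "\<sigma> s" q] 1 by simp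
    qed
    have smd: "smooth_on I (\<lambda>s. snd d (\<sigma> s))"
    proof (rule smooth_on_cong[OF I(1)])
      show "smooth_on I (\<lambda>s. snd d p + s *\<^sub>R w0)"
        by (intro smooth_on_add smooth_on_const smooth_on_bounded_linear bounded_linear_scaleR_left I)
    qed (simp add: \<sigma>)
    have sm: "smooth_map std_atlas (insert d A) I \<sigma>"
      by (rule B.smooth_map_curveI) (use \<sigma> smd I in \<open>auto simp: charts_at_iff intro!: exI[of _ d] exI[of _ I] simp del: split_paired_Ex\<close>)
    have \<sigma>0: "\<sigma> 0 = p" using d(1) by (simp add: \<sigma>_def)
    have "smooth_map std_atlas A I \<sigma>"
      by (rule smooth_map_atlas_mono[OF sm]) (use \<sigma> d(2) in auto)
    then have "\<sigma> \<in> curves_through A S p" by (intro curves_throughI[OF I]) (use \<sigma> \<sigma>0 in auto)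
    moreover have "velocity A \<sigma> 0 c0 = w"
    proof -
      have "((\<lambda>s. snd d p + s *\<^sub>R w0) has_vector_derivative w0) (at 0)"
        by (auto intro!: derivative_eq_intros simp: has_vector_derivative_def)
      then have "((\<lambda>s. snd d (\<sigma> s)) has_vector_derivative w0) (at 0)"
        by (rule has_vector_derivative_transform_within_open[OF _ I]) (simp add: \<sigma>)
      then have "velocity (insert d A) \<sigma> 0 d = w0" using dc \<sigma>0 by (simp add: velocity_def vector_derivative_at)
      moreover have "velocity (insert d A) \<sigma> 0 c0 = Dat (transition d c0) (snd d p) (velocity (insert d A) \<sigma> 0 d)"
        by (rule B.tangent_transform[OF B.velocity_tangent[OF sm I], unfolded \<sigma>0, OF dc])
      moreover have "velocity A \<sigma> 0 c0 = velocity (insert d A) \<sigma> 0 c0"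
        using dc(2) c0 \<sigma>0 by (simp add: velocity_def)
      ultimately show ?thesis by (simp add: w0(2) \<tau>_def)
    qed
    ultimately show ?thesis by (intro bexI[of _ \<sigma>])
  qed
  note curves = this
  have s: "subspace (\<tau> ` L)" using linear_subspace_image[OF \<tau> L(1)] .
  have "dim (\<tau> ` L) = n" using dim_image_eq[OF \<tau>, of L] inj L(2) by (metis inj_on_subset subset_UNIV)
  from s this curves show ?thesis by (rule that)
qed

lemma slice_nbhd:
  assumes L: "local_flow c0 c Q H R \<Theta>" and \<sigma>: "\<sigma> \<in> curves_through A S p"
    and p: "p \<in> fst c0" "(snd c0 p, t) \<in> Q"
  obtains I where "open I" "0 \<in> I" "smooth_on I (\<lambda>s. snd c0 (\<sigma> s))"
    "\<And>s. s \<in> I \<Longrightarrow> \<sigma> s \<in> S \<and> \<sigma> s \<in> fst c0 \<and> (snd c0 (\<sigma> s), t + r * s) \<in> Q"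
    "((\<lambda>s. snd c0 (\<sigma> s)) has_vector_derivative velocity A \<sigma> 0 c0) (at 0)"
proof -
  note D = local_flowD[OF L]
  from curves_throughE[OF \<sigma>] obtain I0 where I0: "open I0" "0 \<in> I0" "connected I0" "\<sigma> ` I0 \<subseteq> S"
    "smooth_map std_atlas A I0 \<sigma>" "\<sigma> 0 = p" by blast
  have c0: "c0 \<in> charts_at A (\<sigma> 0)" using p D(1) I0(6) by (simp add: charts_at_iff)
  from smooth_map_curve[OF I0(5,1,2) c0] obtain N where N: "open N" "0 \<in> N" "N \<subseteq> I0" "\<And>s. s \<in> N \<Longrightarrow> \<sigma> s \<in> fst c0"
    "smooth_on N (\<lambda>s. snd c0 (\<sigma> s))" by blast
  let ?I = "N \<inter> (\<lambda>s. (snd c0 (\<sigma> s), t + r * s)) -` Q"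
  have op: "open ?I"
    by (intro continuous_open_preimage continuous_on_Pair smooth_on_continuous[OF N(5)] N(1) D(3) continuous_intros)
  show ?thesis
  proof (rule that[OF op])
    show "0 \<in> ?I" using N(2) p(2) I0(6) by simp
    show "smooth_on ?I (\<lambda>s. snd c0 (\<sigma> s))" by (rule smooth_on_subset[OF N(5)]) auto
    show "\<sigma> s \<in> S \<and> \<sigma> s \<in> fst c0 \<and> (snd c0 (\<sigma> s), t + r * s) \<in> Q" if "s \<in> ?I" for s
      using that N(3,4) I0(4) by auto
    show "((\<lambda>s. snd c0 (\<sigma> s)) has_vector_derivative velocity A \<sigma> 0 c0) (at 0)"
      by (rule has_velocity[OF I0(5,1,2) c0])
  qed
qed

text \<open>The speed \<open>r\<close> along the generator lets one computation serve both for
  push-forwards of vectors of \<open>S\<close> (r = 0) and for \<open>U\<close> (constant \<sigma>,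
  r = 1). The third claim inverts the derivative of \<open>H\<close> just on vectors tangent to S x
  R, where \<open>H\<close> really represents the flow; it yields the linear independence needed
  later.\<close>

lemma slice_velocity:
  assumes L: "local_flow c0 c Q H R \<Theta>" and \<sigma>: "\<sigma> \<in> curves_through A S p"
    and p: "p \<in> fst c0" "(snd c0 p, t) \<in> Q"
  shows "(\<lambda>s. flow (\<sigma> s) (t + r * s)) \<in> curves_through A \<Sigma> (flow p t)"
    "velocity A (\<lambda>s. flow (\<sigma> s) (t + r * s)) 0 c = Dat H (snd c0 p, t) (velocity A \<sigma> 0 c0, r)"
    "snd c (flow p t) \<in> R \<Longrightarrow> Dat \<Theta> (snd c (flow p t)) (Dat H (snd c0 p, t) (velocity A \<sigma> 0 c0, r)) = (velocity A \<sigma> 0 c0, r)"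
proof -
  note D = local_flowD[OF L]
  from slice_nbhd[OF assms, of r] obtain I where I: "open I" "0 \<in> I" "smooth_on I (\<lambda>s. snd c0 (\<sigma> s))"
    "\<And>s. s \<in> I \<Longrightarrow> \<sigma> s \<in> S \<and> \<sigma> s \<in> fst c0 \<and> (snd c0 (\<sigma> s), t + r * s) \<in> Q"
    "((\<lambda>s. snd c0 (\<sigma> s)) has_vector_derivative velocity A \<sigma> 0 c0) (at 0)" by blast
  have \<sigma>0: "\<sigma> 0 = p" using \<sigma> by (simp add: curves_through_def)
  let ?\<beta> = "\<lambda>s. flow (\<sigma> s) (t + r * s)" and ?b = "\<lambda>s. (snd c0 (\<sigma> s), t + r * s)"
  have \<beta>: "?\<beta> s \<in> \<Sigma>" "?\<beta> s \<in> fst c" "snd c (?\<beta> s) = H (?b s)" "t + r * s \<in> life (\<sigma> s)" if "s \<in> I" for s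
    using D(8,9,10)[of "\<sigma> s" "t + r * s"] I(4)[OF that] \<Sigma>_iff by auto
  have b: "smooth_on I ?b"
    by (intro smooth_on_Pair smooth_on_add smooth_on_const smooth_on_bounded_linear bounded_linear_mult_right I)
  have Hb: "smooth_on I (\<lambda>s. H (?b s))"
    by (rule smooth_on_compose[OF I(1) D(3,4) b]) (use I(4) in auto)
  have smc: "smooth_on I (\<lambda>s. snd c (?\<beta> s))" by (rule smooth_on_cong[OF I(1) Hb]) (simp add: \<beta>(3))
  have sm: "smooth_map std_atlas A I ?\<beta>"
    by (rule smooth_map_curveI[of I ?\<beta>]) (use \<beta>(2) smc I(1) D(2) in \<open>auto simp: charts_at_iff intro!: exI[of _ c] exI[of _ I] simp del: split_paired_Ex\<close>)
  show curve: "?\<beta> \<in> curves_through A \<Sigma> (flow p t)"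
    by (rule curves_throughI[OF I(1,2) _ sm]) (use \<beta>(1) \<sigma>0 in auto)
  have bd: "(?b has_vector_derivative (velocity A \<sigma> 0 c0, r)) (at 0)"
    by (intro has_vector_derivative_Pair I(5)) (auto intro!: derivative_eq_intros simp: has_vector_derivative_def)
  have b0: "?b 0 = (snd c0 p, t)" by (simp add: \<sigma>0)
  have "((\<lambda>s. H (?b s)) has_vector_derivative Dat H (?b 0) (velocity A \<sigma> 0 c0, r)) (at 0)"
    by (rule has_vector_derivative_comp_Dat[OF D(4) bd]) (use p(2) b0 in simp)
  then have Hd: "((\<lambda>s. snd c (?\<beta> s)) has_vector_derivative Dat H (?b 0) (velocity A \<sigma> 0 c0, r)) (at 0)"
    by (rule has_vector_derivative_transform_within_open[OF _ I(1,2)]) (simp add: \<beta>(3))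
  have "c \<in> charts_at A (?\<beta> 0)" using \<beta>(2)[OF I(2)] D(2) by (simp add: charts_at_iff)
  then show "velocity A ?\<beta> 0 c = Dat H (snd c0 p, t) (velocity A \<sigma> 0 c0, r)"
    using vector_derivative_at[OF Hd] b0 by (simp add: velocity_def)
  assume R: "snd c (flow p t) \<in> R"
  let ?M = "I \<inter> (\<lambda>s. snd c (?\<beta> s)) -` R"
  have M: "open ?M" by (rule continuous_open_preimage[OF smooth_on_continuous[OF smc] I(1) D(5)])
  have M0: "0 \<in> ?M" using I(2) R \<sigma>0 by simp
  have "((\<lambda>s. \<Theta> (snd c (?\<beta> s))) has_vector_derivative
      Dat \<Theta> (snd c (?\<beta> 0)) (Dat H (?b 0) (velocity A \<sigma> 0 c0, r))) (at 0)"
    by (rule has_vector_derivative_comp_Dat[OF D(6) Hd]) (use R \<sigma>0 in simp)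
  then have "(?b has_vector_derivative
      Dat \<Theta> (snd c (?\<beta> 0)) (Dat H (?b 0) (velocity A \<sigma> 0 c0, r))) (at 0)"
  proof (rule has_vector_derivative_transform_within_open[OF _ M M0])
    show "\<Theta> (snd c (?\<beta> s)) = ?b s" if "s \<in> ?M" for s
      using that by (intro D(12) \<beta>) auto
  qed
  from vector_derivative_unique_at[OF this bd]
  show "Dat \<Theta> (snd c (flow p t)) (Dat H (snd c0 p, t) (velocity A \<sigma> 0 c0, r)) = (velocity A \<sigma> 0 c0, r)"
    using \<sigma>0 by simp
qed

lemma local_flow_at':
  assumes t: "t \<in> life p" and c: "c \<in> charts_at A (flow p t)"
  obtains c0 Q H R \<Theta> where "local_flow c0 c Q H R \<Theta>" "p \<in> fst c0" "(snd c0 p, t) \<in> Q" "snd c (flow p t) \<in> R"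
proof -
  obtain c0 where c0: "c0 \<in> charts_at A p" using S_chart[OF life_S[OF t]] by (elim exE)
  then have p0: "p \<in> fst c0" by (simp add: charts_at_iff)
  obtain Q H R \<Theta> where L: "local_flow c0 c Q H R \<Theta>" "(snd c0 p, t) \<in> Q" "snd c (flow p t) \<in> R"
    by (rule local_flow_exists[OF t c0 c])
  show ?thesis by (rule that[OF L(1) p0 L(2,3)])
qed

lemma flow_chart: "t \<in> life p \<Longrightarrow> \<exists>c. c \<in> charts_at A (flow p t)"
  using flow_points charts_at_nonempty[of "flow p t" A] by simp

lemma slice_curve:
  assumes t: "t \<in> life p" and \<sigma>: "\<sigma> \<in> curves_through A S p"
  shows "(\<lambda>s. flow (\<sigma> s) (t + r * s)) \<in> curves_through A \<Sigma> (flow p t)"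
proof -
  obtain c where c: "c \<in> charts_at A (flow p t)" using flow_chart[OF t] by (elim exE)
  obtain c0 Q H R \<Theta> where L: "local_flow c0 c Q H R \<Theta>" "p \<in> fst c0" "(snd c0 p, t) \<in> Q" "snd c (flow p t) \<in> R"
    by (rule local_flow_at'[OF t c])
  show ?thesis by (rule slice_velocity(1)[OF L(1) \<sigma> L(2,3)])
qed

text \<open>With the constant curve, the statements about transported curves specialize to the
  generator through \<open>p\<close>.\<close>

lemma constant_curve: assumes p: "p \<in> S" shows "(\<lambda>_. p) \<in> curves_through A S p" "velocity A (\<lambda>_. p) 0 = (\<lambda>_. 0)"
proof -
  obtain c where c: "c \<in> charts_at A p" using S_chart[OF p] by (elim exE)
  have "smooth_map std_atlas A (UNIV :: real set) (\<lambda>_. p)"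
    by (rule smooth_map_curveI[of UNIV "\<lambda>_. p"])
      (use c in \<open>auto simp: charts_at_iff smooth_on_const intro!: exI[of _ c] exI[of _ UNIV] simp del: split_paired_Ex\<close>)
  then show "(\<lambda>_. p) \<in> curves_through A S p" using p by (intro curves_throughI[of UNIV]) auto
  show "velocity A (\<lambda>_. p) 0 = (\<lambda>_. 0)" by (auto simp: velocity_def)
qed

text \<open>The push-forward along a generator of the initial velocity of \<open>\<sigma>\<close>, and the covariant derivative
  of \<open>U\<close> in its direction.\<close>

definition slice_field :: "(real \<Rightarrow> 'm) \<Rightarrow> real \<Rightarrow> ('m, 'e) tvec" where
  "slice_field \<sigma> t = velocity A (\<lambda>s. flow (\<sigma> s) t) 0"

definition slice_rotation :: "(real \<Rightarrow> 'm) \<Rightarrow> real \<Rightarrow> ('m, 'e) tvec" where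
  "slice_rotation \<sigma> t = cov_along A g (\<lambda>s. flow (\<sigma> s) t) (\<lambda>s. U (flow (\<sigma> s) t)) 0"

lemma slice_field_sub_tangent:
  assumes "t \<in> life p" "\<sigma> \<in> curves_through A S p"
  shows "(\<lambda>s. flow (\<sigma> s) t) \<in> curves_through A \<Sigma> (flow p t)" "slice_field \<sigma> t \<in> sub_tangent A \<Sigma> (flow p t)"
proof -
  show 1: "(\<lambda>s. flow (\<sigma> s) t) \<in> curves_through A \<Sigma> (flow p t)"
    using slice_curve[OF assms, of 0] by simp
  then show "slice_field \<sigma> t \<in> sub_tangent A \<Sigma> (flow p t)" by (auto simp: sub_tangent_def slice_field_def)
qed

lemma U_sub_tangent:
  assumes t: "t \<in> life p"
  shows "U (flow p t) \<in> sub_tangent A \<Sigma> (flow p t)"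
proof -
  note cc = constant_curve[OF life_S[OF t]]
  let ?\<beta> = "\<lambda>s. flow p (t + 1 * s)"
  have curve: "?\<beta> \<in> curves_through A \<Sigma> (flow p t)" using slice_curve[OF t cc(1), of 1] by simp
  obtain c where c: "c \<in> charts_at A (flow p t)" using flow_chart[OF t] by (elim exE)
  obtain c0 Q H R \<Theta> where L: "local_flow c0 c Q H R \<Theta>" "p \<in> fst c0" "(snd c0 p, t) \<in> Q" "snd c (flow p t) \<in> R"
    by (rule local_flow_at'[OF t c])
  have vT: "velocity A ?\<beta> 0 \<in> tangent_space A (flow p t)"
    by (rule sub_tangent_tangent[of _ \<Sigma>]) (use curve in \<open>auto simp: sub_tangent_def\<close>)
  have "velocity A ?\<beta> 0 c = Dat H (snd c0 p, t) (0, 1)"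
    using slice_velocity(2)[OF L(1) cc(1) L(2,3), of 1] cc(2) by simp
  also have "\<dots> = U (flow p t) c" using velocity_flow_chart[OF L(1) life_S[OF t] L(2,3)] U_eq[OF t] by simp
  finally have "velocity A ?\<beta> 0 = U (flow p t)"
    by (intro tangent_eqI[OF vT U_tangent c]) (use t \<Sigma>_iff in auto)
  then show ?thesis using curve by (metis (mono_tags, lifting) mem_Collect_eq sub_tangent_def)
qed

lemma slice_rotation_nabla:
  assumes t: "t \<in> life p" and \<sigma>: "\<sigma> \<in> curves_through A S p"
  shows "nabla_sub A g \<Sigma> U (flow p t) (slice_field \<sigma> t) = slice_rotation \<sigma> t" "slice_rotation \<sigma> t \<in> tangent_space A (flow p t)"
  using nabla_sub_eq[OF slice_field_sub_tangent(1)[OF assms]] by (simp_all add: slice_field_def slice_rotation_def)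

text \<open>Brings the family of generators over \<sigma> into one chart, as a smooth map of two
  real variables. Its s-derivative is the push-forward, its t-derivative is \<open>U\<close>, and
  the conclusions are shaped to fit \<open>geodesic_variation\<close>.\<close>

lemma slice_family:
  assumes L: "local_flow c0 c Q H R \<Theta>" and \<sigma>: "\<sigma> \<in> curves_through A S p"
    and p: "p \<in> fst c0" "(snd c0 p, t0) \<in> Q"
  obtains h :: "real \<times> real \<Rightarrow> 'e" and W where "open W" "(0, t0) \<in> W" "smooth_on W h" "h ` W \<subseteq> snd c ` fst c"
    "\<And>s t. (s, t) \<in> W \<Longrightarrow> t \<in> life (\<sigma> s) \<and> flow (\<sigma> s) t \<in> fst c \<and> h (s, t) = snd c (flow (\<sigma> s) t)"
    "\<And>s t. (s, t) \<in> W \<Longrightarrow> Dat h (s, t) (0, 1) = U (flow (\<sigma> s) t) c"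
    "\<And>z. z \<in> W \<Longrightarrow> Dat (\<lambda>z. Dat h z (0, 1)) z (0, 1) + chr c (h z) (Dat h z (0, 1)) (Dat h z (0, 1)) = 0"
    "\<And>t. (0, t) \<in> W \<Longrightarrow> slice_field \<sigma> t c = Dat h (0, t) (1, 0)"
    "\<And>t. (0, t) \<in> W \<Longrightarrow> slice_rotation \<sigma> t c = Dat (\<lambda>z. Dat h z (0, 1)) (0, t) (1, 0) + chr c (h (0, t)) (Dat h (0, t) (1, 0)) (Dat h (0, t) (0, 1))"
proof -
  note D = local_flowD[OF L]
  have \<sigma>0: "\<sigma> 0 = p" using \<sigma> by (simp add: curves_through_def)
  from slice_nbhd[OF assms, of 0] obtain I where I: "open I" "0 \<in> I" "smooth_on I (\<lambda>s. snd c0 (\<sigma> s))"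
    "\<And>s. s \<in> I \<Longrightarrow> \<sigma> s \<in> S \<and> \<sigma> s \<in> fst c0 \<and> (snd c0 (\<sigma> s), t0 + 0 * s) \<in> Q"
    "((\<lambda>s. snd c0 (\<sigma> s)) has_vector_derivative velocity A \<sigma> 0 c0) (at 0)" by blast
  define b where "b z = (snd c0 (\<sigma> (fst z)), snd z)" for z :: "real \<times> real"
  define h where "h z = H (b z)" for z
  have op0: "open (I \<times> (UNIV :: real set))" using I(1) by (simp add: open_Times)
  have b: "smooth_on (I \<times> UNIV) b"
    unfolding b_def
  proof (rule smooth_on_Pair[OF op0 smooth_on_compose[OF op0 I(1,3)]])
    show "smooth_on (I \<times> (UNIV :: real set)) fst" "smooth_on (I \<times> (UNIV :: real set)) snd"
      by (rule smooth_on_bounded_linear[OF bounded_linear_fst op0], rule smooth_on_bounded_linear[OF bounded_linear_snd op0])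
  qed auto
  define W where "W = (I \<times> UNIV) \<inter> b -` Q"
  have W: "open W" unfolding W_def
    by (rule continuous_open_preimage[OF smooth_on_continuous[OF b] op0 D(3)])
  have h: "smooth_on W h" unfolding h_def
    by (rule smooth_on_compose[OF W D(3,4) smooth_on_subset[OF b]]) (auto simp: W_def)
  have Wp: "\<sigma> s \<in> S" "\<sigma> s \<in> fst c0" "(snd c0 (\<sigma> s), t) \<in> Q" if "(s, t) \<in> W" for s t
    using that I(4)[of s] by (auto simp: W_def b_def)
  have pt: "t \<in> life (\<sigma> s) \<and> flow (\<sigma> s) t \<in> fst c \<and> h (s, t) = snd c (flow (\<sigma> s) t)" if "(s, t) \<in> W" for s t
    using D(8,9,10)[OF Wp[OF that]] by (simp add: h_def b_def)
  have t_line: "((\<lambda>t. k (s, t)) has_vector_derivative Dat k (s, t) (0, 1)) (at t)"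
    if "smooth_on W k" "(s, t) \<in> W" for k :: "real \<times> real \<Rightarrow> 'e" and s t
    by (rule has_vector_derivative_comp_Dat[where g = "\<lambda>t. (s, t)", OF that(1) _ that(2)])
      (auto intro!: derivative_eq_intros simp: has_vector_derivative_def)
  have s_line: "((\<lambda>s. k (s, t)) has_vector_derivative Dat k (s, t) (1, 0)) (at s)"
    if "smooth_on W k" "(s, t) \<in> W" for k :: "real \<times> real \<Rightarrow> 'e" and s t
    by (rule has_vector_derivative_comp_Dat[where g = "\<lambda>s. (s, t)", OF that(1) _ that(2)])
      (auto intro!: derivative_eq_intros simp: has_vector_derivative_def)
  have opt: "open ((\<lambda>t. (s, t)) -` W)" for s :: real by (intro open_vimage W continuous_intros)
  have ops: "open ((\<lambda>s. (s, t)) -` W)" for t :: real by (intro open_vimage W continuous_intros)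
  have ht: "Dat h (s, t) (0, 1) = U (flow (\<sigma> s) t) c" if "(s, t) \<in> W" for s t
  proof -
    have "((\<lambda>t. snd c (flow (\<sigma> s) t)) has_vector_derivative Dat h (s, t) (0, 1)) (at t)"
      by (rule has_vector_derivative_transform_within_open[OF t_line[OF h that] opt[of s]]) (use that pt in auto)
    then show ?thesis
      using pt[OF that] D(2) by (simp add: U_eq velocity_def charts_at_iff vector_derivative_at)
  qed
  note hts = smooth_on_Dat[OF h, of "(0, 1)"]
  show ?thesis
  proof (rule that[OF W _ h _ pt ht])
    show "(0, t0) \<in> W" using I(2) p(2) \<sigma>0 by (simp add: W_def b_def)
    show "h ` W \<subseteq> snd c ` fst c" using pt by auto
    fix z assume z: "z \<in> W"
    obtain s t where st: "z = (s, t)" by (cases z)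
    have stW: "(s, t) \<in> W" using z st by simp
    have cs: "c \<in> charts_at A (flow (\<sigma> s) t)" using pt[OF stW] D(2) by (simp add: charts_at_iff)
    have "t \<in> life (\<sigma> s)" using pt[OF stW] by simp
    note ode = geodesic_ode[OF flow_geodesic(1)[OF Wp(1)[OF stW]] life_open this cs]
    have eqv: "velocity A (flow (\<sigma> s)) t c = Dat h (s, t) (0, 1)" if "(s, t) \<in> W" for t
      using ht[OF that] U_eq pt[OF that] by simp
    have "((\<lambda>t. velocity A (flow (\<sigma> s)) t c) has_vector_derivative Dat (\<lambda>z. Dat h z (0, 1)) (s, t) (0, 1)) (at t)"
      by (rule has_vector_derivative_transform_within_open[OF t_line[OF hts stW] opt[of s]]) (use stW eqv in auto)
    from vector_derivative_unique_at[OF this ode]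
    show "Dat (\<lambda>z. Dat h z (0, 1)) z (0, 1) + chr c (h z) (Dat h z (0, 1)) (Dat h z (0, 1)) = 0"
      using pt[OF stW] by (simp add: st eqv[OF stW])
  next
    fix t assume t: "(0, t) \<in> W"
    have cs: "c \<in> charts_at A (flow (\<sigma> 0) t)" using pt[OF t] D(2) by (simp add: charts_at_iff)
    have "((\<lambda>s. snd c (flow (\<sigma> s) t)) has_vector_derivative Dat h (0, t) (1, 0)) (at 0)"
      by (rule has_vector_derivative_transform_within_open[OF s_line[OF h t] ops[of t]]) (use t pt in auto)
    then show X: "slice_field \<sigma> t c = Dat h (0, t) (1, 0)"
      using cs by (simp add: slice_field_def velocity_def vector_derivative_at)
    have "((\<lambda>s. U (flow (\<sigma> s) t) c) has_vector_derivative Dat (\<lambda>z. Dat h z (0, 1)) (0, t) (1, 0)) (at 0)"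
      by (rule has_vector_derivative_transform_within_open[OF s_line[OF hts t] ops[of t]]) (use t ht in auto)
    then show "slice_rotation \<sigma> t c = Dat (\<lambda>z. Dat h z (0, 1)) (0, t) (1, 0) + chr c (h (0, t)) (Dat h (0, t) (1, 0)) (Dat h (0, t) (0, 1))"
      using cs pt[OF t] by (simp add: slice_rotation_def cov_along_def vector_derivative_at X[symmetric] ht[OF t]) (simp add: slice_field_def)
  qed
qed

end

section \<open>The null hyperplane orthogonal to \<open>U\<close>\<close>

context lorentz
begin

lemma g_zero: "p \<in> points A \<Longrightarrow> w \<in> tangent_space A p \<Longrightarrow> g p (\<lambda>_. 0) w = 0"
  using g_lin[of p w w w 0 0] by simp

text \<open>A linear form vanishing on the kernel of g(U, .) is a multiple of it, and nondegeneracy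
  transfers this from forms to vectors.\<close>

lemma normal_of_null_hyperplane:
  assumes c: "c \<in> charts_at A p" and U: "U \<noteq> 0"
    and w: "\<And>y. mc c (snd c p) U y = 0 \<Longrightarrow> mc c (snd c p) w y = 0"
  shows "\<exists>k. w = k *\<^sub>R U"
proof -
  let ?m = "mc c (snd c p)"
  note l = bilinear_left[OF mc_bilinear[OF c]] and r = bilinear_right[OF mc_bilinear[OF c]]
  obtain V where V: "?m U V \<noteq> 0" using mc_nondegenerate[OF c, of U] U by blast
  define k where "k = ?m w V / ?m U V"
  have "w - k *\<^sub>R U = 0"
  proof (rule mc_nondegenerate[OF c])
    fix y
    define a where "a = ?m U y / ?m U V"
    have "?m U (y - a *\<^sub>R V) = 0" using V by (simp add: linear_diff[OF r] linear_scale[OF r] a_def)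
    from w[OF this] have "?m w y = a * ?m w V" by (simp add: linear_diff[OF r] linear_scale[OF r])
    then show "?m (w - k *\<^sub>R U) y = 0"
      using V by (simp add: linear_diff[OF l] linear_scale[OF l] a_def k_def)
  qed
  then show ?thesis by (intro exI[of _ k]) simp
qed

end

context null_generated
begin

lemma flow_\<Sigma>: "t \<in> life p \<Longrightarrow> flow p t \<in> \<Sigma>"
  by (auto simp: \<Sigma>_iff)

text \<open>The second claim is \<nabla>_U X = \<nabla>_X U: the mixed second derivatives of the
  two-parameter map agree, and the Christoffel symbol is symmetric.\<close>

lemma slice_field_smooth:
  assumes p: "p \<in> S" and \<sigma>: "\<sigma> \<in> curves_through A S p"
  shows "smooth_field_along A (life p) (flow p) (slice_field \<sigma>)"
    "t \<in> life p \<Longrightarrow> cov_along A g (flow p) (slice_field \<sigma>) t = slice_rotation \<sigma> t"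
proof -
  have \<sigma>0: "\<sigma> 0 = p" using \<sigma> by (simp add: curves_through_def)
  have T: "slice_field \<sigma> t \<in> tangent_space A (flow p t)" if "t \<in> life p" for t
    using sub_tangent_tangent[OF slice_field_sub_tangent(2)[OF that \<sigma>]] .
  have loc: "\<exists>N (h :: real \<times> real \<Rightarrow> 'e) W. open N \<and> t \<in> N \<and> (\<forall>s\<in>N. flow p s \<in> fst c \<and> snd c (flow p s) = h (0, s) \<and> (0, s) \<in> W \<and>
      slice_field \<sigma> s c = Dat h (0, s) (1, 0)) \<and> open W \<and> smooth_on W h \<and> Dat h (0, t) (0, 1) = U (flow p t) c \<and>
      slice_rotation \<sigma> t c = Dat (\<lambda>z. Dat h z (0, 1)) (0, t) (1, 0) + chr c (h (0, t)) (Dat h (0, t) (1, 0)) (Dat h (0, t) (0, 1))"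
    if t: "t \<in> life p" and c: "c \<in> charts_at A (flow p t)" for t c
  proof -
    obtain c0 Q H R \<Theta> where L: "local_flow c0 c Q H R \<Theta>" "p \<in> fst c0" "(snd c0 p, t) \<in> Q" "snd c (flow p t) \<in> R"
      by (rule local_flow_at'[OF t c])
    show ?thesis
  proof (rule slice_family[OF L(1) \<sigma> L(2,3)])
    fix h :: "real \<times> real \<Rightarrow> 'e" and W assume W: "open W" "(0, t) \<in> W" "smooth_on W h" "h ` W \<subseteq> snd c ` fst c"
      and 1: "\<And>s t. (s, t) \<in> W \<Longrightarrow> t \<in> life (\<sigma> s) \<and> flow (\<sigma> s) t \<in> fst c \<and> h (s, t) = snd c (flow (\<sigma> s) t)"
        "\<And>s t. (s, t) \<in> W \<Longrightarrow> Dat h (s, t) (0, 1) = U (flow (\<sigma> s) t) c"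
        "\<And>z. z \<in> W \<Longrightarrow> Dat (\<lambda>z. Dat h z (0, 1)) z (0, 1) + chr c (h z) (Dat h z (0, 1)) (Dat h z (0, 1)) = 0"
        "\<And>t. (0, t) \<in> W \<Longrightarrow> slice_field \<sigma> t c = Dat h (0, t) (1, 0)"
        "\<And>t. (0, t) \<in> W \<Longrightarrow> slice_rotation \<sigma> t c = Dat (\<lambda>z. Dat h z (0, 1)) (0, t) (1, 0) + chr c (h (0, t)) (Dat h (0, t) (1, 0)) (Dat h (0, t) (0, 1))"
    have "open ((\<lambda>s. (0, s)) -` W)" by (intro open_vimage W continuous_intros)
    then show ?thesis
      using W 1(1)[of 0] 1(2)[of 0 t] 1(4) 1(5)[of t] \<sigma>0
      by (intro exI[of _ "(\<lambda>s. (0, s)) -` W"] exI[of _ h] exI[of _ W]) auto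
    qed
  qed
  show fld: "smooth_field_along A (life p) (flow p) (slice_field \<sigma>)"
  proof (rule field_alongI[OF life_open T])
    fix t assume t: "t \<in> life p"
    obtain c where c: "c \<in> charts_at A (flow p t)" using flow_chart[OF t] by (elim exE)
    obtain N and h :: "real \<times> real \<Rightarrow> 'e" and W where N: "open N" "t \<in> N" "\<forall>s\<in>N. flow p s \<in> fst c \<and> snd c (flow p s) = h (0, s) \<and> (0, s) \<in> W \<and>
      slice_field \<sigma> s c = Dat h (0, s) (1, 0)" "open W" "smooth_on W h"
      using loc[OF t c] by blast
    have line: "smooth_on N (\<lambda>s. (0::real, s))"
      by (intro smooth_on_Pair smooth_on_const smooth_on_ident N(1))
    have "smooth_on N (\<lambda>s. h (0, s))"
      by (rule smooth_on_compose[OF N(1,4,5) line]) (use N(3) in auto)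
    then have 1: "smooth_on N (\<lambda>s. snd c (flow p s))" by (rule smooth_on_cong[OF N(1)]) (use N(3) in auto)
    have "smooth_on N (\<lambda>s. Dat h (0, s) (1, 0))"
      by (rule smooth_on_compose[OF N(1,4) smooth_on_Dat[OF N(5)] line]) (use N(3) in auto)
    then have "smooth_on N (\<lambda>s. slice_field \<sigma> s c)" by (rule smooth_on_cong[OF N(1)]) (use N(3) in auto)
    then show "\<exists>c N. c \<in> charts_at A (flow p t) \<and> open N \<and> t \<in> N \<and> (\<forall>s\<in>N. flow p s \<in> fst c) \<and>
        smooth_on N (\<lambda>s. snd c (flow p s)) \<and> smooth_on N (\<lambda>s. slice_field \<sigma> s c)"
      using c N 1 by (intro exI[of _ c] exI[of _ N]) auto
  qed
  assume t: "t \<in> life p"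
  obtain c where c: "c \<in> charts_at A (flow p t)" using flow_chart[OF t] by (elim exE)
  show "cov_along A g (flow p) (slice_field \<sigma>) t = slice_rotation \<sigma> t"
  proof (rule tangent_eqI[OF cov_along_tangent[OF fld life_open t] slice_rotation_nabla(2)[OF t \<sigma>] c])
    obtain N and h :: "real \<times> real \<Rightarrow> 'e" and W where N: "open N" "t \<in> N" "\<forall>s\<in>N. flow p s \<in> fst c \<and> snd c (flow p s) = h (0, s) \<and> (0, s) \<in> W \<and>
      slice_field \<sigma> s c = Dat h (0, s) (1, 0)" "open W" "smooth_on W h" "Dat h (0, t) (0, 1) = U (flow p t) c"
      "slice_rotation \<sigma> t c = Dat (\<lambda>z. Dat h z (0, 1)) (0, t) (1, 0) + chr c (h (0, t)) (Dat h (0, t) (1, 0)) (Dat h (0, t) (0, 1))"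
      using loc[OF t c] by blast
    have tW: "(0, t) \<in> W" using N by blast
    have "((\<lambda>s. Dat h (0, s) (1, 0)) has_vector_derivative Dat (\<lambda>z. Dat h z (1, 0)) (0, t) (0, 1)) (at t)"
      by (rule has_vector_derivative_comp_Dat[where g = "\<lambda>s. (0, s)", OF smooth_on_Dat[OF N(5)] _ tW])
        (auto intro!: derivative_eq_intros simp: has_vector_derivative_def)
    then have "((\<lambda>s. slice_field \<sigma> s c) has_vector_derivative Dat (\<lambda>z. Dat h z (1, 0)) (0, t) (0, 1)) (at t)"
      by (rule has_vector_derivative_transform_within_open[OF _ N(1,2)]) (use N(3) in auto)
    then have vd: "vector_derivative (\<lambda>s. slice_field \<sigma> s c) (at t) = Dat (\<lambda>z. Dat h z (0, 1)) (0, t) (1, 0)"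
      by (simp add: vector_derivative_at Dat_commute[OF N(5,4) tW])
    have e: "h (0, t) = snd c (flow p t)" "Dat h (0, t) (1, 0) = slice_field \<sigma> t c" using N(2,3) by auto
    show "cov_along A g (flow p) (slice_field \<sigma>) t c = slice_rotation \<sigma> t c"
      unfolding cov_along_eq[of c "flow p" t, OF c] vd N(7) e N(6)
      by (simp add: U_eq[OF t] chr_sym[OF c, of "slice_field \<sigma> t c"])
  qed
qed

lemma U_field:
  assumes p: "p \<in> S"
  shows "smooth_field_along A (life p) (flow p) (\<lambda>t. U (flow p t))"
    "t \<in> life p \<Longrightarrow> cov_along A g (flow p) (\<lambda>t. U (flow p t)) t = (\<lambda>_. 0)"
proof -
  show "smooth_field_along A (life p) (flow p) (\<lambda>t. U (flow p t))"
    by (rule U_along(1)[OF flow_smooth[OF p] _ life_open]) (auto simp: flow_\<Sigma>)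
  assume t: "t \<in> life p"
  have "cov_along A g (flow p) (\<lambda>t. U (flow p t)) t = cov_along A g (flow p) (velocity A (flow p)) t"
    by (rule cov_along_cong[OF life_open t]) (auto simp: U_eq)
  then show "cov_along A g (flow p) (\<lambda>t. U (flow p t)) t = (\<lambda>_. 0)"
    using flow_geodesic(1)[OF p] t by (simp add: geodesic_def)
qed

lemma constant_on_life:
  assumes d: "\<And>t. t \<in> life p \<Longrightarrow> (f has_real_derivative 0) (at t)" and t: "t \<in> life p"
  shows "f t = f 0"
proof -
  have "f constant_on life p"
    by (rule has_field_derivative_0_imp_constant_on[OF d life_connected life_open])
  then show ?thesis using t zero_life[OF life_S[OF t]] unfolding constant_on_def by metis
qed

text \<open>Along a geodesic g(U, U) is constant, and at parameter 0 it is g(\<xi>, \<xi>) =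
  0.\<close>

lemma U_lightlike:
  assumes t: "t \<in> life p" shows "g (flow p t) (U (flow p t)) (U (flow p t)) = 0"
proof -
  have p: "p \<in> S" using life_S[OF t] .
  have "g (flow p t) (U (flow p t)) (U (flow p t)) = g (flow p 0) (U (flow p 0)) (U (flow p 0))"
  proof (rule constant_on_life[OF _ t])
    fix s assume s: "s \<in> life p"
    have T: "U (flow p s) \<in> tangent_space A (flow p s)" by (rule U_tangent[OF flow_\<Sigma>[OF s]])
    have "g (flow p s) (U (flow p s)) (\<lambda>_. 0) = 0"
      using g_sym[OF flow_points[OF s] T zero_tangent] g_zero[OF flow_points[OF s] T] by simp
    then show "((\<lambda>t. g (flow p t) (U (flow p t)) (U (flow p t))) has_real_derivative 0) (at s)"
      using metric_along[OF U_field(1)[OF p] U_field(1)[OF p] life_open s]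
      by (simp add: U_field(2)[OF p s] g_zero[OF flow_points[OF s] T])
  qed
  also have "\<dots> = 0"
    using U_eq[OF zero_life[OF p]] flow_geodesic(2,3)[OF p] xi_lightlike[OF p] by simp
  finally show ?thesis .
qed

text \<open>Since g(U, U) vanishes on the whole hypersurface, its derivative along the transported
  curve, 2 g(\<nabla>_X U, U), vanishes as well.\<close>

lemma slice_rotation_orthogonal:
  assumes t: "t \<in> life p" and \<sigma>: "\<sigma> \<in> curves_through A S p"
  shows "g (flow p t) (slice_rotation \<sigma> t) (U (flow p t)) = 0"
proof -
  let ?\<beta> = "\<lambda>s. flow (\<sigma> s) t"
  have \<sigma>0: "\<sigma> 0 = p" using \<sigma> by (simp add: curves_through_def)
  from curves_throughE[OF slice_field_sub_tangent(1)[OF t \<sigma>]] obtain I where I: "open I" "0 \<in> I" "connected I"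
    "?\<beta> ` I \<subseteq> \<Sigma>" "smooth_map std_atlas A I ?\<beta>" "?\<beta> 0 = flow p t" by blast
  note fld = U_along(1)[OF I(5,4,1)]
  have "g (?\<beta> s) (U (?\<beta> s)) (U (?\<beta> s)) = 0" if s: "s \<in> I" for s
  proof -
    have "?\<beta> s \<in> \<Sigma>" using I(4) s by auto
    then obtain q u where "u \<in> life q" "?\<beta> s = flow q u" using \<Sigma>_iff by blast
    then show ?thesis using U_lightlike by simp
  qed
  then have "((\<lambda>s. g (?\<beta> s) (U (?\<beta> s)) (U (?\<beta> s))) has_real_derivative 0) (at 0)"
    by (intro has_field_derivative_transform_within_open[OF DERIV_const I(1,2), of 0]) simp
  from DERIV_unique[OF metric_along[OF fld fld I(1,2)] this]
  have "g (flow p t) (slice_rotation \<sigma> t) (U (flow p t)) + g (flow p t) (U (flow p t)) (slice_rotation \<sigma> t) = 0"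
    by (simp add: slice_rotation_def \<sigma>0)
  then show ?thesis
    using g_sym[OF flow_points[OF t] slice_rotation_nabla(2)[OF t \<sigma>] U_tangent[OF flow_\<Sigma>[OF t]]] by simp
qed

text \<open>A Gauss lemma: the derivative of g(X, U) along the generator is g(\<nabla>_U X, U) =
  g(\<nabla>_X U, U) = 0, and the initial value vanishes because \<xi> is normal to
  \<open>S\<close>.\<close>

lemma slice_field_orthogonal:
  assumes t: "t \<in> life p" and \<sigma>: "\<sigma> \<in> curves_through A S p"
  shows "g (flow p t) (slice_field \<sigma> t) (U (flow p t)) = 0"
proof -
  have p: "p \<in> S" using life_S[OF t] .
  have T: "slice_field \<sigma> s \<in> tangent_space A (flow p s)" if "s \<in> life p" for s
    using sub_tangent_tangent[OF slice_field_sub_tangent(2)[OF that \<sigma>]] .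
  have "g (flow p t) (slice_field \<sigma> t) (U (flow p t)) = g (flow p 0) (slice_field \<sigma> 0) (U (flow p 0))"
  proof (rule constant_on_life[OF _ t])
    fix s assume s: "s \<in> life p"
    have "g (flow p s) (slice_field \<sigma> s) (\<lambda>_. 0) = 0"
      using g_sym[OF flow_points[OF s] T[OF s] zero_tangent] g_zero[OF flow_points[OF s] T[OF s]] by simp
    then show "((\<lambda>t. g (flow p t) (slice_field \<sigma> t) (U (flow p t))) has_real_derivative 0) (at s)"
      using metric_along[OF slice_field_smooth(1)[OF p \<sigma>] U_field(1)[OF p] life_open s]
      by (simp add: U_field(2)[OF p s] slice_field_smooth(2)[OF p \<sigma> s] slice_rotation_orthogonal[OF s \<sigma>])
  qed
  also have "\<dots> = 0"
  proof -
    from curves_throughE[OF \<sigma>] obtain I where I: "open I" "0 \<in> I" "connected I" "\<sigma> ` I \<subseteq> S"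
      "smooth_map std_atlas A I \<sigma>" "\<sigma> 0 = p" by blast
    have "slice_field \<sigma> 0 = velocity A \<sigma> 0"
      unfolding slice_field_def by (rule velocity_cong[OF I(1,2)]) (use I(4) flow_geodesic(2) in auto)
    then have "slice_field \<sigma> 0 \<in> sub_tangent A S p" using \<sigma> by (auto simp: sub_tangent_def)
    then have "g p (\<xi> p) (slice_field \<sigma> 0) = 0" "slice_field \<sigma> 0 \<in> tangent_space A p"
      by (rule xi_normal[OF p], rule sub_tangent_tangent)
    then show ?thesis
      using U_eq[OF zero_life[OF p]] flow_geodesic(2,3)[OF p] g_sym[of p "slice_field \<sigma> 0" "\<xi> p"] xi_tangent[OF p] S_points p
      by auto
  qed
  finally show ?thesis .
qed

lemma U_chart_facts:
  assumes t: "t \<in> life p" and c: "c \<in> charts_at A (flow p t)"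
  shows "U (flow p t) c \<noteq> 0" "mc c (snd c (flow p t)) (U (flow p t) c) (U (flow p t) c) = 0"
proof -
  have p: "p \<in> S" using life_S[OF t] .
  obtain c0 Q H R \<Theta> where L: "local_flow c0 c Q H R \<Theta>" "p \<in> fst c0" "(snd c0 p, t) \<in> Q" "snd c (flow p t) \<in> R"
    by (rule local_flow_at'[OF t c])
  note D = local_flowD[OF L(1)]
  \<comment> \<open>The derivative of \<Theta> sends \<open>U\<close> to the unit vector of the
    parameter axis, so \<open>U\<close> cannot vanish.\<close>
  have "Dat \<Theta> (snd c (flow p t)) (U (flow p t) c) = (0, 1)"
    using slice_velocity(3)[OF L(1) constant_curve(1)[OF p] L(2,3,4), of 1]
      velocity_flow_chart[OF L(1) p L(2,3)] constant_curve(2)[OF p] U_eq[OF t] by simp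
  then show "U (flow p t) c \<noteq> 0" using linear_0[OF smooth_on_linear_Dat[OF D(6) L(4)]] by (auto simp: zero_prod_def)
  show "mc c (snd c (flow p t)) (U (flow p t) c) (U (flow p t) c) = 0"
    using U_lightlike[OF t] g_eq_mc[OF c U_tangent U_tangent, OF flow_\<Sigma>[OF t] flow_\<Sigma>[OF t]] by simp
qed

text \<open>The push-forwards of the n slice directions stay independent, and \<open>U\<close> lies
  outside their span, because the derivative of \<Theta> separates them. Together they span n + 1
  dimensions inside the hyperplane of \<open>U\<close>, which has dimension n + 1 itself.\<close>

lemma null_hyperplane_decomposition:
  assumes t: "t \<in> life p" and c: "c \<in> charts_at A (flow p t)"
    and y: "mc c (snd c (flow p t)) (U (flow p t) c) y = 0"
  shows "\<exists>\<sigma>\<in>curves_through A S p. \<exists>k. y = slice_field \<sigma> t c + k *\<^sub>R U (flow p t) c"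
proof -
  let ?q = "flow p t" and ?u = "U (flow p t) c"
  have p: "p \<in> S" using life_S[OF t] .
  obtain c0 Q H R \<Theta> where L: "local_flow c0 c Q H R \<Theta>" "p \<in> fst c0" "(snd c0 p, t) \<in> Q" "snd c ?q \<in> R"
    by (rule local_flow_at'[OF t c])
  note D = local_flowD[OF L(1)]
  have c0: "c0 \<in> charts_at A p" using L(2) D(1) by (simp add: charts_at_iff)
  obtain B where B: "subspace B" "dim B = n" "\<And>w. w \<in> B \<Longrightarrow> \<exists>\<sigma>\<in>curves_through A S p. velocity A \<sigma> 0 c0 = w"
    using slice_directions[OF p c0] by blast
  define \<Lambda> where "\<Lambda> w = Dat H (snd c0 p, t) (w, 0)" for w
  have lH: "linear (Dat H (snd c0 p, t))" by (rule smooth_on_linear_Dat[OF D(4) L(3)])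
  have l\<Theta>: "linear (Dat \<Theta> (snd c ?q))" by (rule smooth_on_linear_Dat[OF D(6) L(4)])
  have l: "linear \<Lambda>"
  proof (rule linearI)
    show "\<Lambda> (a + b) = \<Lambda> a + \<Lambda> b" for a b
      using linear_add[OF lH, of "(a, 0)" "(b, 0)"] by (simp add: \<Lambda>_def)
    show "\<Lambda> (k *\<^sub>R a) = k *\<^sub>R \<Lambda> a" for k a
      using linear_scale[OF lH, of k "(a, 0)"] by (simp add: \<Lambda>_def)
  qed
  have u: "?u = Dat H (snd c0 p, t) (0, 1)"
    using velocity_flow_chart[OF L(1) p L(2,3)] U_eq[OF t] by simp
  have \<Theta>u: "Dat \<Theta> (snd c ?q) ?u = (0, 1)"
    using slice_velocity(3)[OF L(1) constant_curve(1)[OF p] L(2,3,4), of 1] constant_curve(2)[OF p] u by simp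
  have X: "slice_field \<sigma> t c = \<Lambda> (velocity A \<sigma> 0 c0)" "Dat \<Theta> (snd c ?q) (\<Lambda> (velocity A \<sigma> 0 c0)) = (velocity A \<sigma> 0 c0, 0)"
    if "\<sigma> \<in> curves_through A S p" for \<sigma>
    using slice_velocity(2)[OF L(1) that L(2,3), of 0] slice_velocity(3)[OF L(1) that L(2,3,4), of 0]
    by (simp_all add: slice_field_def \<Lambda>_def)
  have \<Theta>\<Lambda>: "Dat \<Theta> (snd c ?q) (\<Lambda> w) = (w, 0)" if "w \<in> B" for w using B(3)[OF that] X(2) by blast
  have inj: "inj_on \<Lambda> (span B)"
    unfolding span_eq_iff[THEN iffD2, OF B(1)]
    by (rule inj_onI) (metis \<Theta>\<Lambda> fst_conv)
  have sub: "subspace (\<Lambda> ` B)" by (rule linear_subspace_image[OF l B(1)])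
  have notin: "?u \<notin> span (\<Lambda> ` B)"
    unfolding span_eq_iff[THEN iffD2, OF sub] using \<Theta>\<Lambda> \<Theta>u by force
  have dB: "dim (span (insert ?u (\<Lambda> ` B))) = n + 1"
    using notin dim_image_eq[OF l inj] B(2) by (simp add: dim_insert)
  \<comment> \<open>Lowering the index of \<open>U\<close> turns the metric hyperplane into a
    Euclidean one, whose dimension is known.\<close>
  define a where "a = lower c (snd c ?q) ?u"
  have a: "a \<bullet> z = mc c (snd c ?q) ?u z" for z unfolding a_def by (rule lower(3)[OF c])
  have "a \<noteq> 0"
    using inj_onD[OF lower(2)[OF c], of ?u 0] linear_0[OF lower(1)[OF c]] U_chart_facts(1)[OF t c] by (auto simp: a_def)
  then have dh: "dim {z. a \<bullet> z = 0} = n + 1" using dim_hyperplane[of a] dim by simp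
  have "insert ?u (\<Lambda> ` B) \<subseteq> {z. a \<bullet> z = 0}"
  proof -
    have "a \<bullet> \<Lambda> w = 0" if w: "w \<in> B" for w
    proof -
      obtain \<sigma> where \<sigma>: "\<sigma> \<in> curves_through A S p" "velocity A \<sigma> 0 c0 = w" using B(3)[OF w] by blast
      have "mc c (snd c ?q) (slice_field \<sigma> t c) ?u = 0"
        using slice_field_orthogonal[OF t \<sigma>(1)] g_eq_mc[OF c sub_tangent_tangent[OF slice_field_sub_tangent(2)[OF t \<sigma>(1)]] U_tangent[OF flow_\<Sigma>[OF t]]]
        by simp
      then show ?thesis using X(1)[OF \<sigma>(1)] \<sigma>(2) mc_sym[OF c, of ?u] by (simp add: a)
    qed
    then show ?thesis using U_chart_facts(2)[OF t c] by (auto simp: a)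
  qed
  then have "span (insert ?u (\<Lambda> ` B)) \<subseteq> {z. a \<bullet> z = 0}"
    by (rule span_minimal[OF _ subspace_hyperplane])
  then have "span (insert ?u (\<Lambda> ` B)) = {z. a \<bullet> z = 0}"
    by (rule subspace_dim_equal[OF subspace_span subspace_hyperplane]) (simp only: dh dB order_refl)
  then have "y \<in> span (insert ?u (\<Lambda> ` B))" using y by (simp add: a)
  then obtain k where "y - k *\<^sub>R ?u \<in> \<Lambda> ` B"
    unfolding span_breakdown_eq span_eq_iff[THEN iffD2, OF sub] by blast
  then obtain w where w: "w \<in> B" "y - k *\<^sub>R ?u = \<Lambda> w" by blast
  obtain \<sigma> where \<sigma>: "\<sigma> \<in> curves_through A S p" "velocity A \<sigma> 0 c0 = w" using B(3)[OF w(1)] by blast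
  have "y = slice_field \<sigma> t c + k *\<^sub>R ?u" using w(2) X(1)[OF \<sigma>(1)] \<sigma>(2) by (simp add: algebra_simps)
  then show ?thesis using \<sigma>(1) by blast
qed

end

section \<open>The totally umbilical case: curvature, Ricci trace and Jacobi fields\<close>

locale umbilical = null_generated +
  fixes \<mu> assumes umbilical: "umbilical_with A g S \<xi> \<V> \<mu>"
begin

text \<open>Umbilicity says that \<nabla>_X U + \<mu> X is orthogonal to all push-forwards and to
  \<open>U\<close>. These fill the hyperplane of \<open>U\<close>, whose only normal direction is
  \<open>U\<close> itself.\<close>

lemma umbilic_equation:
  assumes t: "t \<in> life p" and c: "c \<in> charts_at A (flow p t)" and \<sigma>: "\<sigma> \<in> curves_through A S p"
  shows "\<exists>k. slice_rotation \<sigma> t c + \<mu> (flow p t) *\<^sub>R slice_field \<sigma> t c = k *\<^sub>R U (flow p t) c"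
proof (rule normal_of_null_hyperplane[OF c U_chart_facts(1)[OF t c]])
  let ?q = "flow p t"
  fix y assume "mc c (snd c ?q) (U ?q c) y = 0"
  then obtain \<sigma>' k where \<sigma>': "\<sigma>' \<in> curves_through A S p" "y = slice_field \<sigma>' t c + k *\<^sub>R U ?q c"
    using null_hyperplane_decomposition[OF t c] by blast
  note X = slice_field_sub_tangent(2)[OF t \<sigma>] and X' = slice_field_sub_tangent(2)[OF t \<sigma>'(1)]
  note l = bilinear_left[OF mc_bilinear[OF c]] and r = bilinear_right[OF mc_bilinear[OF c]]
  have eq: "mc c (snd c ?q) (slice_rotation \<sigma> t c + \<mu> ?q *\<^sub>R slice_field \<sigma> t c) (z c) = 0" if z: "z \<in> sub_tangent A \<Sigma> ?q" for z
  proof -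
    have "null_second_form A g S \<xi> \<V> ?q (slice_field \<sigma> t) z = \<mu> ?q * g ?q (slice_field \<sigma> t) z"
      using umbilical X z flow_\<Sigma>[OF t] unfolding umbilical_with_def by blast
    then have "- g ?q (slice_rotation \<sigma> t) z = \<mu> ?q * g ?q (slice_field \<sigma> t) z"
      by (simp add: null_second_form_def slice_rotation_nabla(1)[OF t \<sigma>])
    then show ?thesis
      using g_eq_mc[OF c slice_rotation_nabla(2)[OF t \<sigma>] sub_tangent_tangent[OF z]]
        g_eq_mc[OF c sub_tangent_tangent[OF X] sub_tangent_tangent[OF z]]
      by (simp add: linear_add[OF l] linear_scale[OF l])
  qed
  show "mc c (snd c ?q) (slice_rotation \<sigma> t c + \<mu> ?q *\<^sub>R slice_field \<sigma> t c) y = 0"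
    unfolding \<sigma>'(2) linear_add[OF r] linear_scale[OF r] eq[OF X'] eq[OF U_sub_tangent[OF t]] by simp
qed

definition mu :: "'a \<Rightarrow> real \<Rightarrow> real" where "mu p t = \<mu> (flow p t)"

definition \<kappa> :: "'a \<Rightarrow> real \<Rightarrow> real" where "\<kappa> p t = Dat (mu p) t 1 - (mu p t)\<^sup>2"

lemma mu_smooth: assumes p: "p \<in> S" shows "smooth_on (life p) (mu p)"
proof (rule smooth_on_local)
  fix t assume t: "t \<in> life p"
  obtain c where c: "c \<in> charts_at A (flow p t)" using flow_chart[OF t] by (elim exE)
  have sm: "smooth_map A std_atlas \<Sigma> \<mu>" using umbilical by (simp add: umbilical_with_def)
  obtain N F where N: "open N" "snd c (flow p t) \<in> N" "smooth_on N F"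
    "\<forall>y\<in>\<Sigma> \<inter> fst c. snd c y \<in> N \<longrightarrow> \<mu> y = F (snd c y)"
    using bspec[OF bspec[OF bspec[OF conjunct2[OF conjunct2[OF sm[unfolded smooth_map_def]]] flow_\<Sigma>[OF t]] c],
        of "(UNIV, id)"] by auto
  from smooth_map_curve[OF flow_smooth[OF p] life_open t c] obtain M where M: "open M" "t \<in> M" "M \<subseteq> life p"
    "\<And>s. s \<in> M \<Longrightarrow> flow p s \<in> fst c" "smooth_on M (\<lambda>s. snd c (flow p s))" by blast
  let ?M = "M \<inter> (\<lambda>s. snd c (flow p s)) -` N"
  have op: "open ?M" by (rule continuous_open_preimage[OF smooth_on_continuous[OF M(5)] M(1) N(1)])
  have "smooth_on ?M (\<lambda>s. F (snd c (flow p s)))"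
    by (rule smooth_on_compose[OF op N(1,3) smooth_on_subset[OF M(5)]]) auto
  then have "smooth_on ?M (mu p)"
    by (rule smooth_on_cong[OF op]) (use N(4) M(3,4) flow_\<Sigma> in \<open>auto simp: mu_def\<close>)
  then show "\<exists>N. open N \<and> t \<in> N \<and> smooth_on N (mu p)" using op M(2) N(2) by (intro exI[of _ ?M]) auto
qed

lemma \<kappa>_smooth: assumes p: "p \<in> S" shows "smooth_on (life p) (\<kappa> p)"
  unfolding \<kappa>_def power2_eq_square
  by (intro smooth_on_diff smooth_on_mult smooth_on_Dat mu_smooth p life_open)

text \<open>Along the generator write y = \<nabla>_U X = \<alpha> U - \<mu> X. Its covariant
  derivative is \<alpha>' U - \<mu>' X - \<mu> y, since \<open>U\<close> is parallel, while
  \<open>geodesic_variation\<close> identifies it with - R(X, U) U. Substituting y once more gives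
  the coefficient \<mu>' - \<mu>^2 of X.\<close>

lemma curv_slice:
  assumes t: "t \<in> life p" and c: "c \<in> charts_at A (flow p t)" and \<sigma>: "\<sigma> \<in> curves_through A S p"
  shows "\<exists>k. curv c (snd c (flow p t)) (slice_field \<sigma> t c) (U (flow p t) c) (U (flow p t) c) = \<kappa> p t *\<^sub>R slice_field \<sigma> t c + k *\<^sub>R U (flow p t) c"
proof -
  have p: "p \<in> S" using life_S[OF t] .
  have \<sigma>0: "\<sigma> 0 = p" using \<sigma> by (simp add: curves_through_def)
  have cA: "c \<in> A" using c by (simp add: charts_at_iff)
  obtain c0 Q H R \<Theta> where L: "local_flow c0 c Q H R \<Theta>" "p \<in> fst c0" "(snd c0 p, t) \<in> Q" "snd c (flow p t) \<in> R"
    by (rule local_flow_at'[OF t c])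
  show ?thesis
  proof (rule slice_family[OF L(1) \<sigma> L(2,3)])
    fix h :: "real \<times> real \<Rightarrow> 'b" and W assume W: "open W" "(0, t) \<in> W" "smooth_on W h" "h ` W \<subseteq> snd c ` fst c"
    and pt: "\<And>s t. (s, t) \<in> W \<Longrightarrow> t \<in> life (\<sigma> s) \<and> flow (\<sigma> s) t \<in> fst c \<and> h (s, t) = snd c (flow (\<sigma> s) t)"
    and ht: "\<And>s t. (s, t) \<in> W \<Longrightarrow> Dat h (s, t) (0, 1) = U (flow (\<sigma> s) t) c"
    and geo: "\<And>z. z \<in> W \<Longrightarrow> Dat (\<lambda>z. Dat h z (0, 1)) z (0, 1) + chr c (h z) (Dat h z (0, 1)) (Dat h z (0, 1)) = 0"
    and hs: "\<And>t. (0, t) \<in> W \<Longrightarrow> slice_field \<sigma> t c = Dat h (0, t) (1, 0)"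
    and hY: "\<And>t. (0, t) \<in> W \<Longrightarrow> slice_rotation \<sigma> t c = Dat (\<lambda>z. Dat h z (0, 1)) (0, t) (1, 0) + chr c (h (0, t)) (Dat h (0, t) (1, 0)) (Dat h (0, t) (0, 1))"
  define Yh where "Yh z = Dat (\<lambda>z. Dat h z (0, 1)) z (1, 0) + chr c (h z) (Dat h z (1, 0)) (Dat h z (0, 1))" for z
  have smY: "smooth_on W Yh" unfolding Yh_def
    by (rule smooth_on_add[OF W(1) smooth_on_Dat[OF smooth_on_Dat[OF W(3)]]
          smooth_on_chr_apply[OF cA W(1,3,4) smooth_on_Dat[OF W(3)] smooth_on_Dat[OF W(3)]]])
  define N where "N = (\<lambda>s. (0, s)) -` W"
  have N: "open N" "t \<in> N" unfolding N_def using W(2) by (auto intro!: open_vimage W(1) continuous_intros)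
  have Nl: "N \<subseteq> life p" using pt[of 0] \<sigma>0 by (auto simp: N_def)
  have line: "smooth_on N (\<lambda>s. (0::real, s))"
    by (intro smooth_on_Pair smooth_on_const smooth_on_ident N(1))
  have along: "smooth_on N (\<lambda>s. k (0, s))"
     "((\<lambda>s. k (0, s)) has_vector_derivative Dat k (0, t) (0, 1)) (at t)"
    if "smooth_on W k" for k :: "real \<times> real \<Rightarrow> 'b"
  proof -
    show "smooth_on N (\<lambda>s. k (0, s))"
      by (rule smooth_on_compose[OF N(1) W(1) that line]) (auto simp: N_def)
    show "((\<lambda>s. k (0, s)) has_vector_derivative Dat k (0, t) (0, 1)) (at t)"
      by (rule has_vector_derivative_comp_Dat[where g = "\<lambda>s. (0, s)", OF that _ W(2)])
        (auto intro!: derivative_eq_intros simp: has_vector_derivative_def)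
  qed
  define x where "x s = Dat h (0, s) (1, 0)" for s
  define u where "u s = Dat h (0, s) (0, 1)" for s
  define y where "y s = Yh (0, s)" for s
  have sm: "smooth_on N x" "smooth_on N u" "smooth_on N y"
    unfolding x_def u_def y_def
    by (rule along(1)[OF smooth_on_Dat[OF W(3)]] along(1)[OF smY])+
  have dx: "(x has_vector_derivative Dat (\<lambda>z. Dat h z (0, 1)) (0, t) (1, 0)) (at t)"
    using along(2)[OF smooth_on_Dat[OF W(3), of "(1, 0)"]] unfolding x_def Dat_commute[OF W(3,1,2), of "(1, 0)"] .
  have du: "(u has_vector_derivative Dat (\<lambda>z. Dat h z (0, 1)) (0, t) (0, 1)) (at t)"
    unfolding u_def by (rule along(2)[OF smooth_on_Dat[OF W(3)]])
  have dy: "(y has_vector_derivative Dat Yh (0, t) (0, 1)) (at t)"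
    unfolding y_def by (rule along(2)[OF smY])
  have at_s: "x s = slice_field \<sigma> s c" "u s = U (flow p s) c" "y s = slice_rotation \<sigma> s c" "c \<in> charts_at A (flow p s)" if "s \<in> N" for s
    using that hs ht[of 0 s] hY[of s] \<sigma>0 pt[of 0 s] cA by (auto simp: N_def x_def u_def y_def Yh_def charts_at_iff)
  have u0: "u s \<noteq> 0" if "s \<in> N" for s
    using U_chart_facts(1)[of s p c] subsetD[OF Nl that] at_s(2,4)[OF that] by simp
  \<comment> \<open>\<open>umbilic_equation\<close> supplies a coefficient at each point separately;
    the Euclidean quotient produces the same number as a smooth function that can be
    differentiated.\<close>
  define \<alpha> where "\<alpha> s = ((y s + mu p s *\<^sub>R x s) \<bullet> u s) / (u s \<bullet> u s)" for s
  have mN: "smooth_on N (mu p)" by (rule smooth_on_subset[OF mu_smooth[OF p] Nl])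
  have \<alpha>: "smooth_on N \<alpha>"
    unfolding \<alpha>_def
    by (intro smooth_on_divide smooth_on_inner smooth_on_add smooth_on_scaleR N sm mN) (simp add: u0)
  have y_eq: "y s = \<alpha> s *\<^sub>R u s - mu p s *\<^sub>R x s" if s: "s \<in> N" for s
  proof -
    obtain k where "slice_rotation \<sigma> s c + \<mu> (flow p s) *\<^sub>R slice_field \<sigma> s c = k *\<^sub>R U (flow p s) c"
      using umbilic_equation[of s p c \<sigma>] s Nl at_s(4)[OF s] \<sigma> by blast
    then have k: "y s + mu p s *\<^sub>R x s = k *\<^sub>R u s" by (simp add: at_s[OF s] mu_def)
    then have "\<alpha> s = k" using u0[OF s] by (simp add: \<alpha>_def)
    then show ?thesis using k by (simp add: algebra_simps)
  qed
  have dm: "(mu p has_vector_derivative Dat (mu p) t 1) (at t)"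
    using smooth_on_vector_derivative(1)[OF N(1) mN N(2)]
    by (simp add: Dat_vector_derivative[OF smooth_on_differentiable[OF mN N(2)]])
  obtain \<alpha>' where d\<alpha>: "(\<alpha> has_vector_derivative \<alpha>') (at t)"
    using smooth_on_vector_derivative(1)[OF N(1) \<alpha> N(2)] by blast
  have "((\<lambda>s. \<alpha> s *\<^sub>R u s - mu p s *\<^sub>R x s) has_vector_derivative
     ((\<alpha> t *\<^sub>R Dat (\<lambda>z. Dat h z (0, 1)) (0, t) (0, 1) + \<alpha>' *\<^sub>R u t)
      - (mu p t *\<^sub>R Dat (\<lambda>z. Dat h z (0, 1)) (0, t) (1, 0) + Dat (mu p) t 1 *\<^sub>R x t))) (at t)"
    by (intro has_vector_derivative_diff has_vector_derivative_scaleR du dx)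
      (use d\<alpha> dm in \<open>simp_all add: has_real_derivative_iff_has_vector_derivative\<close>)
  then have "(y has_vector_derivative
     ((\<alpha> t *\<^sub>R Dat (\<lambda>z. Dat h z (0, 1)) (0, t) (0, 1) + \<alpha>' *\<^sub>R u t)
      - (mu p t *\<^sub>R Dat (\<lambda>z. Dat h z (0, 1)) (0, t) (1, 0) + Dat (mu p) t 1 *\<^sub>R x t))) (at t)"
    by (rule has_vector_derivative_transform_within_open[OF _ N]) (simp add: y_eq)
  from vector_derivative_unique_at[OF this dy]
  have Dy: "Dat Yh (0, t) (0, 1) = (\<alpha> t *\<^sub>R Dat (\<lambda>z. Dat h z (0, 1)) (0, t) (0, 1) + \<alpha>' *\<^sub>R u t)
      - (mu p t *\<^sub>R Dat (\<lambda>z. Dat h z (0, 1)) (0, t) (1, 0) + Dat (mu p) t 1 *\<^sub>R x t)" by simp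
  have q: "h (0, t) = snd c (flow p t)" using pt[OF W(2)] \<sigma>0 by simp
  let ?G = "chr c (snd c (flow p t))"
  note l = bilinear_right[OF chr_bilinear[OF c]]
  define x' where "x' = Dat (\<lambda>z. Dat h z (0, 1)) (0, t) (1, 0)"
  have u': "Dat (\<lambda>z. Dat h z (0, 1)) (0, t) (0, 1) = - ?G (u t) (u t)"
    using geo[OF W(2)] by (simp add: u_def q eq_neg_iff_add_eq_0)
  have yt: "y t = x' + ?G (u t) (x t)"
    by (simp add: y_def Yh_def x'_def q x_def u_def chr_sym[OF c, of "Dat h (0, t) (1, 0)"])
  have Dy': "Dat Yh (0, t) (0, 1) = \<alpha>' *\<^sub>R u t - \<alpha> t *\<^sub>R ?G (u t) (u t) - mu p t *\<^sub>R x' - Dat (mu p) t 1 *\<^sub>R x t"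
    unfolding Dy u' x'_def by (simp add: algebra_simps)
  have "- curv c (snd c (flow p t)) (x t) (u t) (u t) = Dat Yh (0, t) (0, 1) + ?G (u t) (y t)"
    using geodesic_variation[OF cA W(1,3,4,2) geo] by (simp add: Yh_def[abs_def] y_def x_def u_def q)
  also have "?G (u t) (y t) = \<alpha> t *\<^sub>R ?G (u t) (u t) - mu p t *\<^sub>R ?G (u t) (x t)"
    unfolding y_eq[OF N(2)] by (simp add: linear_diff[OF l] linear_scale[OF l])
  also have "Dat Yh (0, t) (0, 1) + (\<alpha> t *\<^sub>R ?G (u t) (u t) - mu p t *\<^sub>R ?G (u t) (x t)) =
      \<alpha>' *\<^sub>R u t - mu p t *\<^sub>R y t - Dat (mu p) t 1 *\<^sub>R x t"
    unfolding Dy' yt by (simp add: algebra_simps)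
  also have "\<dots> = \<alpha>' *\<^sub>R u t - mu p t *\<^sub>R (\<alpha> t *\<^sub>R u t - mu p t *\<^sub>R x t) - Dat (mu p) t 1 *\<^sub>R x t"
    unfolding y_eq[OF N(2)] ..
  finally have "curv c (snd c (flow p t)) (x t) (u t) (u t) = \<kappa> p t *\<^sub>R x t + (mu p t * \<alpha> t - \<alpha>') *\<^sub>R u t"
    unfolding \<kappa>_def power2_eq_square by (simp add: algebra_simps minus_equation_iff[of "curv c _ _ _ _"] equation_minus_iff)
  then show ?thesis unfolding at_s(1,2)[OF N(2)] by blast
  qed
qed

text \<open>The component along \<open>U\<close> contributes R(U, U) U = 0, so it only changes the
  coefficient of \<open>U\<close> on the right.\<close>

lemma curv_null_hyperplane:
  assumes t: "t \<in> life p" and c: "c \<in> charts_at A (flow p t)"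
    and y: "mc c (snd c (flow p t)) (U (flow p t) c) y = 0"
  shows "\<exists>k. curv c (snd c (flow p t)) y (U (flow p t) c) (U (flow p t) c) = \<kappa> p t *\<^sub>R y + k *\<^sub>R U (flow p t) c"
proof -
  let ?u = "U (flow p t) c"
  obtain \<sigma> k where \<sigma>: "\<sigma> \<in> curves_through A S p" "y = slice_field \<sigma> t c + k *\<^sub>R ?u"
    using null_hyperplane_decomposition[OF assms] by blast
  obtain k1 where "curv c (snd c (flow p t)) (slice_field \<sigma> t c) ?u ?u = \<kappa> p t *\<^sub>R slice_field \<sigma> t c + k1 *\<^sub>R ?u"
    using curv_slice[OF t c \<sigma>(1)] by blast
  then have "curv c (snd c (flow p t)) y ?u ?u = \<kappa> p t *\<^sub>R y + (k1 - \<kappa> p t * k) *\<^sub>R ?u"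
    unfolding \<sigma>(2) by (simp add: linear_add[OF curv_linear[OF c]] linear_scale[OF curv_linear[OF c]] curv_self algebra_simps)
  then show ?thesis by blast
qed

lemma ricci_generator:
  assumes t: "t \<in> life p"
  shows "ricci A g (flow p t) (velocity A (flow p) t) (velocity A (flow p) t) = real n * \<kappa> p t"
proof -
  obtain c where c: "c \<in> charts_at A (flow p t)"
    "\<And>y z. ricci A g (flow p t) y z = (\<Sum>b\<in>Basis. curv c (snd c (flow p t)) b (y c) (z c) \<bullet> b)"
    using ricci_eq[OF flow_points[OF t]] by blast
  show ?thesis
    unfolding c(2) U_eq[OF t, symmetric]
    by (rule trace_curv[OF c(1) dim U_chart_facts[OF t c(1)] curv_null_hyperplane[OF t c(1)]])
qed

text \<open>Orthogonality places \<open>J\<close> in the hyperplane where the curvature acts as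
  \<kappa> modulo \<open>U\<close>, with no reference to the screen. Dividing the Ricci formula by n
  identifies \<kappa> with the coefficient in the equation.\<close>

theorem jacobi_equation:
  assumes n: "n > 0" and p: "p \<in> S" and J: "orthogonal_jacobi_field A g (life p) (flow p) J"
  shows "\<exists>f. ricci_jacobi_equation n A g (life p) (flow p) J f"
proof -
  have fJ: "smooth_field_along A (life p) (flow p) J"
    using J by (simp add: orthogonal_jacobi_field_def jacobi_field_def)
  define J2 where "J2 = cov_along A g (flow p) (cov_along A g (flow p) J)"
  have fJ1: "smooth_field_along A (life p) (flow p) (cov_along A g (flow p) J)"
    by (rule cov_along_smooth[OF fJ life_open])
  have fJ2: "smooth_field_along A (life p) (flow p) J2"
    unfolding J2_def by (rule cov_along_smooth[OF fJ1 life_open])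
  have fU: "smooth_field_along A (life p) (flow p) (velocity A (flow p))"
    by (rule velocity_smooth_field[OF flow_smooth[OF p] life_open])
  have T: "J t \<in> tangent_space A (flow p t)" "J2 t \<in> tangent_space A (flow p t)"
    "velocity A (flow p) t \<in> tangent_space A (flow p t)" if "t \<in> life p" for t
    using fJ fJ2 fU that by (auto simp: smooth_field_along_def)
  define Z where "Z t = (\<lambda>c. J2 t c + \<kappa> p t *\<^sub>R J t c)" for t
  have ZT: "Z t \<in> tangent_space A (flow p t)" if "t \<in> life p" for t
    using tangent_space_lincomb[OF T(2)[OF that] T(1)[OF that], of 1 "\<kappa> p t"] by (simp add: Z_def)
  have ex: "\<exists>k. Z t = (\<lambda>c. k *\<^sub>R velocity A (flow p) t c)" if t: "t \<in> life p" for t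
  proof -
    obtain c where c: "c \<in> charts_at A (flow p t)" using flow_chart[OF t] by (elim exE)
    have "g (flow p t) (J t) (velocity A (flow p) t) = 0"
      using J t by (simp add: orthogonal_jacobi_field_def)
    then have "mc c (snd c (flow p t)) (U (flow p t) c) (J t c) = 0"
      using g_eq_mc[OF c T(1,3)[OF t]] mc_sym[OF c, of "J t c"] by (simp add: U_eq[OF t])
    from curv_null_hyperplane[OF t c this] obtain k where
      k: "curv c (snd c (flow p t)) (J t c) (U (flow p t) c) (U (flow p t) c) = \<kappa> p t *\<^sub>R J t c + k *\<^sub>R U (flow p t) c"
      by blast
    have "(\<lambda>c. J2 t c + riemann A g (flow p t) (J t) (velocity A (flow p) t) (velocity A (flow p) t) c) = (\<lambda>_. 0)"
      using J t by (simp add: orthogonal_jacobi_field_def jacobi_field_def J2_def)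
    from fun_cong[OF this, of c] have "J2 t c + curv c (snd c (flow p t)) (J t c) (U (flow p t) c) (U (flow p t) c) = 0"
      by (simp add: riemann_eq[OF c] U_eq[OF t])
    then have "J2 t c = - (\<kappa> p t *\<^sub>R J t c + k *\<^sub>R U (flow p t) c)"
      unfolding k by (rule eq_neg_iff_add_eq_0[THEN iffD2])
    then have "Z t c = (- k) *\<^sub>R velocity A (flow p) t c" by (simp add: Z_def U_eq[OF t])
    from tangent_eqI[OF ZT[OF t] tangent_space_scale[OF T(3)[OF t]] c this] show ?thesis by blast
  qed
  \<comment> \<open>The coefficient is first chosen pointwise; its smoothness follows afterwards
    because in a chart it equals a quotient of inner products with the nonvanishing
    velocity.\<close>
  define f where "f t = (SOME k. Z t = (\<lambda>c. k *\<^sub>R velocity A (flow p) t c))" for t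
  have f: "Z t = (\<lambda>c. f t *\<^sub>R velocity A (flow p) t c)" if "t \<in> life p" for t
    unfolding f_def by (rule someI_ex[OF ex[OF that]])
  have "smooth_on (life p) f"
  proof (rule smooth_on_local)
    fix t assume t: "t \<in> life p"
    obtain c where c: "c \<in> charts_at A (flow p t)" using flow_chart[OF t] by (elim exE)
    have cA: "c \<in> A" using c by (simp add: charts_at_iff)
    from field_along_chart[OF fJ life_open t c] obtain N1 where N1: "open N1" "t \<in> N1" "N1 \<subseteq> life p"
      "\<And>s. s \<in> N1 \<Longrightarrow> flow p s \<in> fst c" "smooth_on N1 (\<lambda>s. snd c (flow p s))" "smooth_on N1 (\<lambda>s. J s c)" by blast
    from field_along_chart[OF fJ2 life_open t c] obtain N2 where N2: "open N2" "t \<in> N2" "N2 \<subseteq> life p"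
      "\<And>s. s \<in> N2 \<Longrightarrow> flow p s \<in> fst c" "smooth_on N2 (\<lambda>s. snd c (flow p s))" "smooth_on N2 (\<lambda>s. J2 s c)" by blast
    from field_along_chart[OF fU life_open t c] obtain N3 where N3: "open N3" "t \<in> N3" "N3 \<subseteq> life p"
      "\<And>s. s \<in> N3 \<Longrightarrow> flow p s \<in> fst c" "smooth_on N3 (\<lambda>s. snd c (flow p s))" "smooth_on N3 (\<lambda>s. velocity A (flow p) s c)" by blast
    define N where "N = N1 \<inter> N2 \<inter> N3"
    have N: "open N" "t \<in> N" "N \<subseteq> life p" using N1 N2 N3 by (auto simp: N_def)
    have sub: "N \<subseteq> N1" "N \<subseteq> N2" "N \<subseteq> N3" by (auto simp: N_def)
    note sm = smooth_on_subset[OF N1(6) sub(1)] smooth_on_subset[OF N2(6) sub(2)] smooth_on_subset[OF N3(6) sub(3)]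
    have u0: "velocity A (flow p) s c \<noteq> 0" if s: "s \<in> N" for s
      using U_chart_facts(1)[of s p c] s N(3) N1(4) sub(1) cA U_eq[of s p] by (auto simp: charts_at_iff)
    have "smooth_on N (\<lambda>s. ((J2 s c + \<kappa> p s *\<^sub>R J s c) \<bullet> velocity A (flow p) s c) / (velocity A (flow p) s c \<bullet> velocity A (flow p) s c))"
      by (intro smooth_on_divide smooth_on_inner smooth_on_add smooth_on_scaleR N sm
          smooth_on_subset[OF \<kappa>_smooth[OF p] N(3)]) (simp add: u0)
    then have "smooth_on N f"
    proof (rule smooth_on_cong[OF N(1)])
      fix s assume s: "s \<in> N"
      then have "J2 s c + \<kappa> p s *\<^sub>R J s c = f s *\<^sub>R velocity A (flow p) s c"
        using fun_cong[OF f, of s c] N(3) by (auto simp: Z_def)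
      then show "((J2 s c + \<kappa> p s *\<^sub>R J s c) \<bullet> velocity A (flow p) s c) / (velocity A (flow p) s c \<bullet> velocity A (flow p) s c) = f s"
        using u0[OF s] by simp
    qed
    then show "\<exists>N. open N \<and> t \<in> N \<and> smooth_on N f" using N by blast
  qed
  then have "ricci_jacobi_equation n A g (life p) (flow p) J f"
    unfolding ricci_jacobi_equation_def using f n by (auto simp: ricci_generator Z_def J2_def)
  then show ?thesis by blast
qed

end

section \<open>A plane wave\<close>

abbreviation std_chart :: "('e, 'e) chart" where "std_chart \<equiv> (UNIV, id)"

text \<open>The value zero off the standard chart follows the convention of
  \<open>tangent_space\<close>, which makes equality of tangent vectors equality of
  functions.\<close>

definition tv :: "'e::euclidean_space \<Rightarrow> ('e, 'e) tvec" where
  "tv a = (\<lambda>d. if d = std_chart then a else 0)"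

lemma tv_std [simp]: "tv a std_chart = a"
  by (simp add: tv_def)

lemma tv_zero: "tv 0 = (\<lambda>_. 0)"
  by (auto simp: tv_def)

lemma tv_scale: "(\<lambda>d. k *\<^sub>R tv a d) = tv (k *\<^sub>R a)"
  by (auto simp: tv_def)

lemma tv_inj: "tv a = tv b \<longleftrightarrow> a = b"
  by (metis tv_std)

lemma tv_eq_zero: "tv a = (\<lambda>_. 0) \<longleftrightarrow> a = 0"
  using tv_inj[of a 0] by (simp add: tv_zero)

lemma transition_std [simp]: "transition std_chart std_chart = id"
  by (simp add: transition_def fun_eq_iff inv_into_f_f[of id UNIV, simplified])

lemma smooth_atlas_std: "smooth_atlas (std_atlas :: ('e::euclidean_space, 'e) chart set)"
  by (auto simp: smooth_atlas_def std_atlas_def id_def smooth_on_ident transition_std[unfolded id_def])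

lemma tangent_std: "tangent_space std_atlas p = range tv"
proof
  show "tangent_space std_atlas p \<subseteq> range tv"
  proof
    fix v :: "('a, 'a) tvec" assume v: "v \<in> tangent_space std_atlas p"
    have "v = tv (v std_chart)"
    proof
      fix c :: "('a, 'a) chart"
      have "c \<notin> charts_at std_atlas p \<Longrightarrow> v c = 0" using v unfolding tangent_space_def by blast
      then show "v c = tv (v std_chart) c" by (simp add: tv_def)
    qed
    then show "v \<in> range tv" by blast
  qed
  show "range tv \<subseteq> tangent_space std_atlas p" by (auto simp: tangent_space_def tv_def split: if_splits)
qed

lemma tv_tangent [simp]: "tv a \<in> tangent_space std_atlas p"
  by (simp add: tangent_std)

lemma coord_vec_std [simp]: "coord_vec std_atlas p std_chart a = tv a"
  by (auto simp: coord_vec_def tv_def)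

lemma velocity_std: "velocity std_atlas \<gamma> t = tv (vector_derivative \<gamma> (at t))"
  by (auto simp: velocity_def tv_def)

interpretation std: atlas "std_atlas :: ('e::euclidean_space, 'e) chart set"
  by unfold_locales (rule smooth_atlas_std)

lemma manifold_topology_std:
  "manifold_topology (std_atlas :: ('e::euclidean_space, 'e) chart set) = euclidean"
  unfolding topology_eq std.openin_manifold by (simp add: std_atlas_def points_def)

lemma second_countable_euclidean: "second_countable (euclidean :: 'e::euclidean_space topology)"
proof -
  obtain \<B> :: "'e set set" where \<B>: "countable \<B>" "topological_basis \<B>"
    using ex_countable_basis by blast
  show ?thesis
    unfolding second_countable_def
  proof (intro exI[of _ \<B>] conjI ballI allI impI)
    show "openin euclidean V" if "V \<in> \<B>" for V using topological_basis_open[OF \<B>(2) that] by simp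
    fix U :: "'e set" and x assume "openin euclidean U \<and> x \<in> U"
    then show "\<exists>V\<in>\<B>. x \<in> V \<and> V \<subseteq> U" 
      by (metis open_openin topological_basisE[OF \<B>(2)])
  qed (rule \<B>(1))
qed

lemma smooth_manifold_std: "smooth_manifold (std_atlas :: ('e::euclidean_space, 'e) chart set)"
proof -
  have "Hausdorff_space (euclidean :: 'e topology)"
    unfolding Hausdorff_space_def
  proof (intro allI impI, elim conjE)
    fix x y :: 'e assume "x \<noteq> y"
    from hausdorff[OF this] show "\<exists>U V. openin euclidean U \<and> openin euclidean V \<and> x \<in> U \<and> y \<in> V \<and> disjnt U V"
      by (auto simp: disjnt_def)
  qed
  then show ?thesis
    by (simp add: smooth_manifold_def smooth_atlas_std manifold_topology_std second_countable_euclidean)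
qed

lemma smooth_map_std_std:
  fixes f :: "'e::euclidean_space \<Rightarrow> 'f::euclidean_space"
  shows "smooth_on UNIV F \<Longrightarrow> (\<And>x. x \<in> X \<Longrightarrow> f x = F x) \<Longrightarrow> smooth_map std_atlas std_atlas X f"
  by (auto simp: smooth_map_def intro!: exI[of _ UNIV] exI[of _ F])

lemma points_tangent_std: "points (tangent_atlas std_atlas) = UNIV \<times> range tv"
  by (auto simp: std.points_tangent tangent_std)

lemma charts_at_tangent_std: "charts_at (tangent_atlas std_atlas) (p, tv a) = {tchart std_atlas std_chart}"
  by (simp add: charts_at_tangent_atlas)

lemma tchart_std: "fst (tchart std_atlas std_chart) = UNIV \<times> range tv"
  "snd (tchart std_atlas std_chart) (p, v) = (p, v std_chart)"
  by (auto simp: tchart_def tangent_std)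

lemma smooth_map_to_tangent_std:
  fixes F :: "'k::euclidean_space \<Rightarrow> 'e::euclidean_space"
  assumes "smooth_on UNIV F" "smooth_on UNIV h" "\<And>x. x \<in> X \<Longrightarrow> f x = (F x, tv (h x))"
  shows "smooth_map std_atlas (tangent_atlas std_atlas) X f"
  using assms(3) smooth_on_Pair[OF open_UNIV assms(1,2)]
  by (auto simp: smooth_map_def points_tangent_std charts_at_tangent_std tchart_std
      intro!: exI[of _ UNIV] exI[of _ "\<lambda>x. (F x, h x)"])

lemma smooth_map_from_tangent_std:
  fixes K :: "'e::euclidean_space \<times> 'e \<Rightarrow> 'e"
  assumes "smooth_on UNIV K" "\<And>p v. (p, v) \<in> X \<Longrightarrow> v \<in> range tv \<and> f (p, v) = K (p, v std_chart)"
  shows "smooth_map (tangent_atlas std_atlas) std_atlas X f"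
  unfolding smooth_map_def
proof (intro conjI ballI)
  show "X \<subseteq> points (tangent_atlas std_atlas)" using assms(2) by (auto simp: points_tangent_std)
  fix x c d assume x: "x \<in> X" and c: "c \<in> charts_at (tangent_atlas std_atlas) x" and d: "d \<in> charts_at std_atlas (f x)"
  obtain p a where "x = (p, tv a)" using assms(2) x by (cases x) blast
  then have c': "c = tchart std_atlas std_chart" using c by (simp add: charts_at_tangent_std)
  show "\<exists>N F. open N \<and> snd c x \<in> N \<and> smooth_on N F \<and>
      (\<forall>y\<in>X \<inter> fst c. snd c y \<in> N \<longrightarrow> f y \<in> fst d \<and> snd d (f y) = F (snd c y))"
    using d assms by (intro exI[of _ UNIV] exI[of _ K]) (auto simp: c' tchart_std)
qed simp

lemma curve_std:
  assumes "\<sigma> \<in> curves_through std_atlas X p"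
  obtains \<epsilon> where "\<epsilon> > 0" "\<sigma> ` {-\<epsilon><..<\<epsilon>} \<subseteq> X" "\<sigma> 0 = p"
    "(\<sigma> has_vector_derivative (velocity std_atlas \<sigma> 0 std_chart)) (at 0)"
proof -
  obtain \<epsilon> where e: "\<epsilon> > 0" "\<sigma> ` {-\<epsilon><..<\<epsilon>} \<subseteq> X" "smooth_map std_atlas std_atlas {-\<epsilon><..<\<epsilon>} \<sigma>" "\<sigma> 0 = p"
    using assms by (auto simp: curves_through_def)
  have "((\<lambda>s. snd std_chart (\<sigma> s)) has_vector_derivative (velocity std_atlas \<sigma> 0 std_chart)) (at 0)"
    by (rule std.has_velocity[OF e(3)]) (use e(1) in auto)
  then show ?thesis using that e by simp
qed

lemma line_std:
  assumes "\<And>s. p + s *\<^sub>R w \<in> X"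
  shows "(\<lambda>s. p + s *\<^sub>R w) \<in> curves_through std_atlas X p" "velocity std_atlas (\<lambda>s. p + s *\<^sub>R w) t = tv w"
proof -
  have "smooth_on UNIV (\<lambda>s. p + s *\<^sub>R w)"
    by (intro smooth_on_add smooth_on_const smooth_on_bounded_linear bounded_linear_scaleR_left open_UNIV)
  then have "smooth_map std_atlas std_atlas {-1<..<1} (\<lambda>s. p + s *\<^sub>R w)" by (rule smooth_map_std_std) simp
  then show "(\<lambda>s. p + s *\<^sub>R w) \<in> curves_through std_atlas X p"
    using assms by (auto simp: curves_through_def intro!: exI[of _ 1])
  have "((\<lambda>s. p + s *\<^sub>R w) has_vector_derivative w) (at t)"
    by (auto intro!: derivative_eq_intros simp: has_vector_derivative_def)
  then show "velocity std_atlas (\<lambda>s. p + s *\<^sub>R w) t = tv w" by (simp add: velocity_std vector_derivative_at)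
qed

text \<open>The coordinates are \<open>u = x \<bullet> e0\<close>, \<open>v = x \<bullet> e1\<close> and the Euclidean components \<open>perp x\<close>; the
  metric is \<open>2 du dv + e\<^bsup>2u\<^esup> |dx|\<^sup>2\<close>. In these coordinates the normal geodesics of \<open>u = v = 0\<close> are
  straight lines, so that the normal exponential map is \<open>(p, a) \<mapsto> p + a\<close>.\<close>

locale plane_wave =
  fixes e0 e1 :: "'e::euclidean_space"
  assumes e: "e0 \<in> Basis" "e1 \<in> Basis" "e0 \<noteq> e1"
begin

lemma e_inner [simp]: "e0 \<bullet> e0 = 1" "e1 \<bullet> e1 = 1" "e0 \<bullet> e1 = 0" "e1 \<bullet> e0 = 0"
  using e by (auto simp: inner_Basis)

definition perp :: "'e \<Rightarrow> 'e" where "perp a = a - (a \<bullet> e0) *\<^sub>R e0 - (a \<bullet> e1) *\<^sub>R e1"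

lemma perp_linear: "linear perp"
  unfolding perp_def by (rule linearI) (simp_all add: algebra_simps inner_add_left)

lemma perp_bounded_linear: "bounded_linear perp"
  using perp_linear linear_conv_bounded_linear by blast

lemma perp_inner [simp]: "perp a \<bullet> e0 = 0" "perp a \<bullet> e1 = 0" "e0 \<bullet> perp a = 0" "e1 \<bullet> perp a = 0"
  by (simp_all add: perp_def inner_diff_left inner_diff_right inner_commute)

lemma perp_perp [simp]: "perp (perp a) = perp a"
  by (simp add: perp_def[of "perp a"])

lemma perp_e [simp]: "perp e0 = 0" "perp e1 = 0" "perp 0 = 0"
  by (simp_all add: perp_def)

lemmas perp_simps = linear_add[OF perp_linear] linear_diff[OF perp_linear] linear_scale[OF perp_linear]
  linear_neg[OF perp_linear]

lemma decomposition: "a = (a \<bullet> e0) *\<^sub>R e0 + (a \<bullet> e1) *\<^sub>R e1 + perp a"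
  by (simp add: perp_def)

definition gm :: "'e \<Rightarrow> 'e \<Rightarrow> 'e \<Rightarrow> real" where
  "gm x a b = (a \<bullet> e0) * (b \<bullet> e1) + (a \<bullet> e1) * (b \<bullet> e0) + exp (2 * (x \<bullet> e0)) * (perp a \<bullet> perp b)"

definition G :: "('e, 'e) metric" where "G p v w = gm p (v std_chart) (w std_chart)"

lemma G_tv [simp]: "G p (tv a) (tv b) = gm p a b"
  by (simp add: G_def)

lemma metric_coeff_G: "metric_coeff std_atlas G std_chart x a b = gm x a b"
  by (simp add: metric_coeff_def Let_def inv_into_f_f[of id UNIV, simplified])

lemma lorentzian_G: "lorentzian_metric std_atlas G"
  unfolding lorentzian_metric_def
proof (intro conjI ballI allI)
  show "G p u v = G p v u" for p u v by (simp add: G_def gm_def inner_commute algebra_simps)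
  show "G p (\<lambda>c. r *\<^sub>R u c + s *\<^sub>R v c) w = r * G p u w + s * G p v w" for p u v w r s
    by (simp add: G_def gm_def perp_simps inner_add_left algebra_simps)
  fix c :: "('e, 'e) chart" and a b assume "c \<in> std_atlas"
  then have c: "c = std_chart" by (simp add: std_atlas_def)
  show "smooth_on (snd c ` fst c) (\<lambda>x. metric_coeff std_atlas G c x a b)"
    unfolding c metric_coeff_G gm_def
    by (simp, intro smooth_on_add smooth_on_mult smooth_on_const smooth_on_exp smooth_on_bounded_linear
        bounded_linear_inner_left open_UNIV)
next
  fix p :: 'e
  define w where "w = exp (- (p \<bullet> e0))"
  have w: "exp (2 * (p \<bullet> e0)) * (w * w) = 1" by (simp add: w_def flip: exp_add)
  \<comment> \<open>For the metric 2 du dv the vectors (e0 + e1) / sqrt 2 and (e0 - e1) / sqrt 2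
    have squares 1 and -1; \<open>e1\<close> is the index of the timelike one. The factor
    \<open>w\<close> = e^(-u) normalizes the remaining directions.\<close>
  define E where "E b = (if b = e0 then (1 / sqrt 2) *\<^sub>R (e0 + e1) else if b = e1 then (1 / sqrt 2) *\<^sub>R (e0 - e1) else w *\<^sub>R b)" for b
  have other: "b \<bullet> e0 = 0" "b \<bullet> e1 = 0" "perp b = b" if "b \<in> Basis" "b \<noteq> e0" "b \<noteq> e1" for b
    using that e by (auto simp: inner_Basis perp_def)
  have s2: "1 / sqrt 2 * (1 / sqrt 2) = (1 / 2 :: real)" by simp
  have "gm p (E b) (E b') = (if b \<noteq> b' then 0 else if b = e1 then -1 else 1)" if "b \<in> Basis" "b' \<in> Basis" for b b'
    using other[of b] other[of b'] that w s2
    by (auto simp: E_def gm_def perp_simps inner_add_left inner_diff_left inner_Basis e(3) e(3)[symmetric])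
  then show "\<exists>b0\<in>(Basis :: 'e set). \<exists>E. \<forall>b\<in>Basis. E b \<in> tangent_space std_atlas p \<and>
        (\<forall>b'\<in>Basis. G p (E b) (E b') = (if b \<noteq> b' then 0 else if b = b0 then -1 else 1))"
    using e(2) by (intro bexI[of _ e1] exI[of _ "\<lambda>b. tv (E b)"]) auto
qed

sublocale lorentz std_atlas G
  by unfold_locales (rule lorentzian_G)

text \<open>Obtained from the Koszul formula, in which only the factor e^(2u) is differentiated;
  uniqueness of the Christoffel symbol then confirms it.\<close>

definition chr_pw :: "'e \<Rightarrow> 'e \<Rightarrow> 'e \<Rightarrow> 'e" where
  "chr_pw x a b = (a \<bullet> e0) *\<^sub>R perp b + (b \<bullet> e0) *\<^sub>R perp a - (exp (2 * (x \<bullet> e0)) * (perp a \<bullet> perp b)) *\<^sub>R e1"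

lemma christoffel_pw: "chr std_chart x = chr_pw x"
proof -
  have c: "std_chart \<in> charts_at std_atlas x" by simp
  have "is_christoffel std_chart x (chr_pw x)"
    unfolding is_christoffel_def
  proof (intro conjI allI)
    show "bilinear (chr_pw x)"
      by (rule bilinearI; rule linearI) (simp_all add: chr_pw_def perp_simps inner_add_left inner_add_right algebra_simps)
    show "chr_pw x a b = chr_pw x b a" for a b by (simp add: chr_pw_def inner_commute)
    fix v a b
    have "((\<lambda>y. gm y a b) has_derivative (\<lambda>v. (2 * (v \<bullet> e0)) * exp (2 * (x \<bullet> e0)) * (perp a \<bullet> perp b))) (at x)"
      unfolding gm_def by (auto intro!: derivative_eq_intros simp: algebra_simps)
    then show "Dat (\<lambda>y. mc std_chart y a b) x v = mc std_chart x (chr_pw x v a) b + mc std_chart x a (chr_pw x v b)"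
      by (simp add: metric_coeff_G Dat_eq) (simp add: gm_def chr_pw_def perp_simps inner_add_left inner_diff_left
          inner_add_right inner_diff_right inner_commute algebra_simps)
  qed
  with is_christoffel_unique[OF c christoffel[OF c]] show ?thesis by simp
qed

lemma cov_along_pw:
  "cov_along std_atlas G \<gamma> Z t = tv (vector_derivative (\<lambda>s. Z s std_chart) (at t)
     + chr_pw (\<gamma> t) (velocity std_atlas \<gamma> t std_chart) (Z t std_chart))"
  by (rule ext) (auto simp: cov_along_def tv_def christoffel_pw)

text \<open>The covariant derivative of the constant field \<open>e0\<close>. On vectors without
  \<open>e1\<close> component it agrees with the identity modulo \<open>e0\<close>, which is where
  the umbilicity function -1 comes from.\<close>

lemma chr_pw_e0: "chr_pw x a e0 = perp a"
  by (simp add: chr_pw_def)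

text \<open>The constant field e0 - e1 has square -2 and serves as time orientation.\<close>

lemma spacetime_pw: "spacetime std_atlas G (\<lambda>_. tv (e0 - e1))"
proof -
  have "smooth_map std_atlas (tangent_atlas std_atlas) UNIV (\<lambda>p. (p, tv (e0 - e1)))"
    by (rule smooth_map_to_tangent_std[OF smooth_on_ident[OF open_UNIV] smooth_on_const]) simp
  moreover have "connected_space (euclidean :: 'e topology)"
    using connectedin_topspace[of "euclidean :: 'e topology"] by (simp add: connected_UNIV)
  ultimately show ?thesis
    by (simp add: spacetime_def smooth_manifold_std manifold_topology_std lorentzian_G smooth_field_def
        gm_def perp_simps inner_diff_left)
qed

section \<open>The spacelike plane, its normal bundle and its normal exponential map\<close>

definition S0 :: "'e set" where "S0 = {x. x \<bullet> e0 = 0 \<and> x \<bullet> e1 = 0}"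

lemma S0_subspace: "subspace S0"
  by (auto simp: S0_def subspace_def inner_add_left)

lemma perp_S0: "x \<in> S0 \<Longrightarrow> perp x = x" "perp x \<in> S0"
  by (simp add: S0_def perp_def, simp add: S0_def)

lemma S0_dim: assumes "DIM('e) = n + 2" shows "dim S0 = n"
proof -
  have "S0 = {x. \<forall>i\<in>Basis. i \<notin> Basis - {e0, e1} \<longrightarrow> x \<bullet> i = 0}"
    using e by (auto simp: S0_def)
  moreover have "card (Basis - {e0, e1} :: 'e set) = n"
    using e assms by (simp add: card_Diff_subset)
  ultimately show ?thesis using dim_substandard[of "Basis - {e0, e1}"] by simp
qed

text \<open>Straight lines realize every direction of the subspace; conversely the functionals that
  cut it out vanish along a curve, hence also on its velocity.\<close>

lemma sub_tangent_S0:
  assumes p: "p \<in> S0" shows "sub_tangent std_atlas S0 p = tv ` S0"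
proof
  show "tv ` S0 \<subseteq> sub_tangent std_atlas S0 p"
  proof
    fix x assume "x \<in> tv ` S0"
    then obtain w where w: "w \<in> S0" "x = tv w" by blast
    have "p + s *\<^sub>R w \<in> S0" for s using p w(1) S0_subspace by (simp add: subspace_add subspace_scale)
    from line_std[of p w S0, OF this] w(2) show "x \<in> sub_tangent std_atlas S0 p"
      unfolding sub_tangent_def by (metis (mono_tags, lifting) mem_Collect_eq)
  qed
  show "sub_tangent std_atlas S0 p \<subseteq> tv ` S0"
  proof
    fix x assume "x \<in> sub_tangent std_atlas S0 p"
    then obtain \<sigma> where \<sigma>: "\<sigma> \<in> curves_through std_atlas S0 p" "x = velocity std_atlas \<sigma> 0"
      by (auto simp: sub_tangent_def)
    obtain w where w: "x = tv w" using std.sub_tangent_tangent[OF \<open>x \<in> sub_tangent std_atlas S0 p\<close>] by (auto simp: tangent_std)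
    obtain \<epsilon> where \<epsilon>: "\<epsilon> > 0" "\<sigma> ` {-\<epsilon><..<\<epsilon>} \<subseteq> S0" "\<sigma> 0 = p" "(\<sigma> has_vector_derivative w) (at 0)"
      using curve_std[OF \<sigma>(1)] \<sigma>(2) w by (metis tv_std)
    have mem: "\<sigma> s \<bullet> e0 = 0 \<and> \<sigma> s \<bullet> e1 = 0" if "s \<in> {-\<epsilon><..<\<epsilon>}" for s
      using subsetD[OF \<epsilon>(2) imageI[OF that]] by (simp add: S0_def)
    have "w \<bullet> b = 0" if b: "b = e0 \<or> b = e1" for b
    proof -
      have "((\<lambda>s. \<sigma> s \<bullet> b) has_vector_derivative w \<bullet> b) (at 0)"
        by (rule bounded_linear.has_vector_derivative[OF bounded_linear_inner_left \<epsilon>(4)])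
      moreover have "((\<lambda>s. \<sigma> s \<bullet> b) has_vector_derivative 0) (at 0)"
        by (rule has_vector_derivative_transform_within_open[OF has_vector_derivative_const, of "{-\<epsilon><..<\<epsilon>}" _ 0])
          (use \<epsilon>(1) b mem in auto)
      ultimately show ?thesis by (rule vector_derivative_unique_at)
    qed
    then show "x \<in> tv ` S0" using w by (auto simp: S0_def)
  qed
qed

text \<open>The normal spaces are spanned by \<open>e0\<close> and \<open>e1\<close>. The set serves
  both as the normal bundle and as the exponential domain, since here the normal exponential map is
  a global diffeomorphism.\<close>

definition NB0 :: "('e \<times> ('e, 'e) tvec) set" where "NB0 = {(p, tv a) | p a. p \<in> S0 \<and> perp a = 0}"

lemma normal_bundle_pw: "normal_bundle std_atlas G S0 = NB0"
proof -
  have "(\<forall>w\<in>S0. gm p a w = 0) \<longleftrightarrow> perp a = 0" if "p \<in> S0" for p a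
  proof
    assume "\<forall>w\<in>S0. gm p a w = 0"
    then have "gm p a (perp a) = 0" using perp_S0 by blast
    then show "perp a = 0" by (simp add: gm_def)
  qed (auto simp: gm_def S0_def)
  note eq = this
  show ?thesis
    unfolding normal_bundle_def NB0_def by (auto simp: sub_tangent_S0 tangent_std) (use eq in blast)+
qed

lemma spacelike_pw: assumes "DIM('e) = n + 2" shows "spacelike_submanifold std_atlas G n S0"
proof -
  have "embedded_submanifold std_atlas n S0"
    unfolding embedded_submanifold_def
  proof (intro conjI ballI)
    fix p assume "p \<in> S0"
    have "insert std_chart std_atlas = (std_atlas :: ('e, 'e) chart set)" by (simp add: std_atlas_def)
    then show "\<exists>d L. p \<in> fst d \<and> fst d \<subseteq> points std_atlas \<and> smooth_atlas (insert d std_atlas) \<and>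
        subspace L \<and> dim L = n \<and> snd d ` (S0 \<inter> fst d) = L \<inter> snd d ` fst d"
      using S0_dim[OF assms] S0_subspace smooth_atlas_std[where 'e = 'e]
      by (intro exI[of _ std_chart] exI[of _ S0]) simp
  qed simp
  moreover have "connected S0" using subspace_imp_convex[OF S0_subspace] convex_connected by blast
  moreover have "gm p w w > 0" if "w \<in> S0" "w \<noteq> 0" for p w
    using that perp_S0(1)[OF that(1)] by (simp add: gm_def S0_def)
  ultimately show ?thesis
    by (auto simp: spacelike_submanifold_def manifold_topology_std sub_tangent_S0 tv_eq_zero)
qed

abbreviation \<xi>0 :: "'e \<Rightarrow> ('e, 'e) tvec" where "\<xi>0 \<equiv> \<lambda>_. tv e0"

lemma lightlike_pw: "lightlike_normal_field std_atlas G S0 \<xi>0"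
proof -
  have "smooth_map std_atlas (tangent_atlas std_atlas) S0 (\<lambda>p. (p, tv e0))"
    by (rule smooth_map_to_tangent_std[OF smooth_on_ident[OF open_UNIV] smooth_on_const]) simp
  moreover have "e0 \<noteq> 0" using e(1) by auto
  ultimately show ?thesis
    by (auto simp: lightlike_normal_field_def smooth_field_def normal_bundle_pw NB0_def tv_eq_zero gm_def)
qed

text \<open>Every term of \<open>chr_pw x a a\<close> contains \<open>perp a\<close>, so straight
  lines in such directions are geodesics.\<close>

lemma exp_rel_pw:
  assumes a: "perp a = 0" shows "exp_rel std_atlas G p (tv a) (p + a)"
proof -
  note l = line_std[of p a UNIV, simplified]
  have "smooth_on UNIV (\<lambda>s. p + s *\<^sub>R a)"
    by (intro smooth_on_add smooth_on_const smooth_on_bounded_linear bounded_linear_scaleR_left open_UNIV)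
  then have "smooth_map std_atlas std_atlas {-1<..<2} (\<lambda>s. p + s *\<^sub>R a)" by (rule smooth_map_std_std) simp
  moreover have "cov_along std_atlas G (\<lambda>s. p + s *\<^sub>R a) (velocity std_atlas (\<lambda>s. p + s *\<^sub>R a)) t = (\<lambda>_. 0)" for t
    unfolding cov_along_pw l(2) using a by (simp add: chr_pw_def tv_zero)
  ultimately have "geodesic std_atlas G {-1<..<2} (\<lambda>s. p + s *\<^sub>R a)" by (simp add: geodesic_def)
  then show ?thesis
    unfolding exp_rel_def using l(2)[of 0] by (intro exI[of _ "\<lambda>s. p + s *\<^sub>R a"] exI[of _ "-1"] exI[of _ 2]) simp
qed

lemma exp_map_pw: "perp a = 0 \<Longrightarrow> exp_map std_atlas G p (tv a) = p + a"
  using smooth_manifold_std[where 'e = 'e] by (intro exp_map_eq exp_rel_pw) (simp_all add: smooth_manifold_def)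

lemma normal_exp_domain_pw: "normal_exp_domain std_atlas G S0 NB0"
  unfolding normal_exp_domain_def
proof (intro conjI)
  let ?E = "\<lambda>(p, v). exp_map std_atlas G p v"
  have "openin (manifold_topology (tangent_atlas (std_atlas :: ('e, 'e) chart set))) (points (tangent_atlas std_atlas))"
  proof (subst std.openin_tangent, intro conjI ballI)
    fix c :: "('e, 'e) chart" assume "c \<in> std_atlas"
    then have c: "c = std_chart" "std_chart \<in> (std_atlas :: ('e, 'e) chart set)" by (simp_all add: std_atlas_def)
    have "points (tangent_atlas std_atlas) \<inter> fst (tchart std_atlas std_chart) = fst (tchart (std_atlas :: ('e, 'e) chart set) std_chart)"
      by (auto simp: points_tangent_std tchart_std)
    then show "open (snd (tchart std_atlas c) ` (points (tangent_atlas std_atlas) \<inter> fst (tchart std_atlas c)))"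
      unfolding c(1) by (simp add: std.tchart_image[OF c(2)])
  qed simp
  moreover have "NB0 = points (tangent_atlas std_atlas) \<inter> NB0" by (auto simp: points_tangent_std NB0_def)
  ultimately show "openin (subtopology (manifold_topology (tangent_atlas std_atlas)) (normal_bundle std_atlas G S0)) NB0"
    unfolding normal_bundle_pw openin_subtopology by blast
  show "\<forall>p\<in>S0. (p, \<lambda>_. 0) \<in> NB0" by (auto simp: NB0_def tv_zero[symmetric] tv_inj)
  show "\<forall>(p, v)\<in>NB0. \<forall>s\<in>{0..1}. (p, \<lambda>c. s *\<^sub>R v c) \<in> NB0"
    by (auto simp: NB0_def tv_scale tv_inj perp_simps)
  show "\<forall>(p, v)\<in>NB0. \<exists>q. exp_rel std_atlas G p v q" using exp_rel_pw by (auto simp: NB0_def)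
  have E: "?E (p, tv a) = p + a" if "perp a = 0" for p a using exp_map_pw[OF that] by simp
  \<comment> \<open>The inverse of (p, a) -> p + a: the perpendicular part of \<open>q\<close> is
    the base point and the rest is the normal vector.\<close>
  define K where "K q = (perp q, tv ((q \<bullet> e0) *\<^sub>R e0 + (q \<bullet> e1) *\<^sub>R e1))" for q
  have K: "K q \<in> NB0" "?E (K q) = q" for q
  proof -
    have 0: "perp ((q \<bullet> e0) *\<^sub>R e0 + (q \<bullet> e1) *\<^sub>R e1) = 0" by (simp add: perp_simps)
    then show "K q \<in> NB0" unfolding K_def NB0_def using perp_S0(2) by blast
    show "?E (K q) = q" unfolding K_def E[OF 0] using decomposition[of q] by (simp add: algebra_simps)
  qed
  have KE: "K (?E x) = x" if x: "x \<in> NB0" for x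
  proof -
    obtain p a where a: "x = (p, tv a)" "p \<in> S0" "perp a = 0" using x by (auto simp: NB0_def)
    have "(a \<bullet> e0) *\<^sub>R e0 + (a \<bullet> e1) *\<^sub>R e1 = a" using decomposition[of a] a(3) by simp
    then show ?thesis
      unfolding a(1) E[OF a(3)] using a(2,3) perp_S0(1)[OF a(2)] by (simp add: K_def perp_simps inner_add_left S0_def)
  qed
  have bij: "bij_betw ?E NB0 UNIV" by (rule bij_betw_byWitness[where f' = K]) (use K KE in auto)
  have inv: "inv_into NB0 ?E q = K q" for q
    by (rule inv_into_f_eq[OF bij_betw_imp_inj_on[OF bij] K])
  have sm: "smooth_on UNIV (\<lambda>q. (q \<bullet> e0) *\<^sub>R e0 + (q \<bullet> e1) *\<^sub>R e1)"
    by (rule smooth_on_add[OF open_UNIV smooth_on_scaleR[OF open_UNIV smooth_on_bounded_linear[OF bounded_linear_inner_left open_UNIV] smooth_on_const]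
          smooth_on_scaleR[OF open_UNIV smooth_on_bounded_linear[OF bounded_linear_inner_left open_UNIV] smooth_on_const]])
  have "smooth_map (tangent_atlas std_atlas) std_atlas NB0 ?E"
    by (rule smooth_map_from_tangent_std[of "\<lambda>x. fst x + snd x"])
      (auto simp: NB0_def exp_map_pw intro!: smooth_on_bounded_linear bounded_linear_add bounded_linear_fst bounded_linear_snd)
  moreover have "smooth_map std_atlas (tangent_atlas std_atlas) UNIV (inv_into NB0 ?E)"
    by (rule smooth_map_to_tangent_std[OF smooth_on_bounded_linear[OF perp_bounded_linear open_UNIV] sm])
      (simp add: inv K_def)
  ultimately show "\<exists>W. openin (manifold_topology std_atlas) W \<and> diffeo (tangent_atlas std_atlas) std_atlas NB0 W ?E"
    using bij by (intro exI[of _ UNIV]) (simp add: diffeo_def manifold_topology_std)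
qed

lemma null_generation_pw:
  assumes "DIM('e) = n + 2"
  shows "null_generation n std_atlas G (\<lambda>_. tv (e0 - e1)) S0 \<xi>0 NB0"
  by (simp add: null_generation_def assms spacetime_pw spacelike_pw lightlike_pw normal_exp_domain_pw)

end

section \<open>The null hypersurface of the plane wave and its Jacobi fields\<close>

locale plane_wave_dim = plane_wave e0 e1 for e0 e1 :: "'e::euclidean_space" +
  fixes n :: nat
  assumes DIM: "DIM('e) = n + 2"

sublocale plane_wave_dim \<subseteq> pw: null_generated n std_atlas G "\<lambda>_. tv (e0 - e1)" S0 \<xi>0 NB0
  by unfold_locales (rule null_generation_pw[OF DIM])

context plane_wave_dim
begin

lemma life_pw: "p \<in> S0 \<Longrightarrow> pw.life p = UNIV"
proof -
  assume p: "p \<in> S0"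
  have "(p, tv (t *\<^sub>R e0)) \<in> NB0" for t using p by (auto simp: NB0_def tv_inj perp_simps)
  then show ?thesis using p by (auto simp: pw.life_iff tv_scale)
qed

lemma flow_pw: "pw.flow p = (\<lambda>t. p + t *\<^sub>R e0)"
  by (rule ext) (simp add: generator_def tv_scale exp_map_pw perp_simps)

lemma velocity_flow_pw: "velocity std_atlas (pw.flow p) t = tv e0"
  unfolding flow_pw by (rule line_std(2)[of p e0 UNIV]) simp

lemma \<Sigma>_pw: "q \<in> pw.\<Sigma> \<Longrightarrow> q \<bullet> e1 = 0 \<and> pw.U q = tv e0"
proof -
  assume "q \<in> pw.\<Sigma>"
  then obtain p t where t: "t \<in> pw.life p" "q = pw.flow p t" using pw.\<Sigma>_iff by blast
  then have "p \<in> S0" using pw.life_S by blast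
  then show ?thesis
    using pw.U_eq[OF t(1)] t(2) by (simp add: velocity_flow_pw) (simp add: flow_pw S0_def inner_add_left)
qed

text \<open>Along curves in the hypersurface \<open>U\<close> has the constant components
  \<open>e0\<close>, so the covariant derivative is the Christoffel term alone. The hypersurface
  lies in v = 0, so its tangent vectors have no \<open>e1\<close> component.\<close>

lemma nabla_pw:
  assumes x: "x \<in> sub_tangent std_atlas pw.\<Sigma> q"
  shows "nabla_sub std_atlas G pw.\<Sigma> pw.U q x = tv (perp (x std_chart))" "x std_chart \<bullet> e1 = 0"
proof -
  obtain \<sigma> where \<sigma>: "\<sigma> \<in> curves_through std_atlas pw.\<Sigma> q" "x = velocity std_atlas \<sigma> 0"
    using x by (auto simp: sub_tangent_def)
  obtain \<epsilon> where \<epsilon>: "\<epsilon> > 0" "\<sigma> ` {-\<epsilon><..<\<epsilon>} \<subseteq> pw.\<Sigma>" "\<sigma> 0 = q" "(\<sigma> has_vector_derivative x std_chart) (at 0)"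
    using curve_std[OF \<sigma>(1)] unfolding \<sigma>(2) by blast
  have mem: "\<sigma> s \<bullet> e1 = 0" "pw.U (\<sigma> s) = tv e0" if "s \<in> {-\<epsilon><..<\<epsilon>}" for s
    using \<Sigma>_pw[OF subsetD[OF \<epsilon>(2) imageI[OF that]]] by auto
  have "vector_derivative (\<lambda>s. pw.U (\<sigma> s) std_chart) (at 0) = vector_derivative (\<lambda>s. e0) (at 0)"
    by (rule vector_derivative_cong[of "{-\<epsilon><..<\<epsilon>}"]) (use \<epsilon>(1) mem in auto)
  then show "nabla_sub std_atlas G pw.\<Sigma> pw.U q x = tv (perp (x std_chart))"
    unfolding \<sigma>(2) pw.nabla_sub_eq(1)[OF \<sigma>(1)] cov_along_pw
    using mem(2)[of 0] \<epsilon>(1) by (simp add: chr_pw_e0)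
  have "((\<lambda>s. \<sigma> s \<bullet> e1) has_vector_derivative x std_chart \<bullet> e1) (at 0)"
    by (rule bounded_linear.has_vector_derivative[OF bounded_linear_inner_left \<epsilon>(4)])
  moreover have "((\<lambda>s. \<sigma> s \<bullet> e1) has_vector_derivative 0) (at 0)"
    by (rule has_vector_derivative_transform_within_open[OF has_vector_derivative_const, of "{-\<epsilon><..<\<epsilon>}" _ 0])
      (use \<epsilon>(1) mem in auto)
  ultimately show "x std_chart \<bullet> e1 = 0" by (rule vector_derivative_unique_at)
qed

text \<open>On tangent vectors, where the mixed du dv terms drop out, the metric reduces to e^(2u)
  times the product of perpendicular parts. This is exactly what pairing \<open>perp x\<close> with
  \<open>y\<close> gives, whence B = - g.\<close>

lemma umbilical_pw: "umbilical_with std_atlas G S0 \<xi>0 NB0 (\<lambda>_. -1)"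
  unfolding umbilical_with_def
proof (intro conjI ballI)
  show "smooth_map std_atlas std_atlas pw.\<Sigma> (\<lambda>_. -1 :: real)"
    by (rule smooth_map_std_std[OF smooth_on_const]) simp
  fix q x y assume x: "x \<in> sub_tangent std_atlas pw.\<Sigma> q" and y: "y \<in> sub_tangent std_atlas pw.\<Sigma> q"
  show "null_second_form std_atlas G S0 \<xi>0 NB0 q x y = -1 * G q x y"
    using nabla_pw(2)[OF x] nabla_pw(2)[OF y]
    by (simp add: null_second_form_def nabla_pw(1)[OF x] G_def gm_def)
qed

end

sublocale plane_wave_dim \<subseteq> um: umbilical n std_atlas G "\<lambda>_. tv (e0 - e1)" S0 \<xi>0 NB0 "\<lambda>_. -1"
  by unfold_locales (rule umbilical_pw)

context plane_wave_dim
begin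

lemma zero_S0: "0 \<in> S0"
  by (simp add: S0_def)

text \<open>The general formula for the umbilical case replaces a curvature computation: with \<mu>
  = -1 constant, \<kappa> = 0 - 1.\<close>

lemma ricci_pw:
  "p \<in> S0 \<Longrightarrow> ricci std_atlas G (pw.flow p t) (tv e0) (tv e0) = - real n"
  using um.ricci_generator[of t p] by (simp add: life_pw velocity_flow_pw um.\<kappa>_def um.mu_def[abs_def])

lemma cov_pw: "cov_along std_atlas G (pw.flow p) (\<lambda>_. tv (k *\<^sub>R e0)) = (\<lambda>_. tv 0)"
  by (rule ext) (simp add: cov_along_pw velocity_flow_pw chr_pw_def perp_simps)

lemma cov_cov_pw:
  "cov_along std_atlas G (pw.flow p) (cov_along std_atlas G (pw.flow p) (\<lambda>_. tv (k *\<^sub>R e0))) t c = 0"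
  using cov_pw[of p 0] unfolding cov_pw[of p k] by (simp add: tv_zero)

text \<open>A constant multiple of \<open>U\<close> is parallel along the generator, R(U, U) U = 0,
  and \<open>U\<close> is lightlike. The values 1 and 0 of \<open>k\<close> give the two fields used
  as witnesses.\<close>

lemma orthogonal_jacobi_pw: "orthogonal_jacobi_field std_atlas G UNIV (pw.flow p) (\<lambda>_. tv (k *\<^sub>R e0))"
proof -
  have "smooth_on UNIV (\<lambda>t. p + t *\<^sub>R e0)"
    by (intro smooth_on_add smooth_on_const smooth_on_bounded_linear bounded_linear_scaleR_left open_UNIV)
  then have "smooth_map std_atlas (tangent_atlas std_atlas) UNIV (\<lambda>t. (pw.flow p t, tv (k *\<^sub>R e0)))"
    by (rule smooth_map_to_tangent_std[OF _ smooth_on_const]) (simp add: flow_pw)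
  moreover have "riemann std_atlas G q (tv (k *\<^sub>R e0)) (tv e0) (tv e0) c = 0" for q c
  proof (cases "c \<in> charts_at std_atlas q")
    case True
    have "curv std_chart (snd std_chart q) (k *\<^sub>R e0) e0 e0 = 0"
      by (subst linear_scale[OF curv_linear[of std_chart q]]) (simp_all add: curv_self)
    then show ?thesis unfolding riemann_eq[OF True] using True by simp
  qed (simp add: riemann_def)
  ultimately show ?thesis
    by (simp add: orthogonal_jacobi_field_def jacobi_field_def smooth_field_along_def cov_cov_pw
        velocity_flow_pw gm_def perp_simps)
qed

text \<open>With vanishing second derivative and Ric(\<gamma>', \<gamma>') / n = -1, the left side
  is - k \<gamma>'.\<close>

lemma ricci_jacobi_pw:
  assumes "n > 0" "p \<in> S0"
  shows "ricci_jacobi_equation n std_atlas G UNIV (pw.flow p) (\<lambda>_. tv (k *\<^sub>R e0)) (\<lambda>_. - k)"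
  unfolding ricci_jacobi_equation_def cov_cov_pw velocity_flow_pw ricci_pw[OF assms(2)]
  using assms(1) by (simp add: smooth_on_const) (simp add: tv_def fun_eq_iff)

text \<open>In both directions the perpendicular part is zero, so the covariant derivative of
  \<open>U\<close> vanishes and its pairing with the transversal field is zero whatever that field
  is.\<close>

lemma rotation_form_pw:
  assumes "p \<in> S0"
  shows "rotation_form std_atlas G S0 \<xi>0 NB0 (pw.flow p t) (tv e0) = 0"
    "rotation_form std_atlas G S0 \<xi>0 NB0 (pw.flow p t) (tv 0) = 0"
proof -
  have t: "t \<in> pw.life p" using assms by (simp add: life_pw)
  have G0: "G q (tv 0) w = 0" for q w by (simp add: G_def gm_def)
  have x: "tv e0 \<in> sub_tangent std_atlas pw.\<Sigma> (pw.flow p t)"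
    using pw.U_sub_tangent[OF t] pw.U_eq[OF t] by (simp add: velocity_flow_pw)
  show "rotation_form std_atlas G S0 \<xi>0 NB0 (pw.flow p t) (tv e0) = 0"
    by (simp add: rotation_form_def nabla_pw(1)[OF x] G0)
  have "velocity std_atlas (\<lambda>s. pw.flow p t + s *\<^sub>R 0) 0 = tv 0" by (rule line_std(2)[of _ _ UNIV]) simp
  moreover have "(\<lambda>s. pw.flow p t + s *\<^sub>R 0) \<in> curves_through std_atlas pw.\<Sigma> (pw.flow p t)"
    by (rule line_std(1)) (simp add: pw.flow_\<Sigma>[OF t])
  ultimately have y: "tv 0 \<in> sub_tangent std_atlas pw.\<Sigma> (pw.flow p t)"
    unfolding sub_tangent_def by (intro CollectI exI[of _ "\<lambda>s. pw.flow p t + s *\<^sub>R 0"]) simp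
  show "rotation_form std_atlas G S0 \<xi>0 NB0 (pw.flow p t) (tv 0) = 0"
    by (simp add: rotation_form_def nabla_pw(1)[OF y] G0)
qed

text \<open>Flowing for a fixed time is a translation, so screen vectors are the velocities of
  curves in \<open>S0\<close> and lie in that subspace, which does not contain
  \<open>e0\<close>.\<close>

lemma not_screen_pw:
  assumes p: "p \<in> S0"
  shows "tv e0 \<notin> screen std_atlas G S0 \<xi>0 NB0 (pw.flow p t)"
proof
  assume "tv e0 \<in> screen std_atlas G S0 \<xi>0 NB0 (pw.flow p t)"
  moreover have "t \<in> pw.life p" using p by (simp add: life_pw)
  ultimately obtain \<sigma> where \<sigma>: "\<sigma> \<in> curves_through std_atlas S0 p" "tv e0 = velocity std_atlas (\<lambda>s. pw.flow (\<sigma> s) t) 0"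
    by (auto simp: screen_def pw.flow_coords)
  have "vector_derivative (\<lambda>s. \<sigma> s + t *\<^sub>R e0) (at 0) = velocity std_atlas \<sigma> 0 std_chart"
  proof -
    have "(\<sigma> has_vector_derivative velocity std_atlas \<sigma> 0 std_chart) (at 0)"
      by (rule curve_std[OF \<sigma>(1)])
    from has_vector_derivative_add[OF this has_vector_derivative_const[of "t *\<^sub>R e0"]]
    show ?thesis by (simp add: vector_derivative_at)
  qed
  then have "velocity std_atlas (\<lambda>s. pw.flow (\<sigma> s) t) 0 = tv (velocity std_atlas \<sigma> 0 std_chart)"
    unfolding flow_pw by (subst velocity_std) simp
  then have "tv e0 = tv (velocity std_atlas \<sigma> 0 std_chart)" by (rule trans[OF \<sigma>(2)])
  moreover have "velocity std_atlas \<sigma> 0 \<in> tv ` S0"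
    using \<sigma>(1) unfolding sub_tangent_S0[OF p, symmetric] by (auto simp: sub_tangent_def)
  ultimately have "e0 \<in> S0" by (auto simp: tv_inj)
  then show False by (simp add: S0_def)
qed

end

theorem corollary7p17:
  fixes n :: nat
  assumes "2 \<le> n" and "DIM('e::euclidean_space) = n + 2"
  shows
    "(\<forall>(A :: ('m, 'e) chart set) g T S \<xi> \<V> \<mu> p J.
        null_generation n A g T S \<xi> \<V> \<and> umbilical_with A g S \<xi> \<V> \<mu> \<and> p \<in> S \<and>
        orthogonal_jacobi_field A g (generator_interval S \<xi> \<V> p) (generator A g \<xi> p) J \<longrightarrow>
        (\<exists>f. ricci_jacobi_equation n A g (generator_interval S \<xi> \<V> p) (generator A g \<xi> p) J f))
     \<and>
     (\<exists>(A :: ('e, 'e) chart set) g T S \<xi> \<V> \<mu> p I \<gamma> J f J' f'.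
        null_generation n A g T S \<xi> \<V> \<and> umbilical_with A g S \<xi> \<V> \<mu> \<and> p \<in> S \<and>
        I = generator_interval S \<xi> \<V> p \<and> \<gamma> = generator A g \<xi> p \<and>
        orthogonal_jacobi_field A g I \<gamma> J \<and> ricci_jacobi_equation n A g I \<gamma> J f \<and>
        (\<exists>t\<in>I. J t \<notin> screen A g S \<xi> \<V> (\<gamma> t)) \<and>
        (\<exists>t\<in>I. f t \<noteq> deriv (\<lambda>s. rotation_form A g S \<xi> \<V> (\<gamma> s) (J s)) t
                        - \<mu> (\<gamma> t) * rotation_form A g S \<xi> \<V> (\<gamma> t) (J t)) \<and>
        orthogonal_jacobi_field A g I \<gamma> J' \<and> ricci_jacobi_equation n A g I \<gamma> J' f' \<and>
        (\<forall>t\<in>I. rotation_form A g S \<xi> \<V> (\<gamma> t) (J' t) = rotation_form A g S \<xi> \<V> (\<gamma> t) (J t)) \<and>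
        (\<exists>t\<in>I. f' t \<noteq> f t))"
proof (rule conjI)
  show "\<forall>(A :: ('m, 'e) chart set) g T S \<xi> \<V> \<mu> p J.
        null_generation n A g T S \<xi> \<V> \<and> umbilical_with A g S \<xi> \<V> \<mu> \<and> p \<in> S \<and>
        orthogonal_jacobi_field A g (generator_interval S \<xi> \<V> p) (generator A g \<xi> p) J \<longrightarrow>
        (\<exists>f. ricci_jacobi_equation n A g (generator_interval S \<xi> \<V> p) (generator A g \<xi> p) J f)"
  proof (intro allI impI, elim conjE)
    fix A :: "('m, 'e) chart set" and g T S \<xi> \<V> \<mu> p J
    assume h: "null_generation n A g T S \<xi> \<V>" "umbilical_with A g S \<xi> \<V> \<mu>" "p \<in> S"
      "orthogonal_jacobi_field A g (generator_interval S \<xi> \<V> p) (generator A g \<xi> p) J"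
    interpret umbilical n A g T S \<xi> \<V> \<mu> by unfold_locales (rule h)+
    show "\<exists>f. ricci_jacobi_equation n A g (generator_interval S \<xi> \<V> p) (generator A g \<xi> p) J f"
      using assms(1) by (intro jacobi_equation h) simp
  qed
next
  have "2 \<le> card (Basis :: 'e set)" using assms by simp
  then obtain e0 e1 :: 'e where e: "e0 \<in> Basis" "e1 \<in> Basis" "e0 \<noteq> e1"
    by (metis card_le_Suc0_iff_eq finite_Basis not_less_eq_eq numeral_2_eq_2)
  interpret plane_wave_dim e0 e1 n by unfold_locales (rule e assms(2))+
  have n: "n > 0" using assms(1) by simp
  note J = orthogonal_jacobi_pw[of 0] and R = ricci_jacobi_pw[OF n zero_S0]
  show "\<exists>(A :: ('e, 'e) chart set) g T S \<xi> \<V> \<mu> p I \<gamma> J f J' f'.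
        null_generation n A g T S \<xi> \<V> \<and> umbilical_with A g S \<xi> \<V> \<mu> \<and> p \<in> S \<and>
        I = generator_interval S \<xi> \<V> p \<and> \<gamma> = generator A g \<xi> p \<and>
        orthogonal_jacobi_field A g I \<gamma> J \<and> ricci_jacobi_equation n A g I \<gamma> J f \<and>
        (\<exists>t\<in>I. J t \<notin> screen A g S \<xi> \<V> (\<gamma> t)) \<and>
        (\<exists>t\<in>I. f t \<noteq> deriv (\<lambda>s. rotation_form A g S \<xi> \<V> (\<gamma> s) (J s)) t
                        - \<mu> (\<gamma> t) * rotation_form A g S \<xi> \<V> (\<gamma> t) (J t)) \<and>
        orthogonal_jacobi_field A g I \<gamma> J' \<and> ricci_jacobi_equation n A g I \<gamma> J' f' \<and>
        (\<forall>t\<in>I. rotation_form A g S \<xi> \<V> (\<gamma> t) (J' t) = rotation_form A g S \<xi> \<V> (\<gamma> t) (J t)) \<and>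
        (\<exists>t\<in>I. f' t \<noteq> f t)"
    \<comment> \<open>The witnesses are J = \<gamma>' with f = -1 and J' = 0 with f' = 0. Both have
      zero rotation form, so the explicit formula would give 0 for the first, and equal values of
      \<tau> go with different f.\<close>
    by (intro exI[of _ std_atlas] exI[of _ G] exI[of _ "\<lambda>_. tv (e0 - e1)"] exI[of _ S0] exI[of _ \<xi>0] exI[of _ NB0]
        exI[of _ "\<lambda>_. -1 :: real"] exI[of _ "0 :: 'e"] exI[of _ "UNIV :: real set"] exI[of _ "pw.flow 0"]
        exI[of _ "\<lambda>_ :: real. tv e0"] exI[of _ "\<lambda>_ :: real. -1 :: real"] exI[of _ "\<lambda>_ :: real. tv 0"] exI[of _ "\<lambda>_ :: real. 0 :: real"])
      (use J[of 1] J[of 0] R[of 1] R[of 0] not_screen_pw[OF zero_S0]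
        in \<open>simp add: null_generation_pw[OF DIM] umbilical_pw zero_S0 life_pw rotation_form_pw[OF zero_S0]\<close>)
qed

end
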